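(* Let $f:\mathbb R\to\mathbb R$ be an even (measurable) function for which there exist fixed $\epsilon>0$ and $A>0$ with $|f(x)|<A(1+|x|)^{-(1+\epsilon)}$ for all $x\in\mathbb R$. Let $m\ge1$ be an integer and let $M_m=\lim_{N\to\infty}\mathbb E\{(Z_f)^m\}$. Then $$M_m=\sum_{r=1}^m\int_{-\infty}^\infty\cdots\int_{-\infty}^\infty R_r(x_1,\dots,x_r)\sum_{\sigma\in P(m,r)}\prod_{q=1}^r f^{\lambda_q}(x_q)\,dx_1\cdots dx_r,$$ where $\lambda_q=\lambda_q(\sigma)=\#\{j:\sigma(j)=q\}$, $f^{\lambda_q}(x)=f(x)^{\lambda_q}$, and $$R_r(x_1,\dots,x_r)=\det\left\{\frac{\sin(\pi(x_j-x_i))}{\pi(x_j-x_i)}\right\}_{1\le i,j\le r}.$$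
   Context: For a positive integer $N$ define the $2\pi$-periodic function $$F_N(\theta)=\sum_{j=-\infty}^\infty f\left(\tfrac N{2\pi}(\theta+2\pi j)\right),$$ and for an $N\times N$ unitary matrix $U$ with eigenvalues $e^{i\theta_1},\dots,e^{i\theta_N}$ (with multiplicity) define $Z_f(U)=\sum_{j=1}^N F_N(\theta_j)$. $\mathbb E$ denotes expectation over $U$ in the unitary group $U(N)$ with respect to Haar probability measure. $P(m,r)$ is the collection of set partitions of $m$ elements into $r$ non-empty blocks, encoded as maps $\sigma:\{1,\dots,m\}\to\{1,\dots,r\}$ such that (1) for every $q\in\{1,\dots,r\}$ there is at least one $j$ with $\sigma(j)=q$; (2) for all $j$, either $\sigma(j)=1$ or there exists $k<j$ with $\sigma(j)=\sigma(k)+1$. The entry $\sin(\pi x)/(\pi x)$ is interpreted as $1$ at $x=0$. *)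

theory Defs
  imports
    "HOL-Probability.Probability"
    "Jordan_Normal_Form.Schur_Decomposition"
begin

text \<open>
  The matrix size tends to infinity in the theorem, so unitary matrices are elements of the
  carrier-based matrix type of \<open>Jordan_Normal_Form\<close>.
\<close>

definition unitary_group :: "nat \<Rightarrow> complex mat set" where
  "unitary_group N = {U \<in> carrier_mat N N. U * mat_adjoint U = 1\<^sub>m N}"

text \<open>
  The Borel \<open>\<sigma>\<close>-algebra of the unitary group for the topology inherited from the space of
  all \<open>N \<times> N\<close> complex matrices. Since the complex plane is second countable, the Borel sets of
  the matrix space are generated by the entries, i.e. they form the product \<open>\<sigma>\<close>-algebra; those
  of the subspace are their traces.
\<close>

definition unitary_borel :: "nat \<Rightarrow> complex mat measure" where
  "unitary_borel N =
     vimage_algebra (unitary_group N) (\<lambda>U. \<lambda>ij\<in>{0..<N} \<times> {0..<N}. U $$ ij)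
       (\<Pi>\<^sub>M ij\<in>{0..<N} \<times> {0..<N}. (borel :: complex measure))"

text \<open>
  The Haar probability measure, given by its defining property; left invariance determines it
  uniquely (and implies right invariance, the group being compact).
\<close>

definition haar_prob :: "nat \<Rightarrow> complex mat measure \<Rightarrow> bool" where
  "haar_prob N \<mu> \<longleftrightarrow>
     prob_space \<mu> \<and>
     space \<mu> = unitary_group N \<and>
     sets \<mu> = sets (unitary_borel N) \<and>
     (\<forall>V\<in>unitary_group N. \<forall>A\<in>sets \<mu>. emeasure \<mu> ((\<lambda>U. V * U) ` A) = emeasure \<mu> A)"

definition F_per :: "(real \<Rightarrow> real) \<Rightarrow> nat \<Rightarrow> real \<Rightarrow> real" where
  "F_per f N \<theta> =
     (\<Sum>\<^sub>\<infinity>j\<in>(UNIV :: int set). f (real N / (2 * pi) * (\<theta> + 2 * pi * real_of_int j)))"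

text \<open>
  \<^term>\<open>proots (char_poly U)\<close> is the multiset of eigenvalues with algebraic multiplicity.
  The choice of eigenangle made by \<^const>\<open>Arg\<close> is irrelevant, as
  \<^term>\<open>F_per f N\<close> is \<open>2\<pi>\<close>-periodic.
\<close>

definition Z_stat :: "(real \<Rightarrow> real) \<Rightarrow> nat \<Rightarrow> complex mat \<Rightarrow> real" where
  "Z_stat f N U = (\<Sum>z\<in>#proots (char_poly U). F_per f N (Arg z))"

text \<open>Maps on \<open>{1..m}\<close> are made unique as total functions by extensionality.\<close>

definition set_partitions :: "nat \<Rightarrow> nat \<Rightarrow> (nat \<Rightarrow> nat) set" where
  "set_partitions m r =
     {\<sigma> \<in> {1..m} \<rightarrow>\<^sub>E {1..r}.
        (\<forall>q\<in>{1..r}. \<exists>j\<in>{1..m}. \<sigma> j = q) \<and>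
        (\<forall>j\<in>{1..m}. \<sigma> j = 1 \<or> (\<exists>k\<in>{1..m}. k < j \<and> \<sigma> j = \<sigma> k + 1))}"

definition block_size :: "nat \<Rightarrow> (nat \<Rightarrow> nat) \<Rightarrow> nat \<Rightarrow> nat" where
  "block_size m \<sigma> q = card {j \<in> {1..m}. \<sigma> j = q}"

text \<open>
  Matrix indices start at \<open>0\<close>, the variables \<open>x 1, \<dots>, x r\<close> at \<open>1\<close>;
  the library's \<open>sinc y\<close> is \<open>sin y / y\<close> for \<open>y \<noteq> 0\<close>, and \<open>1\<close> for \<open>y = 0\<close>.
\<close>

definition R_corr :: "nat \<Rightarrow> (nat \<Rightarrow> real) \<Rightarrow> real" where
  "R_corr r x =
     Determinant.det (Matrix.mat r r (\<lambda>(i, j). sinc (pi * (x (Suc j) - x (Suc i)))))"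

end

theory Submission
  imports Defs
begin

text \<open>
  The Weyl integration formula is derived from left invariance alone. Multiplying \<open>U\<close> by a
  rank-one unitary perturbation \<open>1 + u v v\<^sup>*\<close> changes \<open>det U ^ (- l) * (\<Prod>j. \<chi>_U (x j))\<close> by an explicit
  rational function of \<open>u\<close>, and comparing coefficients yields Schwinger--Dyson equations. For the
  product of this function with the Vandermonde determinant of the \<open>x j\<close> they say that its
  expectation is an eigenvector of two Euler operators. Hence only exponents with prescribed sum and
  sum of squares occur, and these determine a single exponent set: the expectation is one alternating
  monomial sum. Sylvester's resultant turns this into Toeplitz determinants for
  \<open>det U ^ (- l) * (\<Prod>i. q (z i))\<close>, where \<open>z i\<close> are the eigenvalues, and Stone--Weierstrass extends
  the formula to continuous and then to bounded Borel functions of the eigenvalues.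

  Expanding \<open>(\<Sum>i. F (\<theta> i)) ^ m\<close> along the factorizations of maps \<open>{1..m} \<rightarrow> {..<N}\<close> into a set
  partition followed by an injection gives integrals of determinants of a Dirichlet kernel, which
  tends to the sine kernel; the periodization of \<open>f\<close> is dominated by a multiple of
  \<open>(1 + \<bar>x\<bar>) powr (- (1 + \<epsilon>))\<close>, so that the limit may be taken under the integral.
\<close>

section \<open>Alternants\<close>

text \<open>Left invariance gives no access to a diagonalization, so no Jacobian is computed and
  some constants stay unknown. The eigenvalues of the Euler operators are identified through the one
  coefficient known to be nonzero, the factor of the Toeplitz determinant through the test
  \<open>q = monom 1 l\<close>, whose integrand is 1. The equations close because one divided
  difference occurs twice: as the trace of a product of two matrices U (x - U)^(-1), by the
  resolvent identity, and as the interaction term that a second-order Euler operator picks up from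
  the Vandermonde determinant. Multiplication by that determinant absorbs the interaction; what
  remains acts diagonally on monomials. Powers of det U are carried along because polynomials in z
  are not dense in the continuous functions on the circle, while Laurent polynomials are.
  Exponentials exp (s F) lead from products over the eigenvalues to all moments of sums. The kernel
  found on the torus is not a squared Vandermonde determinant but one alternating sum; it is complex
  valued, which accounts for the real parts.\<close>

lemma multivariate_poly_zero:
  fixes d :: "(nat \<Rightarrow> nat) \<Rightarrow> 'a::idom" and S :: "nat \<Rightarrow> 'a set"
  assumes "\<And>j. j < n \<Longrightarrow> infinite (S j)"
    and "\<And>x. (\<And>j. j < n \<Longrightarrow> x j \<in> S j) \<Longrightarrow>
          (\<Sum>\<alpha>\<in>{..<n} \<rightarrow>\<^sub>E {..<M}. d \<alpha> * (\<Prod>i<n. x i ^ \<alpha> i)) = 0"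
    and "\<alpha> \<in> {..<n} \<rightarrow>\<^sub>E {..<M}"
  shows "d \<alpha> = 0"
  using assms
proof (induction n arbitrary: d \<alpha>)
  case 0
  from 0(2)[of undefined] 0(3) show ?case by simp
next
  case (Suc n)
  let ?P = "{..<n} \<rightarrow>\<^sub>E {..<M}"
  have expand: "(\<Sum>\<alpha>\<in>{..<Suc n} \<rightarrow>\<^sub>E {..<M}. d \<alpha> * (\<Prod>i<Suc n. x i ^ \<alpha> i))
      = (\<Sum>k<M. (\<Sum>\<beta>\<in>?P. d (\<beta>(n := k)) * (\<Prod>i<n. x i ^ \<beta> i)) * x n ^ k)" for x
  proof -
    have inj: "inj_on (\<lambda>(y, g). g(n := y)) ({..<M} \<times> ?P)"
      by (intro inj_combinator) auto
    let ?F = "\<lambda>\<alpha>. d \<alpha> * (\<Prod>i<Suc n. x i ^ \<alpha> i)"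
    have "sum ?F ({..<Suc n} \<rightarrow>\<^sub>E {..<M}) = sum ?F ((\<lambda>(y, g). g(n := y)) ` ({..<M} \<times> ?P))"
      by (simp only: lessThan_Suc PiE_insert_eq)
    also have "\<dots> = sum (?F \<circ> (\<lambda>(y, g). g(n := y))) ({..<M} \<times> ?P)"
      by (rule sum.reindex[OF inj])
    also have "\<dots> = (\<Sum>(k, \<beta>)\<in>{..<M} \<times> ?P. d (\<beta>(n := k)) * (\<Prod>i<Suc n. x i ^ (\<beta>(n := k)) i))"
      by (intro sum.cong refl) (simp add: case_prod_beta del: fun_upd_apply prod.lessThan_Suc)
    also have "\<dots> = (\<Sum>k<M. \<Sum>\<beta>\<in>?P. d (\<beta>(n := k)) * (\<Prod>i<n. x i ^ \<beta> i) * x n ^ k)"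
    proof -
      have upd: "(\<Prod>i<n. x i ^ (\<beta>(n := k)) i) = (\<Prod>i<n. x i ^ \<beta> i)" for \<beta> k
        by (intro prod.cong) auto
      show ?thesis
        unfolding sum.cartesian_product[symmetric] prod.lessThan_Suc upd
        by (simp add: mult.assoc)
    qed
    finally show ?thesis by (simp add: sum_distrib_right)
  qed
  \<comment> \<open>With the other variables fixed in their sets, the expanded sum is a polynomial
    in the last variable vanishing on the infinite set \<open>S n\<close>; hence each of its
    coefficients vanishes, and the induction hypothesis applies to them.\<close>
  have slice: "(\<Sum>\<beta>\<in>?P. d (\<beta>(n := k)) * (\<Prod>i<n. x i ^ \<beta> i)) = 0"
    if x: "\<And>j. j < n \<Longrightarrow> x j \<in> S j" and "k < M" for x k
  proof -
    define c where "c k = (\<Sum>\<beta>\<in>?P. d (\<beta>(n := k)) * (\<Prod>i<n. x i ^ \<beta> i))" for k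
    define p where "p = (\<Sum>k<M. monom (c k) k)"
    have "poly p t = 0" if "t \<in> S n" for t
    proof -
      have "(\<Sum>\<alpha>\<in>{..<Suc n} \<rightarrow>\<^sub>E {..<M}. d \<alpha> * (\<Prod>i<Suc n. (x(n := t)) i ^ \<alpha> i)) = 0"
        by (rule Suc.prems(2)) (use that x in \<open>auto simp: less_Suc_eq\<close>)
      then show ?thesis
        unfolding expand by (simp add: p_def c_def poly_sum poly_monom)
    qed
    then have "S n \<subseteq> {t. poly p t = 0}" by auto
    then have "p = 0"
      using Suc.prems(1)[of n] poly_roots_finite[of p] infinite_super by blast
    then have "coeff p k = 0" by simp
    then show ?thesis using \<open>k < M\<close> by (simp add: p_def coeff_sum c_def)
  qed
  have "\<alpha> i < M" if "i < Suc n" for i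
    using PiE_mem[OF Suc.prems(3), of i] that by simp
  then have \<alpha>: "\<alpha> n < M" "restrict \<alpha> {..<n} \<in> ?P"
    by (simp_all add: restrict_PiE_iff)
  have "d ((restrict \<alpha> {..<n})(n := \<alpha> n)) = 0"
  proof (rule Suc.IH[of "\<lambda>\<beta>. d (\<beta>(n := \<alpha> n))"])
    show "infinite (S j)" if "j < n" for j using Suc.prems(1) that by simp
    show "(\<Sum>\<beta>\<in>?P. d (\<beta>(n := \<alpha> n)) * (\<Prod>i<n. x i ^ \<beta> i)) = 0"
      if "\<And>j. j < n \<Longrightarrow> x j \<in> S j" for x
      by (rule slice[OF that \<alpha>(1)])
  qed (rule \<alpha>(2))
  moreover have "(restrict \<alpha> {..<n})(n := \<alpha> n) = \<alpha>"
    using Suc.prems(3) by (intro ext) (auto simp: PiE_iff extensional_def less_Suc_eq)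
  ultimately show ?case by simp
qed

lemma prod_poly_expand:
  fixes g :: "nat \<Rightarrow> 'a::comm_semiring_1 poly" and w :: "nat \<Rightarrow> nat \<Rightarrow> 'a"
  assumes "\<And>i. i < n \<Longrightarrow> degree (g i) < M"
  shows "(\<Prod>i<n. poly (g i) (x i)) =
    (\<Sum>\<alpha>\<in>{..<n} \<rightarrow>\<^sub>E {..<M}. (\<Prod>i<n. coeff (g i) (\<alpha> i)) * (\<Prod>i<n. x i ^ \<alpha> i))"
proof -
  have "poly (g i) (x i) = (\<Sum>k<M. coeff (g i) k * x i ^ k)" if "i < n" for i
    unfolding poly_altdef using assms[OF that]
    by (intro sum.mono_neutral_left) (auto simp: coeff_eq_0)
  then have "(\<Prod>i<n. poly (g i) (x i)) = (\<Prod>i<n. \<Sum>k<M. coeff (g i) k * x i ^ k)"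
    by (intro prod.cong) auto
  also have "\<dots> = (\<Sum>\<alpha>\<in>{..<n} \<rightarrow>\<^sub>E {..<M}. \<Prod>i<n. coeff (g i) (\<alpha> i) * x i ^ \<alpha> i)"
    by (intro prod_sum_PiE) auto
  finally show ?thesis by (simp add: prod.distrib)
qed

lemma poly_eq_prod_roots:
  fixes A :: "'a::idom poly"
  assumes "finite R" "\<And>r. r \<in> R \<Longrightarrow> poly A r = 0" "degree A \<le> card R"
  shows "\<exists>c. A = Polynomial.smult c (\<Prod>r\<in>R. [:- r, 1:])"
  using assms
proof (induction R arbitrary: A rule: finite_induct)
  case empty
  then show ?case by (auto elim!: degree_eq_zeroE)
next
  case (insert r R)
  show ?case
  proof (cases "A = 0")
    case True
    then show ?thesis by (intro exI[of _ 0]) auto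
  next
    case False
    from insert.prems(1)[of r] obtain B where B: "A = [:- r, 1:] * B"
      by (auto simp: poly_eq_0_iff_dvd)
    have "degree B \<le> card R"
      using False insert.prems(2) insert.hyps unfolding B
      by (subst (asm) degree_mult_eq) auto
    moreover have "poly B s = 0" if "s \<in> R" for s
      using insert.prems(1)[of s] insert.hyps(2) that by (auto simp: B)
    ultimately obtain c where "B = Polynomial.smult c (\<Prod>r\<in>R. [:- r, 1:])"
      using insert.IH by blast
    with B insert.hyps show ?thesis by auto
  qed
qed

text \<open>The Vandermonde determinant. The Leibniz form is taken as the definition because Euler
  operators act on its terms by multiplication with \<pi> j.\<close>

definition alternant :: "nat \<Rightarrow> (nat \<Rightarrow> 'a::comm_ring_1) \<Rightarrow> 'a" where
  "alternant n x = (\<Sum>\<pi> | \<pi> permutes {..<n}. of_int (sign \<pi>) * (\<Prod>i<n. x i ^ \<pi> i))"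

lemma alternant_conv_det:
  "alternant n x = Determinant.det (Matrix.mat n n (\<lambda>(i, j). x i ^ j))"
  unfolding alternant_def
  by (subst det_def'[of _ n])
     (auto simp: atLeast0LessThan intro!: sum.cong prod.cong dest: permutes_in_image)

lemma alternant_eq_0:
  assumes "i < n" "j < n" "i \<noteq> j" "x i = x j"
  shows "alternant n x = 0"
  unfolding alternant_conv_det
  by (rule det_identical_rows[of _ n i j]) (use assms in auto)

text \<open>The left side is the Euler operator in the variable x j. As a polynomial in that
  variable alone the alternant has degree at most n - 1 and vanishes at the other n - 1 points, so
  it is a multiple of the product of the t - x k; the sum on the right is t times the logarithmic
  derivative of this product at t = x j.\<close>

lemma alternant_log_derivative:
  fixes x :: "nat \<Rightarrow> complex"
  assumes inj: "inj_on x {..<n}" and j: "j < n"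
  shows "(\<Sum>\<pi> | \<pi> permutes {..<n}. of_int (sign \<pi>) * (\<Prod>i<n. x i ^ \<pi> i) * of_nat (\<pi> j))
    = alternant n x * (\<Sum>k\<in>{..<n} - {j}. x j / (x j - x k))"
proof -
  define c where "c \<pi> = of_int (sign \<pi>) * (\<Prod>i\<in>{..<n} - {j}. x i ^ \<pi> i)" for \<pi>
  define A where "A = (\<Sum>\<pi> | \<pi> permutes {..<n}. monom (c \<pi>) (\<pi> j))"
  define R where "R = x ` ({..<n} - {j})"
  have fin: "finite {\<pi>. \<pi> permutes {..<n}}" by (simp add: finite_permutations)
  have split: "(\<Prod>i<n. y i) = y j * (\<Prod>i\<in>{..<n} - {j}. y i)" for y :: "nat \<Rightarrow> complex"
    using j by (simp add: prod.remove)
  have polyA: "poly A t = alternant n (x(j := t))" for t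
    unfolding A_def alternant_def poly_sum poly_monom split
    by (intro sum.cong refl) (auto simp: c_def)
  have "card R = n - 1"
    unfolding R_def using inj j by (subst card_image) (auto elim: inj_on_subset)
  moreover have "degree A \<le> n - 1"
    unfolding A_def
  proof (rule degree_sum_le[OF fin])
    fix \<pi> assume "\<pi> \<in> {\<pi>. \<pi> permutes {..<n}}"
    then have "\<pi> j < n" using permutes_in_image j by fastforce
    then show "degree (monom (c \<pi>) (\<pi> j)) \<le> n - 1"
      using degree_monom_le[of "c \<pi>" "\<pi> j"] by linarith
  qed
  moreover have "poly A r = 0" if "r \<in> R" for r
  proof -
    from that obtain k where "k < n" "k \<noteq> j" "r = x k" by (auto simp: R_def)
    then show ?thesis unfolding polyA using j by (intro alternant_eq_0[of j n k]) auto
  qed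
  ultimately obtain d where d: "A = Polynomial.smult d (\<Prod>r\<in>R. [:- r, 1:])"
    using poly_eq_prod_roots[of R A] by (auto simp: R_def)
  have xj: "x j \<noteq> x k" if "k \<in> {..<n} - {j}" for k
    using inj j that by (auto simp: inj_on_def)
  have d': "A = Polynomial.smult d (\<Prod>k\<in>{..<n} - {j}. [:- x k, 1:])"
    unfolding d R_def using inj by (subst prod.reindex) (auto elim: inj_on_subset)
  have "poly (pderiv A) (x j) = d * (\<Sum>k\<in>{..<n} - {j}. \<Prod>i\<in>{..<n} - {j} - {k}. x j - x i)"
    unfolding d' by (simp add: pderiv_smult pderiv_prod poly_sum poly_prod pderiv_pCons)
  also have "\<dots> = (\<Sum>k\<in>{..<n} - {j}. poly A (x j) / (x j - x k))"
    unfolding sum_distrib_left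
  proof (intro sum.cong refl)
    fix k assume k: "k \<in> {..<n} - {j}"
    have "poly A (x j) = d * ((x j - x k) * (\<Prod>i\<in>{..<n} - {j} - {k}. x j - x i))"
      unfolding d' using k by (simp add: poly_prod prod.remove[of "{..<n} - {j}" k "\<lambda>i. x j - x i"])
    then show "d * (\<Prod>i\<in>{..<n} - {j} - {k}. x j - x i) = poly A (x j) / (x j - x k)"
      using xj[OF k] by (simp add: field_simps)
  qed
  finally have 1: "x j * poly (pderiv A) (x j) =
      alternant n x * (\<Sum>k\<in>{..<n} - {j}. x j / (x j - x k))"
    by (simp add: polyA sum_distrib_left mult_ac)
  have "x j * poly (pderiv A) (x j) = (\<Sum>\<pi> | \<pi> permutes {..<n}.
      x j * poly (pderiv (monom (c \<pi>) (\<pi> j))) (x j))"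
    unfolding A_def by (simp add: pderiv_sum poly_sum sum_distrib_left)
  also have "\<dots> = (\<Sum>\<pi> | \<pi> permutes {..<n}. of_int (sign \<pi>) * (\<Prod>i<n. x i ^ \<pi> i) * of_nat (\<pi> j))"
  proof (intro sum.cong refl)
    fix \<pi>
    show "x j * poly (pderiv (monom (c \<pi>) (\<pi> j))) (x j)
      = of_int (sign \<pi>) * (\<Prod>i<n. x i ^ \<pi> i) * of_nat (\<pi> j)"
      unfolding split c_def pderiv_monom poly_monom by (cases "\<pi> j") simp_all
  qed
  finally show ?thesis using 1 by simp
qed

text \<open>Multiplying a coefficient by its exponent is the operator x d/dx, which sends g to
  \<open>pCons 0 (pderiv g)\<close>. Applying it exactly in the variables of J allows a product of
  first-order operators in different variables to be evaluated at once.\<close>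

lemma poly_euler_expand:
  fixes g :: "nat \<Rightarrow> complex poly"
  assumes deg: "\<And>i. i < n \<Longrightarrow> degree (g i) < M" and J: "J \<subseteq> {..<n}"
  shows "(\<Sum>\<alpha>\<in>{..<n} \<rightarrow>\<^sub>E {..<M}.
      (\<Prod>j\<in>J. of_nat (\<alpha> j)) * (\<Prod>i<n. coeff (g i) (\<alpha> i)) * (\<Prod>i<n. x i ^ \<alpha> i))
    = (\<Prod>i<n. if i \<in> J then x i * poly (pderiv (g i)) (x i) else poly (g i) (x i))"
proof -
  define g' where "g' i = (if i \<in> J then pCons 0 (pderiv (g i)) else g i)" for i
  have "degree (g' i) < M" if "i < n" for i
    using deg[OF that] by (auto simp: g'_def degree_pderiv degree_pCons_eq_if pderiv_eq_0_iff)
  from prod_poly_expand[of n g' M x, OF this]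
  have "(\<Prod>i<n. poly (g' i) (x i)) = (\<Sum>\<alpha>\<in>{..<n} \<rightarrow>\<^sub>E {..<M}.
      (\<Prod>i<n. coeff (g' i) (\<alpha> i)) * (\<Prod>i<n. x i ^ \<alpha> i))" by simp
  moreover have "coeff (g' i) k = (if i \<in> J then of_nat k else 1) * coeff (g i) k" for i k
    by (cases k) (auto simp: g'_def coeff_pderiv)
  moreover have "(\<Prod>i<n. if i \<in> J then y i else 1) = (\<Prod>i\<in>J. y i)" for y :: "nat \<Rightarrow> complex"
    using J by (subst prod.inter_restrict[symmetric]) (auto intro!: prod.cong)
  moreover have "poly (g' i) (x i) = (if i \<in> J then x i * poly (pderiv (g i)) (x i) else poly (g i) (x i))"
    for i by (simp add: g'_def)
  ultimately show ?thesis by (simp add: prod.distrib)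
qed

lemma sum_offdiag:
  fixes u :: "nat \<Rightarrow> complex"
  shows "(\<Sum>j<n. \<Sum>k\<in>{..<n} - {j}. u j * u k) = (\<Sum>j<n. u j)\<^sup>2 - (\<Sum>j<n. (u j)\<^sup>2)"
proof -
  have "(\<Sum>j<n. \<Sum>k\<in>{..<n} - {j}. u j * u k) = (\<Sum>j<n. (\<Sum>k<n. u j * u k) - u j * u j)"
    by (intro sum.cong refl) (simp add: sum_diff1)
  then show ?thesis by (simp add: sum_subtractf power2_eq_square sum_product)
qed

text \<open>The coordinates of \<open>P \<and> x P \<and> \<dots> \<and> x^(n - 1) P\<close> in the exterior power of the space of polynomials.\<close>

definition wedge_coeff :: "nat \<Rightarrow> complex poly \<Rightarrow> (nat \<Rightarrow> nat) \<Rightarrow> complex" where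
  "wedge_coeff n P \<alpha> =
    (\<Sum>\<pi> | \<pi> permutes {..<n}. of_int (sign \<pi>) * (\<Prod>i<n. coeff (monom 1 (\<pi> i) * P) (\<alpha> i)))"

context
  fixes n M :: nat and P :: "complex poly"
  assumes deg: "degree P + n \<le> M"
begin

lemma degree_monom_mult_less:
  assumes "\<pi> permutes {..<n}" "i < n"
  shows "degree (monom 1 (\<pi> i) * P) < M"
proof -
  have "\<pi> i < n" using permutes_in_image assms by fastforce
  moreover have "degree (monom 1 (\<pi> i) * P) \<le> \<pi> i + degree P"
    using degree_mult_le[of "monom 1 (\<pi> i)" P] degree_monom_le[of "1::complex" "\<pi> i"] by linarith
  ultimately show ?thesis using deg by linarith
qed

lemma wedge_expand:
  "alternant n x * (\<Prod>i<n. poly P (x i)) =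
    (\<Sum>\<alpha>\<in>{..<n} \<rightarrow>\<^sub>E {..<M}. wedge_coeff n P \<alpha> * (\<Prod>i<n. x i ^ \<alpha> i))"
proof -
  have "alternant n x * (\<Prod>i<n. poly P (x i)) =
      (\<Sum>\<pi> | \<pi> permutes {..<n}. of_int (sign \<pi>) * (\<Prod>i<n. poly (monom 1 (\<pi> i) * P) (x i)))"
    by (simp add: alternant_def sum_distrib_right poly_monom prod.distrib mult.assoc)
  also have "\<dots> = (\<Sum>\<pi> | \<pi> permutes {..<n}. \<Sum>\<alpha>\<in>{..<n} \<rightarrow>\<^sub>E {..<M}. of_int (sign \<pi>) *
      (\<Prod>i<n. coeff (monom 1 (\<pi> i) * P) (\<alpha> i)) * (\<Prod>i<n. x i ^ \<alpha> i))"
    by (intro sum.cong refl, subst prod_poly_expand[of n _ M])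
       (auto simp: degree_monom_mult_less sum_distrib_left mult.assoc)
  also have "\<dots> = (\<Sum>\<alpha>\<in>{..<n} \<rightarrow>\<^sub>E {..<M}. wedge_coeff n P \<alpha> * (\<Prod>i<n. x i ^ \<alpha> i))"
    by (subst sum.swap) (simp add: wedge_coeff_def sum_distrib_right)
  finally show ?thesis .
qed

text \<open>Each Leibniz term is a product of one-variable polynomials x^(\<pi> i) P(x), on which x
  d/dx acts as multiplication by \<pi> i + x P'(x) / P(x).\<close>

lemma wedge_euler:
  assumes P: "\<And>i. i < n \<Longrightarrow> poly P (x i) \<noteq> 0" and J: "J \<subseteq> {..<n}"
  shows "(\<Sum>\<alpha>\<in>{..<n} \<rightarrow>\<^sub>E {..<M}.
      (\<Prod>j\<in>J. of_nat (\<alpha> j)) * wedge_coeff n P \<alpha> * (\<Prod>i<n. x i ^ \<alpha> i))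
    = (\<Prod>i<n. poly P (x i)) * (\<Sum>\<pi> | \<pi> permutes {..<n}. of_int (sign \<pi>) * (\<Prod>i<n. x i ^ \<pi> i) *
        (\<Prod>j\<in>J. of_nat (\<pi> j) + x j * poly (pderiv P) (x j) / poly P (x j)))"
proof -
  have fJ: "finite J" using J finite_subset by blast
  have "(\<Sum>\<alpha>\<in>{..<n} \<rightarrow>\<^sub>E {..<M}.
      (\<Prod>j\<in>J. of_nat (\<alpha> j)) * wedge_coeff n P \<alpha> * (\<Prod>i<n. x i ^ \<alpha> i))
    = (\<Sum>\<pi> | \<pi> permutes {..<n}. of_int (sign \<pi>) * (\<Sum>\<alpha>\<in>{..<n} \<rightarrow>\<^sub>E {..<M}.
      (\<Prod>j\<in>J. of_nat (\<alpha> j)) * (\<Prod>i<n. coeff (monom 1 (\<pi> i) * P) (\<alpha> i)) * (\<Prod>i<n. x i ^ \<alpha> i)))"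
    unfolding wedge_coeff_def sum_distrib_left sum_distrib_right
    by (subst sum.swap) (simp add: mult_ac)
  also have "\<dots> = (\<Sum>\<pi> | \<pi> permutes {..<n}. of_int (sign \<pi>) * ((\<Prod>i<n. x i ^ \<pi> i * poly P (x i)) *
        (\<Prod>j\<in>J. of_nat (\<pi> j) + x j * poly (pderiv P) (x j) / poly P (x j))))"
  proof (intro sum.cong refl arg_cong2[of _ _ _ _ "(*)"])
    fix \<pi> assume "\<pi> \<in> {\<pi>. \<pi> permutes {..<n}}"
    then have \<pi>: "\<pi> permutes {..<n}" by simp
    have 1: "x i * poly (pderiv (monom 1 (\<pi> i) * P)) (x i) =
        x i ^ \<pi> i * poly P (x i) * (of_nat (\<pi> i) + x i * poly (pderiv P) (x i) / poly P (x i))"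
      if "i < n" for i
      using P[OF that] by (cases "\<pi> i") (auto simp: pderiv_mult pderiv_monom poly_monom field_simps)
    have "(\<Sum>\<alpha>\<in>{..<n} \<rightarrow>\<^sub>E {..<M}.
      (\<Prod>j\<in>J. of_nat (\<alpha> j)) * (\<Prod>i<n. coeff (monom 1 (\<pi> i) * P) (\<alpha> i)) * (\<Prod>i<n. x i ^ \<alpha> i))
      = (\<Prod>i<n. x i ^ \<pi> i * poly P (x i) *
          (if i \<in> J then of_nat (\<pi> i) + x i * poly (pderiv P) (x i) / poly P (x i) else 1))"
      by (subst poly_euler_expand[of n "\<lambda>i. monom 1 (\<pi> i) * P" M J x, OF degree_monom_mult_less[OF \<pi>] J])
         (assumption, intro prod.cong refl, auto simp: 1 poly_monom)
    also have "\<dots> = (\<Prod>i<n. x i ^ \<pi> i * poly P (x i)) *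
        (\<Prod>j\<in>J. of_nat (\<pi> j) + x j * poly (pderiv P) (x j) / poly P (x j))"
      unfolding prod.distrib using J
      by (subst prod.inter_restrict[symmetric]) (auto intro!: prod.cong simp: Int_absorb1)
    finally show "(\<Sum>\<alpha>\<in>{..<n} \<rightarrow>\<^sub>E {..<M}.
      (\<Prod>j\<in>J. of_nat (\<alpha> j)) * (\<Prod>i<n. coeff (monom 1 (\<pi> i) * P) (\<alpha> i)) * (\<Prod>i<n. x i ^ \<alpha> i))
      = (\<Prod>i<n. x i ^ \<pi> i * poly P (x i)) *
        (\<Prod>j\<in>J. of_nat (\<pi> j) + x j * poly (pderiv P) (x j) / poly P (x j))" .
  qed
  finally show ?thesis by (simp add: prod.distrib sum_distrib_left mult_ac)
qed

context
  fixes x t :: "nat \<Rightarrow> complex"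
  assumes inj: "inj_on x {..<n}" and P: "\<And>i. i < n \<Longrightarrow> poly P (x i) \<noteq> 0"
  defines "t \<equiv> \<lambda>j. x j * poly (pderiv P) (x j) / poly P (x j)"
begin

text \<open>The sum of the \<pi> j is the same for all permutations, so the first-order operator
  acts on every Leibniz term by the same factor.\<close>

lemma wedge_euler1:
  "(\<Sum>\<alpha>\<in>{..<n} \<rightarrow>\<^sub>E {..<M}. of_nat (\<Sum>j<n. \<alpha> j) * wedge_coeff n P \<alpha> * (\<Prod>i<n. x i ^ \<alpha> i))
    = alternant n x * (\<Prod>i<n. poly P (x i)) * (of_nat (\<Sum>j<n. j) + (\<Sum>j<n. t j))"
proof -
  have "(\<Sum>\<alpha>\<in>{..<n} \<rightarrow>\<^sub>E {..<M}. of_nat (\<Sum>j<n. \<alpha> j) * wedge_coeff n P \<alpha> * (\<Prod>i<n. x i ^ \<alpha> i))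
    = (\<Sum>j<n. \<Sum>\<alpha>\<in>{..<n} \<rightarrow>\<^sub>E {..<M}. (\<Prod>j\<in>{j}. of_nat (\<alpha> j)) * wedge_coeff n P \<alpha> * (\<Prod>i<n. x i ^ \<alpha> i))"
    by (subst sum.swap) (simp add: sum_distrib_right)
  also have "\<dots> = (\<Sum>j<n. (\<Prod>i<n. poly P (x i)) * (\<Sum>\<pi> | \<pi> permutes {..<n}.
      of_int (sign \<pi>) * (\<Prod>i<n. x i ^ \<pi> i) * (of_nat (\<pi> j) + t j)))"
    by (intro sum.cong refl, subst wedge_euler) (use P in \<open>auto simp: t_def\<close>)
  also have "\<dots> = (\<Prod>i<n. poly P (x i)) * (\<Sum>\<pi> | \<pi> permutes {..<n}.
      of_int (sign \<pi>) * (\<Prod>i<n. x i ^ \<pi> i) * (\<Sum>j<n. of_nat (\<pi> j) + t j))"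
    unfolding sum_distrib_left by (subst sum.swap) (simp add: sum_distrib_left)
  also have "\<dots> = (\<Prod>i<n. poly P (x i)) * (\<Sum>\<pi> | \<pi> permutes {..<n}.
      of_int (sign \<pi>) * (\<Prod>i<n. x i ^ \<pi> i) * (of_nat (\<Sum>j<n. j) + (\<Sum>j<n. t j)))"
  proof (intro sum.cong refl arg_cong2[of _ _ _ _ "(*)"])
    fix \<pi> assume "\<pi> \<in> {\<pi>. \<pi> permutes {..<n}}"
    then have "(\<Sum>j<n. \<pi> j) = (\<Sum>j<n. j)"
      using sum.permute[of \<pi> "{..<n}" "\<lambda>i. i"] by (simp add: o_def)
    then show "(\<Sum>j<n. of_nat (\<pi> j) + t j) = of_nat (\<Sum>j<n. j) + (\<Sum>j<n. t j)"
      by (simp add: sum.distrib flip: of_nat_sum)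
  qed
  also have "\<dots> = alternant n x * (\<Prod>i<n. poly P (x i)) * (of_nat (\<Sum>j<n. j) + (\<Sum>j<n. t j))"
    unfolding alternant_def sum_distrib_right[symmetric] by (simp only: mult_ac)
  finally show ?thesis .
qed

text \<open>The sum and the square sum of the \<pi> j do not depend on \<pi>. Among the terms of the
  off-diagonal sum only the mixed ones, t j times \<pi> j, do, and
  \<open>alternant_log_derivative\<close> evaluates them; they become the interaction between the
  points.\<close>

lemma wedge_euler2:
  "(\<Sum>\<alpha>\<in>{..<n} \<rightarrow>\<^sub>E {..<M}. of_nat (\<Sum>j<n. \<Sum>k\<in>{..<n} - {j}. \<alpha> j * \<alpha> k) * wedge_coeff n P \<alpha> * (\<Prod>i<n. x i ^ \<alpha> i))
    = alternant n x * (\<Prod>i<n. poly P (x i)) *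
      ((of_nat (\<Sum>j<n. j) + (\<Sum>j<n. t j))\<^sup>2 - of_nat (\<Sum>j<n. j\<^sup>2) - (\<Sum>j<n. (t j)\<^sup>2)
        - 2 * (\<Sum>j<n. t j * (\<Sum>k\<in>{..<n} - {j}. x j / (x j - x k))))"
proof -
  let ?s = "of_nat (\<Sum>j<n. j) + (\<Sum>j<n. t j)" and ?PP = "\<Prod>i<n. poly P (x i)"
  let ?m = "\<lambda>\<pi>. of_int (sign \<pi>) * (\<Prod>i<n. x i ^ \<pi> i)"
  let ?pm = "{\<pi>. \<pi> permutes {..<n}}"
  have "(\<Sum>\<alpha>\<in>{..<n} \<rightarrow>\<^sub>E {..<M}. of_nat (\<Sum>j<n. \<Sum>k\<in>{..<n} - {j}. \<alpha> j * \<alpha> k) * wedge_coeff n P \<alpha> * (\<Prod>i<n. x i ^ \<alpha> i))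
    = (\<Sum>\<alpha>\<in>{..<n} \<rightarrow>\<^sub>E {..<M}. \<Sum>j<n. \<Sum>k\<in>{..<n} - {j}.
        (\<Prod>j\<in>{j,k}. of_nat (\<alpha> j)) * wedge_coeff n P \<alpha> * (\<Prod>i<n. x i ^ \<alpha> i))"
    unfolding of_nat_sum sum_distrib_right by (intro sum.cong refl) auto
  also have "\<dots> = (\<Sum>j<n. \<Sum>k\<in>{..<n} - {j}. \<Sum>\<alpha>\<in>{..<n} \<rightarrow>\<^sub>E {..<M}.
        (\<Prod>j\<in>{j,k}. of_nat (\<alpha> j)) * wedge_coeff n P \<alpha> * (\<Prod>i<n. x i ^ \<alpha> i))"
    by (subst sum.swap, intro sum.cong refl, subst sum.swap) simp
  also have "\<dots> = (\<Sum>j<n. \<Sum>k\<in>{..<n} - {j}. ?PP * (\<Sum>\<pi>\<in>?pm.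
      ?m \<pi> * ((of_nat (\<pi> j) + t j) * (of_nat (\<pi> k) + t k))))"
    by (intro sum.cong refl, subst wedge_euler) (use P in \<open>auto simp: t_def\<close>)
  also have "\<dots> = (\<Sum>\<pi>\<in>?pm. ?PP * ?m \<pi> * (\<Sum>j<n. \<Sum>k\<in>{..<n} - {j}. (of_nat (\<pi> j) + t j) * (of_nat (\<pi> k) + t k)))"
  proof -
    have "(\<Sum>j<n. \<Sum>k\<in>{..<n} - {j}. \<Sum>\<pi>\<in>?pm. f \<pi> j k) = (\<Sum>\<pi>\<in>?pm. \<Sum>j<n. \<Sum>k\<in>{..<n} - {j}. f \<pi> j k)"
      for f :: "(nat \<Rightarrow> nat) \<Rightarrow> nat \<Rightarrow> nat \<Rightarrow> complex"
      by (subst (2) sum.swap, intro sum.cong refl, subst (2) sum.swap) simp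
    then show ?thesis unfolding sum_distrib_left by (simp add: mult_ac)
  qed
  also have "\<dots> = (\<Sum>\<pi>\<in>?pm. ?PP * ?m \<pi> * (?s\<^sup>2 - of_nat (\<Sum>j<n. j\<^sup>2) - (\<Sum>j<n. (t j)\<^sup>2)
      - 2 * (\<Sum>j<n. t j * of_nat (\<pi> j))))"
  proof (intro sum.cong refl arg_cong2[of _ _ _ _ "(*)"])
    fix \<pi> assume "\<pi> \<in> {\<pi>. \<pi> permutes {..<n}}"
    then have perm: "(\<Sum>j<n. f (\<pi> j)) = (\<Sum>j<n. f j)" for f :: "nat \<Rightarrow> nat"
      using sum.permute[of \<pi> "{..<n}" f] by (simp add: o_def)
    have "(\<Sum>j<n. of_nat (\<pi> j) + t j) = ?s"
      using perm[of "\<lambda>j. j"] by (simp add: sum.distrib flip: of_nat_sum)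
    moreover have "(\<Sum>j<n. (of_nat (\<pi> j) + t j)\<^sup>2) =
        of_nat (\<Sum>j<n. j\<^sup>2) + (\<Sum>j<n. (t j)\<^sup>2) + 2 * (\<Sum>j<n. t j * of_nat (\<pi> j))"
      using perm[of "\<lambda>j. j\<^sup>2"]
      by (simp add: power2_sum sum.distrib sum_distrib_left mult_ac flip: of_nat_sum of_nat_power)
    ultimately show "(\<Sum>j<n. \<Sum>k\<in>{..<n} - {j}. (of_nat (\<pi> j) + t j) * (of_nat (\<pi> k) + t k))
      = ?s\<^sup>2 - of_nat (\<Sum>j<n. j\<^sup>2) - (\<Sum>j<n. (t j)\<^sup>2) - 2 * (\<Sum>j<n. t j * of_nat (\<pi> j))"
      unfolding sum_offdiag by simp
  qed
  also have "\<dots> = alternant n x * ?PP * (?s\<^sup>2 - of_nat (\<Sum>j<n. j\<^sup>2) - (\<Sum>j<n. (t j)\<^sup>2))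
      - 2 * ?PP * (\<Sum>j<n. t j * (\<Sum>\<pi>\<in>?pm. ?m \<pi> * of_nat (\<pi> j)))"
  proof -
    have "(\<Sum>\<pi>\<in>?pm. ?PP * ?m \<pi> * (c - 2 * (\<Sum>j<n. t j * of_nat (\<pi> j))))
      = alternant n x * ?PP * c - 2 * ?PP * (\<Sum>j<n. \<Sum>\<pi>\<in>?pm. t j * (?m \<pi> * of_nat (\<pi> j)))" for c
      unfolding alternant_def
      by (subst sum.swap) (simp add: right_diff_distrib sum_subtractf sum_distrib_left sum_distrib_right mult_ac)
    then show ?thesis by (simp add: sum_distrib_left)
  qed
  also have "(\<Sum>j<n. t j * (\<Sum>\<pi>\<in>?pm. ?m \<pi> * of_nat (\<pi> j))) =
      alternant n x * (\<Sum>j<n. t j * (\<Sum>k\<in>{..<n} - {j}. x j / (x j - x k)))"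
    unfolding sum_distrib_left[of "alternant n x"]
    by (intro sum.cong refl, subst alternant_log_derivative[OF inj]) (auto simp: mult_ac)
  finally show ?thesis by (simp add: algebra_simps)
qed

end

end

section \<open>A Sylvester-type determinant\<close>

text \<open>A kernel vector would be the coefficient list of a nonzero polynomial of degree below n
  with n distinct roots.\<close>

lemma alternant_nonzero:
  fixes x :: "nat \<Rightarrow> complex"
  assumes "inj_on x {..<n}"
  shows "alternant n x \<noteq> 0"
proof
  let ?V = "Matrix.mat n n (\<lambda>(i, j). x i ^ j)"
  assume "alternant n x = 0"
  then obtain v where v: "v \<in> carrier_vec n" "v \<noteq> 0\<^sub>v n" "?V *\<^sub>v v = 0\<^sub>v n"
    unfolding alternant_conv_det by (subst (asm) det_0_iff_vec_prod_zero[of _ n]) auto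
  define p where "p = (\<Sum>j<n. monom (vec_index v j) j)"
  have root: "poly p (x i) = 0" if "i < n" for i
  proof -
    have "vec_index (?V *\<^sub>v v) i = (\<Sum>j<n. x i ^ j * vec_index v j)"
      using that v(1) by (simp add: scalar_prod_def row_def atLeast0LessThan)
    then show ?thesis using v(3) that by (simp add: p_def poly_sum poly_monom mult.commute)
  qed
  have "p \<noteq> 0"
  proof
    assume "p = 0"
    then have "coeff p j = 0" for j by simp
    then have "vec_index v j = 0" if "j < n" for j
      using that \<open>\<And>j. coeff p j = 0\<close>[of j] by (simp add: p_def coeff_sum)
    then have "v = 0\<^sub>v n" using v(1) by (intro eq_vecI) auto
    with v(2) show False by simp
  qed
  have "n \<noteq> 0" using v(1,2) by (auto)
  have "x ` {..<n} \<subseteq> {y. poly p y = 0}" using root by auto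
  then have "card (x ` {..<n}) \<le> card {y. poly p y = 0}"
    by (intro card_mono poly_roots_finite \<open>p \<noteq> 0\<close>)
  also have "\<dots> \<le> degree p" using \<open>p \<noteq> 0\<close> by (rule card_poly_roots_bound)
  also have "\<dots> \<le> n - 1" unfolding p_def
    by (rule degree_sum_le) (auto intro!: order_trans[OF degree_monom_le])
  finally show False using \<open>n \<noteq> 0\<close> card_image[OF assms] by simp
qed

text \<open>
  Laplace expansion along the last \<open>N\<close> rows \<open>q, x q, \<dots>, x^(N - 1) q\<close> of a Sylvester matrix; the
  minors of its first \<open>n\<close> rows are replaced by an arbitrary function \<open>c\<close> of the chosen columns.
\<close>

definition sylvester :: "nat \<Rightarrow> nat \<Rightarrow> complex poly \<Rightarrow> ((nat \<Rightarrow> nat) \<Rightarrow> complex) \<Rightarrow> complex" where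
  "sylvester n N q c = (\<Sum>\<pi> | \<pi> permutes {..<n + N}. of_int (sign \<pi>) * c (restrict \<pi> {..<n}) *
      (\<Prod>i<N. coeff (monom 1 i * q) (\<pi> (n + i))))"

text \<open>The restriction keeps permuted index tuples extensional, so that they can be compared
  with a given tuple as functions.\<close>

definition antisymmetrize :: "nat \<Rightarrow> ((nat \<Rightarrow> nat) \<Rightarrow> complex) \<Rightarrow> (nat \<Rightarrow> nat) \<Rightarrow> complex" where
  "antisymmetrize n c \<alpha> = (\<Sum>\<tau> | \<tau> permutes {..<n}. of_int (sign \<tau>) * c (restrict (\<alpha> \<circ> \<tau>) {..<n}))"

lemma prod_lessThan_add:
  fixes f :: "nat \<Rightarrow> 'a::comm_monoid_mult"
  shows "(\<Prod>i<m + n. f i) = (\<Prod>i<m. f i) * (\<Prod>i<n. f (m + i))"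
  by (induction n) (auto simp: mult.assoc)

lemma restrict_comp_permutes:
  assumes "\<tau> permutes {..<n::nat}"
  shows "restrict (restrict \<pi> {..<n} \<circ> \<tau>) {..<n} = restrict (\<pi> \<circ> \<tau>) {..<n}"
  using permutes_in_image[OF assms] by (intro restrict_ext) auto

lemma sign_mult_permutes:
  assumes "\<pi> permutes S" "finite S" "\<tau> permutes T" "finite T"
  shows "sign (\<pi> \<circ> \<tau>) = sign \<pi> * sign \<tau>"
  using assms by (intro sign_compose) (auto simp: permutation_permutes)

text \<open>Permuting the first n rows changes the sign and leaves the factors of the last N rows
  alone. Thus the expansion sees only the antisymmetric part of c.\<close>

lemma sylvester_antisymmetrize: "fact n * sylvester n N q c = sylvester n N q (antisymmetrize n c)"
proof -
  let ?pm = "\<lambda>k. {\<pi>. \<pi> permutes {..<k::nat}}"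
  let ?f = "\<lambda>\<pi>. of_int (sign \<pi>) * c (restrict \<pi> {..<n}) * (\<Prod>i<N. coeff (monom 1 i * q) (\<pi> (n + i)))"
  have "sylvester n N q (antisymmetrize n c) = (\<Sum>\<pi>\<in>?pm (n + N). \<Sum>\<tau>\<in>?pm n. ?f (\<pi> \<circ> \<tau>))"
    unfolding sylvester_def antisymmetrize_def sum_distrib_left sum_distrib_right
  proof (intro sum.cong refl)
    fix \<pi> \<tau> assume "\<pi> \<in> ?pm (n + N)" "\<tau> \<in> ?pm n"
    then have *: "\<pi> permutes {..<n + N}" "\<tau> permutes {..<n}" by auto
    have "\<tau> (n + i) = n + i" for i using *(2) by (simp add: permutes_def)
    then show "of_int (sign \<pi>) * (of_int (sign \<tau>) * c (restrict (restrict \<pi> {..<n} \<circ> \<tau>) {..<n})) *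
        (\<Prod>i<N. coeff (monom 1 i * q) (\<pi> (n + i))) = ?f (\<pi> \<circ> \<tau>)"
      by (simp add: restrict_comp_permutes[OF *(2)] sign_mult_permutes[OF *(1) _ *(2)])
  qed
  also have "\<dots> = (\<Sum>\<tau>\<in>?pm n. \<Sum>\<pi>\<in>?pm (n + N). ?f (\<pi> \<circ> \<tau>))" by (rule sum.swap)
  also have "\<dots> = (\<Sum>\<tau>\<in>?pm n. sylvester n N q c)"
  proof (rule sum.cong[OF refl])
    fix \<tau> assume "\<tau> \<in> ?pm n"
    then have "\<tau> permutes {..<n + N}" by (auto intro: permutes_subset)
    from sum_permutations_compose_right[OF this, of ?f]
    show "(\<Sum>\<pi>\<in>?pm (n + N). ?f (\<pi> \<circ> \<tau>)) = sylvester n N q c"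
      by (simp only: sylvester_def)
  qed
  also have "\<dots> = fact n * sylvester n N q c"
    by (simp add: card_permutations)
  finally show ?thesis ..
qed

lemma antisymmetrize_comp:
  assumes "\<tau> permutes {..<n}"
  shows "antisymmetrize n c (restrict (\<alpha> \<circ> \<tau>) {..<n}) = of_int (sign \<tau>) * antisymmetrize n c \<alpha>"
proof -
  let ?pm = "{\<pi>. \<pi> permutes {..<n}}"
  have "antisymmetrize n c (restrict (\<alpha> \<circ> \<tau>) {..<n})
      = (\<Sum>\<sigma>\<in>?pm. of_int (sign \<tau>) * (of_int (sign (\<tau> \<circ> \<sigma>)) * c (restrict (\<alpha> \<circ> (\<tau> \<circ> \<sigma>)) {..<n})))"
    unfolding antisymmetrize_def
  proof (intro sum.cong refl)
    fix \<sigma> assume "\<sigma> \<in> ?pm"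
    then have \<sigma>: "\<sigma> permutes {..<n}" by simp
    show "of_int (sign \<sigma>) * c (restrict (restrict (\<alpha> \<circ> \<tau>) {..<n} \<circ> \<sigma>) {..<n}) =
       of_int (sign \<tau>) * (of_int (sign (\<tau> \<circ> \<sigma>)) * c (restrict (\<alpha> \<circ> (\<tau> \<circ> \<sigma>)) {..<n}))"
      by (simp add: restrict_comp_permutes[OF \<sigma>] sign_mult_permutes[OF assms _ \<sigma>] o_assoc
          flip: mult.assoc of_int_mult)
  qed
  also have "\<dots> = of_int (sign \<tau>) * (\<Sum>\<sigma>\<in>?pm. of_int (sign \<sigma>) * c (restrict (\<alpha> \<circ> \<sigma>) {..<n}))"
    unfolding sum_distrib_left[symmetric]
    using setum_permutations_compose_left[OF assms,
        of "\<lambda>\<sigma>. of_int (sign \<sigma>) * c (restrict (\<alpha> \<circ> \<sigma>) {..<n})"]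
    by (simp only:)
  finally show ?thesis by (simp add: antisymmetrize_def)
qed

text \<open>One side permutes the powers of x, the other the columns; passing to inverse
  permutations identifies them.\<close>

lemma wedge_coeff_antisymmetrize:
  "antisymmetrize n (\<lambda>\<alpha>. \<Prod>k<n. coeff (monom 1 k * P) (\<alpha> k)) \<alpha> = wedge_coeff n P \<alpha>"
proof -
  let ?pm = "{\<pi>. \<pi> permutes {..<n}}"
  have "wedge_coeff n P \<alpha> = (\<Sum>\<tau>\<in>?pm. of_int (sign (Hilbert_Choice.inv \<tau>)) * (\<Prod>i<n. coeff (monom 1 (Hilbert_Choice.inv \<tau> i) * P) (\<alpha> i)))"
    unfolding wedge_coeff_def
    using sum_permutations_inverse[of "\<lambda>\<pi>. of_int (sign \<pi>) * (\<Prod>i<n. coeff (monom 1 (\<pi> i) * P) (\<alpha> i))" "{..<n}"]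
    by (simp only:)
  also have "\<dots> = (\<Sum>\<tau>\<in>?pm. of_int (sign \<tau>) * (\<Prod>k<n. coeff (monom 1 k * P) (\<alpha> (\<tau> k))))"
  proof (intro sum.cong refl)
    fix \<tau> assume "\<tau> \<in> ?pm"
    then have \<tau>: "\<tau> permutes {..<n}" by simp
    have "(\<Prod>i<n. coeff (monom 1 (Hilbert_Choice.inv \<tau> i) * P) (\<alpha> i)) =
        (\<Prod>k<n. coeff (monom 1 (Hilbert_Choice.inv \<tau> (\<tau> k)) * P) (\<alpha> (\<tau> k)))"
      using prod.permute[OF \<tau>, of "\<lambda>i. coeff (monom 1 (Hilbert_Choice.inv \<tau> i) * P) (\<alpha> i)"] by (simp add: o_def)
    moreover have "sign (Hilbert_Choice.inv \<tau>) = sign \<tau>"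
      using \<tau> by (intro sign_inverse) (auto simp: permutation_permutes)
    ultimately show "of_int (sign (Hilbert_Choice.inv \<tau>)) * (\<Prod>i<n. coeff (monom 1 (Hilbert_Choice.inv \<tau> i) * P) (\<alpha> i)) =
        of_int (sign \<tau>) * (\<Prod>k<n. coeff (monom 1 k * P) (\<alpha> (\<tau> k)))"
      using permutes_inverses(2)[OF \<tau>] by simp
  qed
  finally show ?thesis by (simp add: antisymmetrize_def)
qed

text \<open>An alternating function of n columns that is supported on the orderings of a single
  n-set is determined by its value at one ordering. So the antisymmetrization of c is a scalar
  multiple of that of the indicator of \<alpha>0, and the Sylvester expansion is linear in
  it.\<close>

lemma sylvester_collapse:
  assumes \<alpha>0: "inj_on \<alpha>0 {..<n}" "\<alpha>0 \<in> extensional {..<n}"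
    and c: "\<And>\<alpha>. \<alpha> \<in> {..<n} \<rightarrow>\<^sub>E {..<n + N} \<Longrightarrow> inj_on \<alpha> {..<n} \<Longrightarrow> \<alpha> ` {..<n} \<noteq> \<alpha>0 ` {..<n}
      \<Longrightarrow> antisymmetrize n c \<alpha> = 0"
  shows "sylvester n N q c = antisymmetrize n c \<alpha>0 * sylvester n N q (\<lambda>\<alpha>. if \<alpha> = \<alpha>0 then 1 else 0)"
proof -
  let ?c0 = "\<lambda>\<alpha>. if \<alpha> = \<alpha>0 then 1 else (0::complex)"
  have eq: "antisymmetrize n c \<alpha> = antisymmetrize n c \<alpha>0 * antisymmetrize n ?c0 \<alpha>"
    if \<alpha>: "\<alpha> \<in> {..<n} \<rightarrow>\<^sub>E {..<n + N}" "inj_on \<alpha> {..<n}" for \<alpha>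
  proof (cases "\<alpha> ` {..<n} = \<alpha>0 ` {..<n}")
    case False
    have "restrict (\<alpha> \<circ> \<tau>) {..<n} \<noteq> \<alpha>0" if "\<tau> permutes {..<n}" for \<tau>
    proof
      assume "restrict (\<alpha> \<circ> \<tau>) {..<n} = \<alpha>0"
      then have "\<alpha>0 ` {..<n} = \<alpha> ` \<tau> ` {..<n}" by (auto simp: image_image)
      with False permutes_image[OF that] show False by simp
    qed
    then have "antisymmetrize n ?c0 \<alpha> = 0" by (simp add: antisymmetrize_def)
    then show ?thesis using c[OF \<alpha> False] by simp
  next
    case True
    \<comment> \<open>Both tuples are injective with the same image, so one arises from the other by
      a unique permutation of the positions.\<close>
    define \<tau> where "\<tau> k = (if k < n then the_inv_into {..<n} \<alpha>0 (\<alpha> k) else k)" for k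
    have bij: "bij_betw \<tau> {..<n} {..<n}"
    proof -
      have "bij_betw \<alpha> {..<n} (\<alpha>0 ` {..<n})" using \<alpha>(2) True by (simp add: bij_betw_def)
      moreover have "bij_betw (the_inv_into {..<n} \<alpha>0) (\<alpha>0 ` {..<n}) {..<n}"
        using \<alpha>0(1) by (intro bij_betw_the_inv_into) (simp add: bij_betw_def)
      ultimately have "bij_betw (the_inv_into {..<n} \<alpha>0 \<circ> \<alpha>) {..<n} {..<n}"
        by (rule bij_betw_trans)
      then show ?thesis by (rule bij_betw_cong[THEN iffD1, rotated]) (auto simp: \<tau>_def)
    qed
    then have \<tau>: "\<tau> permutes {..<n}" by (rule bij_imp_permutes) (auto simp: \<tau>_def)
    have \<alpha>_eq: "\<alpha> = restrict (\<alpha>0 \<circ> \<tau>) {..<n}"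
    proof
      fix k show "\<alpha> k = restrict (\<alpha>0 \<circ> \<tau>) {..<n} k"
      proof (cases "k < n")
        case kn: True
        then have "\<alpha> k \<in> \<alpha>0 ` {..<n}" using True by blast
        then show ?thesis using kn f_the_inv_into_f[OF \<alpha>0(1)] by (simp add: \<tau>_def)
      next
        case False
        then show ?thesis using \<alpha>(1) by (auto simp: PiE_iff extensional_def)
      qed
    qed
    have "antisymmetrize n ?c0 \<alpha>0 = 1"
    proof -
      have "restrict (\<alpha>0 \<circ> \<sigma>) {..<n} = \<alpha>0 \<longleftrightarrow> \<sigma> = id" if \<sigma>: "\<sigma> permutes {..<n}" for \<sigma>
      proof
        assume eq: "restrict (\<alpha>0 \<circ> \<sigma>) {..<n} = \<alpha>0"
        have "\<sigma> k = k" for k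
        proof (cases "k < n")
          case True
          then have "\<alpha>0 (\<sigma> k) = \<alpha>0 k" using fun_cong[OF eq, of k] by simp
          then show ?thesis using \<alpha>0(1) True permutes_in_image[OF \<sigma>, of k] by (auto simp: inj_on_def)
        qed (use \<sigma> in \<open>auto simp: permutes_def\<close>)
        then show "\<sigma> = id" by auto
      qed (use \<alpha>0(2) in \<open>auto simp: extensional_restrict\<close>)
      then have "antisymmetrize n ?c0 \<alpha>0 = (\<Sum>\<sigma> | \<sigma> permutes {..<n}. if \<sigma> = id then 1 else 0)"
        unfolding antisymmetrize_def by (intro sum.cong) auto
      then show ?thesis by (simp add: finite_permutations permutes_id)
    qed
    then show ?thesis
      by (subst (1 2) \<alpha>_eq) (simp add: antisymmetrize_comp[OF \<tau>])
  qed
  have "fact n * sylvester n N q c = antisymmetrize n c \<alpha>0 * (fact n * sylvester n N q ?c0)"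
    unfolding sylvester_antisymmetrize unfolding sylvester_def sum_distrib_left
  proof (intro sum.cong refl)
    fix \<pi> assume "\<pi> \<in> {\<pi>. \<pi> permutes {..<n + N}}"
    then have \<pi>: "\<pi> permutes {..<n + N}" by simp
    have "\<pi> i < n + N" if "i < n" for i
      using permutes_in_image[OF \<pi>, of i] that by simp
    then have "restrict \<pi> {..<n} \<in> {..<n} \<rightarrow>\<^sub>E {..<n + N}"
      by (simp add: restrict_PiE_iff)
    moreover have "inj_on (restrict \<pi> {..<n}) {..<n}"
      using permutes_inj_on[OF \<pi>, of "{..<n}"] by (simp add: inj_on_def)
    ultimately have "antisymmetrize n c (restrict \<pi> {..<n}) =
        antisymmetrize n c \<alpha>0 * antisymmetrize n ?c0 (restrict \<pi> {..<n})" by (rule eq)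
    then show "of_int (sign \<pi>) * antisymmetrize n c (restrict \<pi> {..<n}) *
          (\<Prod>i<N. coeff (monom 1 i * q) (\<pi> (n + i))) =
        antisymmetrize n c \<alpha>0 * (of_int (sign \<pi>) * antisymmetrize n ?c0 (restrict \<pi> {..<n}) *
          (\<Prod>i<N. coeff (monom 1 i * q) (\<pi> (n + i))))" by simp
  qed
  then show ?thesis by simp
qed

text \<open>By induction over transpositions: the shift turns the transposition of a and b into that
  of n + a and n + b.\<close>

lemma sign_shift_permutes:
  fixes n N :: nat
  assumes "\<sigma> permutes {..<N}"
  shows "(\<lambda>i. if i < n then i else n + \<sigma> (i - n)) permutes {n..<n + N} \<and>
    sign (\<lambda>i. if i < n then i else n + \<sigma> (i - n)) = sign \<sigma>"
  using assms finite_lessThan[of N]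
proof (induction rule: permutes_induct)
  case id
  have "(\<lambda>i. if i < n then i else n + id (i - n)) = id" by auto
  then show ?case by (simp add: permutes_id)
next
  case (swap a b p)
  let ?h = "\<lambda>p i. if i < n then i else n + p (i - n)"
  have eq: "?h (Transposition.transpose a b \<circ> p) = Transposition.transpose (n + a) (n + b) \<circ> ?h p"
    by (auto simp: Transposition.transpose_def fun_eq_iff)
  have t: "Transposition.transpose (n + a) (n + b) permutes {n..<n + N}"
    using swap by (intro permutes_swap_id) auto
  have "sign (Transposition.transpose (n + a) (n + b)) = sign (Transposition.transpose a b)"
    by (simp add: sign_swap_id)
  moreover have "Transposition.transpose a b permutes {..<N}"
    using swap by (intro permutes_swap_id) auto
  ultimately show ?case
    unfolding eq using swap t
    by (auto intro!: permutes_compose simp: sign_mult_permutes simp del: o_apply)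
qed

text \<open>Once the first n rows occupy the columns of \<alpha>0, the last N rows are left with the
  window {l..<l + N}, where they form a Toeplitz matrix of coefficients of q. The factor \<kappa> is
  the sign of the reordering; it is chosen before q, so that a test polynomial can later determine
  it together with the other constants.\<close>

lemma sylvester_toeplitz:
  fixes l n N :: nat
  assumes ln: "l \<le> n"
  defines "\<alpha>0 \<equiv> restrict (\<lambda>k. if k < l then k else N + k) {..<n}"
  shows "\<exists>\<kappa>. \<forall>q. sylvester n N q (\<lambda>\<alpha>. if \<alpha> = \<alpha>0 then 1 else 0) =
    \<kappa> * (\<Sum>\<sigma> | \<sigma> permutes {..<N}. of_int (sign \<sigma>) * (\<Prod>i<N. coeff (monom 1 i * q) (l + \<sigma> i)))"
proof -
  \<comment> \<open>The first n indices follow \<alpha>0, the last N go to the gap {l..<l + N} in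
    increasing order. Every permutation extending \<alpha>0 is then \<rho> composed with a
    permutation of the last N indices.\<close>
  define \<rho> where "\<rho> i = (if i < l then i else if i < n then N + i else if i < n + N then i - n + l else i)" for i
  have \<rho>: "\<rho> permutes {..<n + N}"
  proof (rule bij_imp_permutes)
    show "bij_betw \<rho> {..<n + N} {..<n + N}"
      by (rule bij_betw_byWitness[where f' =
           "\<lambda>i. if i < l then i else if i < l + N then i - l + n else if i < n + N then i - N else i"])
        (use ln in \<open>auto simp: \<rho>_def\<close>)
  qed (use ln in \<open>auto simp: \<rho>_def\<close>)
  let ?h = "\<lambda>p i. if i < n then i else n + p (i - n)"
  let ?A = "{\<pi>. \<pi> permutes {..<n + N} \<and> restrict \<pi> {..<n} = \<alpha>0}"
  have A: "?A = (\<lambda>\<sigma>. \<rho> \<circ> ?h \<sigma>) ` {\<sigma>. \<sigma> permutes {..<N}}"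
  proof (intro equalityI subsetI)
    fix \<pi> assume "\<pi> \<in> ?A"
    then have \<pi>: "\<pi> permutes {..<n + N}" and res: "restrict \<pi> {..<n} = \<alpha>0" by auto
    have \<pi>\<rho>: "\<pi> k = \<rho> k" if "k < n" for k
      using fun_cong[OF res, of k] that by (auto simp: \<alpha>0_def \<rho>_def)
    define \<theta> where "\<theta> = Hilbert_Choice.inv \<rho> \<circ> \<pi>"
    have \<theta>: "\<theta> permutes {..<n + N}"
      unfolding \<theta>_def using \<pi> \<rho> by (intro permutes_compose permutes_inv) auto
    have \<theta>1: "\<theta> k = k" if "k < n" for k
      using \<pi>\<rho>[OF that] permutes_inverses(2)[OF \<rho>] by (simp add: \<theta>_def)
    have \<theta>2: "\<theta> k \<ge> n" if "k \<ge> n" for k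
    proof (rule ccontr)
      assume "\<not> n \<le> \<theta> k"
      then have "\<theta> (\<theta> k) = \<theta> k" by (intro \<theta>1) auto
      then have "\<theta> k = k" using permutes_inj[OF \<theta>] by (auto simp: inj_def)
      with that \<open>\<not> n \<le> \<theta> k\<close> show False by simp
    qed
    define \<sigma> where "\<sigma> i = \<theta> (n + i) - n" for i
    have "\<theta> = ?h \<sigma>"
      using \<theta>1 \<theta>2 by (auto simp: \<sigma>_def fun_eq_iff)
    moreover have "\<sigma> permutes {..<N}"
    proof (rule bij_imp_permutes)
      have "inj_on \<sigma> {..<N}"
      proof (rule inj_onI)
        fix i j assume "\<sigma> i = \<sigma> j"
        then have "\<theta> (n + i) = \<theta> (n + j)"
          using \<theta>2[of "n + i"] \<theta>2[of "n + j"] by (simp add: \<sigma>_def)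
        then have "n + i = n + j" using permutes_inj[OF \<theta>] unfolding inj_def by blast
        then show "i = j" by simp
      qed
      moreover have "\<sigma> ` {..<N} \<subseteq> {..<N}"
      proof clarsimp
        fix i assume "i < N"
        then have "\<theta> (n + i) < n + N" using permutes_in_image[OF \<theta>, of "n + i"] by auto
        then show "\<sigma> i < N" using \<theta>2[of "n + i"] by (auto simp: \<sigma>_def)
      qed
      ultimately show "bij_betw \<sigma> {..<N} {..<N}"
        by (simp add: bij_betw_def endo_inj_surj)
    next
      fix i assume "i \<notin> {..<N}"
      then show "\<sigma> i = i" using \<theta> by (auto simp: \<sigma>_def permutes_def)
    qed
    moreover have "\<pi> = \<rho> \<circ> \<theta>"
      using permutes_inverses(1)[OF \<rho>] by (auto simp: \<theta>_def)
    ultimately show "\<pi> \<in> (\<lambda>\<sigma>. \<rho> \<circ> ?h \<sigma>) ` {\<sigma>. \<sigma> permutes {..<N}}" by blast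
  next
    fix \<pi> assume "\<pi> \<in> (\<lambda>\<sigma>. \<rho> \<circ> ?h \<sigma>) ` {\<sigma>. \<sigma> permutes {..<N}}"
    then obtain \<sigma> where \<sigma>: "\<sigma> permutes {..<N}" and \<pi>: "\<pi> = \<rho> \<circ> ?h \<sigma>" by auto
    have "?h \<sigma> permutes {..<n + N}"
      using sign_shift_permutes[OF \<sigma>, of n] by (auto intro: permutes_subset)
    then have "\<pi> permutes {..<n + N}" unfolding \<pi> using \<rho> by (intro permutes_compose)
    moreover have "restrict \<pi> {..<n} = \<alpha>0"
      unfolding \<pi> \<alpha>0_def by (intro restrict_ext) (auto simp: \<rho>_def)
    ultimately show "\<pi> \<in> ?A" by simp
  qed
  have inj: "inj_on (\<lambda>\<sigma>. \<rho> \<circ> ?h \<sigma>) {\<sigma>. \<sigma> permutes {..<N}}"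
  proof (rule inj_onI)
    fix \<sigma> \<sigma>' :: "nat \<Rightarrow> nat"
    assume eq: "\<rho> \<circ> ?h \<sigma> = \<rho> \<circ> ?h \<sigma>'"
    have "\<rho> (n + \<sigma> i) = \<rho> (n + \<sigma>' i)" for i
      using fun_cong[OF eq, of "n + i"] by simp
    then have "n + \<sigma> i = n + \<sigma>' i" for i
      by (rule injD[OF permutes_inj[OF \<rho>]])
    then show "\<sigma> = \<sigma>'" by (auto simp: fun_eq_iff)
  qed
  have "sylvester n N q (\<lambda>\<alpha>. if \<alpha> = \<alpha>0 then 1 else 0) =
      of_int (sign \<rho>) * (\<Sum>\<sigma> | \<sigma> permutes {..<N}. of_int (sign \<sigma>) * (\<Prod>i<N. coeff (monom 1 i * q) (l + \<sigma> i)))"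
    (is "?lhs = ?rhs") for q
  proof -
    have "?lhs = (\<Sum>\<pi>\<in>?A. of_int (sign \<pi>) * (\<Prod>i<N. coeff (monom 1 i * q) (\<pi> (n + i))))"
      unfolding sylvester_def
      by (rule sum.mono_neutral_cong_right) (auto simp: finite_permutations)
    also have "\<dots> = (\<Sum>\<sigma> | \<sigma> permutes {..<N}. of_int (sign (\<rho> \<circ> ?h \<sigma>)) *
        (\<Prod>i<N. coeff (monom 1 i * q) (\<rho> (n + \<sigma> i))))"
      unfolding A sum.reindex[OF inj] by (simp add: o_def)
    also have "\<dots> = ?rhs"
      unfolding sum_distrib_left
    proof (intro sum.cong refl)
      fix \<sigma> assume "\<sigma> \<in> {\<sigma>. \<sigma> permutes {..<N}}"
      then have \<sigma>: "\<sigma> permutes {..<N}" by simp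
      note h = sign_shift_permutes[OF \<sigma>, of n]
      have "sign (\<rho> \<circ> ?h \<sigma>) = sign \<rho> * sign \<sigma>"
        using sign_mult_permutes[OF \<rho> _ conjunct1[OF h]] h by simp
      moreover have "(\<Prod>i<N. coeff (monom 1 i * q) (\<rho> (n + \<sigma> i))) = (\<Prod>i<N. coeff (monom 1 i * q) (l + \<sigma> i))"
      proof (intro prod.cong refl)
        fix i assume "i \<in> {..<N}"
        then have "\<sigma> i < N" using permutes_in_image[OF \<sigma>, of i] by auto
        then have "\<rho> (n + \<sigma> i) = l + \<sigma> i" using ln by (auto simp: \<rho>_def)
        then show "coeff (monom 1 i * q) (\<rho> (n + \<sigma> i)) = coeff (monom 1 i * q) (l + \<sigma> i)" by simp
      qed
      ultimately show "of_int (sign (\<rho> \<circ> ?h \<sigma>)) * (\<Prod>i<N. coeff (monom 1 i * q) (\<rho> (n + \<sigma> i))) =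
        of_int (sign \<rho>) * (of_int (sign \<sigma>) * (\<Prod>i<N. coeff (monom 1 i * q) (l + \<sigma> i)))"
        by simp
    qed
    finally show ?thesis .
  qed
  then show ?thesis by blast
qed

lemma det_scaled_vandermonde:
  "Determinant.det (Matrix.mat N N (\<lambda>(i, s). w s * z s ^ i)) = (\<Prod>s<N. w s) * alternant N z"
proof -
  let ?A = "Matrix.mat N N (\<lambda>(i, s). w s * z s ^ i)"
  have "Determinant.det ?A = Determinant.det (transpose_mat ?A)"
    by (rule det_transpose[symmetric]) auto
  also have "transpose_mat ?A = Matrix.mat N N (\<lambda>(s, i). w s * z s ^ i)"
    by (intro eq_matI) auto
  also have "Determinant.det \<dots> = (\<Sum>\<pi> | \<pi> permutes {0..<N}. of_int (sign \<pi>) *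
      (\<Prod>i = 0..<N. w i * z i ^ \<pi> i))"
    by (subst det_def'[of _ N]) (auto intro!: sum.cong prod.cong dest: permutes_in_image)
  finally show ?thesis
    by (simp add: alternant_def prod.distrib sum_distrib_left atLeast0LessThan mult_ac)
qed

lemma degree_shifted_less:
  fixes p :: "complex poly"
  assumes "k < a" "degree p \<le> b"
  shows "degree (monom 1 k * p) < a + b"
proof -
  have "degree (monom 1 k * p) \<le> k + degree p"
    using degree_mult_le[of "monom 1 k" p] degree_monom_le[of "1::complex" k] by linarith
  then show ?thesis using assms by linarith
qed

lemma poly_conv_sum_lessThan:
  fixes p :: "complex poly"
  assumes "degree p < M"
  shows "poly p x = (\<Sum>k<M. coeff p k * x ^ k)"
  unfolding poly_altdef using assms
  by (intro sum.mono_neutral_left) (auto simp: coeff_eq_0)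

text \<open>The Sylvester matrix S is multiplied by a matrix Y whose first n columns are unit
  vectors and whose other columns evaluate polynomials at the roots. The rows belonging to P vanish
  there, so S Y is block triangular, with diagonal blocks a triangular matrix with diagonal P(0) and
  a Vandermonde matrix scaled by the q(z s). The determinant of Y is a Vandermonde determinant
  scaled by n-th powers of the roots, which can be cancelled for distinct nonzero roots.\<close>

lemma sylvester_roots_generic:
  fixes z :: "nat \<Rightarrow> complex"
  assumes q: "degree q \<le> n" and inj: "inj_on z {..<N}" and nz: "\<And>i. i < N \<Longrightarrow> z i \<noteq> 0"
  defines "P \<equiv> \<Prod>i<N. [:- z i, 1:]"
  shows "sylvester n N q (\<lambda>\<alpha>. \<Prod>k<n. coeff (monom 1 k * P) (\<alpha> k)) = ((-1) ^ N) ^ n * (\<Prod>i<N. poly q (z i))"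
proof -
  define row where "row r = (if r < n then monom 1 r * P else monom 1 (r - n) * q)" for r
  define S where "S = Matrix.mat (n + N) (n + N) (\<lambda>(r, c). coeff (row r) c)"
  define Y where "Y = Matrix.mat (n + N) (n + N) (\<lambda>(k, c). if c < n then (if k = c then 1 else 0) else z (c - n) ^ k)"
  let ?A1 = "Matrix.mat n n (\<lambda>(r, c). coeff (row r) c)"
  let ?A3 = "Matrix.mat N n (\<lambda>(r, c). coeff (row (n + r)) c)"
  let ?A4 = "Matrix.mat N N (\<lambda>(i, s). poly q (z s) * z s ^ i)"
  let ?Y2 = "Matrix.mat n N (\<lambda>(k, s). z s ^ k)"
  let ?Y4 = "Matrix.mat N N (\<lambda>(i, s). z s ^ n * z s ^ i)"
  have degP: "degree P \<le> N"
    unfolding P_def using degree_prod_sum_le[of "{..<N}" "\<lambda>i. [:- z i, 1:]"] by simp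
  have degrow: "degree (row r) < n + N" if "r < n + N" for r
    using that degree_shifted_less[of r n P N] degree_shifted_less[of "r - n" N q n] degP q
    by (auto simp: row_def add.commute)
  have PZ: "poly P (z s) = 0" if "s < N" for s
    using that by (auto simp: P_def poly_prod)
  have S: "S \<in> carrier_mat (n + N) (n + N)" and Y: "Y \<in> carrier_mat (n + N) (n + N)"
    by (auto simp: S_def Y_def)
  have SY: "(S * Y) $$ (r, c) = (if c < n then coeff (row r) c else poly (row r) (z (c - n)))"
    if "r < n + N" "c < n + N" for r c
  proof -
    have "(S * Y) $$ (r, c) = (\<Sum>k<n + N. coeff (row r) k * (if c < n then (if k = c then 1 else 0) else z (c - n) ^ k))"
      using that by (simp add: S_def Y_def scalar_prod_def atLeast0LessThan)
    also have "\<dots> = (if c < n then coeff (row r) c else poly (row r) (z (c - n)))"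
      using that by (cases "c < n")
        (simp_all add: poly_conv_sum_lessThan[OF degrow] if_distrib[of "(*) _"] cong: if_cong)
    finally show ?thesis .
  qed
  have "S * Y = four_block_mat ?A1 (0\<^sub>m n N) ?A3 ?A4"
  proof (rule eq_matI)
    fix r c
    assume "r < dim_row (four_block_mat ?A1 (0\<^sub>m n N) ?A3 ?A4)" "c < dim_col (four_block_mat ?A1 (0\<^sub>m n N) ?A3 ?A4)"
    then have rc: "r < n + N" "c < n + N" by auto
    show "(S * Y) $$ (r, c) = four_block_mat ?A1 (0\<^sub>m n N) ?A3 ?A4 $$ (r, c)"
      unfolding SY[OF rc] using rc
      by (auto simp: row_def poly_monom PZ)
  qed (use S Y in auto)
  then have "Determinant.det (S * Y) = Determinant.det ?A1 * Determinant.det ?A4"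
    by (simp add: det_four_block_mat_upper_right_zero[of _ n _ N])
  moreover have "Determinant.det ?A1 = ((-1) ^ N * (\<Prod>i<N. z i)) ^ n"
  proof -
    have "coeff (row r) r = coeff P 0" if "r < n" for r
      using that by (simp add: row_def coeff_monom_mult)
    moreover have "coeff P 0 = (-1) ^ N * (\<Prod>i<N. z i)"
      by (simp add: P_def poly_0_coeff_0[symmetric] poly_prod prod_uminus)
    moreover have "upper_triangular ?A1"
      by (rule upper_triangularI) (auto simp: row_def coeff_monom_mult)
    ultimately show ?thesis
      by (subst det_upper_triangular[of _ n]) (auto simp: prod_list_diag_prod)
  qed
  moreover have "Determinant.det ?A4 = (\<Prod>s<N. poly q (z s)) * alternant N z"
    by (rule det_scaled_vandermonde)
  moreover have "Determinant.det Y = (\<Prod>s<N. z s ^ n) * alternant N z"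
  proof -
    have "Y = four_block_mat (1\<^sub>m n) ?Y2 (0\<^sub>m N n) ?Y4"
      by (rule eq_matI) (auto simp: Y_def simp flip: power_add)
    then have "Determinant.det Y = Determinant.det (1\<^sub>m n) * Determinant.det ?Y4"
      by (simp add: det_four_block_mat_lower_left_zero[of _ n _ N])
    then show ?thesis by (simp add: det_scaled_vandermonde)
  qed
  moreover have "Determinant.det (S * Y) = Determinant.det S * Determinant.det Y"
    by (rule det_mult[OF S Y])
  ultimately have "Determinant.det S * ((\<Prod>s<N. z s ^ n) * alternant N z) =
      ((-1) ^ N) ^ n * (\<Prod>i<N. poly q (z i)) * ((\<Prod>s<N. z s ^ n) * alternant N z)"
    by (simp add: power_mult_distrib prod_power_distrib mult_ac)
  moreover have "(\<Prod>s<N. z s ^ n) * alternant N z \<noteq> 0"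
    using alternant_nonzero[OF inj] nz by auto
  ultimately have "Determinant.det S = ((-1) ^ N) ^ n * (\<Prod>i<N. poly q (z i))"
    using mult_right_cancel by blast
  moreover have "Determinant.det S = sylvester n N q (\<lambda>\<alpha>. \<Prod>k<n. coeff (monom 1 k * P) (\<alpha> k))"
  proof -
    have "Determinant.det S = (\<Sum>\<pi> | \<pi> permutes {..<n + N}. of_int (sign \<pi>) * (\<Prod>r<n + N. S $$ (r, \<pi> r)))"
      by (subst det_def'[OF S]) (simp add: atLeast0LessThan)
    also have "\<dots> = (\<Sum>\<pi> | \<pi> permutes {..<n + N}. of_int (sign \<pi>) * (\<Prod>r<n + N. coeff (row r) (\<pi> r)))"
    proof (rule sum.cong[OF refl], rule arg_cong2[of _ _ _ _ "(*)", OF refl], rule prod.cong[OF refl])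
      fix \<pi> r assume "\<pi> \<in> {\<pi>. \<pi> permutes {..<n + N}}" "r \<in> {..<n + N}"
      then have "\<pi> r < n + N" "r < n + N" using permutes_in_image[of \<pi> "{..<n + N}" r] by auto
      then show "S $$ (r, \<pi> r) = coeff (row r) (\<pi> r)" by (simp add: S_def)
    qed
    also have "\<dots> = sylvester n N q (\<lambda>\<alpha>. \<Prod>k<n. coeff (monom 1 k * P) (\<alpha> k))"
      unfolding sylvester_def prod_lessThan_add
      by (rule sum.cong[OF refl]) (simp add: row_def mult.assoc)
    finally show ?thesis .
  qed
  ultimately show ?thesis by simp
qed

lemma continuous_coeff_prod_linear:
  fixes g :: "'a::topological_space \<Rightarrow> nat \<Rightarrow> complex"
  assumes "\<And>i. continuous_on A (\<lambda>t. g t i)"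
  shows "continuous_on A (\<lambda>t. coeff (\<Prod>i<N. [:- g t i, 1:]) k)"
proof (induction N arbitrary: k)
  case (Suc N)
  have eq: "coeff (\<Prod>i<Suc N. [:- g t i, 1:]) k =
      (if k = 0 then 0 else coeff (\<Prod>i<N. [:- g t i, 1:]) (k - 1)) - g t N * coeff (\<Prod>i<N. [:- g t i, 1:]) k" for t
    by (cases k) (auto simp: mult.commute[of _ "[:- g t N, 1:]"])
  show ?case unfolding eq
    by (cases "k = 0") (auto intro!: continuous_intros Suc.IH assms)
qed auto

text \<open>Both sides are continuous in the roots. Moving root i by t (i + 1) makes the roots
  distinct and nonzero for all but finitely many t, and t tends to 0.\<close>

lemma sylvester_roots:
  fixes z :: "nat \<Rightarrow> complex"
  assumes q: "degree q \<le> n"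
  shows "sylvester n N q (\<lambda>\<alpha>. \<Prod>k<n. coeff (monom 1 k * (\<Prod>i<N. [:- z i, 1:])) (\<alpha> k)) =
    ((-1) ^ N) ^ n * (\<Prod>i<N. poly q (z i))"
proof -
  define w where "w t i = z i + t * of_nat (Suc i)" for t :: complex and i
  define P where "P t = (\<Prod>i<N. [:- w t i, 1:])" for t
  define L where "L t = sylvester n N q (\<lambda>\<alpha>. \<Prod>k<n. coeff (monom 1 k * P t) (\<alpha> k))" for t
  define R where "R t = ((-1) ^ N) ^ n * (\<Prod>i<N. poly q (w t i))" for t
  \<comment> \<open>The values of t at which two roots may collide or a root vanishes. Pairs with i
    = j contribute 0, since division by zero yields 0; this is harmless because only the punctured
    limit at 0 is taken.\<close>
  define B where "B = (\<lambda>(i, j). - (z i - z j) / (of_nat (Suc i) - of_nat (Suc j))) ` ({..<N} \<times> {..<N}) \<union>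
      (\<lambda>i. - z i / of_nat (Suc i)) ` {..<N}"
  have "finite B" by (simp add: B_def)
  have eq: "L t = R t" if t: "t \<notin> B" for t
    unfolding L_def R_def P_def
  proof (rule sylvester_roots_generic[OF q])
    show "inj_on (w t) {..<N}"
    proof (rule inj_onI, rule ccontr)
      fix i j assume ij: "i \<in> {..<N}" "j \<in> {..<N}" "w t i = w t j" "i \<noteq> j"
      then have "(of_nat (Suc i) - of_nat (Suc j) :: complex) \<noteq> 0"
        by (simp only: right_minus_eq of_nat_eq_iff)
      moreover have "t * (of_nat (Suc i) - of_nat (Suc j)) = - (z i - z j)"
        using ij(3) by (simp add: w_def algebra_simps)
      ultimately have "t = - (z i - z j) / (of_nat (Suc i) - of_nat (Suc j))"
        by (simp only: eq_divide_eq if_False not_False_eq_True if_True)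
      then have "t \<in> B" using ij(1,2) unfolding B_def by (intro UnI1 image_eqI[of _ _ "(i, j)"]) auto
      with t show False ..
    qed
    show "w t i \<noteq> 0" if "i < N" for i
    proof
      assume "w t i = 0"
      then have "t * of_nat (Suc i) = - z i" by (simp only: w_def add_eq_0_iff)
      then have "t = - z i / of_nat (Suc i)" using of_nat_neq_0[of i, where 'a = complex] by (simp only: eq_divide_eq if_False not_False_eq_True if_True)
      then have "t \<in> B" using that unfolding B_def by (intro UnI2 image_eqI[of _ _ i]) auto
      with t show False ..
    qed
  qed
  have cw: "continuous_on UNIV (\<lambda>t. w t i)" for i
    unfolding w_def by (intro continuous_intros)
  have "continuous_on UNIV L"
  proof -
    have "continuous_on UNIV (\<lambda>t. coeff (monom 1 k * P t) j)" for k j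
      unfolding P_def coeff_monom_mult
      by (cases "k \<le> j") (auto intro!: continuous_coeff_prod_linear cw)
    then show ?thesis
      unfolding L_def sylvester_def by (intro continuous_intros)
  qed
  then have L: "L \<midarrow>0\<rightarrow> L 0" by (simp add: continuous_on_eq_continuous_at isCont_def)
  have "continuous_on UNIV R"
    unfolding R_def by (intro continuous_intros cw)
  then have R: "R \<midarrow>0\<rightarrow> R 0" by (simp add: continuous_on_eq_continuous_at isCont_def)
  have "\<forall>\<^sub>F t in at 0. t \<notin> B"
    using islimpt_finite[OF \<open>finite B\<close>, of 0] by (simp add: islimpt_iff_eventually)
  then have "\<forall>\<^sub>F t in at 0. L t = R t" by (rule eventually_mono) (rule eq)
  then have "R \<midarrow>0\<rightarrow> L 0" using L by (rule Lim_transform_eventually[rotated])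
  then have "L 0 = R 0" using R by (intro LIM_unique)
  then show ?thesis by (simp add: L_def R_def P_def w_def)
qed

section \<open>Resolvents and rank-one perturbations\<close>

text \<open>Both sides are the determinant of one block matrix with identities on the diagonal and
  off-diagonal blocks R and C, factorized by eliminating either block first.\<close>

lemma det_one_minus_mult_swap:
  fixes C R :: "'a::idom mat"
  assumes C: "C \<in> carrier_mat n m" and R: "R \<in> carrier_mat m n"
  shows "Determinant.det (1\<^sub>m n - C * R) = Determinant.det (1\<^sub>m m - R * C)"
proof -
  let ?M = "four_block_mat (1\<^sub>m m) R C (1\<^sub>m n)"
  have "four_block_mat (1\<^sub>m m) (0\<^sub>m m n) C (1\<^sub>m n) * four_block_mat (1\<^sub>m m) R (0\<^sub>m n m) (1\<^sub>m n - C * R)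
      = four_block_mat (1\<^sub>m m * 1\<^sub>m m + 0\<^sub>m m n * 0\<^sub>m n m) (1\<^sub>m m * R + 0\<^sub>m m n * (1\<^sub>m n - C * R))
          (C * 1\<^sub>m m + 1\<^sub>m n * 0\<^sub>m n m) (C * R + 1\<^sub>m n * (1\<^sub>m n - C * R))"
    by (rule mult_four_block_mat) (use C R in auto)
  also have "\<dots> = ?M"
  proof -
    have "C * R + (1\<^sub>m n - C * R) = 1\<^sub>m n"
      using C R by (intro eq_matI) auto
    then show ?thesis using C R by (simp add: left_mult_zero_mat[of _ n n])
  qed
  finally have M: "four_block_mat (1\<^sub>m m) (0\<^sub>m m n) C (1\<^sub>m n) * four_block_mat (1\<^sub>m m) R (0\<^sub>m n m) (1\<^sub>m n - C * R) = ?M" .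
  have 1: "Determinant.det ?M = Determinant.det (1\<^sub>m n - C * R)"
  proof -
    have "Determinant.det (four_block_mat (1\<^sub>m m) (0\<^sub>m m n) C (1\<^sub>m n)) = 1"
      by (subst det_four_block_mat_upper_right_zero[of _ m _ n]) (use C in auto)
    moreover have "Determinant.det (four_block_mat (1\<^sub>m m) R (0\<^sub>m n m) (1\<^sub>m n - C * R)) = Determinant.det (1\<^sub>m n - C * R)"
      by (subst det_four_block_mat_lower_left_zero[of _ m _ n]) (use C R in auto)
    ultimately show ?thesis
      unfolding M[symmetric] by (subst det_mult[of _ "m + n"]) (use C R in auto)
  qed
  have "four_block_mat (1\<^sub>m m) R (0\<^sub>m n m) (1\<^sub>m n) * four_block_mat (1\<^sub>m m - R * C) (0\<^sub>m m n) C (1\<^sub>m n)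
      = four_block_mat (1\<^sub>m m * (1\<^sub>m m - R * C) + R * C) (1\<^sub>m m * 0\<^sub>m m n + R * 1\<^sub>m n)
          (0\<^sub>m n m * (1\<^sub>m m - R * C) + 1\<^sub>m n * C) (0\<^sub>m n m * 0\<^sub>m m n + 1\<^sub>m n * 1\<^sub>m n)"
    by (rule mult_four_block_mat) (use C R in auto)
  also have "\<dots> = ?M"
  proof -
    have "1\<^sub>m m - R * C + R * C = 1\<^sub>m m"
      using C R by (intro eq_matI) auto
    then show ?thesis using C R by (simp add: left_mult_zero_mat[of _ m m])
  qed
  finally have M': "four_block_mat (1\<^sub>m m) R (0\<^sub>m n m) (1\<^sub>m n) * four_block_mat (1\<^sub>m m - R * C) (0\<^sub>m m n) C (1\<^sub>m n) = ?M" .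
  have 2: "Determinant.det ?M = Determinant.det (1\<^sub>m m - R * C)"
  proof -
    have "Determinant.det (four_block_mat (1\<^sub>m m) R (0\<^sub>m n m) (1\<^sub>m n)) = 1"
      by (subst det_four_block_mat_lower_left_zero[of _ m _ n]) (use R in auto)
    moreover have "Determinant.det (four_block_mat (1\<^sub>m m - R * C) (0\<^sub>m m n) C (1\<^sub>m n)) = Determinant.det (1\<^sub>m m - R * C)"
      by (subst det_four_block_mat_upper_right_zero[of _ m _ n]) (use C R in auto)
    ultimately show ?thesis
      unfolding M'[symmetric] by (subst det_mult[of _ "m + n"]) (use C R in auto)
  qed
  from 1 2 show ?thesis by simp
qed

definition shifted :: "nat \<Rightarrow> complex \<Rightarrow> complex mat \<Rightarrow> complex mat" where
  "shifted N x U = x \<cdot>\<^sub>m 1\<^sub>m N - U"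

text \<open>Entries of (x - U)^(-1) by Cramer's rule. In this form they are polynomials in the
  entries of U divided by the characteristic polynomial, which gives measurability and bounds
  directly.\<close>

definition resolvent :: "nat \<Rightarrow> complex mat \<Rightarrow> complex \<Rightarrow> nat \<Rightarrow> nat \<Rightarrow> complex" where
  "resolvent N U x a b = adj_mat (shifted N x U) $$ (a, b) / poly (char_poly U) x"

text \<open>Entries of U (x - U)^(-1) = x (x - U)^(-1) - 1, see \<open>cayley_mult\<close>. This
  matrix describes the response of the characteristic polynomial to a rank-one perturbation.\<close>

definition cayley :: "nat \<Rightarrow> complex mat \<Rightarrow> complex \<Rightarrow> nat \<Rightarrow> nat \<Rightarrow> complex" where
  "cayley N U x a b = x * resolvent N U x a b - (if a = b then 1 else 0)"

definition rank_one :: "nat \<Rightarrow> complex \<Rightarrow> (nat \<Rightarrow> complex) \<Rightarrow> complex mat" where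
  "rank_one N u v = Matrix.mat N N (\<lambda>(a, b). (if a = b then 1 else 0) + u * v a * cnj (v b))"

definition herm_form :: "nat \<Rightarrow> (nat \<Rightarrow> complex) \<Rightarrow> (nat \<Rightarrow> nat \<Rightarrow> complex) \<Rightarrow> complex" where
  "herm_form N v A = (\<Sum>a<N. \<Sum>b<N. cnj (v a) * A a b * v b)"

lemma poly_char_poly:
  fixes U :: "complex mat"
  assumes U: "U \<in> carrier_mat N N"
  shows "poly (char_poly U) x = Determinant.det (shifted N x U)"
proof -
  have hom: "comm_ring_hom (\<lambda>p :: complex poly. poly p x)" by unfold_locales auto
  have "poly (char_poly U) x = Determinant.det (map_mat (\<lambda>p. poly p x) (char_poly_matrix U))"
    by (simp add: char_poly_def comm_ring_hom.hom_det[OF hom])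
  also have "map_mat (\<lambda>p. poly p x) (char_poly_matrix U) = shifted N x U"
    using U by (intro eq_matI) (auto simp: char_poly_matrix_def shifted_def)
  finally show ?thesis .
qed

context
  fixes N :: nat and U :: "complex mat"
  assumes U: "U \<in> carrier_mat N N"
begin

lemma shifted_carrier: "shifted N x U \<in> carrier_mat N N"
  using U by (auto simp: shifted_def)

lemma shifted_index: "a < N \<Longrightarrow> b < N \<Longrightarrow> shifted N x U $$ (a, b) = (if a = b then x else 0) - U $$ (a, b)"
  using U by (simp add: shifted_def)

lemma resolvent_left:
  assumes x: "poly (char_poly U) x \<noteq> 0" and ab: "a < N" "b < N"
  shows "(\<Sum>k<N. resolvent N U x a k * shifted N x U $$ (k, b)) = (if a = b then 1 else 0)"
proof -
  note adj = adj_mat[OF shifted_carrier[of x]]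
  have "(\<Sum>k<N. adj_mat (shifted N x U) $$ (a, k) * shifted N x U $$ (k, b)) =
      (adj_mat (shifted N x U) * shifted N x U) $$ (a, b)"
    using ab shifted_carrier[of x] adj(1)
    by (auto simp: scalar_prod_def atLeast0LessThan)
  also have "\<dots> = (if a = b then poly (char_poly U) x else 0)"
    unfolding adj(3) poly_char_poly[OF U] using ab by simp
  finally show ?thesis using x
    by (auto simp: resolvent_def sum_divide_distrib[symmetric])
qed

lemma resolvent_right:
  assumes x: "poly (char_poly U) x \<noteq> 0" and ab: "a < N" "b < N"
  shows "(\<Sum>k<N. shifted N x U $$ (a, k) * resolvent N U x k b) = (if a = b then 1 else 0)"
proof -
  note adj = adj_mat[OF shifted_carrier[of x]]
  have "(\<Sum>k<N. shifted N x U $$ (a, k) * adj_mat (shifted N x U) $$ (k, b)) =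
      (shifted N x U * adj_mat (shifted N x U)) $$ (a, b)"
    using ab shifted_carrier[of x] adj(1)
    by (auto simp: scalar_prod_def atLeast0LessThan)
  also have "\<dots> = (if a = b then poly (char_poly U) x else 0)"
    unfolding adj(2) poly_char_poly[OF U] using ab by simp
  finally show ?thesis using x
    by (auto simp: resolvent_def sum_divide_distrib[symmetric])
qed

lemma resolvent_identity:
  assumes x: "poly (char_poly U) x \<noteq> 0" and y: "poly (char_poly U) y \<noteq> 0" and ab: "a < N" "b < N"
  shows "(x - y) * (\<Sum>k<N. resolvent N U x a k * resolvent N U y k b) = resolvent N U y a b - resolvent N U x a b"
proof -
  let ?X = "resolvent N U x" and ?Y = "resolvent N U y"
  have "(\<Sum>k<N. \<Sum>l<N. ?X a k * shifted N x U $$ (k, l) * ?Y l b) = ?Y a b"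
  proof -
    have "(\<Sum>k<N. \<Sum>l<N. ?X a k * shifted N x U $$ (k, l) * ?Y l b) =
        (\<Sum>l<N. (\<Sum>k<N. ?X a k * shifted N x U $$ (k, l)) * ?Y l b)"
      by (subst sum.swap) (simp add: sum_distrib_right)
    also have "\<dots> = (\<Sum>l<N. if a = l then ?Y l b else 0)"
      by (intro sum.cong refl) (simp add: resolvent_left[OF x ab(1)])
    finally show ?thesis using ab by simp
  qed
  moreover have "(\<Sum>k<N. \<Sum>l<N. ?X a k * shifted N y U $$ (k, l) * ?Y l b) = ?X a b"
  proof -
    have "(\<Sum>k<N. \<Sum>l<N. ?X a k * shifted N y U $$ (k, l) * ?Y l b) =
        (\<Sum>k<N. ?X a k * (\<Sum>l<N. shifted N y U $$ (k, l) * ?Y l b))"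
      by (simp add: sum_distrib_left mult.assoc)
    also have "\<dots> = (\<Sum>k<N. if k = b then ?X a k else 0)"
      by (intro sum.cong refl) (simp add: resolvent_right[OF y _ ab(2)])
    finally show ?thesis using ab by simp
  qed
  moreover have "(\<Sum>k<N. \<Sum>l<N. ?X a k * shifted N x U $$ (k, l) * ?Y l b) -
      (\<Sum>k<N. \<Sum>l<N. ?X a k * shifted N y U $$ (k, l) * ?Y l b) = (x - y) * (\<Sum>k<N. ?X a k * ?Y k b)"
  proof -
    have "(\<Sum>k<N. \<Sum>l<N. ?X a k * shifted N x U $$ (k, l) * ?Y l b) -
      (\<Sum>k<N. \<Sum>l<N. ?X a k * shifted N y U $$ (k, l) * ?Y l b) =
      (\<Sum>k<N. \<Sum>l<N. if k = l then (x - y) * (?X a k * ?Y k b) else 0)"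
      unfolding sum_subtractf[symmetric]
      by (intro sum.cong refl) (auto simp: shifted_index algebra_simps)
    then show ?thesis by (simp add: sum_distrib_left)
  qed
  ultimately show ?thesis by simp
qed

lemma cayley_mult:
  assumes x: "poly (char_poly U) x \<noteq> 0" and ab: "a < N" "b < N"
  shows "cayley N U x a b = (\<Sum>k<N. U $$ (a, k) * resolvent N U x k b)"
proof -
  have "(\<Sum>k<N. shifted N x U $$ (a, k) * resolvent N U x k b) =
      (\<Sum>k<N. (if k = a then x * resolvent N U x k b else 0) - U $$ (a, k) * resolvent N U x k b)"
    using ab by (intro sum.cong refl) (auto simp: shifted_index algebra_simps)
  then show ?thesis
    using resolvent_right[OF x ab] ab by (simp add: sum_subtractf cayley_def algebra_simps)
qed

text \<open>The derivative of the characteristic polynomial is the sum of the characteristic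
  polynomials of the principal submatrices, and their values at x are the diagonal entries of the
  adjugate.\<close>

lemma trace_resolvent:
  "(\<Sum>a<N. resolvent N U x a a) = poly (pderiv (char_poly U)) x / poly (char_poly U) x"
proof -
  have "poly (pderiv (char_poly U)) x = (\<Sum>i<N. poly (char_poly (mat_delete U i i)) x)"
    by (simp add: pderiv_char_poly[OF U] poly_sum)
  also have "\<dots> = (\<Sum>i<N. adj_mat (shifted N x U) $$ (i, i))"
  proof (rule sum.cong[OF refl])
    fix i assume i: "i \<in> {..<N}"
    have c: "mat_delete U i i \<in> carrier_mat (N - 1) (N - 1)" using U by (auto simp: mat_delete_def)
    have "shifted (N - 1) x (mat_delete U i i) = mat_delete (shifted N x U) i i"
      using U i by (intro eq_matI) (auto simp: mat_delete_def shifted_def)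
    then show "poly (char_poly (mat_delete U i i)) x = adj_mat (shifted N x U) $$ (i, i)"
      using i shifted_carrier[of x] by (simp add: poly_char_poly[OF c] adj_mat_def cofactor_def)
  qed
  finally show ?thesis by (simp add: resolvent_def sum_divide_distrib[symmetric])
qed

lemma trace_cayley:
  "(\<Sum>a<N. cayley N U x a a) = x * poly (pderiv (char_poly U)) x / poly (char_poly U) x - of_nat N"
proof -
  have "(\<Sum>a<N. cayley N U x a a) = x * (\<Sum>a<N. resolvent N U x a a) - of_nat N"
    by (simp add: cayley_def sum_subtractf sum_distrib_left)
  then show ?thesis by (simp add: trace_resolvent)
qed

text \<open>By the resolvent identity the trace of a product of two resolvents is a divided
  difference of their traces. Hence quadratic traces bring in no spectral quantity beyond the
  logarithmic derivative of the characteristic polynomial, and the equations for its products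
  close.\<close>

lemma trace_cayley_mult:
  assumes x: "poly (char_poly U) x \<noteq> 0" and y: "poly (char_poly U) y \<noteq> 0" and xy: "x \<noteq> y"
  defines "t \<equiv> \<lambda>x. x * poly (pderiv (char_poly U)) x / poly (char_poly U) x"
  shows "(\<Sum>a<N. \<Sum>b<N. cayley N U x a b * cayley N U y b a) = of_nat N - (x * t x - y * t y) / (x - y)"
proof -
  let ?X = "resolvent N U x" and ?Y = "resolvent N U y"
  define p q where "p = (\<Sum>a<N. ?X a a)" and "q = (\<Sum>a<N. ?Y a a)"
  have "cayley N U x a b * cayley N U y b a = x * y * (?X a b * ?Y b a) -
      (if a = b then x * ?X a a + y * ?Y a a - 1 else 0)" for a b
    by (auto simp: cayley_def algebra_simps)
  then have "(\<Sum>a<N. \<Sum>b<N. cayley N U x a b * cayley N U y b a) =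
      x * y * (\<Sum>a<N. \<Sum>b<N. ?X a b * ?Y b a) - (x * p + y * q - of_nat N)"
    by (simp add: sum_subtractf sum.distrib sum_distrib_left p_def q_def)
  moreover have "(x - y) * (\<Sum>a<N. \<Sum>b<N. ?X a b * ?Y b a) = q - p"
    unfolding sum_distrib_left[of "x - y" "\<lambda>a. \<Sum>b<N. ?X a b * ?Y b a"]
    by (simp add: resolvent_identity[OF x y] sum_subtractf p_def q_def)
  then have "(\<Sum>a<N. \<Sum>b<N. ?X a b * ?Y b a) = (q - p) / (x - y)"
    using xy by (simp add: eq_divide_eq mult.commute)
  ultimately have "(\<Sum>a<N. \<Sum>b<N. cayley N U x a b * cayley N U y b a) =
      x * y * ((q - p) / (x - y)) - (x * p + y * q - of_nat N)"
    by simp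
  also have "\<dots> = of_nat N - (x * (x * p) - y * (y * q)) / (x - y)"
    using xy by (simp add: field_simps)
  finally show ?thesis by (simp add: t_def p_def q_def trace_resolvent)
qed

lemma det_rank_one_general:
  "Determinant.det (Matrix.mat N N (\<lambda>(a, b). (if a = b then 1 else 0) - c a * r b)) =
    (1 :: complex) - (\<Sum>k<N. r k * c k)"
proof -
  let ?C = "Matrix.mat N 1 (\<lambda>(a, _). c a)" and ?R = "Matrix.mat 1 N (\<lambda>(_, b). r b)"
  have "Matrix.mat N N (\<lambda>(a, b). (if a = b then 1 else 0) - c a * r b) = 1\<^sub>m N - ?C * ?R"
    by (intro eq_matI) (auto simp: scalar_prod_def)
  then have "Determinant.det (Matrix.mat N N (\<lambda>(a, b). (if a = b then 1 else 0) - c a * r b)) =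
      Determinant.det (1\<^sub>m 1 - ?R * ?C)"
    by (simp add: det_one_minus_mult_swap[of _ N 1])
  also have "\<dots> = 1 - (\<Sum>k<N. r k * c k)"
    by (subst det_single) (auto simp: scalar_prod_def atLeast0LessThan)
  finally show ?thesis .
qed

lemma rank_one_carrier: "rank_one N u v \<in> carrier_mat N N"
  by (simp add: rank_one_def)

text \<open>With r the row vector u v^H U (x - U)^(-1), where v^H is the adjoint of v, the perturbed
  x - V U factors as (1 - v r) (x - U). The determinant of the first factor is 1 - r v.\<close>

lemma char_poly_rank_one:
  assumes x: "poly (char_poly U) x \<noteq> 0"
  shows "poly (char_poly (rank_one N u v * U)) x = poly (char_poly U) x * (1 - u * herm_form N v (cayley N U x))"
proof -
  define r where "r b = u * (\<Sum>a<N. cnj (v a) * cayley N U x a b)" for b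
  let ?K = "Matrix.mat N N (\<lambda>(a, b). (if a = b then 1 else 0) - v a * r b)"
  have VU: "rank_one N u v * U \<in> carrier_mat N N" using U rank_one_carrier by (intro mult_carrier_mat)
  have rB: "(\<Sum>k<N. r k * shifted N x U $$ (k, b)) = u * (\<Sum>a<N. cnj (v a) * U $$ (a, b))" if b: "b < N" for b
  proof -
    have "(\<Sum>k<N. cayley N U x a k * shifted N x U $$ (k, b)) = U $$ (a, b)" if a: "a < N" for a
    proof -
      have "(\<Sum>k<N. cayley N U x a k * shifted N x U $$ (k, b)) =
          (\<Sum>k<N. \<Sum>l<N. U $$ (a, l) * resolvent N U x l k * shifted N x U $$ (k, b))"
        by (intro sum.cong refl) (simp add: cayley_mult[OF x a] sum_distrib_right)
      also have "\<dots> = (\<Sum>l<N. U $$ (a, l) * (\<Sum>k<N. resolvent N U x l k * shifted N x U $$ (k, b)))"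
        by (subst sum.swap) (simp add: sum_distrib_left mult.assoc)
      also have "\<dots> = (\<Sum>l<N. if l = b then U $$ (a, l) else 0)"
        by (intro sum.cong refl) (simp add: resolvent_left[OF x _ b])
      finally show ?thesis using b by simp
    qed
    note 1 = this
    have "(\<Sum>k<N. r k * shifted N x U $$ (k, b)) =
        u * (\<Sum>k<N. \<Sum>a<N. cnj (v a) * (cayley N U x a k * shifted N x U $$ (k, b)))"
      by (simp add: r_def sum_distrib_left sum_distrib_right mult.assoc)
    also have "(\<Sum>k<N. \<Sum>a<N. cnj (v a) * (cayley N U x a k * shifted N x U $$ (k, b))) =
        (\<Sum>a<N. cnj (v a) * (\<Sum>k<N. cayley N U x a k * shifted N x U $$ (k, b)))"
      by (subst sum.swap) (simp add: sum_distrib_left)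
    finally show ?thesis by (simp add: 1)
  qed
  have "shifted N x (rank_one N u v * U) = ?K * shifted N x U"
  proof (rule eq_matI)
    fix a b assume "a < dim_row (?K * shifted N x U)" "b < dim_col (?K * shifted N x U)"
    then have ab: "a < N" "b < N" using shifted_carrier[of x] by auto
    have "(?K * shifted N x U) $$ (a, b) = (\<Sum>k<N. ((if a = k then 1 else 0) - v a * r k) * shifted N x U $$ (k, b))"
      using ab shifted_carrier[of x] by (auto simp: scalar_prod_def atLeast0LessThan)
    also have "\<dots> = (\<Sum>k<N. (if k = a then shifted N x U $$ (k, b) else 0) - v a * (r k * shifted N x U $$ (k, b)))"
      by (intro sum.cong refl) (auto simp: algebra_simps)
    also have "\<dots> = shifted N x U $$ (a, b) - v a * (\<Sum>k<N. r k * shifted N x U $$ (k, b))"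
      using ab by (simp add: sum_subtractf sum_distrib_left)
    finally have R: "(?K * shifted N x U) $$ (a, b) = shifted N x U $$ (a, b) - v a * u * (\<Sum>k<N. cnj (v k) * U $$ (k, b))"
      by (simp add: rB[OF ab(2)])
    have "(rank_one N u v * U) $$ (a, b) = (\<Sum>k<N. ((if a = k then 1 else 0) + u * v a * cnj (v k)) * U $$ (k, b))"
      using ab U by (auto simp: scalar_prod_def atLeast0LessThan rank_one_def)
    also have "\<dots> = (\<Sum>k<N. (if k = a then U $$ (k, b) else 0) + v a * u * (cnj (v k) * U $$ (k, b)))"
      by (intro sum.cong refl) (auto simp: algebra_simps)
    also have "\<dots> = U $$ (a, b) + v a * u * (\<Sum>k<N. cnj (v k) * U $$ (k, b))"
      using ab by (simp add: sum.distrib sum_distrib_left)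
    finally show "shifted N x (rank_one N u v * U) $$ (a, b) = (?K * shifted N x U) $$ (a, b)"
      unfolding R using ab VU U carrier_matD[OF rank_one_carrier[of u v]] by (simp add: shifted_def)
  qed (use VU U in \<open>auto simp: shifted_def\<close>)
  then have "poly (char_poly (rank_one N u v * U)) x = Determinant.det ?K * poly (char_poly U) x"
    unfolding poly_char_poly[OF VU] poly_char_poly[OF U]
    by (simp add: det_mult[OF _ shifted_carrier])
  also have "Determinant.det ?K = 1 - (\<Sum>k<N. r k * v k)"
    by (rule det_rank_one_general)
  also have "(\<Sum>k<N. r k * v k) = u * herm_form N v (cayley N U x)"
    unfolding r_def herm_form_def
    by (simp add: sum_distrib_left sum_distrib_right mult.assoc, rule sum.swap)
  finally show ?thesis by simp
qed

end

lemma det_rank_one: "Determinant.det (rank_one N u v) = 1 + u * (\<Sum>k<N. cnj (v k) * v k)"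
proof -
  have "rank_one N u v = Matrix.mat N N (\<lambda>(a, b). (if a = b then 1 else 0) - v a * (- u * cnj (v b)))"
    unfolding rank_one_def by (intro eq_matI) auto
  then show ?thesis
    using det_rank_one_general[OF zero_carrier_mat, of N v "\<lambda>b. - u * cnj (v b)"]
    by (simp add: sum_distrib_left sum_negf mult.assoc)
qed

section \<open>The unitary group and Haar measure\<close>

lemma mat_adjoint_index:
  assumes "A \<in> carrier_mat N N" "i < N" "j < N"
  shows "mat_adjoint A $$ (i, j) = conjugate (A $$ (j, i))"
  using assms by (simp add: mat_adjoint_def mat_of_rows_def)

lemma mat_adjoint_carrier: "A \<in> carrier_mat N N \<Longrightarrow> mat_adjoint A \<in> carrier_mat N N"
  by (auto simp: mat_adjoint_def intro!: carrier_matI)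

lemma mat_adjoint_adjoint:
  fixes A :: "complex mat"
  assumes "A \<in> carrier_mat N N"
  shows "mat_adjoint (mat_adjoint A) = A"
  using assms mat_adjoint_carrier[OF assms] mat_adjoint_carrier[OF mat_adjoint_carrier[OF assms]]
  by (intro eq_matI) (auto simp: mat_adjoint_index[of _ N])

lemma mat_adjoint_mult:
  fixes A B :: "complex mat"
  assumes "A \<in> carrier_mat N N" "B \<in> carrier_mat N N"
  shows "mat_adjoint (A * B) = mat_adjoint B * mat_adjoint A"
proof (rule eq_matI)
  have AB: "A * B \<in> carrier_mat N N" using assms by simp
  note c = assms AB mat_adjoint_carrier[OF assms(1)] mat_adjoint_carrier[OF assms(2)] mat_adjoint_carrier[OF AB]
  show "dim_row (mat_adjoint (A * B)) = dim_row (mat_adjoint B * mat_adjoint A)"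
    "dim_col (mat_adjoint (A * B)) = dim_col (mat_adjoint B * mat_adjoint A)"
    using c by auto
  fix i j assume "i < dim_row (mat_adjoint B * mat_adjoint A)" "j < dim_col (mat_adjoint B * mat_adjoint A)"
  then have ij: "i < N" "j < N" using c by auto
  have "mat_adjoint (A * B) $$ (i, j) = cnj (\<Sum>k<N. A $$ (j, k) * B $$ (k, i))"
    using ij assms by (simp add: mat_adjoint_index[OF AB] scalar_prod_def atLeast0LessThan)
  also have "\<dots> = (\<Sum>k<N. mat_adjoint B $$ (i, k) * mat_adjoint A $$ (k, j))"
    unfolding cnj_sum
    by (intro sum.cong refl) (use ij assms in \<open>auto simp: mat_adjoint_index[of _ N] mult.commute\<close>)
  also have "\<dots> = (mat_adjoint B * mat_adjoint A) $$ (i, j)"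
    using ij c by (auto simp: scalar_prod_def atLeast0LessThan)
  finally show "mat_adjoint (A * B) $$ (i, j) = (mat_adjoint B * mat_adjoint A) $$ (i, j)" .
qed

lemma unitary_group_carrier: "U \<in> unitary_group N \<Longrightarrow> U \<in> carrier_mat N N"
  by (simp add: unitary_group_def)

lemma unitary_group_adjoint_mult:
  assumes "U \<in> unitary_group N"
  shows "mat_adjoint U * U = 1\<^sub>m N"
  using assms mat_mult_left_right_inverse[of U N "mat_adjoint U"]
  by (auto simp: unitary_group_def mat_adjoint_carrier)

lemma unitary_group_adjoint: "U \<in> unitary_group N \<Longrightarrow> mat_adjoint U \<in> unitary_group N"
  using unitary_group_adjoint_mult[of U N]
  by (auto simp: unitary_group_def mat_adjoint_carrier mat_adjoint_adjoint)

lemma unitary_group_mult: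
  assumes "U \<in> unitary_group N" "V \<in> unitary_group N"
  shows "U * V \<in> unitary_group N"
proof -
  note c = unitary_group_carrier[OF assms(1)] unitary_group_carrier[OF assms(2)]
  note a = mat_adjoint_carrier[OF c(1)] mat_adjoint_carrier[OF c(2)]
  have "U * V * (mat_adjoint V * mat_adjoint U) = U * (V * mat_adjoint V) * mat_adjoint U"
    using c a by (simp add: assoc_mult_mat[of _ N N _ N _ N])
  also have "\<dots> = 1\<^sub>m N"
    using assms c a by (simp add: unitary_group_def)
  finally show ?thesis using c by (simp add: unitary_group_def mat_adjoint_mult[OF c])
qed

lemma unitary_row_norm:
  assumes U: "U \<in> unitary_group N" and i: "i < N"
  shows "(\<Sum>k<N. (cmod (U $$ (i, k)))\<^sup>2) = 1"
proof -
  note c = unitary_group_carrier[OF U]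
  have "(U * mat_adjoint U) $$ (i, i) = (\<Sum>k<N. U $$ (i, k) * cnj (U $$ (i, k)))"
    using i c mat_adjoint_carrier[OF c]
    by (auto simp: scalar_prod_def atLeast0LessThan mat_adjoint_index[OF c])
  also have "\<dots> = of_real (\<Sum>k<N. (cmod (U $$ (i, k)))\<^sup>2)"
    unfolding of_real_sum by (intro sum.cong refl) (simp only: complex_norm_square)
  finally have "of_real (\<Sum>k<N. (cmod (U $$ (i, k)))\<^sup>2) = (1::complex)"
    using U i by (simp add: unitary_group_def)
  then show ?thesis by (simp only: of_real_eq_1_iff)
qed

lemma unitary_entry_bound:
  assumes U: "U \<in> unitary_group N" and "i < N" "j < N"
  shows "cmod (U $$ (i, j)) \<le> 1"
proof -
  have "(cmod (U $$ (i, j)))\<^sup>2 \<le> (\<Sum>k<N. (cmod (U $$ (i, k)))\<^sup>2)"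
    by (rule member_le_sum) (use assms in auto)
  then show ?thesis using unitary_row_norm[OF U \<open>i < N\<close>] by (simp add: power_le_one_iff abs_square_le_1)
qed

lemma unitary_det_norm:
  assumes "U \<in> unitary_group N"
  shows "cmod (Determinant.det U) = 1"
proof -
  note c = unitary_group_carrier[OF assms]
  have "Determinant.det (mat_adjoint U) = cnj (Determinant.det U)"
  proof -
    have "Determinant.det (mat_adjoint U) = Determinant.det (transpose_mat (mat_adjoint U))"
      using mat_adjoint_carrier[OF c] by (simp add: det_transpose)
    also have "\<dots> = (\<Sum>p | p permutes {0..<N}. of_int (sign p) * (\<Prod>i = 0..<N. cnj (U $$ (i, p i))))"
      using c mat_adjoint_carrier[OF c]
      by (subst det_def'[of _ N]) (auto intro!: sum.cong prod.cong dest: permutes_in_image simp: mat_adjoint_index[OF c])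
    also have "\<dots> = cnj (Determinant.det U)"
      by (subst det_def'[OF c]) (simp add: cnj_sum cnj_prod)
    finally show ?thesis .
  qed
  moreover have "Determinant.det U * Determinant.det (mat_adjoint U) = 1"
    using assms c mat_adjoint_carrier[OF c]
    by (simp add: unitary_group_def flip: det_mult[of _ N])
  ultimately have "of_real ((cmod (Determinant.det U))\<^sup>2) = (1::complex)"
    by (simp only: complex_norm_square)
  then have "(cmod (Determinant.det U))\<^sup>2 = 1" by (simp only: of_real_eq_1_iff)
  then show ?thesis by (simp add: abs_square_eq_1)
qed

lemma unitary_preserves_norm:
  assumes U: "U \<in> unitary_group N" and v: "v \<in> carrier_vec N"
  shows "(U *\<^sub>v v) \<bullet>c (U *\<^sub>v v) = v \<bullet>c v"
proof -
  note c = unitary_group_carrier[OF U]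
  have Uv: "vec_index (U *\<^sub>v v) i = (\<Sum>k<N. U $$ (i, k) * vec_index v k)" if "i < N" for i
    using that c v by (simp add: scalar_prod_def atLeast0LessThan)
  have "(U *\<^sub>v v) \<bullet>c (U *\<^sub>v v) = (\<Sum>i<N. vec_index (U *\<^sub>v v) i * cnj (vec_index (U *\<^sub>v v) i))"
    using c by (simp add: scalar_prod_def atLeast0LessThan)
  also have "\<dots> = (\<Sum>i<N. (\<Sum>k<N. U $$ (i, k) * vec_index v k) * cnj (\<Sum>l<N. U $$ (i, l) * vec_index v l))"
    by (intro sum.cong refl) (simp add: Uv del: cnj_sum)
  also have "\<dots> = (\<Sum>i<N. \<Sum>k<N. \<Sum>l<N. vec_index v k * cnj (vec_index v l) * (cnj (U $$ (i, l)) * U $$ (i, k)))"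
    by (simp add: cnj_sum sum_product mult_ac)
  also have "\<dots> = (\<Sum>k<N. \<Sum>l<N. vec_index v k * cnj (vec_index v l) * (\<Sum>i<N. cnj (U $$ (i, l)) * U $$ (i, k)))"
    unfolding sum_distrib_left by (subst sum.swap, rule sum.cong[OF refl], rule sum.swap)
  also have "\<dots> = (\<Sum>k<N. \<Sum>l<N. if l = k then vec_index v k * cnj (vec_index v k) else 0)"
  proof (intro sum.cong refl)
    fix k l assume "k \<in> {..<N}" "l \<in> {..<N}"
    then have kl: "k < N" "l < N" by auto
    have "(\<Sum>i<N. cnj (U $$ (i, l)) * U $$ (i, k)) = (mat_adjoint U * U) $$ (l, k)"
      using kl c mat_adjoint_carrier[OF c] by (auto simp: scalar_prod_def atLeast0LessThan mat_adjoint_index[OF c])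
    also have "\<dots> = (if l = k then 1 else 0)"
      using kl by (simp add: unitary_group_adjoint_mult[OF U])
    finally show "vec_index v k * cnj (vec_index v l) * (\<Sum>i<N. cnj (U $$ (i, l)) * U $$ (i, k)) =
        (if l = k then vec_index v k * cnj (vec_index v k) else 0)" by simp
  qed
  also have "\<dots> = v \<bullet>c v"
    using v by (simp add: scalar_prod_def atLeast0LessThan)
  finally show ?thesis .
qed

lemma unitary_eigenvalue_norm:
  assumes U: "U \<in> unitary_group N" and z: "poly (char_poly U) z = 0"
  shows "cmod z = 1"
proof -
  note c = unitary_group_carrier[OF U]
  from z have "eigenvalue U z" by (simp add: eigenvalue_root_char_poly[OF c])
  then obtain v where v: "v \<in> carrier_vec N" "v \<noteq> 0\<^sub>v N" "U *\<^sub>v v = z \<cdot>\<^sub>v v"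
    using c by (auto simp: eigenvalue_def eigenvector_def)
  have "(z * cnj z) * (v \<bullet>c v) = v \<bullet>c v"
    using unitary_preserves_norm[OF U v(1)] v(1) unfolding v(3)
    by (simp add: conjugate_smult_vec mult_ac)
  moreover have "v \<bullet>c v \<noteq> 0" using v(1,2) by (simp add: conjugate_square_eq_0_vec)
  ultimately have "z * cnj z = 1" by (metis mult_cancel_right2)
  then have "of_real ((cmod z)\<^sup>2) = (1::complex)" by (simp only: complex_norm_square)
  then have "(cmod z)\<^sup>2 = 1" by (simp only: of_real_eq_1_iff)
  then show ?thesis by (simp add: abs_square_eq_1)
qed

lemma unitary_spectrum:
  assumes U: "U \<in> unitary_group N"
  obtains z :: "nat \<Rightarrow> complex" where "char_poly U = (\<Prod>i<N. [:- z i, 1:])" "\<And>i. i < N \<Longrightarrow> cmod (z i) = 1"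
    "proots (char_poly U) = image_mset z (mset_set {..<N})"
proof -
  obtain as where as: "char_poly U = (\<Prod>a\<leftarrow>as. [:- a, 1:])" "length as = N"
    using char_poly_factorized[OF unitary_group_carrier[OF U]] by blast
  define z where "z i = as ! i" for i
  have eq: "char_poly U = (\<Prod>i<N. [:- z i, 1:])"
    unfolding as(1) z_def as(2)[symmetric]
    by (subst prod.list_conv_set_nth) (simp add: atLeast0LessThan)
  moreover have "cmod (z i) = 1" if "i < N" for i
    by (rule unitary_eigenvalue_norm[OF U]) (use that in \<open>auto simp: eq poly_prod\<close>)
  moreover have "proots (char_poly U) = image_mset z (mset_set {..<N})"
    unfolding eq by (subst proots_prod) (auto simp: sum_unfold_sum_mset)
  ultimately show thesis by (rule that)
qed

lemma unitary_det_spectrum: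
  fixes U :: "complex mat"
  assumes "U \<in> carrier_mat N N" "char_poly U = (\<Prod>i<N. [:- z i, 1:])"
  shows "Determinant.det U = (\<Prod>i<N. z i)"
proof -
  have "(-1) ^ N * Determinant.det U = poly (char_poly U) 0"
  proof -
    have "shifted N 0 U = (-1) \<cdot>\<^sub>m U" using assms(1) by (intro eq_matI) (auto simp: shifted_def)
    then show ?thesis using assms(1) by (simp add: poly_char_poly[OF assms(1)])
  qed
  also have "\<dots> = (-1) ^ N * (\<Prod>i<N. z i)"
    by (simp add: assms(2) poly_prod prod_uminus)
  finally show ?thesis by simp
qed

text \<open>The product of 1 + u v v^H with its adjoint exceeds 1 by (u + cnj u + u cnj u s) v v^H.
  For u = (w - 1) / s and real s the bracket equals (w cnj w - 1) / s, which is 0.\<close>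

lemma rank_one_unitary:
  assumes w: "cmod w = 1" and s: "s = (\<Sum>k<N. cnj (v k) * v k)" "s \<noteq> 0"
  shows "rank_one N ((w - 1) / s) v \<in> unitary_group N"
proof -
  define u where "u = (w - 1) / s"
  let ?V = "rank_one N u v"
  have c: "?V \<in> carrier_mat N N" by (simp add: rank_one_def)
  have cs: "cnj s = s" by (simp add: s(1) cnj_sum mult.commute)
  have ww: "w * cnj w = 1" using w complex_norm_square[of w] by simp
  have "u + cnj u + u * cnj u * s = (w * cnj w - 1) / s"
    using s(2) by (simp add: u_def cs field_simps)
  then have u0: "u + cnj u + u * cnj u * s = 0" by (simp add: ww)
  have "?V * mat_adjoint ?V = 1\<^sub>m N"
  proof (rule eq_matI)
    fix a b assume "a < dim_row (1\<^sub>m N)" "b < dim_col (1\<^sub>m N)"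
    then have ab: "a < N" "b < N" by auto
    have "(?V * mat_adjoint ?V) $$ (a, b) = (\<Sum>k<N. ?V $$ (a, k) * cnj (?V $$ (b, k)))"
      using ab c mat_adjoint_carrier[OF c] by (auto simp: scalar_prod_def atLeast0LessThan mat_adjoint_index[OF c])
    also have "\<dots> = (\<Sum>k<N. (if k = a then (if a = b then 1 else 0) + cnj u * cnj (v b) * v a else 0)
        + (if k = b then u * v a * cnj (v b) else 0) + u * cnj u * v a * cnj (v b) * (cnj (v k) * v k))"
      by (intro sum.cong refl) (use ab in \<open>auto simp: rank_one_def algebra_simps\<close>)
    also have "\<dots> = (if a = b then 1 else 0) + v a * cnj (v b) * (u + cnj u + u * cnj u * s)"
      using ab by (simp add: sum.distrib s(1) sum_distrib_left algebra_simps)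
    finally show "(?V * mat_adjoint ?V) $$ (a, b) = 1\<^sub>m N $$ (a, b)"
      unfolding u0 using ab by simp
  qed (use c mat_adjoint_carrier[OF c] in auto)
  with c show ?thesis by (simp add: unitary_group_def u_def)
qed

section \<open>Bounded measurable functions, an algebra on which integrability is automatic\<close>

definition bounded_meas :: "'a measure \<Rightarrow> ('a \<Rightarrow> complex) \<Rightarrow> bool" where
  "bounded_meas M f \<longleftrightarrow> f \<in> borel_measurable M \<and> (\<exists>B. \<forall>x\<in>space M. norm (f x) \<le> B)"

lemma bounded_meas_const [intro]: "bounded_meas M (\<lambda>_. c)"
  by (auto simp: bounded_meas_def)

lemma bounded_meas_add [intro]:
  assumes "bounded_meas M f" "bounded_meas M g"
  shows "bounded_meas M (\<lambda>x. f x + g x)"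
proof -
  from assms obtain B C where "\<And>x. x \<in> space M \<Longrightarrow> norm (f x) \<le> B" "\<And>x. x \<in> space M \<Longrightarrow> norm (g x) \<le> C"
    by (auto simp: bounded_meas_def)
  then have "\<forall>x\<in>space M. norm (f x + g x) \<le> B + C"
    by (auto intro: norm_triangle_le add_mono)
  with assms show ?thesis by (auto simp: bounded_meas_def)
qed

lemma bounded_meas_mult [intro]:
  assumes "bounded_meas M f" "bounded_meas M g"
  shows "bounded_meas M (\<lambda>x. f x * g x)"
proof -
  from assms obtain B C where B: "\<And>x. x \<in> space M \<Longrightarrow> norm (f x) \<le> B" "\<And>x. x \<in> space M \<Longrightarrow> norm (g x) \<le> C"
    by (auto simp: bounded_meas_def)
  have "\<forall>x\<in>space M. norm (f x * g x) \<le> B * C"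
  proof
    fix x assume "x \<in> space M"
    from B(1)[OF this] B(2)[OF this] show "norm (f x * g x) \<le> B * C"
      unfolding norm_mult by (intro mult_mono order_trans[OF norm_ge_zero B(1)]) (use \<open>x \<in> space M\<close> in auto)
  qed
  with assms show ?thesis by (auto simp: bounded_meas_def)
qed

lemma bounded_meas_uminus [intro]: "bounded_meas M f \<Longrightarrow> bounded_meas M (\<lambda>x. - f x)"
  by (auto simp: bounded_meas_def)

lemma bounded_meas_diff [intro]: "bounded_meas M f \<Longrightarrow> bounded_meas M g \<Longrightarrow> bounded_meas M (\<lambda>x. f x - g x)"
  using bounded_meas_add[OF _ bounded_meas_uminus, of M f g] by simp

lemma bounded_meas_sum [intro]:
  "(\<And>i. i \<in> I \<Longrightarrow> bounded_meas M (f i)) \<Longrightarrow> bounded_meas M (\<lambda>x. \<Sum>i\<in>I. f i x)"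
  by (induction I rule: infinite_finite_induct) auto

lemma bounded_meas_prod [intro]:
  "(\<And>i. i \<in> I \<Longrightarrow> bounded_meas M (f i)) \<Longrightarrow> bounded_meas M (\<lambda>x. \<Prod>i\<in>I. f i x)"
  by (induction I rule: infinite_finite_induct) auto

lemma bounded_meas_power [intro]: "bounded_meas M f \<Longrightarrow> bounded_meas M (\<lambda>x. f x ^ k)"
  by (induction k) auto

lemma bounded_meas_cong:
  assumes "\<And>x. x \<in> space M \<Longrightarrow> f x = g x"
  shows "bounded_meas M f \<longleftrightarrow> bounded_meas M g"
  unfolding bounded_meas_def using assms measurable_cong[of M f g borel] by auto

lemma bounded_meas_inverse:
  assumes "bounded_meas M f" "c > 0" "\<And>x. x \<in> space M \<Longrightarrow> c \<le> norm (f x)"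
  shows "bounded_meas M (\<lambda>x. inverse (f x))"
proof -
  have "norm (inverse (f x)) \<le> inverse c" if "x \<in> space M" for x
    using assms(2) assms(3)[OF that] by (simp add: norm_inverse le_imp_inverse_le)
  then show ?thesis using assms(1) by (auto simp: bounded_meas_def)
qed

lemma bounded_meas_det:
  assumes "\<And>x. x \<in> space M \<Longrightarrow> A x \<in> carrier_mat n n"
    and "\<And>i j. i < n \<Longrightarrow> j < n \<Longrightarrow> bounded_meas M (\<lambda>x. A x $$ (i, j))"
  shows "bounded_meas M (\<lambda>x. Determinant.det (A x))"
proof -
  have "bounded_meas M (\<lambda>x. \<Sum>p | p permutes {0..<n}. of_int (sign p) * (\<Prod>i = 0..<n. A x $$ (i, p i)))"
  proof (intro bounded_meas_sum bounded_meas_mult bounded_meas_prod bounded_meas_const)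
    fix p i assume "p \<in> {p. p permutes {0..<n}}" "i \<in> {0..<n}"
    then have "i < n" "p i < n" using permutes_in_image[of p "{0..<n}" i] by auto
    then show "bounded_meas M (\<lambda>x. A x $$ (i, p i))" by (rule assms(2))
  qed
  then show ?thesis
    by (subst bounded_meas_cong[of M _ "\<lambda>x. \<Sum>p | p permutes {0..<n}. of_int (sign p) * (\<Prod>i = 0..<n. A x $$ (i, p i))"])
       (auto simp: det_def'[OF assms(1)])
qed

lemma bounded_meas_coeff_prod:
  assumes "finite I" "\<And>i. i \<in> I \<Longrightarrow> bounded_meas M (\<lambda>x. a x i)"
    "\<And>i. i \<in> I \<Longrightarrow> bounded_meas M (\<lambda>x. c x i)"
  shows "bounded_meas M (\<lambda>x. coeff (\<Prod>i\<in>I. [:a x i, c x i:]) k)"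
  using assms
proof (induction I arbitrary: k rule: finite_induct)
  case (insert i I)
  have eq: "coeff (\<Prod>i\<in>insert i I. [:a x i, c x i:]) k =
      (if k = 0 then 0 else c x i * coeff (\<Prod>i\<in>I. [:a x i, c x i:]) (k - 1)) + a x i * coeff (\<Prod>i\<in>I. [:a x i, c x i:]) k" for x
    using insert.hyps by (cases k) auto
  show ?case unfolding eq
    using insert.IH insert.prems by (cases "k = 0") (auto intro!: bounded_meas_add bounded_meas_mult)
qed auto

section \<open>Haar measure: measurability, invariance, and bounds away from the unit circle\<close>

locale haar_unitary =
  fixes N :: nat and M :: "complex mat measure"
  assumes haar: "haar_prob N M"
begin

sublocale prob_space M
  using haar by (simp add: haar_prob_def)

lemma space_M: "space M = unitary_group N"
  using haar by (simp add: haar_prob_def)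

lemma sets_M: "sets M = sets (unitary_borel N)"
  using haar by (simp add: haar_prob_def)

lemma integrable_bounded_meas: "bounded_meas M f \<Longrightarrow> integrable M f"
  by (auto simp: bounded_meas_def intro: integrable_const_bound)

lemma measurable_entry:
  assumes "i < N" "j < N"
  shows "(\<lambda>U. U $$ (i, j)) \<in> borel_measurable M"
proof -
  let ?P = "\<Pi>\<^sub>M ij\<in>{0..<N} \<times> {0..<N}. (borel :: complex measure)"
  have "(\<lambda>U. (\<lambda>ij\<in>{0..<N} \<times> {0..<N}. U $$ ij)) \<in> measurable (unitary_borel N) ?P"
    unfolding unitary_borel_def by (rule measurable_vimage_algebra1) (auto simp: space_PiM)
  then have "(\<lambda>U. (\<lambda>ij\<in>{0..<N} \<times> {0..<N}. U $$ ij) (i, j)) \<in> borel_measurable (unitary_borel N)"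
    by (rule measurable_compose[OF _ measurable_component_singleton]) (use assms in auto)
  then show ?thesis
    using assms by (simp add: measurable_cong_sets[OF sets_M refl])
qed

lemma bounded_meas_entry: "i < N \<Longrightarrow> j < N \<Longrightarrow> bounded_meas M (\<lambda>U. U $$ (i, j))"
  unfolding bounded_meas_def space_M using measurable_entry unitary_entry_bound by blast

lemma measurable_left_mult:
  assumes V: "V \<in> unitary_group N"
  shows "(\<lambda>U. V * U) \<in> measurable M M"
proof -
  let ?P = "\<Pi>\<^sub>M ij\<in>{0..<N} \<times> {0..<N}. (borel :: complex measure)"
  have "(\<lambda>U. V * U) \<in> measurable M (unitary_borel N)"
    unfolding unitary_borel_def
  proof (rule measurable_vimage_algebra2)
    show "(\<lambda>U. V * U) \<in> space M \<rightarrow> unitary_group N"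
      using unitary_group_mult[OF V] by (auto simp: space_M)
    show "(\<lambda>U. (\<lambda>ij\<in>{0..<N} \<times> {0..<N}. (V * U) $$ ij)) \<in> measurable M ?P"
    proof (rule measurable_restrict)
      fix ij assume "ij \<in> {0..<N} \<times> {0..<N}"
      then obtain i j where ij: "ij = (i, j)" "i < N" "j < N" by auto
      have "(\<lambda>U. \<Sum>k<N. V $$ (i, k) * U $$ (k, j)) \<in> borel_measurable M"
        using ij measurable_entry by (intro borel_measurable_sum borel_measurable_times) auto
      also have "?this \<longleftrightarrow> (\<lambda>U. (V * U) $$ ij) \<in> borel_measurable M"
        using ij unitary_group_carrier[OF V]
        by (intro measurable_cong) (auto simp: space_M scalar_prod_def atLeast0LessThan dest!: unitary_group_carrier)
      finally show "(\<lambda>U. (V * U) $$ ij) \<in> borel_measurable M" .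
    qed
  qed
  then show ?thesis by (simp add: measurable_cong_sets[OF refl sets_M])
qed

text \<open>The defining invariance speaks of images of sets. The preimage of a set under
  multiplication by V is its image under multiplication by the adjoint of V, which is again
  unitary.\<close>

lemma distr_left_mult:
  assumes V: "V \<in> unitary_group N"
  shows "distr M M (\<lambda>U. V * U) = M"
proof (rule measure_eqI)
  fix A assume "A \<in> sets (distr M M (\<lambda>U. V * U))"
  then have A: "A \<in> sets M" by simp
  let ?W = "mat_adjoint V"
  have W: "?W \<in> unitary_group N" using V by (rule unitary_group_adjoint)
  note c = unitary_group_carrier[OF V] unitary_group_carrier[OF W]
  have VW: "V * ?W = 1\<^sub>m N" "?W * V = 1\<^sub>m N"
    using V unitary_group_adjoint_mult[OF V] by (auto simp: unitary_group_def)
  have "(\<lambda>U. V * U) -` A \<inter> space M = (\<lambda>U. ?W * U) ` A"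
  proof (intro equalityI subsetI)
    fix U assume U: "U \<in> (\<lambda>U. V * U) -` A \<inter> space M"
    then have cU: "U \<in> carrier_mat N N" by (auto simp: space_M dest: unitary_group_carrier)
    have "U = ?W * (V * U)"
      using c cU VW by (simp flip: assoc_mult_mat[of _ N N _ N _ N])
    then show "U \<in> (\<lambda>U. ?W * U) ` A" using U by blast
  next
    fix U assume "U \<in> (\<lambda>U. ?W * U) ` A"
    then obtain U' where U': "U' \<in> A" "U = ?W * U'" by auto
    then have U'M: "U' \<in> unitary_group N" using sets.sets_into_space[OF A] by (auto simp: space_M)
    have "V * U = U'"
      using c unitary_group_carrier[OF U'M] VW unfolding U'(2) by (simp flip: assoc_mult_mat[of _ N N _ N _ N])
    then show "U \<in> (\<lambda>U. V * U) -` A \<inter> space M"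
      using U' unitary_group_mult[OF W U'M] by (auto simp: space_M)
  qed
  moreover have "emeasure M ((\<lambda>U. ?W * U) ` A) = emeasure M A"
    using haar W A by (auto simp: haar_prob_def)
  ultimately show "emeasure (distr M M (\<lambda>U. V * U)) A = emeasure M A"
    by (simp add: emeasure_distr[OF measurable_left_mult[OF V] A])
qed simp

lemma integral_left_mult:
  fixes f :: "complex mat \<Rightarrow> complex"
  assumes V: "V \<in> unitary_group N" and f: "f \<in> borel_measurable M"
  shows "(\<integral>U. f (V * U) \<partial>M) = (\<integral>U. f U \<partial>M)"
  using integral_distr[OF measurable_left_mult[OF V] f] by (simp add: distr_left_mult[OF V])

lemma bounded_meas_coeff_char_poly: "bounded_meas M (\<lambda>U. coeff (char_poly U) k)"
proof -
  have eq: "char_poly U = (\<Sum>p | p permutes {0..<N}. of_int (sign p) *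
      (\<Prod>i = 0..<N. [:- U $$ (i, p i), if i = p i then 1 else 0:]))" if "U \<in> space M" for U
  proof -
    have c: "U \<in> carrier_mat N N" using that by (auto simp: space_M dest: unitary_group_carrier)
    show ?thesis
      unfolding char_poly_def det_def'[OF char_poly_matrix_closed[OF c]]
    proof (rule sum.cong[OF refl], rule arg_cong2[of _ _ _ _ "(*)", OF refl], rule prod.cong[OF refl])
      fix p i assume "p \<in> {p. p permutes {0..<N}}" "i \<in> {0..<N}"
      then have "i < N" "p i < N" using permutes_in_image[of p "{0..<N}" i] by auto
      then show "char_poly_matrix U $$ (i, p i) = [:- U $$ (i, p i), if i = p i then 1 else 0:]"
        using c by (auto simp: char_poly_matrix_def)
    qed
  qed
  have "bounded_meas M (\<lambda>U. \<Sum>p | p permutes {0..<N}. of_int (sign p) *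
      coeff (\<Prod>i = 0..<N. [:- U $$ (i, p i), if i = p i then 1 else 0:]) k)"
  proof (intro bounded_meas_sum bounded_meas_mult bounded_meas_const bounded_meas_coeff_prod bounded_meas_uminus)
    fix p i assume "p \<in> {p. p permutes {0..<N}}" "i \<in> {0..<N}"
    then have "i < N" "p i < N" using permutes_in_image[of p "{0..<N}" i] by auto
    then show "bounded_meas M (\<lambda>U. U $$ (i, p i))" by (rule bounded_meas_entry)
  qed simp
  then show ?thesis
    by (subst bounded_meas_cong, subst eq) (auto simp: coeff_sum of_int_poly)
qed

lemma degree_char_poly: "U \<in> space M \<Longrightarrow> degree (char_poly U) = N"
  using degree_monic_char_poly[of U N] by (auto simp: space_M dest: unitary_group_carrier)

lemma bounded_meas_poly_char_poly: "bounded_meas M (\<lambda>U. poly (char_poly U) x)"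
proof -
  have "bounded_meas M (\<lambda>U. \<Sum>k\<le>N. coeff (char_poly U) k * x ^ k)"
    by (intro bounded_meas_sum bounded_meas_mult bounded_meas_const bounded_meas_coeff_char_poly)
  then show ?thesis
    by (subst bounded_meas_cong) (auto simp: poly_altdef degree_char_poly)
qed

lemma bounded_meas_inverse_det: "bounded_meas M (\<lambda>U. inverse (Determinant.det U))"
proof (rule bounded_meas_inverse[of _ _ 1])
  show "bounded_meas M (\<lambda>U. Determinant.det U)"
    by (rule bounded_meas_det[of _ _ N]) (auto simp: space_M unitary_group_carrier intro: bounded_meas_entry)
qed (auto simp: space_M unitary_det_norm)

text \<open>Every eigenvalue lies on the unit circle, at distance at least ||x| - 1| from x. The
  bound is uniform in U; this is why evaluation points are kept off the circle, where the resolvent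
  entries are bounded functions of U.\<close>

lemma poly_char_poly_ge:
  assumes "U \<in> space M"
  shows "\<bar>cmod x - 1\<bar> ^ N \<le> cmod (poly (char_poly U) x)"
proof -
  from assms have "U \<in> unitary_group N" by (simp add: space_M)
  then obtain z where z: "char_poly U = (\<Prod>i<N. [:- z i, 1:])" "\<And>i. i < N \<Longrightarrow> cmod (z i) = 1"
    by (rule unitary_spectrum) blast
  have "\<bar>cmod x - 1\<bar> ^ N = (\<Prod>i<N. \<bar>cmod x - 1\<bar>)" by simp
  also have "\<dots> \<le> (\<Prod>i<N. cmod (x - z i))"
  proof (rule prod_mono)
    fix i assume "i \<in> {..<N}"
    then show "0 \<le> \<bar>cmod x - 1\<bar> \<and> \<bar>cmod x - 1\<bar> \<le> cmod (x - z i)"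
      using norm_triangle_ineq3[of x "z i"] z(2) by simp
  qed
  finally show ?thesis by (simp add: z(1) poly_prod prod_norm)
qed

lemma poly_char_poly_nonzero:
  assumes "U \<in> space M" "cmod x \<noteq> 1"
  shows "poly (char_poly U) x \<noteq> 0"
proof -
  have "0 < \<bar>cmod x - 1\<bar> ^ N" using assms(2) by (intro zero_less_power) simp
  also have "\<dots> \<le> cmod (poly (char_poly U) x)" by (rule poly_char_poly_ge[OF assms(1)])
  finally show ?thesis by auto
qed

lemma bounded_meas_cayley:
  assumes x: "cmod x \<noteq> 1" and ab: "a < N" "b < N"
  shows "bounded_meas M (\<lambda>U. cayley N U x a b)"
proof -
  have "bounded_meas M (\<lambda>U. inverse (poly (char_poly U) x))"
    by (rule bounded_meas_inverse[OF bounded_meas_poly_char_poly, of "\<bar>cmod x - 1\<bar> ^ N"])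
       (use x poly_char_poly_ge in auto)
  moreover have "bounded_meas M (\<lambda>U. Determinant.det (mat_delete (shifted N x U) b a))"
  proof (rule bounded_meas_det[of _ _ "N - 1"])
    fix U assume "U \<in> space M"
    then show "mat_delete (shifted N x U) b a \<in> carrier_mat (N - 1) (N - 1)"
      by (auto simp: space_M mat_delete_def shifted_def dest!: unitary_group_carrier)
  next
    fix i j assume ij: "i < N - 1" "j < N - 1"
    define i' j' where "i' = (if i < b then i else Suc i)" and "j' = (if j < a then j else Suc j)"
    have ij': "i' < N" "j' < N" using ij by (auto simp: i'_def j'_def)
    have "bounded_meas M (\<lambda>U. (if i' = j' then x else 0) - U $$ (i', j'))"
      using ij' by (intro bounded_meas_diff bounded_meas_const bounded_meas_entry)
    then show "bounded_meas M (\<lambda>U. mat_delete (shifted N x U) b a $$ (i, j))"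
      by (subst bounded_meas_cong)
         (use ij ij' in \<open>auto simp: space_M mat_delete_def shifted_index i'_def j'_def shifted_def dest!: unitary_group_carrier\<close>)
  qed
  ultimately have "bounded_meas M (\<lambda>U. x * ((-1) ^ (b + a) * Determinant.det (mat_delete (shifted N x U) b a) *
      inverse (poly (char_poly U) x)) - (if a = b then 1 else 0))"
    by (intro bounded_meas_diff bounded_meas_mult bounded_meas_const)
  then show ?thesis
  proof (subst bounded_meas_cong)
    fix U assume "U \<in> space M"
    then have "shifted N x U \<in> carrier_mat N N" by (auto simp: space_M intro: shifted_carrier unitary_group_carrier)
    then show "cayley N U x a b = x * ((-1) ^ (b + a) * Determinant.det (mat_delete (shifted N x U) b a) *
      inverse (poly (char_poly U) x)) - (if a = b then 1 else 0)"
      using ab by (simp add: cayley_def resolvent_def adj_mat_def cofactor_def divide_inverse)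
  qed
qed

lemma bounded_meas_herm_form: "cmod x \<noteq> 1 \<Longrightarrow> bounded_meas M (\<lambda>U. herm_form N v (cayley N U x))"
  unfolding herm_form_def
  by (intro bounded_meas_sum bounded_meas_mult bounded_meas_const bounded_meas_cayley) auto

end

section \<open>Schwinger--Dyson equations\<close>

lemma coeff_prod_linear:
  fixes h :: "nat \<Rightarrow> complex"
  shows "coeff (\<Prod>j<n. [:1, - h j:]) 0 = 1"
    and "coeff (\<Prod>j<n. [:1, - h j:]) 1 = - (\<Sum>j<n. h j)"
    and "2 * coeff (\<Prod>j<n. [:1, - h j:]) 2 = (\<Sum>j<n. h j)\<^sup>2 - (\<Sum>j<n. (h j)\<^sup>2)"
proof (induction n)
  case (Suc n)
  have eq: "coeff (p * [:1, - h n:]) (Suc k) = coeff p (Suc k) - h n * coeff p k" for p k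
    by (simp add: mult.commute[of p])
  {
    case 1 show ?case using Suc.IH(1) by (simp add: coeff_mult)
  next
    case 2 show ?case using Suc.IH(1,2) eq[of "\<Prod>j<n. [:1, - h j:]" 0] by simp
  next
    case 3 show ?case using Suc.IH(2,3) eq[of "\<Prod>j<n. [:1, - h j:]" 1]
      by (simp add: numeral_2_eq_2 power2_eq_square algebra_simps)
  }
qed auto

lemma degree_prod_linear_le: "degree (\<Prod>j<n. [:1, - h j:] :: complex poly) \<le> n"
proof -
  have "degree (\<Prod>j<n. [:1, - h j:]) \<le> (\<Sum>j<n. degree [:1, - h j:])"
    using degree_prod_sum_le[of "{..<n}" "\<lambda>j. [:1, - h j:]"] by (simp add: o_def)
  also have "\<dots> \<le> (\<Sum>j<n. 1)" by (intro sum_mono) simp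
  finally show ?thesis by simp
qed

context
  fixes N :: nat
begin

text \<open>For a = b the two terms add up to the vector (1 + w) e_a; the expansion of the Hermitian
  form below covers this case, so that sums may run over all pairs.\<close>

definition basis2 :: "nat \<Rightarrow> nat \<Rightarrow> complex \<Rightarrow> nat \<Rightarrow> complex" where
  "basis2 a b w k = (if k = a then 1 else 0) + (if k = b then w else 0)"

lemma herm_form_basis:
  assumes "a < N"
  shows "herm_form N (\<lambda>k. if k = a then 1 else 0) A = A a a"
proof -
  have "(\<Sum>j<N. cnj (if i = a then 1 else 0) * A i j * (if j = a then 1 else 0)) = (if i = a then A i a else 0)" for i
    using assms by (simp add: if_distrib[of "\<lambda>c. _ * c"] cong: if_cong)
  then have "herm_form N (\<lambda>k. if k = a then 1 else 0) A = (\<Sum>i<N. if i = a then A i a else 0)"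
    by (simp add: herm_form_def)
  then show ?thesis using assms by simp
qed

lemma herm_form_basis2:
  assumes "a < N" "b < N"
  shows "herm_form N (basis2 a b w) A = A a a + w * A a b + cnj w * A b a + cnj w * w * A b b"
proof -
  have "(\<Sum>j<N. cnj (basis2 a b w i) * A i j * basis2 a b w j) =
      cnj (basis2 a b w i) * ((\<Sum>j<N. if j = a then A i j else 0) + w * (\<Sum>j<N. if j = b then A i j else 0))" for i
    unfolding sum_distrib_left sum.distrib[symmetric]
    by (intro sum.cong refl) (auto simp: basis2_def algebra_simps)
  then have "herm_form N (basis2 a b w) A = (\<Sum>i<N. cnj (basis2 a b w i) * (A i a + w * A i b))"
    using assms by (simp add: herm_form_def)
  also have "\<dots> = (\<Sum>i<N. (if i = a then A i a + w * A i b else 0)) + cnj w * (\<Sum>i<N. if i = b then A i a + w * A i b else 0)"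
    unfolding sum_distrib_left sum.distrib[symmetric]
    by (intro sum.cong refl) (auto simp: basis2_def algebra_simps)
  finally show ?thesis using assms by (simp add: algebra_simps)
qed

text \<open>The vectors \<open>e_a + w e_b\<close> with \<open>w\<close> a fourth root of unity, together with the \<open>e_a\<close>,
  form a weighted complex projective 2-design.\<close>

lemma herm_form_design:
  "8 * ((\<Sum>a<N. A a a) * (\<Sum>a<N. B a a) + (\<Sum>a<N. \<Sum>b<N. A a b * B b a)) =
    (\<Sum>a<N. \<Sum>b<N. \<Sum>w\<in>{1, \<i>, -1, -\<i>}. herm_form N (basis2 a b w) A * herm_form N (basis2 a b w) B)
    - 8 * of_nat N * (\<Sum>a<N. herm_form N (\<lambda>k. if k = a then 1 else 0) A * herm_form N (\<lambda>k. if k = a then 1 else 0) B)"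
proof -
  have ne: "distinct [1, \<i>, -1, -\<i>]" by (auto simp: complex_eq_iff)
  have S: "(\<Sum>w\<in>{1, \<i>, -1, -\<i>}. f w) = f 1 + f \<i> + f (-1) + f (-\<i>)" for f :: "complex \<Rightarrow> complex"
    using ne by (simp add: add.assoc)
  have "(\<Sum>w\<in>{1, \<i>, -1, -\<i>}. herm_form N (basis2 a b w) A * herm_form N (basis2 a b w) B) =
      4 * ((A a a + A b b) * (B a a + B b b) + A a b * B b a + A b a * B a b)" if "a < N" "b < N" for a b
    unfolding S herm_form_basis2[OF that] by (simp add: algebra_simps)
  then have "(\<Sum>a<N. \<Sum>b<N. \<Sum>w\<in>{1, \<i>, -1, -\<i>}. herm_form N (basis2 a b w) A * herm_form N (basis2 a b w) B) =
      (\<Sum>a<N. \<Sum>b<N. 4 * (A a a * B a a) + 4 * (A b b * B b b) + 4 * (A a a * B b b) + 4 * (A b b * B a a)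
          + 4 * (A a b * B b a) + 4 * (A b a * B a b))"
    by (intro sum.cong refl) (simp add: algebra_simps)
  also have "\<dots> = 8 * of_nat N * (\<Sum>a<N. A a a * B a a) + 8 * ((\<Sum>a<N. A a a) * (\<Sum>a<N. B a a)) + 8 * (\<Sum>a<N. \<Sum>b<N. A a b * B b a)"
  proof -
    have 1: "(\<Sum>a<N. \<Sum>b<N. A b b * B a a) = (\<Sum>a<N. \<Sum>b<N. A a a * B b b)" by (rule sum.swap)
    have 2: "(\<Sum>a<N. \<Sum>b<N. A b a * B a b) = (\<Sum>a<N. \<Sum>b<N. A a b * B b a)" by (rule sum.swap)
    show ?thesis
      by (simp add: sum.distrib 1 2 sum_product flip: sum_distrib_left)
  qed
  finally show ?thesis by (simp add: herm_form_basis algebra_simps)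
qed

end

context haar_unitary
begin

lemma integral_sum_bounded:
  "(\<And>i. i \<in> I \<Longrightarrow> bounded_meas M (f i)) \<Longrightarrow> (\<integral>U. (\<Sum>i\<in>I. f i U) \<partial>M) = (\<Sum>i\<in>I. \<integral>U. f i U \<partial>M)"
  by (intro Bochner_Integration.integral_sum integrable_bounded_meas)

definition char_poly_prod :: "nat \<Rightarrow> nat \<Rightarrow> (nat \<Rightarrow> complex) \<Rightarrow> complex mat \<Rightarrow> complex" where
  "char_poly_prod l n x U = inverse (Determinant.det U) ^ l * (\<Prod>j<n. poly (char_poly U) (x j))"

lemma bounded_meas_char_poly_prod: "bounded_meas M (char_poly_prod l n x)"
  unfolding char_poly_prod_def
  by (intro bounded_meas_mult bounded_meas_power bounded_meas_inverse_det bounded_meas_prod bounded_meas_poly_char_poly)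

text \<open>
  For \<open>w\<close> on the unit circle and \<open>s = |v|\<^sup>2\<close>, the matrix \<open>1 + u v v\<^sup>*\<close> with \<open>u = (w - 1) / s\<close> is unitary
  of determinant \<open>w\<close>; the identity is the coefficient of \<open>u ^ k\<close> in the resulting invariance.
\<close>

lemma schwinger_dyson:
  fixes v :: "nat \<Rightarrow> complex"
  assumes x: "\<And>j. j < n \<Longrightarrow> cmod (x j) \<noteq> 1"
  shows "(\<integral>U. char_poly_prod l n x U * coeff (\<Prod>j<n. [:1, - herm_form N v (cayley N U (x j)):]) k \<partial>M) =
    coeff ([:1, \<Sum>k<N. cnj (v k) * v k:] ^ l) k * (\<integral>U. char_poly_prod l n x U \<partial>M)"
proof -
  define s where "s = (\<Sum>k<N. cnj (v k) * v k)"
  define h where "h U j = herm_form N v (cayley N U (x j))" for U j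
  have bh: "bounded_meas M (\<lambda>U. h U j)" if "j < n" for j
    unfolding h_def using x[OF that] by (rule bounded_meas_herm_form)
  define p where "p U = (\<Prod>j<n. [:1, - h U j:])" for U
  have bp: "bounded_meas M (\<lambda>U. coeff (p U) k)" for k
    unfolding p_def by (intro bounded_meas_coeff_prod bounded_meas_uminus bounded_meas_const bh) auto
  have degp: "degree (p U) \<le> n" for U
    unfolding p_def by (rule degree_prod_linear_le)
  define G where "G = (\<integral>U. char_poly_prod l n x U \<partial>M)"
  have "(\<integral>U. char_poly_prod l n x U * coeff (p U) k \<partial>M) = coeff ([:1, s:] ^ l) k * G"
  proof (cases "s = 0")
    case True
    have "(\<Sum>k<N. (cmod (v k))\<^sup>2) = 0"
    proof -
      have "of_real (\<Sum>k<N. (cmod (v k))\<^sup>2) = s"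
        unfolding s_def of_real_sum by (intro sum.cong refl) (simp only: complex_norm_square mult.commute)
      with True show ?thesis by (simp only: of_real_eq_0_iff)
    qed
    then have "v k = 0" if "k < N" for k
      using that by (simp add: sum_nonneg_eq_0_iff)
    then have "h U j = 0" for U j by (simp add: h_def herm_form_def)
    then have "p U = 1" for U by (simp add: p_def flip: one_pCons)
    then show ?thesis using True by (simp add: G_def flip: one_pCons)
  next
    case False
    \<comment> \<open>The expectation after the perturbation, as a polynomial in u. Since w = 1 + s
      u, invariance says that C(u) = (1 + s u)^l G whenever 1 + s u lies on the unit circle, hence
      at infinitely many u, hence identically.\<close>
    define C where "C = (\<Sum>k\<le>n. monom (\<integral>U. char_poly_prod l n x U * coeff (p U) k \<partial>M) k)"
    have "poly C ((w - 1) / s) = w ^ l * G" if w: "cmod w = 1" for w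
    proof -
      define u where "u = (w - 1) / s"
      define V where "V = rank_one N u v"
      have V: "V \<in> unitary_group N"
        unfolding V_def u_def by (rule rank_one_unitary[OF w]) (use False in \<open>auto simp: s_def\<close>)
      have detV: "Determinant.det V = w"
        unfolding V_def det_rank_one using False by (simp add: u_def flip: s_def)
      have gV: "char_poly_prod l n x (V * U) = inverse w ^ l * (char_poly_prod l n x U * poly (p U) u)" if U: "U \<in> space M" for U
      proof -
        have c: "U \<in> carrier_mat N N" using U by (auto simp: space_M dest: unitary_group_carrier)
        have "poly (char_poly (V * U)) (x j) = poly (char_poly U) (x j) * (1 - u * h U j)" if "j < n" for j
          unfolding V_def h_def by (rule char_poly_rank_one[OF c poly_char_poly_nonzero[OF U x[OF that]]])
        then show ?thesis
          using c unitary_group_carrier[OF V]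
          by (simp add: char_poly_prod_def p_def det_mult[of _ N] detV poly_prod prod.distrib power_mult_distrib mult_ac)
      qed
      have "G = (\<integral>U. char_poly_prod l n x (V * U) \<partial>M)"
        unfolding G_def using bounded_meas_char_poly_prod
        by (intro integral_left_mult[OF V, symmetric]) (simp add: bounded_meas_def)
      also have "\<dots> = (\<integral>U. inverse w ^ l * (char_poly_prod l n x U * poly (p U) u) \<partial>M)"
        by (rule Bochner_Integration.integral_cong) (simp_all add: gV)
      also have "\<dots> = inverse w ^ l * (\<integral>U. (\<Sum>k\<le>n. char_poly_prod l n x U * coeff (p U) k * u ^ k) \<partial>M)"
      proof -
        have "poly (p U) u = (\<Sum>k\<le>n. coeff (p U) k * u ^ k)" for U
          unfolding poly_altdef using degp[of U]
          by (intro sum.mono_neutral_left) (auto simp: coeff_eq_0)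
        then have "char_poly_prod l n x U * poly (p U) u = (\<Sum>k\<le>n. char_poly_prod l n x U * coeff (p U) k * u ^ k)" for U
          by (simp only: sum_distrib_left mult.assoc)
        then show ?thesis by (simp only: integral_mult_right_zero)
      qed
      also have "(\<integral>U. (\<Sum>k\<le>n. char_poly_prod l n x U * coeff (p U) k * u ^ k) \<partial>M) = poly C u"
        unfolding C_def poly_sum poly_monom
        by (subst Bochner_Integration.integral_sum)
           (auto intro!: integrable_bounded_meas bounded_meas_mult bounded_meas_char_poly_prod bp)
      finally have "G = inverse w ^ l * poly C u" .
      moreover have "w \<noteq> 0" using w by auto
      ultimately show ?thesis by (simp add: u_def field_simps)
    qed
    then have "poly C y = poly (Polynomial.smult G ([:1, s:] ^ l)) y" if "y \<in> (\<lambda>w. (w - 1) / s) ` sphere 0 1" for y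
      using that False by (auto simp: mult.commute dist_norm)
    then have "(\<lambda>w. (w - 1) / s) ` sphere 0 1 \<subseteq> {y. poly (C - Polynomial.smult G ([:1, s:] ^ l)) y = 0}"
      by auto
    moreover have "infinite ((\<lambda>w. (w - 1) / s) ` sphere (0::complex) 1)"
    proof -
      have "connected (sphere (0::complex) 1)" by (rule connected_sphere) simp
      moreover have "1 \<in> sphere (0::complex) 1" "-1 \<in> sphere (0::complex) 1" "(1::complex) \<noteq> -1" by auto
      ultimately have "infinite (sphere (0::complex) 1)"
        unfolding connected_finite_iff_sing[OF \<open>connected (sphere (0::complex) 1)\<close>] by (metis empty_iff singletonD)
      moreover have "inj_on (\<lambda>w. (w - 1) / s) (sphere 0 1)" using False by (auto simp: inj_on_def)
      ultimately show ?thesis using finite_imageD by blast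
    qed
    ultimately have "C - Polynomial.smult G ([:1, s:] ^ l) = 0"
      using poly_roots_finite infinite_super by blast
    then have eq: "coeff C k = coeff ([:1, s:] ^ l) k * G" by (simp add: mult.commute)
    show ?thesis
    proof (cases "k \<le> n")
      case True
      then show ?thesis using eq by (simp add: C_def coeff_sum)
    next
      case False
      then have "coeff (p U) k = 0" for U using degp[of U] by (intro coeff_eq_0) simp
      moreover have "coeff C k = 0" using False by (simp add: C_def coeff_sum)
      ultimately show ?thesis using eq by simp
    qed
  qed
  then show ?thesis by (simp add: p_def h_def G_def s_def)
qed

text \<open>The linear coefficient for the unit vectors, summed over a basis, gives the trace. Only
  the independence of K from the points x is recorded: it makes the relation an eigenvalue equation
  in x.\<close>

lemma schwinger_dyson_trace1:
  "\<exists>K. \<forall>n x. (\<forall>j<n. cmod (x j) \<noteq> 1) \<longrightarrow>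
    (\<integral>U. char_poly_prod l n x U * (\<Sum>j<n. \<Sum>a<N. cayley N U (x j) a a) \<partial>M) = K * (\<integral>U. char_poly_prod l n x U \<partial>M)"
proof -
  let ?e = "\<lambda>a k. if k = a then 1 else (0::complex)"
  define K where "K = (\<Sum>a<N. - coeff ([:1, \<Sum>k<N. cnj (?e a k) * ?e a k:] ^ l) 1)"
  have "(\<integral>U. char_poly_prod l n x U * (\<Sum>j<n. \<Sum>a<N. cayley N U (x j) a a) \<partial>M) = K * (\<integral>U. char_poly_prod l n x U \<partial>M)"
    if x: "\<forall>j<n. cmod (x j) \<noteq> 1" for n x
  proof -
    let ?h = "\<lambda>a U j. herm_form N (?e a) (cayley N U (x j))"
    have bh: "bounded_meas M (\<lambda>U. herm_form N v (cayley N U (x j)))" if "j < n" for j v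
      using x that by (intro bounded_meas_herm_form) auto
    have "(\<Sum>j<n. \<Sum>a<N. cayley N U (x j) a a) = (\<Sum>a<N. \<Sum>j<n. ?h a U j)" for U
      by (subst sum.swap) (simp add: herm_form_basis)
    then have "(\<integral>U. char_poly_prod l n x U * (\<Sum>j<n. \<Sum>a<N. cayley N U (x j) a a) \<partial>M) =
        (\<integral>U. (\<Sum>a<N. char_poly_prod l n x U * (\<Sum>j<n. ?h a U j)) \<partial>M)"
      by (simp add: sum_distrib_left)
    also have "\<dots> = (\<Sum>a<N. \<integral>U. char_poly_prod l n x U * (\<Sum>j<n. ?h a U j) \<partial>M)"
      by (intro Bochner_Integration.integral_sum integrable_bounded_meas bounded_meas_mult bounded_meas_char_poly_prod bounded_meas_sum bh)
         (use x in auto)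
    also have "\<dots> = K * (\<integral>U. char_poly_prod l n x U \<partial>M)"
      unfolding K_def sum_distrib_right
    proof (rule sum.cong[OF refl])
      fix a
      show "(\<integral>U. char_poly_prod l n x U * (\<Sum>j<n. ?h a U j) \<partial>M) =
          - coeff ([:1, \<Sum>k<N. cnj (?e a k) * ?e a k:] ^ l) 1 * (\<integral>U. char_poly_prod l n x U \<partial>M)"
      proof -
        have "- (\<integral>U. char_poly_prod l n x U * (\<Sum>j<n. ?h a U j) \<partial>M) =
          coeff ([:1, \<Sum>k<N. cnj (?e a k) * ?e a k:] ^ l) 1 * (\<integral>U. char_poly_prod l n x U \<partial>M)"
          using schwinger_dyson[of n x l "?e a" 1] x unfolding coeff_prod_linear(2) by simp
        from arg_cong[OF this, of uminus] show ?thesis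
          by (simp only: add.inverse_inverse mult_minus_left)
      qed
    qed
    finally show ?thesis .
  qed
  then show ?thesis by blast
qed

text \<open>The quadratic coefficient for a vector v is half the off-diagonal sum of products of
  Hermitian forms at v. Weighting the vectors as in \<open>herm_form_design\<close> turns these
  products into tr A tr B + tr (A B); the constant again depends on neither n nor x.\<close>

lemma schwinger_dyson_trace2:
  "\<exists>K. \<forall>n x. (\<forall>j<n. cmod (x j) \<noteq> 1) \<longrightarrow>
    (\<integral>U. char_poly_prod l n x U * (\<Sum>j<n. \<Sum>i\<in>{..<n} - {j}. (\<Sum>a<N. cayley N U (x j) a a) * (\<Sum>a<N. cayley N U (x i) a a) +
        (\<Sum>a<N. \<Sum>b<N. cayley N U (x j) a b * cayley N U (x i) b a)) \<partial>M) = K * (\<integral>U. char_poly_prod l n x U \<partial>M)"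
proof -
  let ?e = "\<lambda>a k. if k = a then 1 else (0::complex)"
  let ?W = "{1, \<i>, -1, -\<i>}"
  define c where "c v = 2 * coeff ([:1, \<Sum>k<N. cnj (v k) * v k:] ^ l) 2" for v :: "nat \<Rightarrow> complex"
  define K where "K = ((\<Sum>a<N. \<Sum>b<N. \<Sum>w\<in>?W. c (basis2 a b w)) - 8 * of_nat N * (\<Sum>a<N. c (?e a))) / 8"
  have "(\<integral>U. char_poly_prod l n x U * (\<Sum>j<n. \<Sum>i\<in>{..<n} - {j}. (\<Sum>a<N. cayley N U (x j) a a) * (\<Sum>a<N. cayley N U (x i) a a) +
        (\<Sum>a<N. \<Sum>b<N. cayley N U (x j) a b * cayley N U (x i) b a)) \<partial>M) = K * (\<integral>U. char_poly_prod l n x U \<partial>M)"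
    if x: "\<forall>j<n. cmod (x j) \<noteq> 1" for n x
  proof -
    let ?h = "\<lambda>v U j. herm_form N v (cayley N U (x j))"
    define q where "q v U = (\<Sum>j<n. \<Sum>i\<in>{..<n} - {j}. ?h v U j * ?h v U i)" for v U
    have bq: "bounded_meas M (\<lambda>U. char_poly_prod l n x U * q v U)" for v
      unfolding q_def using x
      by (intro bounded_meas_mult bounded_meas_char_poly_prod bounded_meas_sum bounded_meas_herm_form) auto
    have Iq: "(\<integral>U. char_poly_prod l n x U * q v U \<partial>M) = c v * (\<integral>U. char_poly_prod l n x U \<partial>M)" for v
    proof -
      have "q v U = 2 * coeff (\<Prod>j<n. [:1, - ?h v U j:]) 2" for U
        unfolding q_def sum_offdiag coeff_prod_linear(3) ..
      then have "(\<integral>U. char_poly_prod l n x U * q v U \<partial>M) = 2 * (\<integral>U. char_poly_prod l n x U * coeff (\<Prod>j<n. [:1, - ?h v U j:]) 2 \<partial>M)"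
        by (simp add: mult.left_commute)
      also have "\<dots> = c v * (\<integral>U. char_poly_prod l n x U \<partial>M)"
        using schwinger_dyson[of n x l v 2] x by (simp add: c_def)
      finally show ?thesis .
    qed
    have split: "char_poly_prod l n x U * (\<Sum>j<n. \<Sum>i\<in>{..<n} - {j}. (\<Sum>a<N. cayley N U (x j) a a) * (\<Sum>a<N. cayley N U (x i) a a) +
        (\<Sum>a<N. \<Sum>b<N. cayley N U (x j) a b * cayley N U (x i) b a)) =
        ((\<Sum>a<N. \<Sum>b<N. \<Sum>w\<in>?W. char_poly_prod l n x U * q (basis2 a b w) U) - 8 * of_nat N * (\<Sum>a<N. char_poly_prod l n x U * q (?e a) U)) / 8"
      (is "?g * ?L = ?R") for U
    proof -
      have "8 * ?L = (\<Sum>j<n. \<Sum>i\<in>{..<n} - {j}. (\<Sum>a<N. \<Sum>b<N. \<Sum>w\<in>?W. ?h (basis2 a b w) U j * ?h (basis2 a b w) U i)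
          - 8 * of_nat N * (\<Sum>a<N. ?h (?e a) U j * ?h (?e a) U i))"
        unfolding sum_distrib_left[of 8] herm_form_design ..
      also have "\<dots> = (\<Sum>a<N. \<Sum>b<N. \<Sum>w\<in>?W. q (basis2 a b w) U) - 8 * of_nat N * (\<Sum>a<N. q (?e a) U)"
      proof -
        have 1: "(\<Sum>j<n. \<Sum>i\<in>{..<n} - {j}. \<Sum>a<N. f a j i) = (\<Sum>a<N. \<Sum>j<n. \<Sum>i\<in>{..<n} - {j}. f a j i)"
          for f :: "nat \<Rightarrow> nat \<Rightarrow> nat \<Rightarrow> complex"
          by (rule trans[OF sum.cong[OF refl sum.swap] sum.swap])
        have 2: "(\<Sum>j<n. \<Sum>i\<in>{..<n} - {j}. \<Sum>w\<in>?W. f w j i) = (\<Sum>w\<in>?W. \<Sum>j<n. \<Sum>i\<in>{..<n} - {j}. f w j i)"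
          for f :: "complex \<Rightarrow> nat \<Rightarrow> nat \<Rightarrow> complex"
          by (rule trans[OF sum.cong[OF refl sum.swap] sum.swap])
        show ?thesis
          unfolding q_def sum_subtractf sum_distrib_left[symmetric] 1 2 ..
      qed
      finally have "?L = ((\<Sum>a<N. \<Sum>b<N. \<Sum>w\<in>?W. q (basis2 a b w) U) - 8 * of_nat N * (\<Sum>a<N. q (?e a) U)) / 8"
        by (simp add: field_simps)
      then show ?thesis
        by (simp only: times_divide_eq_right right_diff_distrib sum_distrib_left mult_ac)
    qed
    have "(\<integral>U. (\<Sum>a<N. \<Sum>b<N. \<Sum>w\<in>?W. char_poly_prod l n x U * q (basis2 a b w) U) \<partial>M) =
        (\<Sum>a<N. \<integral>U. (\<Sum>b<N. \<Sum>w\<in>?W. char_poly_prod l n x U * q (basis2 a b w) U) \<partial>M)"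
      by (intro integral_sum_bounded bounded_meas_sum bq)
    also have "\<dots> = (\<Sum>a<N. \<Sum>b<N. \<integral>U. (\<Sum>w\<in>?W. char_poly_prod l n x U * q (basis2 a b w) U) \<partial>M)"
      by (intro sum.cong[OF refl] integral_sum_bounded bounded_meas_sum bq)
    also have "\<dots> = (\<Sum>a<N. \<Sum>b<N. \<Sum>w\<in>?W. \<integral>U. char_poly_prod l n x U * q (basis2 a b w) U \<partial>M)"
      by (rule sum.cong[OF refl], rule sum.cong[OF refl], rule integral_sum_bounded, rule bq)
    finally have 1: "(\<integral>U. (\<Sum>a<N. \<Sum>b<N. \<Sum>w\<in>?W. char_poly_prod l n x U * q (basis2 a b w) U) \<partial>M) =
        (\<Sum>a<N. \<Sum>b<N. \<Sum>w\<in>?W. c (basis2 a b w)) * (\<integral>U. char_poly_prod l n x U \<partial>M)"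
      unfolding Iq sum_distrib_right .
    have 2: "(\<integral>U. 8 * of_nat N * (\<Sum>a<N. char_poly_prod l n x U * q (?e a) U) \<partial>M) =
        8 * of_nat N * ((\<Sum>a<N. c (?e a)) * (\<integral>U. char_poly_prod l n x U \<partial>M))"
      unfolding integral_mult_right_zero
      by (subst integral_sum_bounded, rule bq) (simp only: Iq sum_distrib_right)
    have "(\<integral>U. ((\<Sum>a<N. \<Sum>b<N. \<Sum>w\<in>?W. char_poly_prod l n x U * q (basis2 a b w) U) -
          8 * of_nat N * (\<Sum>a<N. char_poly_prod l n x U * q (?e a) U)) / 8 \<partial>M) =
        ((\<integral>U. (\<Sum>a<N. \<Sum>b<N. \<Sum>w\<in>?W. char_poly_prod l n x U * q (basis2 a b w) U) \<partial>M) -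
          (\<integral>U. 8 * of_nat N * (\<Sum>a<N. char_poly_prod l n x U * q (?e a) U) \<partial>M)) / 8"
      unfolding integral_divide_zero
      by (subst Bochner_Integration.integral_diff)
         (intro integrable_bounded_meas bounded_meas_sum bounded_meas_mult[OF bounded_meas_const] bq refl)+
    then show ?thesis
      unfolding split 1 2 K_def by (simp only: left_diff_distrib times_divide_eq_left mult.assoc)
  qed
  then show ?thesis by blast
qed

end

section \<open>Moments of products of characteristic polynomials\<close>

text \<open>
  \<open>S0\<close> omits the \<open>N\<close> numbers closest to \<open>c / 2\<close>, so it is the only \<open>n\<close>-set maximizing the sum of
  \<open>(2 t - c)\<^sup>2\<close>.
\<close>

lemma maximal_exponents_unique:
  fixes n N l :: nat
  assumes S: "S \<subseteq> {..<n + N}" and "finite S" "card S = n" and l: "l \<le> n"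
  defines "S0 \<equiv> {..<l} \<union> {l + N..<n + N}"
  assumes sum1: "\<Sum>S = \<Sum>S0" and sum2: "(\<Sum>t\<in>S. t\<^sup>2) = (\<Sum>t\<in>S0. t\<^sup>2)"
  shows "S = S0"
proof -
  \<comment> \<open>Twice the midpoint of the gap {l..<l + N}: there |2 t - c| is at most N - 1,
    while on \<open>S0\<close> it is at least N + 1. Since f is quadratic in t, its sum over an
    n-set is determined by the sum and the square sum of the set.\<close>
  define c where "c = 2 * int l + int N - 1"
  define f where "f t = (2 * int t - c)\<^sup>2" for t
  have fin: "finite S0" by (simp add: S0_def)
  have "card S0 = card {..<l} + card {l + N..<n + N}"
    unfolding S0_def by (intro card_Un_disjoint) auto
  then have card: "card S0 = n" using l by simp
  have f: "(\<Sum>t\<in>T. f t) = 4 * int (\<Sum>t\<in>T. t\<^sup>2) - 4 * c * int (\<Sum>T) + int (card T) * c\<^sup>2" for T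
  proof -
    have "f t = 4 * int (t\<^sup>2) - 4 * c * int t + c\<^sup>2" for t
      by (simp add: f_def power2_eq_square algebra_simps)
    then show ?thesis by (simp add: sum.distrib sum_subtractf sum_distrib_left)
  qed
  have "(\<Sum>t\<in>S. f t) = (\<Sum>t\<in>S0. f t)"
    unfolding f sum1 sum2 card \<open>card S = n\<close> ..
  then have eq: "(\<Sum>t\<in>S - S0. f t) = (\<Sum>t\<in>S0 - S. f t)"
    using sum.Int_Diff[of S f S0] sum.Int_Diff[of S0 f S] fin \<open>finite S\<close> by (simp add: Int_commute)
  have card_eq: "card (S - S0) = card (S0 - S)"
    using card_Int_Diff[OF \<open>finite S\<close>, of S0] card_Int_Diff[OF fin, of S] card \<open>card S = n\<close>
    by (simp add: Int_commute)
  have "S - S0 = {}"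
  proof (rule ccontr)
    assume ne: "S - S0 \<noteq> {}"
    then have pos: "card (S - S0) > 0" using \<open>finite S\<close> by (simp add: card_gt_0_iff)
    from ne obtain t0 where "t0 \<in> S - S0" by auto
    then have N: "N \<ge> 1" using S by (auto simp: S0_def)
    have "(\<Sum>t\<in>S - S0. f t) \<le> (\<Sum>t\<in>S - S0. (int N - 1)\<^sup>2)"
    proof (rule sum_mono)
      fix t assume "t \<in> S - S0"
      then have "l \<le> t" "t < l + N" using S by (auto simp: S0_def)
      then have "\<bar>2 * int t - c\<bar> \<le> \<bar>int N - 1\<bar>" using N by (simp add: c_def)
      then show "f t \<le> (int N - 1)\<^sup>2" unfolding f_def by (simp only: abs_le_square_iff)
    qed
    also have "\<dots> = int (card (S - S0)) * (int N - 1)\<^sup>2" by simp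
    also have "\<dots> < int (card (S - S0)) * (int N + 1)\<^sup>2"
    proof -
      have "(int N - 1)\<^sup>2 < (int N + 1)\<^sup>2" using N by (simp add: power2_eq_square algebra_simps)
      with pos show ?thesis by (intro mult_strict_left_mono) auto
    qed
    also have "\<dots> = (\<Sum>t\<in>S0 - S. (int N + 1)\<^sup>2)" by (simp add: card_eq)
    also have "\<dots> \<le> (\<Sum>t\<in>S0 - S. f t)"
    proof (rule sum_mono)
      fix t assume "t \<in> S0 - S"
      then have "t < l \<or> l + N \<le> t" by (auto simp: S0_def)
      then have "\<bar>int N + 1\<bar> \<le> \<bar>2 * int t - c\<bar>" by (auto simp: c_def)
      then show "(int N + 1)\<^sup>2 \<le> f t" unfolding f_def by (simp only: abs_le_square_iff)
    qed
    finally show False using eq by simp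
  qed
  moreover have "S0 - S = {}"
  proof -
    have "card (S0 - S) = 0" unfolding card_eq[symmetric] \<open>S - S0 = {}\<close> by simp
    then show ?thesis using fin by (simp only: card_0_eq finite_Diff)
  qed
  ultimately show ?thesis by blast
qed

text \<open>A nonzero Leibniz term needs \<pi> i at most i for i < l, since no coefficient lies
  below the shift, and \<pi> i at least i for the other i, by the degree of P. The first condition
  fixes the small indices inductively; the second, with the equality of the sums of i and \<pi> i,
  fixes the rest. The identity contributes l constant coefficients and n - l leading ones.\<close>

lemma wedge_coeff_extreme:
  assumes P: "degree P = N" "lead_coeff P = 1" and l: "l \<le> n"
  defines "\<alpha>0 \<equiv> restrict (\<lambda>k. if k < l then k else N + k) {..<n}"
  shows "wedge_coeff n P \<alpha>0 = coeff P 0 ^ l"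
proof -
  have only_id: "(\<Prod>i<n. coeff (monom 1 (\<pi> i) * P) (\<alpha>0 i)) = 0" if \<pi>: "\<pi> permutes {..<n}" and ne: "\<pi> \<noteq> id" for \<pi>
  proof (rule ccontr)
    assume "(\<Prod>i<n. coeff (monom 1 (\<pi> i) * P) (\<alpha>0 i)) \<noteq> 0"
    then have nz: "coeff (monom 1 (\<pi> i) * P) (\<alpha>0 i) \<noteq> 0" if "i < n" for i
      using that by auto
    have le: "\<pi> i \<le> i" if "i < l" for i
      using nz[of i] that l by (auto simp: \<alpha>0_def coeff_monom_mult split: if_splits)
    have ge: "\<pi> i \<ge> i" if "l \<le> i" "i < n" for i
    proof -
      have "coeff (monom 1 (\<pi> i) * P) (N + i) \<noteq> 0" using nz[of i] that by (simp add: \<alpha>0_def)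
      then have "\<pi> i \<le> N + i" "coeff P (N + i - \<pi> i) \<noteq> 0" by (auto simp: coeff_monom_mult split: if_splits)
      then have "N + i - \<pi> i \<le> N" using le_degree P(1) by metis
      with \<open>\<pi> i \<le> N + i\<close> show ?thesis by linarith
    qed
    have low: "\<pi> i = i" if "i < l" for i
      using that
    proof (induction i rule: less_induct)
      case (less i)
      show ?case
      proof (rule ccontr)
        assume "\<pi> i \<noteq> i"
        with le[OF less.prems] have "\<pi> i < i" by simp
        then have "\<pi> (\<pi> i) = \<pi> i" using less by auto
        then have "\<pi> i = i" using permutes_inj[OF \<pi>] by (auto dest: injD)
        with \<open>\<pi> i \<noteq> i\<close> show False ..
      qed
    qed
    have "(\<Sum>i<n. i) = (\<Sum>i<n. \<pi> i)"
      using sum.permute[OF \<pi>, of "\<lambda>i. i"] by (simp add: o_def)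
    moreover have "i \<le> \<pi> i" if "i \<in> {..<n}" for i
      using that low[of i] ge[of i] by (cases "i < l") auto
    ultimately have fix_low: "i = \<pi> i" if "i \<in> {..<n}" for i
      using sum_mono_inv[of "\<lambda>i. i" "{..<n}" \<pi> i] that by auto
    have "\<pi> i = i" for i
    proof (cases "i < n")
      case True
      then show ?thesis using fix_low[of i] by simp
    next
      case False
      then show ?thesis using \<pi> by (simp add: permutes_def)
    qed
    then have "\<pi> = id" by (simp add: fun_eq_iff)
    with ne show False ..
  qed
  have "wedge_coeff n P \<alpha>0 = (\<Sum>\<pi>\<in>{id}. of_int (sign \<pi>) * (\<Prod>i<n. coeff (monom 1 (\<pi> i) * P) (\<alpha>0 i)))"
    unfolding wedge_coeff_def
    by (rule sum.mono_neutral_right) (auto simp: finite_permutations permutes_id only_id)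
  also have "\<dots> = (\<Prod>i<n. coeff (monom 1 i * P) (\<alpha>0 i))" by simp
  also have "\<dots> = (\<Prod>i<n. if i < l then coeff P 0 else 1)"
    using P by (intro prod.cong refl) (auto simp: \<alpha>0_def coeff_monom_mult)
  also have "\<dots> = (\<Prod>i<l. coeff P 0)"
  proof -
    have "{..<n} \<inter> {i. i < l} = {..<l}" using l by auto
    then show ?thesis by (simp add: prod.If_cases)
  qed
  finally show ?thesis by simp
qed

definition eig_prod :: "(complex \<Rightarrow> complex) \<Rightarrow> complex mat \<Rightarrow> complex" where
  "eig_prod f U = (\<Prod>z\<in>#proots (char_poly U). f z)"

context haar_unitary
begin

lemma eig_prod_spectrum:
  assumes "proots (char_poly U) = image_mset z (mset_set {..<N})"
  shows "eig_prod f U = (\<Prod>i<N. f (z i))"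
  by (simp add: eig_prod_def assms multiset.map_comp prod_unfold_prod_mset o_def)

lemma bounded_meas_coeff_shift: "bounded_meas M (\<lambda>U. coeff (monom 1 k * char_poly U) j)"
  unfolding coeff_monom_mult by (cases "k \<le> j") (auto intro: bounded_meas_coeff_char_poly)

lemma bounded_meas_wedge_coeff: "bounded_meas M (\<lambda>U. wedge_coeff n (char_poly U) \<alpha>)"
  unfolding wedge_coeff_def
  by (intro bounded_meas_sum bounded_meas_mult bounded_meas_const bounded_meas_prod bounded_meas_coeff_shift)

text \<open>By \<open>wedge_expand\<close>, the coefficient of the monomial with exponents \<alpha>
  in the alternant times the expectation of \<open>char_poly_prod l n x\<close>.\<close>

definition wedge_moment :: "nat \<Rightarrow> nat \<Rightarrow> (nat \<Rightarrow> nat) \<Rightarrow> complex" where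
  "wedge_moment l n \<alpha> = (\<integral>U. inverse (Determinant.det U) ^ l * wedge_coeff n (char_poly U) \<alpha> \<partial>M)"

lemma integral_wedge_sum:
  "(\<integral>U. inverse (Determinant.det U) ^ l * (\<Sum>\<alpha>\<in>A. c \<alpha> * wedge_coeff n (char_poly U) \<alpha> * y \<alpha>) \<partial>M) =
    (\<Sum>\<alpha>\<in>A. c \<alpha> * wedge_moment l n \<alpha> * y \<alpha>)"
proof -
  have bm: "bounded_meas M (\<lambda>U. inverse (Determinant.det U) ^ l * wedge_coeff n (char_poly U) \<alpha>)" for \<alpha>
    by (intro bounded_meas_mult bounded_meas_power bounded_meas_inverse_det bounded_meas_wedge_coeff)
  have "(\<integral>U. inverse (Determinant.det U) ^ l * (\<Sum>\<alpha>\<in>A. c \<alpha> * wedge_coeff n (char_poly U) \<alpha> * y \<alpha>) \<partial>M) =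
      (\<integral>U. (\<Sum>\<alpha>\<in>A. c \<alpha> * (inverse (Determinant.det U) ^ l * wedge_coeff n (char_poly U) \<alpha>) * y \<alpha>) \<partial>M)"
    by (simp add: sum_distrib_left mult_ac)
  also have "\<dots> = (\<Sum>\<alpha>\<in>A. (\<integral>U. c \<alpha> * (inverse (Determinant.det U) ^ l * wedge_coeff n (char_poly U) \<alpha>) * y \<alpha> \<partial>M))"
    by (intro Bochner_Integration.integral_sum integrable_bounded_meas bounded_meas_mult[OF bounded_meas_mult[OF bounded_meas_const bm] bounded_meas_const])
  finally show ?thesis by (simp add: wedge_moment_def)
qed

text \<open>Comparison of coefficients: an operator multiplying the monomial of exponent \<alpha> by
  c \<alpha> acts on the whole polynomial as the scalar C. The admissible points, distinct and off
  the unit circle, contain a product of infinite sets, so \<open>multivariate_poly_zero\<close>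
  applies.\<close>

lemma wedge_moment_eigen:
  assumes eigen: "\<And>x. inj_on x {..<n} \<Longrightarrow> (\<And>j. j < n \<Longrightarrow> cmod (x j) \<noteq> 1) \<Longrightarrow>
      (\<integral>U. inverse (Determinant.det U) ^ l * (\<Sum>\<alpha>\<in>{..<n} \<rightarrow>\<^sub>E {..<n + N}.
          c \<alpha> * wedge_coeff n (char_poly U) \<alpha> * (\<Prod>i<n. x i ^ \<alpha> i)) \<partial>M) =
      C * (alternant n x * (\<integral>U. char_poly_prod l n x U \<partial>M))"
    and \<alpha>: "\<alpha> \<in> {..<n} \<rightarrow>\<^sub>E {..<n + N}"
  shows "(c \<alpha> - C) * wedge_moment l n \<alpha> = 0"
proof -
  let ?A = "{..<n} \<rightarrow>\<^sub>E {..<n + N}"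
  \<comment> \<open>Disjoint real intervals to the right of 1: any choice of one point from each
    gives pairwise distinct points of modulus different from 1.\<close>
  define S where "S j = complex_of_real ` {2 * real j + 2<..<2 * real j + 3}" for j :: nat
  have infS: "infinite (S j)" for j
  proof -
    have "inj_on complex_of_real {2 * real j + 2<..<2 * real j + 3}" by (simp add: inj_on_def)
    moreover have "infinite {2 * real j + 2<..<2 * real j + 3}" by (rule infinite_Ioo) simp
    ultimately show ?thesis unfolding S_def using finite_imageD by blast
  qed
  show ?thesis
  proof (rule multivariate_poly_zero[of n S _ "n + N", OF infS _ \<alpha>])
    fix x assume x: "\<And>j. j < n \<Longrightarrow> x j \<in> S j"
    have "\<exists>y. x j = complex_of_real y \<and> 2 * real j + 2 < y \<and> y < 2 * real j + 3" if "j < n" for j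
      using x[OF that] by (auto simp: S_def)
    then obtain y where y: "\<And>j. j < n \<Longrightarrow> x j = complex_of_real (y j) \<and> 2 * real j + 2 < y j \<and> y j < 2 * real j + 3"
      by metis
    have inj: "inj_on x {..<n}"
    proof (rule inj_onI)
      fix i j assume ij: "i \<in> {..<n}" "j \<in> {..<n}" "x i = x j"
      then have "y i = y j" using y[of i] y[of j] by simp
      then have "2 * real i < 2 * real j + 1" "2 * real j < 2 * real i + 1" using y[of i] y[of j] ij by auto
      then show "i = j" by linarith
    qed
    have norm: "cmod (x j) \<noteq> 1" if "j < n" for j using y[OF that] by simp
    have "(\<Sum>\<alpha>\<in>?A. 1 * wedge_moment l n \<alpha> * (\<Prod>i<n. x i ^ \<alpha> i)) =
        (\<integral>U. inverse (Determinant.det U) ^ l * (\<Sum>\<alpha>\<in>?A. 1 * wedge_coeff n (char_poly U) \<alpha> * (\<Prod>i<n. x i ^ \<alpha> i)) \<partial>M)"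
      by (rule integral_wedge_sum[symmetric])
    also have "\<dots> = (\<integral>U. alternant n x * char_poly_prod l n x U \<partial>M)"
    proof (rule Bochner_Integration.integral_cong[OF refl])
      fix U assume "U \<in> space M"
      then show "inverse (Determinant.det U) ^ l * (\<Sum>\<alpha>\<in>?A. 1 * wedge_coeff n (char_poly U) \<alpha> * (\<Prod>i<n. x i ^ \<alpha> i)) = alternant n x * char_poly_prod l n x U"
        using wedge_expand[of "char_poly U" n "n + N" x] norm by (simp add: char_poly_prod_def degree_char_poly)
    qed
    finally have "(\<Sum>\<alpha>\<in>?A. c \<alpha> * wedge_moment l n \<alpha> * (\<Prod>i<n. x i ^ \<alpha> i)) =
        C * (\<Sum>\<alpha>\<in>?A. wedge_moment l n \<alpha> * (\<Prod>i<n. x i ^ \<alpha> i))"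
      using eigen[OF inj norm] unfolding integral_wedge_sum by simp
    then show "(\<Sum>\<alpha>\<in>?A. (c \<alpha> - C) * wedge_moment l n \<alpha> * (\<Prod>i<n. x i ^ \<alpha> i)) = 0"
      by (simp add: left_diff_distrib sum_subtractf sum_distrib_left mult.assoc)
  qed
qed

context
  fixes n :: nat and x :: "nat \<Rightarrow> complex"
  assumes inj: "inj_on x {..<n}" and norm: "\<And>j. j < n \<Longrightarrow> cmod (x j) \<noteq> 1"
begin

lemma euler_trace:
  assumes U: "U \<in> space M"
  shows "x j * poly (pderiv (char_poly U)) (x j) / poly (char_poly U) (x j) = (\<Sum>a<N. cayley N U (x j) a a) + of_nat N"
  using trace_cayley[of U N "x j"] U by (auto simp: space_M dest: unitary_group_carrier)

lemma wedge_euler1_char_poly_prod: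
  assumes U: "U \<in> space M"
  shows "inverse (Determinant.det U) ^ l * (\<Sum>\<alpha>\<in>{..<n} \<rightarrow>\<^sub>E {..<n + N}.
      of_nat (\<Sum>j<n. \<alpha> j) * wedge_coeff n (char_poly U) \<alpha> * (\<Prod>i<n. x i ^ \<alpha> i)) =
    (of_nat (\<Sum>j<n. j) + of_nat (n * N)) * alternant n x * char_poly_prod l n x U +
    alternant n x * (char_poly_prod l n x U * (\<Sum>j<n. \<Sum>a<N. cayley N U (x j) a a))"
proof -
  have "(\<Sum>\<alpha>\<in>{..<n} \<rightarrow>\<^sub>E {..<n + N}.
      of_nat (\<Sum>j<n. \<alpha> j) * wedge_coeff n (char_poly U) \<alpha> * (\<Prod>i<n. x i ^ \<alpha> i)) =
    alternant n x * (\<Prod>i<n. poly (char_poly U) (x i)) *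
      (of_nat (\<Sum>j<n. j) + ((\<Sum>j<n. \<Sum>a<N. cayley N U (x j) a a) + of_nat (n * N)))"
    using wedge_euler1[of "char_poly U" n "n + N" x] inj poly_char_poly_nonzero[OF U norm] U
    by (simp add: degree_char_poly euler_trace[OF U] sum.distrib)
  then show ?thesis
    unfolding char_poly_prod_def by (simp add: algebra_simps)
qed

text \<open>Symmetrized in j and k, the interaction term of \<open>wedge_euler2\<close> becomes a
  sum of divided differences, which \<open>trace_cayley_mult\<close> expresses by traces of products
  of two matrices U (x - U)^(-1). What arises is exactly the quadratic combination controlled by
  \<open>schwinger_dyson_trace2\<close>, a multiple of the one in
  \<open>schwinger_dyson_trace1\<close>, and a constant; no factor depending on x is left besides
  the alternant.\<close>

lemma wedge_euler2_char_poly_prod: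
  assumes U: "U \<in> space M"
  defines "s \<equiv> of_nat (\<Sum>j<n. j)"
  shows "inverse (Determinant.det U) ^ l * (\<Sum>\<alpha>\<in>{..<n} \<rightarrow>\<^sub>E {..<n + N}.
      of_nat (\<Sum>j<n. \<Sum>k\<in>{..<n} - {j}. \<alpha> j * \<alpha> k) * wedge_coeff n (char_poly U) \<alpha> * (\<Prod>i<n. x i ^ \<alpha> i)) =
    alternant n x * (char_poly_prod l n x U * (\<Sum>j<n. \<Sum>i\<in>{..<n} - {j}. (\<Sum>a<N. cayley N U (x j) a a) * (\<Sum>a<N. cayley N U (x i) a a) +
        (\<Sum>a<N. \<Sum>b<N. cayley N U (x j) a b * cayley N U (x i) b a))) +
    (2 * s + 2 * of_nat N * (of_nat n - 1)) * alternant n x * (char_poly_prod l n x U * (\<Sum>j<n. \<Sum>a<N. cayley N U (x j) a a)) +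
    (s\<^sup>2 + 2 * s * of_nat (n * N) + (of_nat N)\<^sup>2 * (of_nat n * (of_nat n - 1)) - of_nat (\<Sum>j<n. j\<^sup>2)
      - of_nat N * (of_nat n * (of_nat n - 1))) * alternant n x * char_poly_prod l n x U"
proof -
  have c: "U \<in> carrier_mat N N" using U by (auto simp: space_M dest: unitary_group_carrier)
  define T where "T j = (\<Sum>a<N. cayley N U (x j) a a)" for j
  define Q where "Q j i = (\<Sum>a<N. \<Sum>b<N. cayley N U (x j) a b * cayley N U (x i) b a)" for j i
  define t where "t j = x j * poly (pderiv (char_poly U)) (x j) / poly (char_poly U) (x j)" for j
  have tT: "t j = T j + of_nat N" for j
    unfolding t_def T_def by (rule euler_trace[OF U])
  have P: "poly (char_poly U) (x i) \<noteq> 0" if "i < n" for i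
    by (rule poly_char_poly_nonzero[OF U norm[OF that]])
  have cardn: "(\<Sum>j<n. \<Sum>k\<in>{..<n} - {j}. c) = of_nat n * (of_nat n - 1) * c" for c :: complex
    by (cases n) (auto simp: algebra_simps)
  have Q: "Q j k = of_nat N - (x j * t j - x k * t k) / (x j - x k)" if "j < n" "k < n" "j \<noteq> k" for j k
  proof -
    have "x j \<noteq> x k" using that inj by (auto simp: inj_on_def)
    then show ?thesis
      unfolding Q_def t_def using trace_cayley_mult[OF c P[OF that(1)] P[OF that(2)]] by blast
  qed
  \<comment> \<open>Exchanging j and k in one half of the doubled sum produces the two terms of the
    divided difference of x t.\<close>
  have cross: "2 * (\<Sum>j<n. t j * (\<Sum>k\<in>{..<n} - {j}. x j / (x j - x k))) =
      of_nat n * (of_nat n - 1) * of_nat N - (\<Sum>j<n. \<Sum>k\<in>{..<n} - {j}. Q j k)"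
  proof -
    have sw: "(\<Sum>j<n. \<Sum>k\<in>{..<n} - {j}. f j k) = (\<Sum>j<n. \<Sum>k\<in>{..<n} - {j}. f k j)" for f :: "nat \<Rightarrow> nat \<Rightarrow> complex"
    proof -
      have "(\<Sum>j<n. \<Sum>k\<in>{..<n} - {j}. f j k) = (\<Sum>j<n. \<Sum>k<n. if k \<noteq> j then f j k else 0)" for f :: "nat \<Rightarrow> nat \<Rightarrow> complex"
        by (intro sum.cong[OF refl] sum.mono_neutral_cong_left) auto
      note 1 = this
      show ?thesis unfolding 1 by (subst sum.swap) (intro sum.cong refl, auto)
    qed
    have "2 * (\<Sum>j<n. t j * (\<Sum>k\<in>{..<n} - {j}. x j / (x j - x k))) =
        (\<Sum>j<n. \<Sum>k\<in>{..<n} - {j}. x j * t j / (x j - x k)) + (\<Sum>j<n. \<Sum>k\<in>{..<n} - {j}. x k * t k / (x k - x j))"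
      using sw[of "\<lambda>j k. x j * t j / (x j - x k)"] by (simp add: sum_distrib_left mult.commute)
    also have "\<dots> = (\<Sum>j<n. \<Sum>k\<in>{..<n} - {j}. of_nat N - Q j k)"
      unfolding sum.distrib[symmetric]
    proof (intro sum.cong refl)
      fix j k assume jk: "j \<in> {..<n}" "k \<in> {..<n} - {j}"
      then have "x j \<noteq> x k" using inj by (auto simp: inj_on_def)
      then have "x k * t k / (x k - x j) = - (x k * t k / (x j - x k))"
        by (metis minus_diff_eq minus_divide_right)
      then show "x j * t j / (x j - x k) + x k * t k / (x k - x j) = of_nat N - Q j k"
        using Q[of j k] jk by (simp add: diff_divide_distrib)
    qed
    finally show ?thesis by (simp only: sum_subtractf cardn)
  qed
  have off: "(\<Sum>j<n. t j)\<^sup>2 - (\<Sum>j<n. (t j)\<^sup>2) =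
      (\<Sum>j<n. \<Sum>k\<in>{..<n} - {j}. T j * T k) + 2 * of_nat N * (of_nat n - 1) * (\<Sum>j<n. T j)
        + of_nat n * (of_nat n - 1) * (of_nat N)\<^sup>2"
  proof -
    have "(\<Sum>j<n. t j) = (\<Sum>j<n. T j) + of_nat n * of_nat N" by (simp add: tT sum.distrib)
    moreover have "(\<Sum>j<n. (t j)\<^sup>2) = (\<Sum>j<n. (T j)\<^sup>2) + 2 * of_nat N * (\<Sum>j<n. T j) + of_nat n * (of_nat N)\<^sup>2"
      by (simp add: tT power2_sum sum.distrib sum_distrib_left mult_ac)
    ultimately show ?thesis unfolding sum_offdiag
      by (simp add: power2_eq_square algebra_simps)
  qed
  define a b X2 X1 where "a = (\<Sum>j<n. t j)" and "b = (\<Sum>j<n. (t j)\<^sup>2)"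
    and "X2 = (\<Sum>j<n. \<Sum>k\<in>{..<n} - {j}. T j * T k)" and "X1 = (\<Sum>j<n. T j)"
  define XQ where "XQ = (\<Sum>j<n. \<Sum>k\<in>{..<n} - {j}. Q j k)"
  have aX: "a = X1 + of_nat (n * N)" by (simp add: a_def X1_def tT sum.distrib)
  have "(\<Sum>\<alpha>\<in>{..<n} \<rightarrow>\<^sub>E {..<n + N}.
      of_nat (\<Sum>j<n. \<Sum>k\<in>{..<n} - {j}. \<alpha> j * \<alpha> k) * wedge_coeff n (char_poly U) \<alpha> * (\<Prod>i<n. x i ^ \<alpha> i)) =
    alternant n x * (\<Prod>i<n. poly (char_poly U) (x i)) *
      ((s + a)\<^sup>2 - of_nat (\<Sum>j<n. j\<^sup>2) - b - 2 * (\<Sum>j<n. t j * (\<Sum>k\<in>{..<n} - {j}. x j / (x j - x k))))"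
    unfolding a_def b_def s_def t_def
    by (rule wedge_euler2) (use inj P U in \<open>auto simp: degree_char_poly\<close>)
  also have "(s + a)\<^sup>2 - of_nat (\<Sum>j<n. j\<^sup>2) - b - 2 * (\<Sum>j<n. t j * (\<Sum>k\<in>{..<n} - {j}. x j / (x j - x k))) =
      X2 + XQ + (2 * s + 2 * of_nat N * (of_nat n - 1)) * X1 +
      (s\<^sup>2 + 2 * s * of_nat (n * N) + (of_nat N)\<^sup>2 * (of_nat n * (of_nat n - 1)) - of_nat (\<Sum>j<n. j\<^sup>2)
      - of_nat N * (of_nat n * (of_nat n - 1)))"
    using off unfolding cross
    unfolding a_def[symmetric] b_def[symmetric] X1_def[symmetric] X2_def[symmetric] XQ_def[symmetric]
    by (simp add: power2_sum aX algebra_simps)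
  finally have expansion: "(\<Sum>\<alpha>\<in>{..<n} \<rightarrow>\<^sub>E {..<n + N}.
      of_nat (\<Sum>j<n. \<Sum>k\<in>{..<n} - {j}. \<alpha> j * \<alpha> k) * wedge_coeff n (char_poly U) \<alpha> * (\<Prod>i<n. x i ^ \<alpha> i)) =
    alternant n x * (\<Prod>i<n. poly (char_poly U) (x i)) * (X2 + XQ + (2 * s + 2 * of_nat N * (of_nat n - 1)) * X1 +
      (s\<^sup>2 + 2 * s * of_nat (n * N) + (of_nat N)\<^sup>2 * (of_nat n * (of_nat n - 1)) - of_nat (\<Sum>j<n. j\<^sup>2)
      - of_nat N * (of_nat n * (of_nat n - 1))))" .
  show ?thesis
    unfolding expansion char_poly_prod_def T_def[symmetric] Q_def[symmetric] sum.distrib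
      X1_def[symmetric] X2_def[symmetric] XQ_def[symmetric]
    by (simp add: algebra_simps)
qed

lemma bounded_meas_trace_sum: "bounded_meas M (\<lambda>U. char_poly_prod l n x U * (\<Sum>j<n. \<Sum>a<N. cayley N U (x j) a a))"
  by (intro bounded_meas_mult bounded_meas_char_poly_prod bounded_meas_sum bounded_meas_cayley) (auto simp: norm)

lemma bounded_meas_trace_sum2: "bounded_meas M (\<lambda>U. char_poly_prod l n x U * (\<Sum>j<n. \<Sum>i\<in>{..<n} - {j}.
    (\<Sum>a<N. cayley N U (x j) a a) * (\<Sum>a<N. cayley N U (x i) a a) +
    (\<Sum>a<N. \<Sum>b<N. cayley N U (x j) a b * cayley N U (x i) b a)))"
  by (intro bounded_meas_mult bounded_meas_char_poly_prod bounded_meas_sum bounded_meas_add bounded_meas_cayley) (auto simp: norm)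

end

text \<open>After integration of the first Euler identity each term is a scalar times the alternant
  times the same expectation. Thus all exponents with nonzero moment have the same sum.\<close>

lemma wedge_moment_support1:
  "\<exists>C. \<forall>\<alpha>\<in>{..<n} \<rightarrow>\<^sub>E {..<n + N}. (of_nat (\<Sum>j<n. \<alpha> j) - C) * wedge_moment l n \<alpha> = 0"
proof -
  obtain K1 where K1: "\<And>x. (\<And>j. j < n \<Longrightarrow> cmod (x j) \<noteq> 1) \<Longrightarrow>
      (\<integral>U. char_poly_prod l n x U * (\<Sum>j<n. \<Sum>a<N. cayley N U (x j) a a) \<partial>M) = K1 * (\<integral>U. char_poly_prod l n x U \<partial>M)"
    using schwinger_dyson_trace1[of l] by blast
  show ?thesis
  proof (intro exI ballI, rule wedge_moment_eigen)
    fix x assume inj: "inj_on x {..<n}" and norm: "\<And>j. j < n \<Longrightarrow> cmod (x j) \<noteq> 1"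
    let ?g = "char_poly_prod l n x" and ?T = "\<lambda>U. \<Sum>j<n. \<Sum>a<N. cayley N U (x j) a a"
    let ?c = "of_nat (\<Sum>j<n. j) + of_nat (n * N)"
    have b1: "bounded_meas M (\<lambda>U. ?g U * ?T U)" by (rule bounded_meas_trace_sum) (use inj norm in auto)
    have k1: "(\<integral>U. ?g U * ?T U \<partial>M) = K1 * (\<integral>U. ?g U \<partial>M)" using norm by (rule K1)
    note b = bounded_meas_char_poly_prod b1
    have "(\<integral>U. inverse (Determinant.det U) ^ l * (\<Sum>\<alpha>\<in>{..<n} \<rightarrow>\<^sub>E {..<n + N}.
          of_nat (\<Sum>j<n. \<alpha> j) * wedge_coeff n (char_poly U) \<alpha> * (\<Prod>i<n. x i ^ \<alpha> i)) \<partial>M) =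
        (\<integral>U. ?c * alternant n x * ?g U + alternant n x * (?g U * ?T U) \<partial>M)"
      by (rule Bochner_Integration.integral_cong[OF refl]) (rule wedge_euler1_char_poly_prod[OF inj norm])
    also have "\<dots> = ?c * alternant n x * (\<integral>U. ?g U \<partial>M) + alternant n x * (\<integral>U. ?g U * ?T U \<partial>M)"
      by (subst Bochner_Integration.integral_add) (auto intro!: integrable_bounded_meas b)
    also have "\<dots> = (?c + K1) * (alternant n x * (\<integral>U. ?g U \<partial>M))"
      unfolding k1 by (simp add: algebra_simps)
    finally show "(\<integral>U. inverse (Determinant.det U) ^ l * (\<Sum>\<alpha>\<in>{..<n} \<rightarrow>\<^sub>E {..<n + N}.
          of_nat (\<Sum>j<n. \<alpha> j) * wedge_coeff n (char_poly U) \<alpha> * (\<Prod>i<n. x i ^ \<alpha> i)) \<partial>M) =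
        (?c + K1) * (alternant n x * (\<integral>U. ?g U \<partial>M))" .
  qed
qed

text \<open>The second Euler identity also contains the first-order trace, so the constants of both
  Schwinger--Dyson equations enter the eigenvalue.\<close>

lemma wedge_moment_support2:
  "\<exists>C. \<forall>\<alpha>\<in>{..<n} \<rightarrow>\<^sub>E {..<n + N}. (of_nat (\<Sum>j<n. \<Sum>k\<in>{..<n} - {j}. \<alpha> j * \<alpha> k) - C) * wedge_moment l n \<alpha> = 0"
proof -
  obtain K1 where K1: "\<And>x. (\<And>j. j < n \<Longrightarrow> cmod (x j) \<noteq> 1) \<Longrightarrow>
      (\<integral>U. char_poly_prod l n x U * (\<Sum>j<n. \<Sum>a<N. cayley N U (x j) a a) \<partial>M) = K1 * (\<integral>U. char_poly_prod l n x U \<partial>M)"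
    using schwinger_dyson_trace1[of l] by blast
  obtain K2 where K2: "\<And>x. (\<And>j. j < n \<Longrightarrow> cmod (x j) \<noteq> 1) \<Longrightarrow>
      (\<integral>U. char_poly_prod l n x U * (\<Sum>j<n. \<Sum>i\<in>{..<n} - {j}. (\<Sum>a<N. cayley N U (x j) a a) * (\<Sum>a<N. cayley N U (x i) a a) +
        (\<Sum>a<N. \<Sum>b<N. cayley N U (x j) a b * cayley N U (x i) b a)) \<partial>M) = K2 * (\<integral>U. char_poly_prod l n x U \<partial>M)"
    using schwinger_dyson_trace2[of l] by blast
  define s :: complex where "s = of_nat (\<Sum>j<n. j)"
  define c0 where "c0 = s\<^sup>2 + 2 * s * of_nat (n * N) + (of_nat N)\<^sup>2 * (of_nat n * (of_nat n - 1)) - of_nat (\<Sum>j<n. j\<^sup>2)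
      - of_nat N * (of_nat n * (of_nat n - 1))"
  define c1 where "c1 = 2 * s + 2 * of_nat N * (of_nat n - 1)"
  show ?thesis
  proof (intro exI ballI, rule wedge_moment_eigen)
    fix x assume inj: "inj_on x {..<n}" and norm: "\<And>j. j < n \<Longrightarrow> cmod (x j) \<noteq> 1"
    let ?g = "char_poly_prod l n x" and ?T = "\<lambda>U. \<Sum>j<n. \<Sum>a<N. cayley N U (x j) a a"
    let ?D = "\<lambda>U. \<Sum>j<n. \<Sum>i\<in>{..<n} - {j}. (\<Sum>a<N. cayley N U (x j) a a) * (\<Sum>a<N. cayley N U (x i) a a) +
        (\<Sum>a<N. \<Sum>b<N. cayley N U (x j) a b * cayley N U (x i) b a)"
    have b2: "bounded_meas M (\<lambda>U. ?g U * ?T U)" by (rule bounded_meas_trace_sum) (use inj norm in auto)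
    have b3: "bounded_meas M (\<lambda>U. ?g U * ?D U)" by (rule bounded_meas_trace_sum2) (use inj norm in auto)
    have k1: "(\<integral>U. ?g U * ?T U \<partial>M) = K1 * (\<integral>U. ?g U \<partial>M)" using norm by (rule K1)
    have k2: "(\<integral>U. ?g U * ?D U \<partial>M) = K2 * (\<integral>U. ?g U \<partial>M)" using norm by (rule K2)
    have "(\<integral>U. inverse (Determinant.det U) ^ l * (\<Sum>\<alpha>\<in>{..<n} \<rightarrow>\<^sub>E {..<n + N}.
          of_nat (\<Sum>j<n. \<Sum>k\<in>{..<n} - {j}. \<alpha> j * \<alpha> k) * wedge_coeff n (char_poly U) \<alpha> * (\<Prod>i<n. x i ^ \<alpha> i)) \<partial>M) =
        (\<integral>U. alternant n x * (?g U * ?D U) + c1 * alternant n x * (?g U * ?T U) + c0 * alternant n x * ?g U \<partial>M)"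
      unfolding c0_def c1_def s_def
      by (rule Bochner_Integration.integral_cong[OF refl]) (rule wedge_euler2_char_poly_prod[OF inj norm])
    also have "\<dots> = alternant n x * (\<integral>U. ?g U * ?D U \<partial>M) + c1 * alternant n x * (\<integral>U. ?g U * ?T U \<partial>M) +
        c0 * alternant n x * (\<integral>U. ?g U \<partial>M)"
    proof -
      have "integrable M (\<lambda>U. alternant n x * (?g U * ?D U))" "integrable M (\<lambda>U. c1 * alternant n x * (?g U * ?T U))"
        "integrable M (\<lambda>U. c0 * alternant n x * ?g U)"
        by (rule integrable_bounded_meas[OF bounded_meas_mult[OF bounded_meas_const b3]]
            integrable_bounded_meas[OF bounded_meas_mult[OF bounded_meas_const b2]]
            integrable_bounded_meas[OF bounded_meas_mult[OF bounded_meas_const bounded_meas_char_poly_prod]])+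
      then show ?thesis by (simp only: Bochner_Integration.integral_add Bochner_Integration.integrable_add integral_mult_right_zero)
    qed
    also have "\<dots> = (K2 + c1 * K1 + c0) * (alternant n x * (\<integral>U. ?g U \<partial>M))"
      unfolding k1 k2 by (simp add: algebra_simps)
    finally show "(\<integral>U. inverse (Determinant.det U) ^ l * (\<Sum>\<alpha>\<in>{..<n} \<rightarrow>\<^sub>E {..<n + N}.
          of_nat (\<Sum>j<n. \<Sum>k\<in>{..<n} - {j}. \<alpha> j * \<alpha> k) * wedge_coeff n (char_poly U) \<alpha> * (\<Prod>i<n. x i ^ \<alpha> i)) \<partial>M) =
        (K2 + c1 * K1 + c0) * (alternant n x * (\<integral>U. ?g U \<partial>M))" .
  qed
qed

text \<open>The extreme coefficient is the l-th power of the constant term (-1)^N det U of the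
  characteristic polynomial, so the determinants cancel and the integrand is constant.\<close>

lemma wedge_moment_extreme:
  assumes l: "l \<le> n"
  defines "\<alpha>0 \<equiv> restrict (\<lambda>k. if k < l then k else N + k) {..<n}"
  shows "wedge_moment l n \<alpha>0 = ((-1) ^ N) ^ l"
proof -
  have "wedge_moment l n \<alpha>0 = (\<integral>U. ((-1) ^ N) ^ l \<partial>M)"
    unfolding wedge_moment_def
  proof (rule Bochner_Integration.integral_cong[OF refl])
    fix U assume "U \<in> space M"
    then have U: "U \<in> unitary_group N" by (simp add: space_M)
    note c = unitary_group_carrier[OF U]
    obtain z where z: "char_poly U = (\<Prod>i<N. [:- z i, 1:])" by (rule unitary_spectrum[OF U])
    have "coeff (char_poly U) 0 = (-1) ^ N * Determinant.det U"
      unfolding unitary_det_spectrum[OF c z] by (simp add: z poly_0_coeff_0[symmetric] poly_prod prod_uminus)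
    moreover have "wedge_coeff n (char_poly U) \<alpha>0 = coeff (char_poly U) 0 ^ l"
      unfolding \<alpha>0_def using degree_monic_char_poly[OF c] by (intro wedge_coeff_extreme l) auto
    moreover have "Determinant.det U \<noteq> 0" using unitary_det_norm[OF U] by auto
    ultimately show "inverse (Determinant.det U) ^ l * wedge_coeff n (char_poly U) \<alpha>0 = ((-1) ^ N) ^ l"
      by (simp add: power_mult_distrib power_inverse)
  qed
  then show ?thesis by (simp add: prob_space)
qed

text \<open>The moment of \<alpha>0 is nonzero, which identifies the unknown eigenvalues as the
  values at \<alpha>0. Another nonzero moment would have the same sum and the same square sum of
  exponents, and \<open>maximal_exponents_unique\<close> then gives the same exponent set.\<close>

lemma wedge_moment_zero:
  assumes \<alpha>: "\<alpha> \<in> {..<n} \<rightarrow>\<^sub>E {..<n + N}" "inj_on \<alpha> {..<n}" and l: "l \<le> n"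
  defines "\<alpha>0 \<equiv> restrict (\<lambda>k. if k < l then k else N + k) {..<n}"
  assumes ne: "\<alpha> ` {..<n} \<noteq> \<alpha>0 ` {..<n}"
  shows "wedge_moment l n \<alpha> = 0"
proof (rule ccontr)
  assume nz: "wedge_moment l n \<alpha> \<noteq> 0"
  have \<alpha>0: "\<alpha>0 \<in> {..<n} \<rightarrow>\<^sub>E {..<n + N}"
    unfolding \<alpha>0_def restrict_PiE_iff by auto
  have inj0: "inj_on \<alpha>0 {..<n}" by (auto simp: inj_on_def \<alpha>0_def split: if_splits)
  have nz0: "wedge_moment l n \<alpha>0 \<noteq> 0" unfolding \<alpha>0_def wedge_moment_extreme[OF l] by simp
  have img0: "\<alpha>0 ` {..<n} = {..<l} \<union> {l + N..<n + N}"
  proof (intro equalityI subsetI)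
    fix t assume "t \<in> {..<l} \<union> {l + N..<n + N}"
    then show "t \<in> \<alpha>0 ` {..<n}"
      using l by (intro image_eqI[of _ _ "if t < l then t else t - N"]) (auto simp: \<alpha>0_def)
  qed (auto simp: \<alpha>0_def split: if_splits)
  obtain C1 where C1: "\<And>\<alpha>. \<alpha> \<in> {..<n} \<rightarrow>\<^sub>E {..<n + N} \<Longrightarrow> (of_nat (\<Sum>j<n. \<alpha> j) - C1) * wedge_moment l n \<alpha> = 0"
    using wedge_moment_support1[of n l] by blast
  obtain C2 where C2: "\<And>\<alpha>. \<alpha> \<in> {..<n} \<rightarrow>\<^sub>E {..<n + N} \<Longrightarrow>
      (of_nat (\<Sum>j<n. \<Sum>k\<in>{..<n} - {j}. \<alpha> j * \<alpha> k) - C2) * wedge_moment l n \<alpha> = 0"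
    using wedge_moment_support2[of n l] by blast
  have "of_nat (\<Sum>j<n. \<alpha> j) = C1" "of_nat (\<Sum>j<n. \<alpha>0 j) = C1"
    using C1[OF \<alpha>(1)] C1[OF \<alpha>0] nz nz0 by (simp_all only: mult_eq_0_iff right_minus_eq simp_thms)
  then have e1: "(\<Sum>j<n. \<alpha> j) = (\<Sum>j<n. \<alpha>0 j)"
    unfolding of_nat_eq_iff[where 'a = complex, symmetric] by (simp only:)
  have "of_nat (\<Sum>j<n. \<Sum>k\<in>{..<n} - {j}. \<alpha> j * \<alpha> k) = C2" "of_nat (\<Sum>j<n. \<Sum>k\<in>{..<n} - {j}. \<alpha>0 j * \<alpha>0 k) = C2"
    using C2[OF \<alpha>(1)] C2[OF \<alpha>0] nz nz0 by (simp_all only: mult_eq_0_iff right_minus_eq simp_thms)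
  then have e2: "(\<Sum>j<n. \<Sum>k\<in>{..<n} - {j}. \<alpha> j * \<alpha> k) = (\<Sum>j<n. \<Sum>k\<in>{..<n} - {j}. \<alpha>0 j * \<alpha>0 k)"
    unfolding of_nat_eq_iff[where 'a = complex, symmetric] by (simp only:)
  have off: "(\<Sum>j<n. \<Sum>k\<in>{..<n} - {j}. u j * u k) + (\<Sum>j<n. (u j)\<^sup>2) = (\<Sum>j<n. u j)\<^sup>2" for u :: "nat \<Rightarrow> nat"
  proof -
    have "(\<Sum>j<n. \<Sum>k\<in>{..<n} - {j}. u j * u k) + (\<Sum>j<n. (u j)\<^sup>2) = (\<Sum>j<n. \<Sum>k<n. u j * u k)"
      unfolding sum.distrib[symmetric]
      by (intro sum.cong refl) (simp add: sum.remove[of "{..<n}" _ "\<lambda>k. u _ * u k"] power2_eq_square)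
    then show ?thesis by (simp add: power2_eq_square sum_product)
  qed
  have e3: "(\<Sum>j<n. (\<alpha> j)\<^sup>2) = (\<Sum>j<n. (\<alpha>0 j)\<^sup>2)"
    using off[of \<alpha>] off[of \<alpha>0] e1 e2 by simp
  have "\<alpha> ` {..<n} = {..<l} \<union> {l + N..<n + N}"
  proof (rule maximal_exponents_unique[of _ n N l, OF _ _ _ l])
    show "\<alpha> ` {..<n} \<subseteq> {..<n + N}" using PiE_mem[OF \<alpha>(1)] by blast
    show "card (\<alpha> ` {..<n}) = n" using card_image[OF \<alpha>(2)] by simp
    show "\<Sum>(\<alpha> ` {..<n}) = \<Sum>({..<l} \<union> {l + N..<n + N})"
      unfolding img0[symmetric] sum.reindex[OF \<alpha>(2)] sum.reindex[OF inj0] using e1 by (simp add: o_def)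
    show "(\<Sum>t\<in>\<alpha> ` {..<n}. t\<^sup>2) = (\<Sum>t\<in>{..<l} \<union> {l + N..<n + N}. t\<^sup>2)"
      unfolding img0[symmetric] sum.reindex[OF \<alpha>(2)] sum.reindex[OF inj0] using e3 by (simp add: o_def)
  qed simp
  with ne img0 show False by simp
qed

definition toeplitz_sum :: "nat \<Rightarrow> complex poly \<Rightarrow> complex" where
  "toeplitz_sum l q = (\<Sum>\<sigma> | \<sigma> permutes {..<N}. of_int (sign \<sigma>) * (\<Prod>i<N. coeff (monom 1 i * q) (l + \<sigma> i)))"

lemma toeplitz_sum_monom: "toeplitz_sum l (monom 1 l) = 1"
proof -
  have "(\<Prod>i<N. coeff (monom 1 i * monom 1 l) (l + \<sigma> i)) = (if \<sigma> = id then 1 else (0::complex))"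
    if \<sigma>: "\<sigma> permutes {..<N}" for \<sigma>
  proof (cases "\<sigma> = id")
    case False
    then obtain i where "\<sigma> i \<noteq> i" by (auto simp: fun_eq_iff)
    then have "i < N" "coeff (monom 1 i * monom 1 l) (l + \<sigma> i) = (0::complex)"
      using \<sigma> by (auto simp: permutes_def mult_monom)
    then show ?thesis using False by (auto intro!: prod_zero)
  qed (simp add: mult_monom add.commute)
  then have "toeplitz_sum l (monom 1 l) = (\<Sum>\<sigma> | \<sigma> permutes {..<N}. if \<sigma> = id then 1 else 0)"
    unfolding toeplitz_sum_def by (intro sum.cong refl) auto
  then show ?thesis by (simp add: finite_permutations permutes_id)
qed

text \<open>The resultant of q with the characteristic polynomial is a Sylvester expansion in wedge
  coefficients; in expectation only \<alpha>0 survives, which leaves a multiple of the Toeplitz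
  determinant. The multiple does not depend on q. For q = x^l the integrand and the Toeplitz sum are
  both 1, so it equals 1.\<close>

theorem integral_eig_prod_poly:
  assumes q: "degree q \<le> n" and l: "l \<le> n"
  shows "(\<integral>U. inverse (Determinant.det U) ^ l * eig_prod (poly q) U \<partial>M) = toeplitz_sum l q"
proof -
  define \<alpha>0 where "\<alpha>0 = restrict (\<lambda>k. if k < l then k else N + k) {..<n}"
  define e where "e U = inverse (Determinant.det U) ^ l" for U :: "complex mat"
  define c where "c \<alpha> = (\<integral>U. e U * (\<Prod>k<n. coeff (monom 1 k * char_poly U) (\<alpha> k)) \<partial>M)" for \<alpha>
  have be: "bounded_meas M e" unfolding e_def by (intro bounded_meas_power bounded_meas_inverse_det)
  have bc: "bounded_meas M (\<lambda>U. e U * (\<Prod>k<n. coeff (monom 1 k * char_poly U) (\<alpha> k)))" for \<alpha>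
    by (intro bounded_meas_mult be bounded_meas_prod bounded_meas_coeff_shift)
  obtain \<kappa> where \<kappa>: "\<And>q. sylvester n N q (\<lambda>\<alpha>. if \<alpha> = \<alpha>0 then 1 else 0) = \<kappa> * toeplitz_sum l q"
    using sylvester_toeplitz[OF l, of N] unfolding \<alpha>0_def toeplitz_sum_def by blast
  have asym: "antisymmetrize n c \<alpha> = wedge_moment l n \<alpha>" for \<alpha>
  proof -
    have "antisymmetrize n c \<alpha> = (\<Sum>\<tau> | \<tau> permutes {..<n}. \<integral>U. of_int (sign \<tau>) *
        (e U * (\<Prod>k<n. coeff (monom 1 k * char_poly U) (restrict (\<alpha> \<circ> \<tau>) {..<n} k))) \<partial>M)"
      by (simp add: antisymmetrize_def c_def)
    also have "\<dots> = (\<integral>U. (\<Sum>\<tau> | \<tau> permutes {..<n}. of_int (sign \<tau>) *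
        (e U * (\<Prod>k<n. coeff (monom 1 k * char_poly U) (restrict (\<alpha> \<circ> \<tau>) {..<n} k)))) \<partial>M)"
      by (intro Bochner_Integration.integral_sum[symmetric] integrable_bounded_meas bounded_meas_mult[OF bounded_meas_const] bc)
    also have "\<dots> = (\<integral>U. e U * antisymmetrize n (\<lambda>\<alpha>. \<Prod>k<n. coeff (monom 1 k * char_poly U) (\<alpha> k)) \<alpha> \<partial>M)"
      by (simp add: antisymmetrize_def sum_distrib_left mult.left_commute)
    finally show ?thesis by (simp add: wedge_coeff_antisymmetrize wedge_moment_def e_def)
  qed
  \<comment> \<open>Stated for every admissible polynomial with one and the same \<kappa>', to be
    used for the given q and for the test monomial.\<close>
  have main: "(\<integral>U. e U * eig_prod (poly q) U \<partial>M) = \<kappa>' * toeplitz_sum l q"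
    if q: "degree q \<le> n" and \<kappa>': "\<kappa>' = ((-1) ^ N) ^ n * antisymmetrize n c \<alpha>0 * \<kappa>" for q \<kappa>'
  proof -
    have "(\<integral>U. e U * eig_prod (poly q) U \<partial>M) =
        (\<integral>U. ((-1) ^ N) ^ n * (e U * sylvester n N q (\<lambda>\<alpha>. \<Prod>k<n. coeff (monom 1 k * char_poly U) (\<alpha> k))) \<partial>M)"
    proof (rule Bochner_Integration.integral_cong[OF refl])
      fix U assume "U \<in> space M"
      then have "U \<in> unitary_group N" by (simp add: space_M)
      then obtain z where z: "char_poly U = (\<Prod>i<N. [:- z i, 1:])"
        "proots (char_poly U) = image_mset z (mset_set {..<N})" by (rule unitary_spectrum)
      have "((-1) ^ N) ^ n * ((-1) ^ N) ^ n = (1 :: complex)"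
        unfolding power_mult_distrib[symmetric] by simp
      then have sq: "((-1) ^ N) ^ n * (((-1) ^ N) ^ n * y) = y" for y :: complex
        by (simp only: mult.assoc[symmetric] mult_1_left)
      then show "e U * eig_prod (poly q) U = ((-1) ^ N) ^ n * (e U * sylvester n N q (\<lambda>\<alpha>. \<Prod>k<n. coeff (monom 1 k * char_poly U) (\<alpha> k)))"
        unfolding z(1) sylvester_roots[OF q] eig_prod_spectrum[OF z(2)] by (simp only: mult.left_commute[of "e U"] sq)
    qed
    also have "\<dots> = ((-1) ^ N) ^ n * (\<integral>U. (\<Sum>\<pi> | \<pi> permutes {..<n + N}. of_int (sign \<pi>) *
        (\<Prod>i<N. coeff (monom 1 i * q) (\<pi> (n + i))) * (e U * (\<Prod>k<n. coeff (monom 1 k * char_poly U) (restrict \<pi> {..<n} k)))) \<partial>M)"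
      unfolding integral_mult_right_zero by (simp only: sylvester_def sum_distrib_left mult_ac)
    also have "(\<integral>U. (\<Sum>\<pi> | \<pi> permutes {..<n + N}. of_int (sign \<pi>) *
        (\<Prod>i<N. coeff (monom 1 i * q) (\<pi> (n + i))) * (e U * (\<Prod>k<n. coeff (monom 1 k * char_poly U) (restrict \<pi> {..<n} k)))) \<partial>M) =
        (\<Sum>\<pi> | \<pi> permutes {..<n + N}. \<integral>U. of_int (sign \<pi>) *
        (\<Prod>i<N. coeff (monom 1 i * q) (\<pi> (n + i))) * (e U * (\<Prod>k<n. coeff (monom 1 k * char_poly U) (restrict \<pi> {..<n} k))) \<partial>M)"
      by (intro Bochner_Integration.integral_sum integrable_bounded_meas bounded_meas_mult[OF bounded_meas_const] bc)
    also have "\<dots> = sylvester n N q c"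
      unfolding sylvester_def c_def integral_mult_right_zero by (simp only: mult_ac)
    also have "\<dots> = antisymmetrize n c \<alpha>0 * (\<kappa> * toeplitz_sum l q)"
      unfolding \<kappa>[symmetric]
    proof (rule sylvester_collapse)
      show "inj_on \<alpha>0 {..<n}" by (auto simp: inj_on_def \<alpha>0_def split: if_splits)
      show "\<alpha>0 \<in> extensional {..<n}" by (simp add: \<alpha>0_def)
      show "antisymmetrize n c \<alpha> = 0" if "\<alpha> \<in> {..<n} \<rightarrow>\<^sub>E {..<n + N}" "inj_on \<alpha> {..<n}" "\<alpha> ` {..<n} \<noteq> \<alpha>0 ` {..<n}" for \<alpha>
        unfolding asym using that l unfolding \<alpha>0_def by (intro wedge_moment_zero) auto
    qed
    finally show ?thesis unfolding \<kappa>' by (simp add: mult_ac)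
  qed
  define \<kappa>' where "\<kappa>' = ((-1) ^ N) ^ n * antisymmetrize n c \<alpha>0 * \<kappa>"
  have "(\<integral>U. e U * eig_prod (poly (monom 1 l)) U \<partial>M) = (\<integral>U. 1 \<partial>M)"
  proof (rule Bochner_Integration.integral_cong[OF refl])
    fix U assume "U \<in> space M"
    then have U: "U \<in> unitary_group N" by (simp add: space_M)
    then obtain z where z: "char_poly U = (\<Prod>i<N. [:- z i, 1:])"
      "proots (char_poly U) = image_mset z (mset_set {..<N})" by (rule unitary_spectrum)
    have "Determinant.det U \<noteq> 0" using unitary_det_norm[OF U] by auto
    moreover have "eig_prod (poly (monom 1 l)) U = Determinant.det U ^ l"
      by (simp add: eig_prod_spectrum[OF z(2)] poly_monom prod_power_distrib
          unitary_det_spectrum[OF unitary_group_carrier[OF U] z(1)])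
    ultimately show "e U * eig_prod (poly (monom 1 l)) U = 1"
      by (simp add: e_def power_inverse)
  qed
  moreover have "degree (monom (1::complex) l) \<le> n" using l by (simp add: degree_monom_eq)
  ultimately have "\<kappa>' = 1"
    using main[OF _ \<kappa>'_def, of "monom 1 l"] by (simp add: toeplitz_sum_monom prob_space)
  then show ?thesis using main[OF q \<kappa>'_def] by (simp add: e_def)
qed

end

section \<open>The Weyl integration formula\<close>

lemma power_series_eq_zero:
  fixes c :: "nat \<Rightarrow> real"
  assumes "\<And>s. s \<noteq> 0 \<Longrightarrow> (\<lambda>n. c n * s ^ n) sums 0"
  shows "c n = 0"
  using assms
proof (induction n arbitrary: c)
  case 0
  have "((\<lambda>_. 0) \<longlongrightarrow> c 0) (at (0::real))"
    by (rule powser_limit_0_strong[where a = c and s = 1]) (use 0 in auto)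
  then show ?case using LIM_unique[OF _ tendsto_const] by blast
next
  case (Suc n)
  have "((\<lambda>_. 0) \<longlongrightarrow> c 0) (at (0::real))"
    by (rule powser_limit_0_strong[where a = c and s = 1]) (use Suc.prems in auto)
  then have c0: "c 0 = 0" using LIM_unique[OF _ tendsto_const] by blast
  show ?case
  proof (rule Suc.IH[of "\<lambda>n. c (Suc n)"])
    fix s :: real assume s: "s \<noteq> 0"
    have "(\<lambda>n. c (Suc n) * s ^ Suc n) sums 0"
      using Suc.prems[OF s] sums_Suc_iff[of "\<lambda>n. c n * s ^ n" 0] by (simp add: c0)
    from sums_divide[OF this, of s] show "(\<lambda>n. c (Suc n) * s ^ n) sums 0"
      using s by (simp add: field_simps)
  qed
qed

text \<open>Termwise integration of the exponential series, dominated by the series at |s| |B|. The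
  weight G may be signed, because on the torus it will be the real part of a kernel that is no
  density.\<close>

lemma (in finite_measure) exp_moments_sums:
  fixes Y G :: "'a \<Rightarrow> real"
  assumes [measurable]: "Y \<in> borel_measurable M" "G \<in> borel_measurable M"
    and Y: "\<And>x. x \<in> space M \<Longrightarrow> \<bar>Y x\<bar> \<le> B" and G: "\<And>x. x \<in> space M \<Longrightarrow> \<bar>G x\<bar> \<le> C"
  shows "(\<lambda>m. (\<integral>x. Y x ^ m * G x \<partial>M) / fact m * s ^ m) sums (\<integral>x. exp (s * Y x) * G x \<partial>M)"
proof -
  define f where "f m x = (s * Y x) ^ m / fact m * G x" for m x
  have bound: "norm (f m x) \<le> (\<bar>s\<bar> * \<bar>B\<bar>) ^ m / fact m * \<bar>C\<bar>" if x: "x \<in> space M" for m x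
  proof -
    have "\<bar>Y x\<bar> \<le> \<bar>B\<bar>" "\<bar>G x\<bar> \<le> \<bar>C\<bar>" using Y[OF x] G[OF x] by auto
    then have "\<bar>s * Y x\<bar> ^ m / fact m * \<bar>G x\<bar> \<le> (\<bar>s\<bar> * \<bar>B\<bar>) ^ m / fact m * \<bar>C\<bar>"
      by (intro mult_mono divide_right_mono power_mono) (auto simp: abs_mult intro: mult_left_mono)
    then show ?thesis by (simp add: f_def abs_mult power_abs)
  qed
  have int: "integrable M (f m)" for m
  proof (rule integrable_const_bound)
    show "AE x in M. norm (f m x) \<le> (\<bar>s\<bar> * \<bar>B\<bar>) ^ m / fact m * \<bar>C\<bar>" by (rule AE_I2) (rule bound)
    show "f m \<in> borel_measurable M" unfolding f_def by measurable
  qed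
  have sumexp: "summable (\<lambda>m. (\<bar>s\<bar> * \<bar>B\<bar>) ^ m / fact m * \<bar>C\<bar>)"
    using summable_exp[of "\<bar>s\<bar> * \<bar>B\<bar>"] by (intro summable_mult2) (simp add: field_simps)
  have "(\<lambda>m. \<integral>x. f m x \<partial>M) sums (\<integral>x. (\<Sum>m. f m x) \<partial>M)"
  proof (rule sums_integral[OF int])
    show "AE x in M. summable (\<lambda>m. norm (f m x))"
    proof (rule AE_I2)
      fix x assume "x \<in> space M"
      then show "summable (\<lambda>m. norm (f m x))"
        by (intro summable_comparison_test[OF _ sumexp] exI[of _ 0] allI impI)
          (subst real_norm_def, subst abs_of_nonneg, rule norm_ge_zero, rule bound)
    qed
    have "(\<integral>x. norm (f m x) \<partial>M) \<le> (\<bar>s\<bar> * \<bar>B\<bar>) ^ m / fact m * \<bar>C\<bar> * measure M (space M)" for m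
    proof -
      have "(\<integral>x. norm (f m x) \<partial>M) \<le> (\<integral>x. (\<bar>s\<bar> * \<bar>B\<bar>) ^ m / fact m * \<bar>C\<bar> \<partial>M)"
      proof (rule integral_mono)
        show "integrable M (\<lambda>x. norm (f m x))" by (rule integrable_norm[OF int])
      qed (use bound in simp_all)
      then show ?thesis by (simp add: mult_ac)
    qed
    then show "summable (\<lambda>m. \<integral>x. norm (f m x) \<partial>M)"
      by (intro summable_comparison_test[OF _ summable_mult2[OF sumexp, of "measure M (space M)"]] exI[of _ 0]) auto
  qed
  also have "(\<integral>x. (\<Sum>m. f m x) \<partial>M) = (\<integral>x. exp (s * Y x) * G x \<partial>M)"
  proof -
    have "(\<lambda>m. f m x) sums (exp (s * Y x) * G x)" for x
      unfolding f_def using exp_converges[of "s * Y x"]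
      by (intro sums_mult2) (simp add: field_simps)
    then have "(\<Sum>m. f m x) = exp (s * Y x) * G x" for x by (rule sums_unique[symmetric])
    then show ?thesis by simp
  qed
  also have "(\<lambda>m. \<integral>x. f m x \<partial>M) = (\<lambda>m. (\<integral>x. Y x ^ m * G x \<partial>M) / fact m * s ^ m)"
  proof
    fix m
    have "f m x = s ^ m / fact m * (Y x ^ m * G x)" for x
      by (simp add: f_def power_mult_distrib)
    then show "(\<integral>x. f m x \<partial>M) = (\<integral>x. Y x ^ m * G x \<partial>M) / fact m * s ^ m"
      by simp
  qed
  finally show ?thesis .
qed

section \<open>Normalized Lebesgue measure on the circle, Fourier coefficients and Laurent
  polynomials\<close>

lemma measurable_cis [measurable]: "cis \<in> borel_measurable borel"
  by (intro borel_measurable_continuous_onI continuous_intros)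

definition circ :: "real measure" where
  "circ = uniform_measure lborel {-pi..pi}"

lemma space_circ [simp]: "space circ = UNIV" and sets_circ [simp, measurable_cong]: "sets circ = sets borel"
  by (simp_all add: circ_def)

interpretation circ: prob_space circ
  unfolding circ_def by (rule prob_space_uniform_measure) auto

lemma AE_circ_iff: "(AE x in circ. P x) \<longleftrightarrow> (AE x in lborel. x \<in> {-pi..pi} \<longrightarrow> P x)"
  unfolding circ_def by (rule AE_uniform_measure) auto

lemma circ_conv_density: "circ = density lborel (\<lambda>x. ennreal (indicator {-pi..pi} x / (2 * pi)))"
  unfolding circ_def uniform_measure_def
  by (intro density_cong AE_I2) (auto simp: indicator_def divide_ennreal[symmetric] ennreal_1[symmetric] simp del: ennreal_1)

lemma integral_circ:
  fixes f :: "real \<Rightarrow> 'a::{banach, second_countable_topology}"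
  assumes [measurable]: "f \<in> borel_measurable borel"
  shows "(\<integral>x. f x \<partial>circ) = (1 / (2 * pi)) *\<^sub>R (\<integral>x\<in>{-pi..pi}. f x \<partial>lborel)"
proof -
  have "(\<integral>x. f x \<partial>circ) = (\<integral>x. (indicator {-pi..pi} x / (2 * pi)) *\<^sub>R f x \<partial>lborel)"
    unfolding circ_conv_density by (subst integral_density) auto
  also have "\<dots> = (1 / (2 * pi)) *\<^sub>R (\<integral>x\<in>{-pi..pi}. f x \<partial>lborel)"
    unfolding set_lebesgue_integral_def integral_scaleR_right[symmetric]
    by (intro Bochner_Integration.integral_cong) auto
  finally show ?thesis .
qed

lemma integral_circ_cis: "(\<integral>\<theta>. cis (of_int k * \<theta>) \<partial>circ) = (if k = 0 then 1 else 0)"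
proof (cases "k = 0")
  case False
  have "((\<lambda>\<theta>. cis (of_int k * \<theta>)) has_integral
      (cis (of_int k * pi) / (\<i> * of_int k) - cis (of_int k * (-pi)) / (\<i> * of_int k))) {-pi..pi}"
  proof (rule fundamental_theorem_of_calculus)
    fix x
    have "((\<lambda>x. exp (\<i> * of_real (of_int k * x)) / (\<i> * of_int k)) has_vector_derivative
        exp (\<i> * of_real (of_int k * x))) (at x within {-pi..pi})"
    proof -
      have "((\<lambda>z. exp (\<i> * (of_int k * z)) / (\<i> * of_int k)) has_field_derivative exp (\<i> * (of_int k * of_real x))) (at (of_real x))"
        using False by (auto intro!: derivative_eq_intros simp: mult_ac)
      from has_vector_derivative_real_field[OF this] show ?thesis by simp
    qed
    then show "((\<lambda>x. cis (of_int k * x) / (\<i> * of_int k)) has_vector_derivative cis (of_int k * x)) (at x within {-pi..pi})"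
      by (simp add: cis_conv_exp)
  qed (use pi_ge_zero in linarith)
  moreover have "cis (of_int k * pi) = cis (of_int k * (-pi))"
  proof -
    have "cis (of_int k * pi) = cis (of_int k * (-pi)) * cis (2 * pi * of_int k)"
      by (simp add: cis_mult algebra_simps)
    then show ?thesis by (simp add: cis_multiple_2pi)
  qed
  ultimately have "((\<lambda>\<theta>. cis (of_int k * \<theta>)) has_integral 0) {-pi..pi}" by simp
  then have "integral {-pi..pi} (\<lambda>\<theta>. cis (of_int k * \<theta>)) = 0" by (rule integral_unique)
  moreover have "set_integrable lborel {-pi..pi} (\<lambda>\<theta>. cis (of_int k * \<theta>))"
    by (rule borel_integrable_atLeastAtMost') (auto intro!: continuous_intros)
  ultimately have "(\<integral>\<theta>\<in>{-pi..pi}. cis (of_int k * \<theta>) \<partial>lborel) = 0"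
    using set_borel_integral_eq_integral(2) by metis
  then show ?thesis using False by (subst integral_circ) auto
qed (simp add: circ.prob_space[simplified])

definition circ_coeff :: "(complex \<Rightarrow> complex) \<Rightarrow> int \<Rightarrow> complex" where
  "circ_coeff h d = (\<integral>\<theta>. h (cis \<theta>) * cis (- of_int d * \<theta>) \<partial>circ)"

lemma circ_coeff_laurent:
  "circ_coeff (\<lambda>z. inverse z ^ l * poly q z) d = (if int l + d \<ge> 0 then coeff q (nat (int l + d)) else 0)"
proof -
  have "inverse (cis \<theta>) ^ l * poly q (cis \<theta>) * cis (- of_int d * \<theta>) =
      (\<Sum>k\<le>degree q. coeff q k * cis (of_int (int k - int l - d) * \<theta>))" for \<theta>
  proof -
    have "inverse (cis \<theta>) ^ l * cis \<theta> ^ k * cis (- of_int d * \<theta>) = cis (of_int (int k - int l - d) * \<theta>)" for k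
      by (simp add: Complex.DeMoivre cis_inverse cis_mult algebra_simps)
    then show ?thesis
      by (simp add: poly_altdef sum_distrib_left sum_distrib_right mult_ac)
  qed
  then have "circ_coeff (\<lambda>z. inverse z ^ l * poly q z) d =
      (\<Sum>k\<le>degree q. coeff q k * (\<integral>\<theta>. cis (of_int (int k - int l - d) * \<theta>) \<partial>circ))"
    unfolding circ_coeff_def
    by simp (subst Bochner_Integration.integral_sum, auto intro!: circ.integrable_const_bound[of _ "norm (coeff q _)"] simp: norm_mult)
  also have "\<dots> = (\<Sum>k\<le>degree q. if int k = int l + d then coeff q k else 0)"
    unfolding integral_circ_cis by (intro sum.cong refl) auto
  also have "\<dots> = (if int l + d \<ge> 0 then coeff q (nat (int l + d)) else 0)"
  proof (cases "int l + d \<ge> 0")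
    case True
    then have "(\<Sum>k\<le>degree q. if int k = int l + d then coeff q k else 0) =
        (\<Sum>k\<le>degree q. if k = nat (int l + d) then coeff q k else 0)"
      by (intro sum.cong refl) auto
    then show ?thesis using True by (simp add: coeff_eq_0)
  qed (auto intro!: sum.neutral)
  finally show ?thesis .
qed

definition laurent_on_circle :: "(complex \<Rightarrow> real) \<Rightarrow> bool" where
  "laurent_on_circle g \<longleftrightarrow> (\<exists>l q. \<forall>z\<in>sphere 0 1. of_real (g z) = inverse z ^ l * poly q z)"

text \<open>On the unit circle cnj z = 1 / z, so Re z = (z + 1 / z) / 2 and Im z = -(i / 2) (z - 1 /
  z) are Laurent polynomials. Hence a linear map is one as well, and sums and products are brought
  to a common power of 1 / z.\<close>

lemma real_polynomial_laurent:
  fixes g :: "complex \<Rightarrow> real"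
  assumes "real_polynomial_function g"
  shows "laurent_on_circle g"
  using assms
proof (induction rule: real_polynomial_function.induct)
  case (linear f)
  define a b where "a = complex_of_real (f 1)" and "b = complex_of_real (f \<i>)"
  have "of_real (f z) = inverse z ^ 1 * poly [:a / 2 + \<i> * b / 2, 0, a / 2 - \<i> * b / 2:] z" if "z \<in> sphere 0 1" for z
  proof -
    interpret bounded_linear f by fact
    have nz: "z \<noteq> 0" using that by auto
    have "z * cnj z = 1" using that complex_norm_square[of z] by simp
    then have cz: "cnj z = inverse z" using nz by (simp add: field_simps)
    have "z = Re z *\<^sub>R 1 + Im z *\<^sub>R \<i>" by (simp add: complex_eq_iff)
    then have "f z = Re z * f 1 + Im z * f \<i>" by (metis add scaleR real_scaleR_def)
    then have "of_real (f z) = of_real (Re z) * a + of_real (Im z) * b" by (simp add: a_def b_def)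
    also have "of_real (Re z) = (z + inverse z) / 2" using complex_add_cnj[of z] cz by simp
    also have "of_real (Im z) = - (\<i> / 2) * (z - inverse z)"
      using complex_diff_cnj[of z] cz by (simp add: mult_ac)
    finally have E: "of_real (f z) = (z + inverse z) / 2 * a + - (\<i> / 2) * (z - inverse z) * b" .
    define A B where "A = a / 2 + \<i> * b / 2" and "B = a / 2 - \<i> * b / 2"
    have "inverse z * (A + z * (z * B)) = inverse z * A + z * B"
      using nz by (simp add: distrib_left flip: mult.assoc)
    then show ?thesis by (simp add: E A_def B_def algebra_simps add_divide_distrib diff_divide_distrib)
  qed
  then show ?case unfolding laurent_on_circle_def by blast
next
  case (const c)
  show ?case unfolding laurent_on_circle_def by (intro exI[of _ 0] exI[of _ "[:of_real c:]"]) auto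
next
  case (add f g)
  then obtain l q l' q' where q: "\<And>z. z \<in> sphere 0 1 \<Longrightarrow> of_real (f z) = inverse z ^ l * poly q z"
    "\<And>z. z \<in> sphere 0 1 \<Longrightarrow> of_real (g z) = inverse z ^ l' * poly q' z"
    unfolding laurent_on_circle_def by blast
  have "of_real (f z + g z) = inverse z ^ (l + l') * poly (q * monom 1 l' + q' * monom 1 l) z" if "z \<in> sphere 0 1" for z
  proof -
    have "z \<noteq> 0" using that by auto
    then show ?thesis using q[OF that] by (simp add: poly_monom power_add field_simps)
  qed
  then show ?case unfolding laurent_on_circle_def by blast
next
  case (mult f g)
  then obtain l q l' q' where q: "\<And>z. z \<in> sphere 0 1 \<Longrightarrow> of_real (f z) = inverse z ^ l * poly q z"
    "\<And>z. z \<in> sphere 0 1 \<Longrightarrow> of_real (g z) = inverse z ^ l' * poly q' z"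
    unfolding laurent_on_circle_def by blast
  have "of_real (f z * g z) = inverse z ^ (l + l') * poly (q * q') z" if "z \<in> sphere 0 1" for z
    using q[OF that] by (simp add: power_add mult_ac)
  then show ?case unfolding laurent_on_circle_def by blast
qed

section \<open>Toeplitz determinants as torus integrals\<close>

definition toeplitz_det :: "nat \<Rightarrow> (complex \<Rightarrow> complex) \<Rightarrow> complex" where
  "toeplitz_det N h = (\<Sum>\<sigma> | \<sigma> permutes {..<N}. of_int (sign \<sigma>) * (\<Prod>i<N. circ_coeff h (int (\<sigma> i) - int i)))"

text \<open>Averaging this kernel over all permutations of the angles gives the Weyl density, the
  squared modulus of the Vandermonde determinant divided by N!. The unsymmetrized form suffices for
  symmetric integrands and factorizes over the angles term by term.\<close>

definition weyl_kernel :: "nat \<Rightarrow> (nat \<Rightarrow> real) \<Rightarrow> complex" where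
  "weyl_kernel N \<theta> = (\<Sum>\<sigma> | \<sigma> permutes {..<N}. of_int (sign \<sigma>) * (\<Prod>i<N. cis (- of_int (int (\<sigma> i) - int i) * \<theta> i)))"

definition torus :: "nat \<Rightarrow> (nat \<Rightarrow> real) measure" where
  "torus N = (\<Pi>\<^sub>M i\<in>{..<N}. circ)"

lemma prob_space_torus: "prob_space (torus N)"
  unfolding torus_def by (intro prob_space_PiM circ.prob_space_axioms)

interpretation torus: prob_space "torus N" for N
  by (rule prob_space_torus)

lemma measurable_torus_component: "i < N \<Longrightarrow> (\<lambda>\<theta>. \<theta> i) \<in> borel_measurable (torus N)"
  using measurable_component_singleton[of i "{..<N}" "\<lambda>_. circ"] by (simp add: torus_def measurable_cong_sets[OF refl sets_circ])

lemma measurable_weyl_kernel [measurable]: "weyl_kernel N \<in> borel_measurable (torus N)"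
  unfolding weyl_kernel_def
  by (intro borel_measurable_sum borel_measurable_times borel_measurable_const borel_measurable_prod
      borel_measurable_continuous_on[of cis]) (auto intro!: continuous_intros measurable_torus_component)

lemma weyl_kernel_bound: "norm (weyl_kernel N \<theta>) \<le> fact N"
proof -
  have "norm (weyl_kernel N \<theta>) \<le> (\<Sum>\<sigma> | \<sigma> permutes {..<N}. 1)"
    unfolding weyl_kernel_def
    by (intro sum_norm_le) (auto simp: norm_mult prod_norm[symmetric] sign_def)
  then show ?thesis by (simp add: card_permutations)
qed

lemma integral_torus_prod:
  fixes f :: "nat \<Rightarrow> real \<Rightarrow> complex"
  assumes "\<And>i. i < N \<Longrightarrow> integrable circ (f i)"
  shows "(\<integral>\<theta>. (\<Prod>i<N. f i (\<theta> i)) \<partial>torus N) = (\<Prod>i<N. \<integral>\<theta>. f i \<theta> \<partial>circ)"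
    and "integrable (torus N) (\<lambda>\<theta>. \<Prod>i<N. f i (\<theta> i))"
proof -
  interpret product_sigma_finite "\<lambda>_. circ" by unfold_locales
  show "(\<integral>\<theta>. (\<Prod>i<N. f i (\<theta> i)) \<partial>torus N) = (\<Prod>i<N. \<integral>\<theta>. f i \<theta> \<partial>circ)"
    unfolding torus_def by (rule product_integral_prod) (use assms in auto)
  show "integrable (torus N) (\<lambda>\<theta>. \<Prod>i<N. f i (\<theta> i))"
    unfolding torus_def by (rule product_integrable_prod) (use assms in auto)
qed

lemma toeplitz_det_conv_integral:
  assumes [measurable]: "(\<lambda>\<theta>. h (cis \<theta>)) \<in> borel_measurable borel" and B: "\<And>\<theta>. norm (h (cis \<theta>)) \<le> B"
  shows "toeplitz_det N h = (\<integral>\<theta>. (\<Prod>i<N. h (cis (\<theta> i))) * weyl_kernel N \<theta> \<partial>torus N)"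
proof -
  have int: "integrable circ (\<lambda>\<theta>. h (cis \<theta>) * cis (- of_int d * \<theta>))" for d
  proof (rule circ.integrable_const_bound)
    show "AE \<theta> in circ. norm (h (cis \<theta>) * cis (- of_int d * \<theta>)) \<le> B" using B by (simp add: norm_mult)
    show "(\<lambda>\<theta>. h (cis \<theta>) * cis (- of_int d * \<theta>)) \<in> borel_measurable circ" by measurable
  qed
  let ?f = "\<lambda>\<sigma> i \<theta>. h (cis \<theta>) * cis (- of_int (int (\<sigma> i) - int i) * \<theta>)"
  have "toeplitz_det N h = (\<Sum>\<sigma> | \<sigma> permutes {..<N}. of_int (sign \<sigma>) * (\<integral>\<theta>. (\<Prod>i<N. ?f \<sigma> i (\<theta> i)) \<partial>torus N))"
    unfolding toeplitz_det_def circ_coeff_def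
    by (intro sum.cong refl arg_cong2[of _ _ _ _ "(*)"] integral_torus_prod(1)[symmetric] int)
  also have "\<dots> = (\<integral>\<theta>. (\<Sum>\<sigma> | \<sigma> permutes {..<N}. of_int (sign \<sigma>) * (\<Prod>i<N. ?f \<sigma> i (\<theta> i))) \<partial>torus N)"
    unfolding integral_mult_right_zero[symmetric]
    by (intro Bochner_Integration.integral_sum[symmetric] integrable_mult_right integral_torus_prod(2) int)
  also have "\<dots> = (\<integral>\<theta>. (\<Prod>i<N. h (cis (\<theta> i))) * weyl_kernel N \<theta> \<partial>torus N)"
    by (simp add: weyl_kernel_def prod.distrib sum_distrib_left mult_ac)
  finally show ?thesis .
qed

definition eig_sum :: "(complex \<Rightarrow> real) \<Rightarrow> complex mat \<Rightarrow> real" where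
  "eig_sum F U = (\<Sum>z\<in>#proots (char_poly U). F z)"

lemma mult_le_abs_mult:
  fixes s y C :: real
  assumes "\<bar>y\<bar> \<le> C"
  shows "s * y \<le> \<bar>s\<bar> * C"
proof -
  have "s * y \<le> \<bar>s\<bar> * \<bar>y\<bar>" unfolding abs_mult[symmetric] by (rule abs_ge_self)
  also have "\<dots> \<le> \<bar>s\<bar> * C" by (rule mult_left_mono[OF assms abs_ge_zero])
  finally show ?thesis .
qed

context haar_unitary
begin

lemma spectrumE:
  assumes "U \<in> space M"
  obtains z where "char_poly U = (\<Prod>i<N. [:- z i, 1:])" "\<And>i. i < N \<Longrightarrow> z i \<in> sphere 0 1"
    "\<And>f. eig_prod f U = (\<Prod>i<N. f (z i))" "\<And>F. eig_sum F U = (\<Sum>i<N. F (z i))"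
proof -
  from assms have "U \<in> unitary_group N" by (simp add: space_M)
  then obtain z where z: "char_poly U = (\<Prod>i<N. [:- z i, 1:])" "\<And>i. i < N \<Longrightarrow> cmod (z i) = 1"
    "proots (char_poly U) = image_mset z (mset_set {..<N})" by (rule unitary_spectrum) blast
  moreover have "eig_sum F U = (\<Sum>i<N. F (z i))" for F
    by (simp add: eig_sum_def z(3) multiset.map_comp sum_unfold_sum_mset o_def)
  ultimately show thesis using eig_prod_spectrum[OF z(3)] by (intro that[of z]) auto
qed

text \<open>The factors 1 / z multiply to a power of 1 / det U, and the coefficient of x^i q at l +
  \<sigma> i is the Fourier coefficient of h at \<sigma> i - i. Measurability comes from the
  Sylvester expansion, which is polynomial in the coefficients of the characteristic polynomial; no
  measurable choice of eigenvalues is made.\<close>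

lemma eig_prod_laurent:
  assumes h: "\<And>z. z \<in> sphere 0 1 \<Longrightarrow> h z = inverse z ^ l * poly q z"
  shows "bounded_meas M (eig_prod h)" and "(\<integral>U. eig_prod h U \<partial>M) = toeplitz_det N h"
proof -
  have eq: "eig_prod h U = inverse (Determinant.det U) ^ l * eig_prod (poly q) U" if U: "U \<in> space M" for U
  proof -
    obtain z where z: "char_poly U = (\<Prod>i<N. [:- z i, 1:])" "\<And>i. i < N \<Longrightarrow> z i \<in> sphere 0 1"
      "\<And>f. eig_prod f U = (\<Prod>i<N. f (z i))" using U by (rule spectrumE) blast
    have "Determinant.det U = (\<Prod>i<N. z i)"
      using unitary_det_spectrum[OF _ z(1)] U by (auto simp: space_M dest: unitary_group_carrier)
    moreover have "eig_prod h U = (\<Prod>i<N. inverse (z i) ^ l * poly q (z i))"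
      unfolding z(3) by (intro prod.cong refl h z(2)) simp
    ultimately show ?thesis
      by (simp add: z(3) prod.distrib prod_power_distrib flip: prod_inversef)
  qed
  define n where "n = max (degree q) l"
  show "bounded_meas M (eig_prod h)"
  proof -
    have "bounded_meas M (\<lambda>U. inverse (Determinant.det U) ^ l * (((-1) ^ N) ^ n *
        sylvester n N q (\<lambda>\<alpha>. \<Prod>k<n. coeff (monom 1 k * char_poly U) (\<alpha> k))))"
      unfolding sylvester_def
      by (intro bounded_meas_mult bounded_meas_power bounded_meas_inverse_det bounded_meas_const bounded_meas_sum
          bounded_meas_prod bounded_meas_coeff_shift)
    then show ?thesis
    proof (subst bounded_meas_cong)
      fix U assume U: "U \<in> space M"
      obtain z where z: "char_poly U = (\<Prod>i<N. [:- z i, 1:])"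
        "\<And>f. eig_prod f U = (\<Prod>i<N. f (z i))" using U by (rule spectrumE) blast
      have "((-1) ^ N) ^ n * ((-1) ^ N) ^ n = (1 :: complex)"
        unfolding power_mult_distrib[symmetric] by simp
      then have sq: "((-1) ^ N) ^ n * (((-1) ^ N) ^ n * y) = y" for y :: complex
        by (simp only: mult.assoc[symmetric] mult_1_left)
      have dq: "degree q \<le> n" by (simp add: n_def)
      show "eig_prod h U = inverse (Determinant.det U) ^ l * (((-1) ^ N) ^ n *
        sylvester n N q (\<lambda>\<alpha>. \<Prod>k<n. coeff (monom 1 k * char_poly U) (\<alpha> k)))"
        unfolding eq[OF U] z(1) sylvester_roots[OF dq] sq by (simp only: z(2))
    qed
  qed
  have "(\<integral>U. eig_prod h U \<partial>M) = (\<integral>U. inverse (Determinant.det U) ^ l * eig_prod (poly q) U \<partial>M)"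
    by (rule Bochner_Integration.integral_cong) (simp_all add: eq)
  also have "\<dots> = toeplitz_sum l q"
    by (rule integral_eig_prod_poly[of _ n]) (auto simp: n_def)
  also have "\<dots> = toeplitz_det N h"
  proof -
    have "circ_coeff h d = circ_coeff (\<lambda>z. inverse z ^ l * poly q z) d" for d
      unfolding circ_coeff_def by (rule Bochner_Integration.integral_cong) (simp_all add: h)
    moreover have "coeff (monom 1 i * q) (l + \<sigma> i) = (if 0 \<le> int l + (int (\<sigma> i) - int i) then coeff q (nat (int l + (int (\<sigma> i) - int i))) else 0)"
      for i \<sigma>
    proof -
      have "nat (int l + (int (\<sigma> i) - int i)) = l + \<sigma> i - i" by simp
      moreover have "(0 \<le> int l + (int (\<sigma> i) - int i)) = (i \<le> l + \<sigma> i)" by auto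
      ultimately show ?thesis by (simp add: coeff_monom_mult)
    qed
    ultimately show ?thesis
      unfolding toeplitz_sum_def toeplitz_det_def circ_coeff_laurent by simp
  qed
  finally show "(\<integral>U. eig_prod h U \<partial>M) = toeplitz_det N h" .
qed

lemma eig_prod_norm_le:
  assumes "U \<in> space M" "\<And>z. z \<in> sphere 0 1 \<Longrightarrow> norm (h z) \<le> B"
  shows "norm (eig_prod h U) \<le> B ^ N"
proof -
  obtain z where z: "\<And>i. i < N \<Longrightarrow> z i \<in> sphere 0 1" "\<And>f. eig_prod f U = (\<Prod>i<N. f (z i))"
    using assms(1) by (rule spectrumE) blast
  have "norm (eig_prod h U) = (\<Prod>i<N. norm (h (z i)))" by (simp add: z(2) prod_norm)
  also have "\<dots> \<le> (\<Prod>i<N. B)" by (intro prod_mono conjI norm_ge_zero assms(2) z(1)) simp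
  finally show ?thesis by simp
qed

text \<open>Uniform approximation with error below 1 / (k + 1), hence with the common bound B + 1,
  allows dominated convergence in the expectation and in each Fourier coefficient.\<close>

lemma eig_prod_continuous:
  fixes h :: "complex \<Rightarrow> real"
  assumes h: "continuous_on (sphere 0 1) h"
  shows "eig_prod (\<lambda>z. of_real (h z)) \<in> borel_measurable M"
    and "(\<integral>U. eig_prod (\<lambda>z. of_real (h z)) U \<partial>M) = toeplitz_det N (\<lambda>z. of_real (h z))"
proof -
  have "\<exists>g. real_polynomial_function g \<and> (\<forall>z\<in>sphere 0 1. \<bar>h z - g z\<bar> < 1 / real (Suc k))" for k
  proof -
    have "0 < 1 / real (Suc k)" by simp
    obtain g where "real_polynomial_function g" "\<And>z. z \<in> sphere 0 1 \<Longrightarrow> \<bar>h z - g z\<bar> < 1 / real (Suc k)"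
      by (rule Stone_Weierstrass_real_polynomial_function[OF compact_sphere h \<open>0 < 1 / real (Suc k)\<close>], rule that) auto
    then show ?thesis by (intro exI[of _ g] conjI ballI)
  qed
  then obtain g where g: "\<And>k. real_polynomial_function (g k)"
      "\<And>k z. z \<in> sphere 0 1 \<Longrightarrow> \<bar>h z - g k z\<bar> < 1 / real (Suc k)" by metis
  have "compact (h ` sphere 0 1)" using h by (intro compact_continuous_image compact_sphere)
  then have "bounded (h ` sphere 0 1)" by (rule compact_imp_bounded)
  then obtain B where "\<forall>y\<in>h ` sphere 0 1. norm y \<le> B" unfolding bounded_iff by blast
  then have B: "\<And>z. z \<in> sphere 0 1 \<Longrightarrow> \<bar>h z\<bar> \<le> B" by auto
  have gB: "\<bar>g k z\<bar> \<le> B + 1" if "z \<in> sphere 0 1" for k z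
  proof -
    have "1 / real (Suc k) \<le> 1" by simp
    then show ?thesis using g(2)[OF that, of k] B[OF that] by linarith
  qed
  have lim: "(\<lambda>k. g k z) \<longlonglongrightarrow> h z" if "z \<in> sphere 0 1" for z
  proof (rule LIM_zero_cancel, rule Lim_null_comparison[OF _ LIMSEQ_inverse_real_of_nat])
    show "\<forall>\<^sub>F k in sequentially. norm (g k z - h z) \<le> inverse (real (Suc k))"
      using g(2)[OF that] by (intro always_eventually allI) (simp add: abs_minus_commute inverse_eq_divide less_imp_le)
  qed
  have laur: "bounded_meas M (eig_prod (\<lambda>z. of_real (g k z)))"
    "(\<integral>U. eig_prod (\<lambda>z. of_real (g k z)) U \<partial>M) = toeplitz_det N (\<lambda>z. of_real (g k z))" for k
  proof -
    obtain l q where "\<And>z. z \<in> sphere 0 1 \<Longrightarrow> of_real (g k z) = inverse z ^ l * poly q z"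
      using real_polynomial_laurent[OF g(1)] unfolding laurent_on_circle_def by blast
    note eig_prod_laurent[OF this]
    then show "bounded_meas M (eig_prod (\<lambda>z. of_real (g k z)))"
      "(\<integral>U. eig_prod (\<lambda>z. of_real (g k z)) U \<partial>M) = toeplitz_det N (\<lambda>z. of_real (g k z))" by auto
  qed
  have limU: "(\<lambda>k. eig_prod (\<lambda>z. of_real (g k z)) U) \<longlonglongrightarrow> eig_prod (\<lambda>z. of_real (h z)) U" if U: "U \<in> space M" for U
  proof -
    obtain z where z: "\<And>i. i < N \<Longrightarrow> z i \<in> sphere 0 1" "\<And>f. eig_prod f U = (\<Prod>i<N. f (z i))"
      using U by (rule spectrumE) blast
    show ?thesis unfolding z(2) by (intro tendsto_prod tendsto_of_real lim z(1)) simp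
  qed
  have meas_g: "eig_prod (\<lambda>z. of_real (g k z)) \<in> borel_measurable M" for k
    using laur(1) by (simp add: bounded_meas_def)
  show meas: "eig_prod (\<lambda>z. of_real (h z)) \<in> borel_measurable M"
    by (rule borel_measurable_LIMSEQ_metric[OF meas_g limU])
  have "(\<lambda>k. \<integral>U. eig_prod (\<lambda>z. of_real (g k z)) U \<partial>M) \<longlonglongrightarrow> (\<integral>U. eig_prod (\<lambda>z. of_real (h z)) U \<partial>M)"
  proof (rule integral_dominated_convergence[where w = "\<lambda>_. (B + 1) ^ N"])
    show "AE U in M. norm (eig_prod (\<lambda>z. of_real (g k z)) U) \<le> (B + 1) ^ N" for k
      by (intro AE_I2 eig_prod_norm_le) (use gB in auto)
  qed (use meas meas_g limU in auto)
  moreover have "(\<lambda>k. toeplitz_det N (\<lambda>z. of_real (g k z))) \<longlonglongrightarrow> toeplitz_det N (\<lambda>z. of_real (h z))"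
  proof -
    have contg: "continuous_on UNIV (g k)" for k
      using g(1) by (intro continuous_on_polymonial_function) (simp add: real_polynomial_function_eq)
    have conth: "continuous_on UNIV (\<lambda>\<theta>. h (cis \<theta>))"
      by (rule continuous_on_compose2[OF h]) (auto intro!: continuous_intros)
    have [measurable]: "(\<lambda>\<theta>. h (cis \<theta>)) \<in> borel_measurable borel"
      using conth by (rule borel_measurable_continuous_onI)
    have [measurable]: "(\<lambda>\<theta>. g k (cis \<theta>)) \<in> borel_measurable borel" for k
      by (rule borel_measurable_continuous_onI, rule continuous_on_compose2[OF contg]) (auto intro!: continuous_intros)
    have "(\<lambda>k. circ_coeff (\<lambda>z. of_real (g k z)) d) \<longlonglongrightarrow> circ_coeff (\<lambda>z. of_real (h z)) d" for d
      unfolding circ_coeff_def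
    proof (rule integral_dominated_convergence[where w = "\<lambda>_. B + 1"])
      show "AE \<theta> in circ. (\<lambda>k. of_real (g k (cis \<theta>)) * cis (- of_int d * \<theta>)) \<longlonglongrightarrow> of_real (h (cis \<theta>)) * cis (- of_int d * \<theta>)"
        by (intro AE_I2 tendsto_intros lim) auto
      show "AE \<theta> in circ. norm (of_real (g k (cis \<theta>)) * cis (- of_int d * \<theta>)) \<le> B + 1" for k
        by (intro AE_I2) (use gB in \<open>auto simp: norm_mult\<close>)
    qed auto
    then show ?thesis unfolding toeplitz_det_def by (intro tendsto_intros)
  qed
  ultimately show "(\<integral>U. eig_prod (\<lambda>z. of_real (h z)) U \<partial>M) = toeplitz_det N (\<lambda>z. of_real (h z))"
    unfolding laur(2) by (rule LIMSEQ_unique)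
qed

text \<open>The product of exp (s F) over the eigenvalues is exp of s times the sum of F, so the
  formula for products gives the exponential integrals for all real s. Comparing their power series
  in s yields the moments. Measurability of the sum is read off from the logarithm of the product at
  s = 1.\<close>

lemma eig_sum_continuous:
  assumes F: "continuous_on (sphere 0 1) F"
  shows "eig_sum F \<in> borel_measurable M"
    and "(\<integral>U. eig_sum F U ^ m \<partial>M) = (\<integral>\<theta>. (\<Sum>i<N. F (cis (\<theta> i))) ^ m * Re (weyl_kernel N \<theta>) \<partial>torus N)"
proof -
  have "compact (F ` sphere 0 1)" using F by (intro compact_continuous_image compact_sphere)
  then have "bounded (F ` sphere 0 1)" by (rule compact_imp_bounded)
  then obtain B where "\<forall>y\<in>F ` sphere 0 1. norm y \<le> B" unfolding bounded_iff by blast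
  then have B: "\<And>z. z \<in> sphere 0 1 \<Longrightarrow> \<bar>F z\<bar> \<le> B" by auto
  have prod_exp: "eig_prod (\<lambda>z. of_real (exp (s * F z))) U = of_real (exp (s * eig_sum F U))" if U: "U \<in> space M" for U s
  proof -
    obtain z where z: "\<And>f. eig_prod f U = (\<Prod>i<N. f (z i))" "\<And>F. eig_sum F U = (\<Sum>i<N. F (z i))"
      using U by (rule spectrumE) blast
    show ?thesis by (simp add: z exp_sum sum_distrib_left)
  qed
  have cont: "continuous_on (sphere 0 1) (\<lambda>z. exp (s * F z))" for s
    using F by (intro continuous_intros)
  have "(\<lambda>U. ln (Re (eig_prod (\<lambda>z. of_real (exp (1 * F z))) U))) \<in> borel_measurable M"
    using eig_prod_continuous(1)[OF cont[of 1]] by measurable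
  also have "?this \<longleftrightarrow> eig_sum F \<in> borel_measurable M"
    by (intro measurable_cong, subst prod_exp[of _ 1]) simp_all
  finally show meas [measurable]: "eig_sum F \<in> borel_measurable M" .
  have eB: "\<bar>eig_sum F U\<bar> \<le> real N * B" if U: "U \<in> space M" for U
  proof -
    obtain z where z: "\<And>i. i < N \<Longrightarrow> z i \<in> sphere 0 1" "\<And>F. eig_sum F U = (\<Sum>i<N. F (z i))"
      using U by (rule spectrumE) blast
    have "\<bar>eig_sum F U\<bar> \<le> (\<Sum>i<N. B)" unfolding z(2) by (rule order_trans[OF sum_abs sum_mono]) (use B z in auto)
    then show ?thesis by simp
  qed
  have contF: "continuous_on UNIV (\<lambda>\<theta>. F (cis \<theta>))"
    by (rule continuous_on_compose2[OF F]) (auto intro!: continuous_intros)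
  have [measurable]: "(\<lambda>\<theta>. F (cis \<theta>)) \<in> borel_measurable borel"
    using contF by (rule borel_measurable_continuous_onI)
  have [measurable]: "(\<lambda>\<theta>. \<Sum>i<N. F (cis (\<theta> i))) \<in> borel_measurable (torus N)"
    by (intro borel_measurable_sum measurable_compose[OF measurable_torus_component]) auto
  have tB: "\<bar>\<Sum>i<N. F (cis (\<theta> i))\<bar> \<le> real N * B" for \<theta>
  proof -
    have "\<bar>\<Sum>i<N. F (cis (\<theta> i))\<bar> \<le> (\<Sum>i<N. B)" by (rule order_trans[OF sum_abs sum_mono]) (use B in auto)
    then show ?thesis by simp
  qed
  have exp_eq: "(\<integral>U. exp (s * eig_sum F U) * 1 \<partial>M) = (\<integral>\<theta>. exp (s * (\<Sum>i<N. F (cis (\<theta> i)))) * Re (weyl_kernel N \<theta>) \<partial>torus N)" for s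
  proof -
    have "complex_of_real (\<integral>U. exp (s * eig_sum F U) * 1 \<partial>M) = (\<integral>U. of_real (exp (s * eig_sum F U)) \<partial>M)"
      by simp
    also have "\<dots> = (\<integral>U. eig_prod (\<lambda>z. of_real (exp (s * F z))) U \<partial>M)"
      by (rule Bochner_Integration.integral_cong) (simp_all add: prod_exp)
    also have "\<dots> = toeplitz_det N (\<lambda>z. of_real (exp (s * F z)))"
      by (rule eig_prod_continuous(2)[OF cont])
    also have "\<dots> = (\<integral>\<theta>. (\<Prod>i<N. of_real (exp (s * F (cis (\<theta> i))))) * weyl_kernel N \<theta> \<partial>torus N)"
    proof (rule toeplitz_det_conv_integral[where B = "exp (\<bar>s\<bar> * B)" and h = "\<lambda>z. of_real (exp (s * F z))"])
      fix \<theta>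
      have "s * F (cis \<theta>) \<le> \<bar>s\<bar> * B"
        by (rule mult_le_abs_mult[OF B]) simp
      then show "cmod (of_real (exp (s * F (cis \<theta>)))) \<le> exp (\<bar>s\<bar> * B)" by simp
    next
      show "(\<lambda>\<theta>. complex_of_real (exp (s * F (cis \<theta>)))) \<in> borel_measurable borel"
        by (intro borel_measurable_continuous_onI continuous_intros contF)
    qed
    also have "\<dots> = (\<integral>\<theta>. of_real (exp (s * (\<Sum>i<N. F (cis (\<theta> i))))) * weyl_kernel N \<theta> \<partial>torus N)"
      by (simp add: exp_sum sum_distrib_left)
    finally have "complex_of_real (\<integral>U. exp (s * eig_sum F U) * 1 \<partial>M) =
        (\<integral>\<theta>. of_real (exp (s * (\<Sum>i<N. F (cis (\<theta> i))))) * weyl_kernel N \<theta> \<partial>torus N)" .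
    from arg_cong[OF this, of Re] have "(\<integral>U. exp (s * eig_sum F U) * 1 \<partial>M) =
        Re (\<integral>\<theta>. of_real (exp (s * (\<Sum>i<N. F (cis (\<theta> i))))) * weyl_kernel N \<theta> \<partial>torus N)"
      by (simp only: Re_complex_of_real)
    also have "\<dots> = (\<integral>\<theta>. Re (of_real (exp (s * (\<Sum>i<N. F (cis (\<theta> i))))) * weyl_kernel N \<theta>) \<partial>torus N)"
    proof (rule integral_Re[symmetric], rule torus.integrable_const_bound[where B = "exp (\<bar>s\<bar> * (real N * B)) * fact N"])
      show "AE \<theta> in torus N. norm (of_real (exp (s * (\<Sum>i<N. F (cis (\<theta> i))))) * weyl_kernel N \<theta>) \<le> exp (\<bar>s\<bar> * (real N * B)) * fact N"
      proof (intro AE_I2)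
        fix \<theta>
        have "s * (\<Sum>i<N. F (cis (\<theta> i))) \<le> \<bar>s\<bar> * (real N * B)"
          by (rule mult_le_abs_mult[OF tB])
        then show "norm (of_real (exp (s * (\<Sum>i<N. F (cis (\<theta> i))))) * weyl_kernel N \<theta>) \<le> exp (\<bar>s\<bar> * (real N * B)) * fact N"
          unfolding norm_mult by (intro mult_mono weyl_kernel_bound) auto
      qed
    qed measurable
    finally show ?thesis by simp
  qed
  define a where "a m = (\<integral>U. eig_sum F U ^ m * 1 \<partial>M)" for m
  define b where "b m = (\<integral>\<theta>. (\<Sum>i<N. F (cis (\<theta> i))) ^ m * Re (weyl_kernel N \<theta>) \<partial>torus N)" for m
  have sa: "(\<lambda>m. a m / fact m * s ^ m) sums (\<integral>U. exp (s * eig_sum F U) * 1 \<partial>M)" for s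
    unfolding a_def by (rule exp_moments_sums[where B = "real N * B" and C = 1]) (use eB in auto)
  have sb: "(\<lambda>m. b m / fact m * s ^ m) sums (\<integral>\<theta>. exp (s * (\<Sum>i<N. F (cis (\<theta> i)))) * Re (weyl_kernel N \<theta>) \<partial>torus N)" for s
    unfolding b_def
    by (rule torus.exp_moments_sums[where B = "real N * B" and C = "fact N"])
       (use tB in \<open>auto intro: order_trans[OF abs_Re_le_cmod weyl_kernel_bound]\<close>)
  have "(\<lambda>m. a m / fact m * s ^ m - b m / fact m * s ^ m) sums 0" for s
    using sums_diff[OF sa[of s] sb[of s]] by (simp only: exp_eq diff_self)
  then have "(a m - b m) / fact m = 0"
    by (intro power_series_eq_zero) (simp add: diff_divide_distrib left_diff_distrib)
  then show "(\<integral>U. eig_sum F U ^ m \<partial>M) = (\<integral>\<theta>. (\<Sum>i<N. F (cis (\<theta> i))) ^ m * Re (weyl_kernel N \<theta>) \<partial>torus N)"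
    by (simp add: a_def b_def)
qed

end

section \<open>From continuous functions on the circle to bounded Borel functions of the
  eigenangles\<close>

lemma measurable_Arg [measurable]: "Arg \<in> borel_measurable borel"
proof -
  have 1: "(\<lambda>z. indicator (- \<real>\<^sub>\<le>\<^sub>0) z *\<^sub>R Arg z) \<in> borel_measurable borel"
    by (rule borel_measurable_continuous_on_indicator)
       (auto intro!: continuous_on_Arg closed_nonpos_Reals_complex borel_closed)
  \<comment> \<open>\<open>Arg\<close> is continuous off the closed negative half-line and equals pi
    on it except at the origin, where it is 0 by convention.\<close>
  have "Arg z = indicator (- \<real>\<^sub>\<le>\<^sub>0) z *\<^sub>R Arg z + (if z \<in> \<real>\<^sub>\<le>\<^sub>0 \<and> z \<noteq> 0 then pi else 0)" for z
  proof (cases "z \<in> \<real>\<^sub>\<le>\<^sub>0")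
    case True
    then obtain x where x: "x \<le> 0" "z = of_real x" by (auto simp: nonpos_Reals_def)
    show ?thesis
    proof (cases "x = 0")
      case True
      then show ?thesis using x by (simp add: Arg_zero)
    next
      case False
      then have "Arg z = pi" using x by (simp add: Arg_of_real)
      then show ?thesis using \<open>z \<in> \<real>\<^sub>\<le>\<^sub>0\<close> False x by simp
    qed
  qed (simp add: indicator_def)
  then have eq: "(\<lambda>z. indicator (- \<real>\<^sub>\<le>\<^sub>0) z *\<^sub>R Arg z + (if z \<in> \<real>\<^sub>\<le>\<^sub>0 \<and> z \<noteq> 0 then pi else 0)) = Arg"
    by (intro ext) (rule sym)
  have "\<real>\<^sub>\<le>\<^sub>0 - {0} \<in> sets (borel :: complex measure)"
    by (intro sets.Diff borel_closed closed_nonpos_Reals_complex closed_singleton)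
  then have "(\<lambda>z. indicator (\<real>\<^sub>\<le>\<^sub>0 - {0}) z * pi) \<in> borel_measurable (borel :: complex measure)"
    by (intro borel_measurable_times borel_measurable_indicator borel_measurable_const)
  also have "(\<lambda>z. indicator (\<real>\<^sub>\<le>\<^sub>0 - {0}) z * pi) = (\<lambda>z :: complex. if z \<in> \<real>\<^sub>\<le>\<^sub>0 \<and> z \<noteq> 0 then pi else 0)"
    by (auto simp: indicator_def fun_eq_iff)
  finally have "(\<lambda>z. indicator (- \<real>\<^sub>\<le>\<^sub>0) z *\<^sub>R Arg z + (if z \<in> \<real>\<^sub>\<le>\<^sub>0 \<and> z \<noteq> 0 then pi else 0)) \<in> borel_measurable borel"
    by (rule borel_measurable_add[OF 1])
  then show ?thesis unfolding eq .
qed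

lemma AE_circ_interior: "AE \<theta> in circ. - pi < \<theta> \<and> \<theta> < pi"
proof -
  have "AE \<theta> in lborel. \<theta> \<noteq> - pi \<and> \<theta> \<noteq> pi"
    by (intro AE_conjI AE_lborel_singleton)
  then show ?thesis unfolding AE_circ_iff by (elim AE_mp) (auto intro!: AE_I2)
qed

lemma AE_torus_component:
  assumes "AE \<theta> in circ. P \<theta>" "i < N"
  shows "AE \<theta> in torus N. P (\<theta> i)"
  unfolding torus_def by (rule AE_PiM_component) (use assms circ.prob_space_axioms in auto)

text \<open>The cutoff removes the jump of \<^const>\<open>Arg\<close> at \<open>-1\<close>.\<close>

lemma continuous_on_circle_Arg_cutoff:
  fixes c :: "real \<Rightarrow> real"
  assumes c: "continuous_on UNIV c" and B: "\<And>x. \<bar>c x\<bar> \<le> B"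
  shows "continuous_on (sphere 0 1) (\<lambda>z. c (Arg z) * min 1 (real k * dist z (-1)))"
  unfolding continuous_on_eq_continuous_within
proof
  fix z :: complex assume z: "z \<in> sphere 0 1"
  show "continuous (at z within sphere 0 1) (\<lambda>z. c (Arg z) * min 1 (real k * dist z (-1)))"
  proof (cases "z = -1")
    case True
    have "((\<lambda>z::complex. B * (real k * dist z (-1))) \<longlongrightarrow> B * (real k * dist (-1 :: complex) (-1))) (at (-1) within sphere 0 1)"
      by (rule tendsto_mult[OF tendsto_const tendsto_mult[OF tendsto_const tendsto_dist[OF tendsto_ident_at tendsto_const]]])
    then have lim: "((\<lambda>z. B * (real k * dist z (-1))) \<longlongrightarrow> 0) (at (-1 :: complex) within sphere 0 1)" by simp
    have "((\<lambda>z. c (Arg z) * min 1 (real k * dist z (-1))) \<longlongrightarrow> 0) (at (-1) within sphere 0 1)"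
    proof (rule Lim_null_comparison[OF _ lim], intro always_eventually allI)
      fix z :: complex
      have "norm (c (Arg z) * min 1 (real k * dist z (-1))) = \<bar>c (Arg z)\<bar> * min 1 (real k * dist z (-1))"
        by (simp add: abs_mult)
      also have "\<dots> \<le> B * (real k * dist z (-1))"
        using B[of "Arg z"] by (intro mult_mono) auto
      finally show "norm (c (Arg z) * min 1 (real k * dist z (-1))) \<le> B * (real k * dist z (-1))" .
    qed
    then show ?thesis using True by (simp add: continuous_within)
  next
    case False
    have "z \<notin> \<real>\<^sub>\<le>\<^sub>0"
    proof
      assume "z \<in> \<real>\<^sub>\<le>\<^sub>0"
      then obtain x where "x \<le> 0" "z = of_real x" by (auto simp: nonpos_Reals_def)
      with z have "z = -1" by auto
      with False show False ..
    qed
    then have "continuous (at z) Arg" by (rule continuous_at_Arg)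
    moreover have "continuous (at (Arg z)) c" using c by (simp add: continuous_on_eq_continuous_at)
    ultimately have "continuous (at z) (\<lambda>z. c (Arg z))" by (rule continuous_at_compose[unfolded o_def])
    then have "continuous (at z) (\<lambda>z. c (Arg z) * min 1 (real k * dist z (-1)))"
      by (intro continuous_intros)
    then show ?thesis by (rule continuous_at_imp_continuous_within)
  qed
qed

context haar_unitary
begin

text \<open>Both measurability statements are included so that the property carries what its passage
  to a limit requires.\<close>

definition moment_formula :: "nat \<Rightarrow> (complex \<Rightarrow> real) \<Rightarrow> bool" where
  "moment_formula m F \<longleftrightarrow> eig_sum F \<in> borel_measurable M \<and> (\<lambda>\<theta>. F (cis \<theta>)) \<in> borel_measurable borel \<and>
    (\<integral>U. eig_sum F U ^ m \<partial>M) = (\<integral>\<theta>. (\<Sum>i<N. F (cis (\<theta> i))) ^ m * Re (weyl_kernel N \<theta>) \<partial>torus N)"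

lemma eig_sum_bound:
  assumes "U \<in> space M" "\<And>z. z \<in> sphere 0 1 \<Longrightarrow> \<bar>F z\<bar> \<le> B"
  shows "\<bar>eig_sum F U\<bar> \<le> real N * B"
proof -
  obtain z where z: "\<And>i. i < N \<Longrightarrow> z i \<in> sphere 0 1" "\<And>F. eig_sum F U = (\<Sum>i<N. F (z i))"
    using assms(1) by (rule spectrumE) blast
  have "\<bar>eig_sum F U\<bar> \<le> (\<Sum>i<N. B)" unfolding z(2) by (rule order_trans[OF sum_abs sum_mono]) (use assms(2) z in auto)
  then show ?thesis by simp
qed

lemma torus_sum_bound:
  assumes "\<And>z. z \<in> sphere 0 1 \<Longrightarrow> \<bar>F z\<bar> \<le> B"
  shows "\<bar>\<Sum>i<N. F (cis (\<theta> i))\<bar> \<le> real N * B"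
proof -
  have "\<bar>\<Sum>i<N. F (cis (\<theta> i))\<bar> \<le> (\<Sum>i<N. B)" by (rule order_trans[OF sum_abs sum_mono]) (use assms in auto)
  then show ?thesis by simp
qed

lemma measurable_torus_sum:
  assumes "(\<lambda>\<theta>. f \<theta>) \<in> borel_measurable borel"
  shows "(\<lambda>\<theta>. \<Sum>i<N. f (\<theta> i) :: real) \<in> borel_measurable (torus N)"
  by (intro borel_measurable_sum measurable_compose[OF measurable_torus_component assms]) auto

lemma eig_sum_tendsto:
  assumes U: "U \<in> space M" and lim: "\<And>z. z \<in># proots (char_poly U) \<Longrightarrow> (\<lambda>k. F k z) \<longlonglongrightarrow> G z"
  shows "(\<lambda>k. eig_sum (F k) U) \<longlonglongrightarrow> eig_sum G U"
proof -
  have "U \<in> unitary_group N" using U by (simp add: space_M)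
  then obtain z where z: "char_poly U = (\<Prod>i<N. [:- z i, 1:])" "\<And>i. i < N \<Longrightarrow> cmod (z i) = 1"
    "proots (char_poly U) = image_mset z (mset_set {..<N})" by (rule unitary_spectrum) blast
  have eq: "eig_sum F U = (\<Sum>i<N. F (z i))" for F
    by (simp add: eig_sum_def z(3) multiset.map_comp sum_unfold_sum_mset o_def)
  show ?thesis unfolding eq
    by (intro tendsto_sum lim) (auto simp: z(3))
qed

lemma proots_on_circle: "U \<in> space M \<Longrightarrow> z \<in># proots (char_poly U) \<Longrightarrow> z \<in> sphere 0 1"
proof -
  assume U: "U \<in> space M" and z: "z \<in># proots (char_poly U)"
  have "U \<in> unitary_group N" using U by (simp add: space_M)
  then obtain y where y: "\<And>i. i < N \<Longrightarrow> cmod (y i) = 1"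
    "proots (char_poly U) = image_mset y (mset_set {..<N})" by (rule unitary_spectrum) blast
  with z show ?thesis by auto
qed

text \<open>Dominated convergence on both sides. Convergence almost everywhere on the circle says
  nothing yet about the random eigenvalues, which is why the two limits are assumed
  separately.\<close>

lemma moment_formula_AE_limit:
  assumes F: "\<And>k. moment_formula m (F k)" and B: "\<And>k z. z \<in> sphere 0 1 \<Longrightarrow> \<bar>F k z\<bar> \<le> B"
    and limU: "AE U in M. (\<lambda>k. eig_sum (F k) U) \<longlonglongrightarrow> eig_sum G U"
    and lim\<theta>: "AE \<theta> in circ. (\<lambda>k. F k (cis \<theta>)) \<longlonglongrightarrow> G (cis \<theta>)"
    and G: "eig_sum G \<in> borel_measurable M" "(\<lambda>\<theta>. G (cis \<theta>)) \<in> borel_measurable borel"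
  shows "moment_formula m G"
proof -
  have meas: "eig_sum (F k) \<in> borel_measurable M" "(\<lambda>\<theta>. F k (cis \<theta>)) \<in> borel_measurable borel"
    and eq: "(\<integral>U. eig_sum (F k) U ^ m \<partial>M) = (\<integral>\<theta>. (\<Sum>i<N. F k (cis (\<theta> i))) ^ m * Re (weyl_kernel N \<theta>) \<partial>torus N)" for k
    using F[of k] by (auto simp: moment_formula_def)
  have "(\<lambda>k. \<integral>U. eig_sum (F k) U ^ m \<partial>M) \<longlonglongrightarrow> (\<integral>U. eig_sum G U ^ m \<partial>M)"
  proof (rule integral_dominated_convergence[where w = "\<lambda>_. (real N * B) ^ m"])
    show "AE U in M. (\<lambda>k. eig_sum (F k) U ^ m) \<longlonglongrightarrow> eig_sum G U ^ m"
      using limU by (rule AE_mp) (auto intro!: AE_I2 tendsto_power)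
    show "AE U in M. norm (eig_sum (F k) U ^ m) \<le> (real N * B) ^ m" for k
    proof (rule AE_I2)
      fix U assume "U \<in> space M"
      from eig_sum_bound[OF this B] show "norm (eig_sum (F k) U ^ m) \<le> (real N * B) ^ m"
        by (simp add: power_abs power_mono)
    qed
  qed (use meas(1) G(1) in auto)
  moreover have "(\<lambda>k. \<integral>\<theta>. (\<Sum>i<N. F k (cis (\<theta> i))) ^ m * Re (weyl_kernel N \<theta>) \<partial>torus N) \<longlonglongrightarrow>
      (\<integral>\<theta>. (\<Sum>i<N. G (cis (\<theta> i))) ^ m * Re (weyl_kernel N \<theta>) \<partial>torus N)"
  proof (rule integral_dominated_convergence[where w = "\<lambda>_. (real N * B) ^ m * fact N"])
    have "AE \<theta> in torus N. \<forall>i\<in>{..<N}. (\<lambda>k. F k (cis (\<theta> i))) \<longlonglongrightarrow> G (cis (\<theta> i))"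
      by (subst AE_finite_all) (auto intro!: AE_torus_component lim\<theta>)
    then show "AE \<theta> in torus N. (\<lambda>k. (\<Sum>i<N. F k (cis (\<theta> i))) ^ m * Re (weyl_kernel N \<theta>)) \<longlonglongrightarrow>
        (\<Sum>i<N. G (cis (\<theta> i))) ^ m * Re (weyl_kernel N \<theta>)"
      by (rule AE_mp) (auto intro!: AE_I2 tendsto_intros)
    show "AE \<theta> in torus N. norm ((\<Sum>i<N. F k (cis (\<theta> i))) ^ m * Re (weyl_kernel N \<theta>)) \<le> (real N * B) ^ m * fact N" for k
    proof (rule AE_I2)
      fix \<theta>
      have b: "\<bar>\<Sum>i<N. F k (cis (\<theta> i))\<bar> \<le> real N * B" by (rule torus_sum_bound[OF B])
      have "\<bar>Re (weyl_kernel N \<theta>)\<bar> \<le> fact N" by (rule order_trans[OF abs_Re_le_cmod weyl_kernel_bound])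
      then show "norm ((\<Sum>i<N. F k (cis (\<theta> i))) ^ m * Re (weyl_kernel N \<theta>)) \<le> (real N * B) ^ m * fact N"
        unfolding real_norm_def abs_mult power_abs using b order_trans[OF abs_ge_zero b]
        by (intro mult_mono power_mono) auto
    qed
    show "(\<lambda>\<theta>. (\<Sum>i<N. G (cis (\<theta> i))) ^ m * Re (weyl_kernel N \<theta>)) \<in> borel_measurable (torus N)"
      by (intro borel_measurable_times borel_measurable_power measurable_torus_sum G(2) measurable_compose[OF measurable_weyl_kernel]) auto
    show "(\<lambda>\<theta>. (\<Sum>i<N. F k (cis (\<theta> i))) ^ m * Re (weyl_kernel N \<theta>)) \<in> borel_measurable (torus N)" for k
      by (intro borel_measurable_times borel_measurable_power measurable_torus_sum meas(2) measurable_compose[OF measurable_weyl_kernel]) auto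
  qed auto
  ultimately show ?thesis
    using G unfolding eq moment_formula_def by (auto intro: LIMSEQ_unique)
qed

lemma moment_formula_limit:
  assumes F: "\<And>k. moment_formula m (F k)" and B: "\<And>k z. z \<in> sphere 0 1 \<Longrightarrow> \<bar>F k z\<bar> \<le> B"
    and lim: "\<And>z. z \<in> sphere 0 1 \<Longrightarrow> (\<lambda>k. F k z) \<longlonglongrightarrow> G z"
  shows "moment_formula m G"
proof (rule moment_formula_AE_limit[OF F B])
  have limU: "(\<lambda>k. eig_sum (F k) U) \<longlonglongrightarrow> eig_sum G U" if "U \<in> space M" for U
    by (rule eig_sum_tendsto[OF that]) (rule lim, rule proots_on_circle[OF that])
  then show "AE U in M. (\<lambda>k. eig_sum (F k) U) \<longlonglongrightarrow> eig_sum G U" by (rule AE_I2)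
  have lim\<theta>: "(\<lambda>k. F k (cis \<theta>)) \<longlonglongrightarrow> G (cis \<theta>)" for \<theta> by (rule lim) simp
  then show "AE \<theta> in circ. (\<lambda>k. F k (cis \<theta>)) \<longlonglongrightarrow> G (cis \<theta>)" by simp
  show "eig_sum G \<in> borel_measurable M"
    by (rule borel_measurable_LIMSEQ_real[of M "\<lambda>k. eig_sum (F k)"]) (use F limU in \<open>auto simp: moment_formula_def\<close>)
  show "(\<lambda>\<theta>. G (cis \<theta>)) \<in> borel_measurable borel"
    by (rule borel_measurable_LIMSEQ_real[of borel "\<lambda>k \<theta>. F k (cis \<theta>)"]) (use F lim\<theta> in \<open>auto simp: moment_formula_def\<close>)
qed

lemma moment_formula_continuous:
  assumes "continuous_on (sphere 0 1) F"
  shows "moment_formula m F"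
  unfolding moment_formula_def
proof (intro conjI eig_sum_continuous[OF assms])
  have "continuous_on UNIV (\<lambda>\<theta>. F (cis \<theta>))"
    by (rule continuous_on_compose2[OF assms]) (auto intro!: continuous_intros)
  then show "(\<lambda>\<theta>. F (cis \<theta>)) \<in> borel_measurable borel" by (rule borel_measurable_continuous_onI)
qed

lemma eig_sum_linear: "eig_sum (\<lambda>z. a * F z + b * G z) U = a * eig_sum F U + b * eig_sum G U"
proof -
  have "(\<Sum>z\<in>#A. a * F z + b * G z) = a * (\<Sum>z\<in>#A. F z) + b * (\<Sum>z\<in>#A. G z)" for A
    by (induction A) (simp_all add: algebra_simps)
  then show ?thesis by (simp add: eig_sum_def)
qed

text \<open>The first moment is linear in F. Higher moments are not, so the induction over Borel
  sets is run for m = 1 only.\<close>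

lemma moment_formula1_linear:
  assumes F: "moment_formula 1 F" and G: "moment_formula 1 G"
    and B: "\<And>z. z \<in> sphere 0 1 \<Longrightarrow> \<bar>F z\<bar> \<le> B" and C: "\<And>z. z \<in> sphere 0 1 \<Longrightarrow> \<bar>G z\<bar> \<le> C"
  shows "moment_formula 1 (\<lambda>z. a * F z + b * G z)"
proof -
  have intM: "integrable M (eig_sum F)" if "moment_formula 1 F" "\<And>z. z \<in> sphere 0 1 \<Longrightarrow> \<bar>F z\<bar> \<le> B" for F B
    using that by (intro integrable_const_bound[where B = "real N * B"] AE_I2) (auto simp: moment_formula_def intro: eig_sum_bound)
  have intT: "integrable (torus N) (\<lambda>\<theta>. (\<Sum>i<N. F (cis (\<theta> i))) * Re (weyl_kernel N \<theta>))"
    if F: "moment_formula 1 F" and FB: "\<And>z. z \<in> sphere 0 1 \<Longrightarrow> \<bar>F z\<bar> \<le> B" for F B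
  proof (rule torus.integrable_const_bound[where B = "real N * B * fact N"])
    show "AE \<theta> in torus N. norm ((\<Sum>i<N. F (cis (\<theta> i))) * Re (weyl_kernel N \<theta>)) \<le> real N * B * fact N"
    proof (rule AE_I2)
      fix \<theta>
      have b: "\<bar>\<Sum>i<N. F (cis (\<theta> i))\<bar> \<le> real N * B" by (rule torus_sum_bound[OF FB])
      have "\<bar>Re (weyl_kernel N \<theta>)\<bar> \<le> fact N" by (rule order_trans[OF abs_Re_le_cmod weyl_kernel_bound])
      then show "norm ((\<Sum>i<N. F (cis (\<theta> i))) * Re (weyl_kernel N \<theta>)) \<le> real N * B * fact N"
        unfolding real_norm_def abs_mult using b order_trans[OF abs_ge_zero b] by (intro mult_mono) auto
    qed
    show "(\<lambda>\<theta>. (\<Sum>i<N. F (cis (\<theta> i))) * Re (weyl_kernel N \<theta>)) \<in> borel_measurable (torus N)"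
      using F by (intro borel_measurable_times measurable_torus_sum measurable_compose[OF measurable_weyl_kernel]) (auto simp: moment_formula_def)
  qed
  have "(\<integral>U. eig_sum (\<lambda>z. a * F z + b * G z) U ^ 1 \<partial>M) = a * (\<integral>U. eig_sum F U ^ 1 \<partial>M) + b * (\<integral>U. eig_sum G U ^ 1 \<partial>M)"
    using intM[OF F B] intM[OF G C] by (simp add: eig_sum_linear)
  also have "\<dots> = (\<integral>\<theta>. a * ((\<Sum>i<N. F (cis (\<theta> i))) * Re (weyl_kernel N \<theta>)) + b * ((\<Sum>i<N. G (cis (\<theta> i))) * Re (weyl_kernel N \<theta>)) \<partial>torus N)"
    using F G intT[OF F B] intT[OF G C] by (simp add: moment_formula_def)
  also have "\<dots> = (\<integral>\<theta>. (\<Sum>i<N. a * F (cis (\<theta> i)) + b * G (cis (\<theta> i))) ^ 1 * Re (weyl_kernel N \<theta>) \<partial>torus N)"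
    by (simp add: sum.distrib sum_distrib_left algebra_simps)
  finally have "(\<integral>U. eig_sum (\<lambda>z. a * F z + b * G z) U ^ 1 \<partial>M) =
      (\<integral>\<theta>. (\<Sum>i<N. a * F (cis (\<theta> i)) + b * G (cis (\<theta> i))) ^ 1 * Re (weyl_kernel N \<theta>) \<partial>torus N)" .
  moreover have "eig_sum (\<lambda>z. a * F z + b * G z) \<in> borel_measurable M"
    using F G unfolding eig_sum_linear by (intro borel_measurable_add borel_measurable_times) (auto simp: moment_formula_def)
  moreover have "(\<lambda>\<theta>. a * F (cis \<theta>) + b * G (cis \<theta>)) \<in> borel_measurable borel"
    using F G by (intro borel_measurable_add borel_measurable_times) (auto simp: moment_formula_def)
  ultimately show ?thesis unfolding moment_formula_def by blast
qed

text \<open>Dynkin's argument with the open sets as generator: an open set is reached by continuous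
  functions built from the distance to its complement, complements by linearity, and disjoint unions
  as bounded limits of finite ones.\<close>

lemma moment_formula1_indicator:
  assumes "A \<in> sets (borel :: complex measure)"
  shows "moment_formula 1 (indicator A)"
proof -
  have ind: "\<bar>indicator A z :: real\<bar> \<le> 1" for A and z :: complex by (simp add: indicator_def)
  have "Int_stable {S :: complex set. open S}" by (auto simp: Int_stable_def)
  moreover have "{S :: complex set. open S} \<subseteq> Pow UNIV" by auto
  moreover have "A \<in> sigma_sets UNIV {S. open S}" using assms by (simp add: borel_def)
  ultimately show ?thesis
  proof (induction rule: sigma_sets_induct_disjoint)
    case (basic A)
    then have A: "open A" by simp
    \<comment> \<open>The whole plane is separate because the distance to the empty set is 0 by
      convention, so the approximating functions would vanish.\<close>
    show ?case
    proof (cases "A = UNIV")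
      case True
      then show ?thesis by (intro moment_formula_continuous) (auto simp: indicator_def)
    next
      case False
      define F where "F k z = min 1 (real k * infdist z (- A))" for k z
      show ?thesis
      proof (rule moment_formula_limit[of 1 F 1])
        show "moment_formula 1 (F k)" for k
          unfolding F_def by (intro moment_formula_continuous continuous_intros)
        show "\<bar>F k z\<bar> \<le> 1" for k z
          by (simp add: F_def infdist_nonneg)
        show "(\<lambda>k. F k z) \<longlonglongrightarrow> indicator A z" for z
        proof (cases "z \<in> A")
          case True
          have "closed (- A)" using A by (simp add: closed_Compl)
          then have pos: "infdist z (- A) > 0"
            using True False in_closed_iff_infdist_zero[of "- A" z] infdist_nonneg[of z "- A"] by (auto simp: less_le)
          obtain k0 where k0: "1 / infdist z (- A) \<le> real k0" using real_arch_simple by blast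
          have "F k z = 1" if "k \<ge> k0" for k
          proof -
            have "1 \<le> real k0 * infdist z (- A)" using k0 pos by (simp add: field_simps)
            also have "\<dots> \<le> real k * infdist z (- A)" using that pos by (intro mult_right_mono) auto
            finally show ?thesis by (simp add: F_def)
          qed
          then have "\<forall>\<^sub>F k in sequentially. F k z = indicator A z"
            using True by (auto simp: eventually_sequentially)
          then show ?thesis by (rule tendsto_eventually)
        next
          case False
          then show ?thesis by (simp add: F_def)
        qed
      qed
    qed
  next
    case empty
    then show ?case by (intro moment_formula_continuous) (auto simp: indicator_def)
  next
    case (compl A)
    have "moment_formula 1 (\<lambda>z. 1 * 1 + (- 1) * indicator A z)"
      by (rule moment_formula1_linear[where B = 1 and C = 1]) (use compl ind in \<open>auto intro: moment_formula_continuous\<close>)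
    moreover have "(\<lambda>z. 1 * 1 + (- 1) * indicator A z) = (indicator (UNIV - A) :: complex \<Rightarrow> real)"
      by (auto simp: indicator_def fun_eq_iff)
    ultimately show ?case by simp
  next
    case (union A)
    define F :: "nat \<Rightarrow> complex \<Rightarrow> real" where "F k z = indicator (\<Union>i<k. A i) z" for k z
    show ?case
    proof (rule moment_formula_limit[of 1 F 1])
      show "moment_formula 1 (F k)" for k
      proof (induction k)
        case 0
        then show ?case unfolding F_def by (intro moment_formula_continuous) (auto simp: indicator_def)
      next
        case (Suc k)
        have "moment_formula 1 (\<lambda>z. 1 * F k z + 1 * indicator (A k) z)"
          by (rule moment_formula1_linear[where B = 1 and C = 1, OF Suc union(3)[of k]]) (auto simp: F_def ind)
        moreover have "(\<lambda>z. 1 * F k z + 1 * indicator (A k) z) = F (Suc k)"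
        proof
          fix z
          have "A k \<inter> A i = {}" if "i < k" for i
            using union(1) that by (auto simp: disjoint_family_on_def)
          then show "1 * F k z + 1 * indicator (A k) z = F (Suc k) z"
            by (auto simp: F_def indicator_def lessThan_Suc)
        qed
        ultimately show ?case by simp
      qed
      show "\<bar>F k z\<bar> \<le> 1" for k z by (simp add: F_def ind)
      show "(\<lambda>k. F k z) \<longlonglongrightarrow> indicator (\<Union>i. A i) z" for z
        unfolding F_def by (rule LIMSEQ_indicator_UN)
    qed
  qed
qed

text \<open>Indicators are covered by \<open>moment_formula1_indicator\<close>; simple functions and
  pointwise limits give the rest, again without choosing eigenvalues measurably.\<close>

lemma measurable_eig_sum:
  assumes F: "F \<in> borel_measurable borel"
  shows "eig_sum F \<in> borel_measurable M"
proof -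
  obtain s where s: "\<And>k. simple_function borel (s k)" "\<And>z. (\<lambda>k. s k z) \<longlonglongrightarrow> F z"
    using borel_measurable_implies_sequence_metric[OF F, of 0] by auto
  have "eig_sum (s k) \<in> borel_measurable M" for k
  proof -
    have fin: "finite (range (s k))" using simple_functionD(1)[OF s(1)[of k]] by simp
    have eq: "s k z = (\<Sum>y\<in>range (s k). y * indicator (s k -` {y}) z)" for z
    proof -
      have "(\<Sum>y\<in>range (s k). y * indicator (s k -` {y}) z) = (\<Sum>y\<in>range (s k). if y = s k z then y else 0)"
        by (intro sum.cong refl) (auto simp: indicator_def)
      then show ?thesis using fin by simp
    qed
    have "eig_sum (s k) U = (\<Sum>y\<in>range (s k). y * eig_sum (indicator (s k -` {y})) U)" if U: "U \<in> space M" for U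
    proof -
      obtain z where z: "\<And>F. eig_sum F U = (\<Sum>i<N. F (z i))" using U by (rule spectrumE) blast
      show ?thesis unfolding z by (subst eq) (simp add: sum_distrib_left sum.swap[of _ "range (s k)"])
    qed
    moreover have "s k -` {y} \<in> sets borel" for y
      using simple_functionD(2)[OF s(1)[of k], of "{y}"] by simp
    then have "(\<lambda>U. \<Sum>y\<in>range (s k). y * eig_sum (indicator (s k -` {y})) U) \<in> borel_measurable M"
      using moment_formula1_indicator by (intro borel_measurable_sum borel_measurable_times) (auto simp: moment_formula_def)
    ultimately show ?thesis by (subst measurable_cong)
  qed
  moreover have "(\<lambda>k. eig_sum (s k) U) \<longlonglongrightarrow> eig_sum F U" if "U \<in> space M" for U
    by (rule eig_sum_tendsto[OF that, where F = s and G = F]) (rule s(2))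
  ultimately show ?thesis
    by (rule borel_measurable_LIMSEQ_real[where u = "\<lambda>k. eig_sum (s k)", rotated])
qed

text \<open>
  The case \<open>m = 1\<close> for indicator functions shows that eigenvalues avoid null sets of the circle; this
  permits almost everywhere limits of continuous functions for general \<open>m\<close>.
\<close>

lemma AE_no_eigenvalue_in_null_set:
  assumes A: "A \<in> sets borel" and null: "AE \<theta> in circ. cis \<theta> \<notin> A"
  shows "AE U in M. \<forall>z\<in>#proots (char_poly U). z \<notin> A"
proof -
  have good: "moment_formula 1 (indicator A)" by (rule moment_formula1_indicator[OF A])
  have int: "integrable M (eig_sum (indicator A))"
    using good eig_sum_bound[where F = "indicator A" and B = 1]
    by (intro integrable_const_bound[where B = "real N * 1"] AE_I2) (auto simp: moment_formula_def indicator_def)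
  have nonneg: "eig_sum (indicator A) U \<ge> 0" if "U \<in> space M" for U
  proof -
    obtain z where z: "\<And>F. eig_sum F U = (\<Sum>i<N. F (z i))" using \<open>U \<in> space M\<close> by (rule spectrumE) blast
    show ?thesis unfolding z by (rule sum_nonneg) simp
  qed
  have "AE \<theta> in torus N. \<forall>i\<in>{..<N}. cis (\<theta> i) \<notin> A"
    by (subst AE_finite_all) (auto intro!: AE_torus_component null)
  \<comment> \<open>The kernel need not be nonnegative, but the sum of indicators itself already
    vanishes almost everywhere. On the group the sum is nonnegative, so a zero integral forces it to
    vanish almost surely.\<close>
  then have "AE \<theta> in torus N. (\<Sum>i<N. indicator A (cis (\<theta> i))) ^ 1 * Re (weyl_kernel N \<theta>) = 0"
    by (rule AE_mp) (auto intro!: AE_I2)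
  then have "(\<integral>\<theta>. (\<Sum>i<N. indicator A (cis (\<theta> i))) ^ 1 * Re (weyl_kernel N \<theta>) \<partial>torus N) = 0"
    by (rule integral_eq_zero_AE)
  then have "(\<integral>U. eig_sum (indicator A) U \<partial>M) = 0"
    using good by (simp add: moment_formula_def)
  then have "AE U in M. eig_sum (indicator A) U = 0"
    by (subst (asm) integral_nonneg_eq_0_iff_AE[OF int]) (auto intro!: AE_I2 nonneg)
  then show ?thesis
  proof (rule AE_mp, intro AE_I2 impI)
    fix U assume "U \<in> space M" and zero: "eig_sum (indicator A) U = 0"
    then have "U \<in> unitary_group N" by (simp add: space_M)
    then obtain z where z: "proots (char_poly U) = image_mset z (mset_set {..<N})" by (rule unitary_spectrum)
    have "(\<Sum>i<N. indicator A (z i)) = (0::real)"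
      using zero by (simp add: eig_sum_def z multiset.map_comp sum_unfold_sum_mset o_def)
    then show "\<forall>z\<in>#proots (char_poly U). z \<notin> A"
      by (subst (asm) sum_nonneg_eq_0_iff) (auto simp: z indicator_def split: if_splits)
  qed
qed

text \<open>A Borel function is an almost everywhere limit of continuous ones, which may be clipped
  to [-B, B]. After the cutoff near -1 they are continuous on the circle, and the exceptional set is
  null, hence avoided by almost all spectra.\<close>

theorem eig_sum_moment:
  fixes f :: "real \<Rightarrow> real"
  assumes f [measurable]: "f \<in> borel_measurable borel" and B: "\<And>x. \<bar>f x\<bar> \<le> B"
  shows "(\<integral>U. eig_sum (\<lambda>z. f (Arg z)) U ^ m \<partial>M) = (\<integral>\<theta>. (\<Sum>i<N. f (\<theta> i)) ^ m * Re (weyl_kernel N \<theta>) \<partial>torus N)"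
proof -
  have "f \<in> borel_measurable lebesgue" using f by (simp add: measurable_completion)
  \<comment> \<open>This notion of measurability supplies the approximating continuous functions and
    the negligible exceptional set.\<close>
  then have "f measurable_on UNIV" by (rule lebesgue_measurable_imp_measurable_on_real) simp
  then obtain E g where E: "negligible E" and g: "\<And>k. continuous_on UNIV (g k)"
    and lim: "\<And>x. x \<notin> E \<Longrightarrow> (\<lambda>k. g k x) \<longlonglongrightarrow> f x"
    by (auto simp: measurable_on_def)
  have "E \<in> null_sets (completion lborel)" using E by (simp add: negligible_iff_null_sets)
  then obtain E' where E': "E' \<in> null_sets lborel" "E \<subseteq> E'" by (auto simp: null_sets_completion_iff2)
  define c where "c k x = max (- B) (min B (g k x))" for k x
  have B0: "0 \<le> B" using B[of 0] by linarith
  have c: "continuous_on UNIV (c k)" "\<bar>c k x\<bar> \<le> B" for k x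
    using B0 unfolding c_def by (auto intro!: continuous_intros g)
  have limc: "(\<lambda>k. c k x) \<longlonglongrightarrow> f x" if "x \<notin> E'" for x
  proof -
    have "(\<lambda>k. c k x) \<longlonglongrightarrow> max (- B) (min B (f x))"
      unfolding c_def using that E'(2) by (intro tendsto_intros lim) auto
    then show ?thesis using B[of x] by (simp add: max_def min_def split: if_splits)
  qed
  define F where "F k z = c k (Arg z) * min 1 (real k * dist z (-1))" for k z
  \<comment> \<open>The points where convergence may fail: -1, where the cutoff is 0 for every k,
    and the points whose angle lies in the Borel null set covering the exceptional set.\<close>
  define A where "A = insert (-1) (Arg -` E')"
  have A: "A \<in> sets borel"
  proof -
    have "Arg -` E' \<inter> space borel \<in> sets borel"
      by (rule measurable_sets[OF measurable_Arg]) (use E'(1) in auto)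
    then show ?thesis by (simp add: A_def)
  qed
  have limF: "(\<lambda>k. F k z) \<longlonglongrightarrow> f (Arg z)" if "z \<notin> A" for z
  proof -
    have pos: "dist z (-1) > 0" using that by (auto simp: A_def)
    obtain k0 where k0: "1 / dist z (-1) \<le> real k0" using real_arch_simple by blast
    have "min 1 (real k * dist z (-1)) = 1" if "k \<ge> k0" for k
    proof -
      have "1 \<le> real k0 * dist z (-1)" using k0 pos by (simp add: field_simps)
      also have "\<dots> \<le> real k * dist z (-1)" using that pos by (intro mult_right_mono) auto
      finally show ?thesis by simp
    qed
    then have "(\<lambda>k. min 1 (real k * dist z (-1))) \<longlonglongrightarrow> 1"
      by (intro tendsto_eventually) (auto simp: eventually_sequentially)
    from tendsto_mult[OF limc this, of "Arg z"] show ?thesis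
      using that by (simp add: F_def A_def)
  qed
  have Fb: "\<bar>F k z\<bar> \<le> B" for k z
  proof -
    have "\<bar>F k z\<bar> = \<bar>c k (Arg z)\<bar> * min 1 (real k * dist z (-1))" by (simp add: F_def abs_mult)
    also have "\<dots> \<le> B * 1" using c(2)[of k "Arg z"] B0 by (intro mult_mono) auto
    finally show ?thesis by simp
  qed
  have "AE x in lborel. x \<notin> E'" using E'(1) by (rule AE_not_in)
  then have nE: "AE \<theta> in circ. \<theta> \<notin> E'" unfolding AE_circ_iff by (rule AE_mp) auto
  have Arg_cis: "Arg (cis \<theta>) = \<theta>" if "- pi < \<theta>" "\<theta> < pi" for \<theta>
    using that by (intro Arg_cis) auto
  have nullA: "AE \<theta> in circ. cis \<theta> \<notin> A"
    using AE_circ_interior nE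
  proof eventually_elim
    case (elim \<theta>)
    then have "Arg (cis \<theta>) = \<theta>" by (intro Arg_cis) auto
    moreover have "Arg (-1) = pi" using Arg_of_real[of "-1"] by simp
    ultimately show ?case using elim by (auto simp: A_def)
  qed
  have "moment_formula m (\<lambda>z. f (Arg z))"
  proof (rule moment_formula_AE_limit[of m F B])
    show "moment_formula m (F k)" for k
      unfolding F_def by (intro moment_formula_continuous continuous_on_circle_Arg_cutoff[OF c])
    show "\<bar>F k z\<bar> \<le> B" for k z by (rule Fb)
    show "AE U in M. (\<lambda>k. eig_sum (F k) U) \<longlonglongrightarrow> eig_sum (\<lambda>z. f (Arg z)) U"
      using AE_no_eigenvalue_in_null_set[OF A nullA] AE_space
      by eventually_elim (auto intro!: eig_sum_tendsto limF)
    show "AE \<theta> in circ. (\<lambda>k. F k (cis \<theta>)) \<longlonglongrightarrow> f (Arg (cis \<theta>))"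
      using nullA by eventually_elim (rule limF)
    show "eig_sum (\<lambda>z. f (Arg z)) \<in> borel_measurable M" by (rule measurable_eig_sum) measurable
  qed measurable
  then have "(\<integral>U. eig_sum (\<lambda>z. f (Arg z)) U ^ m \<partial>M) = (\<integral>\<theta>. (\<Sum>i<N. f (Arg (cis (\<theta> i)))) ^ m * Re (weyl_kernel N \<theta>) \<partial>torus N)"
    by (simp add: moment_formula_def)
  also have "\<dots> = (\<integral>\<theta>. (\<Sum>i<N. f (\<theta> i)) ^ m * Re (weyl_kernel N \<theta>) \<partial>torus N)"
  proof (rule integral_cong_AE)
    have "AE \<theta> in torus N. \<forall>i\<in>{..<N}. - pi < \<theta> i \<and> \<theta> i < pi"
    proof (subst AE_finite_all, simp, intro ballI)
      fix i assume "i \<in> {..<N}"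
      then show "AE \<theta> in torus N. - pi < \<theta> i \<and> \<theta> i < pi"
        by (intro AE_torus_component[OF AE_circ_interior]) simp
    qed
    then show "AE \<theta> in torus N. (\<Sum>i<N. f (Arg (cis (\<theta> i)))) ^ m * Re (weyl_kernel N \<theta>) = (\<Sum>i<N. f (\<theta> i)) ^ m * Re (weyl_kernel N \<theta>)"
      by eventually_elim (simp add: Arg_cis)
    have "(\<lambda>\<theta>. f (Arg (cis \<theta>))) \<in> borel_measurable borel" by measurable
    then show "(\<lambda>\<theta>. (\<Sum>i<N. f (Arg (cis (\<theta> i)))) ^ m * Re (weyl_kernel N \<theta>)) \<in> borel_measurable (torus N)"
      by (intro borel_measurable_times borel_measurable_power measurable_torus_sum measurable_compose[OF measurable_weyl_kernel]) auto
    show "(\<lambda>\<theta>. (\<Sum>i<N. f (\<theta> i)) ^ m * Re (weyl_kernel N \<theta>)) \<in> borel_measurable (torus N)"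
      by (intro borel_measurable_times borel_measurable_power measurable_torus_sum f measurable_compose[OF measurable_weyl_kernel]) auto
  qed
  finally show ?thesis .
qed

end

section \<open>Set partitions and permutation sums\<close>

lemma sum_power_PiE:
  fixes y :: "'a \<Rightarrow> 'b::comm_semiring_1"
  assumes B: "finite B"
  shows "(\<Sum>i\<in>B. y i) ^ m = (\<Sum>\<phi>\<in>{1..m} \<rightarrow>\<^sub>E B. \<Prod>i\<in>B. y i ^ card {j\<in>{1..m}. \<phi> j = i})"
proof -
  have "(\<Sum>i\<in>B. y i) ^ m = (\<Prod>j\<in>{1..m}. \<Sum>i\<in>B. y i)" by simp
  also have "\<dots> = (\<Sum>\<phi>\<in>{1..m} \<rightarrow>\<^sub>E B. \<Prod>j\<in>{1..m}. y (\<phi> j))" by (rule prod_sum_PiE) (use B in auto)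
  also have "\<dots> = (\<Sum>\<phi>\<in>{1..m} \<rightarrow>\<^sub>E B. \<Prod>i\<in>B. y i ^ card {j\<in>{1..m}. \<phi> j = i})"
  proof (rule sum.cong[OF refl])
    fix \<phi> assume "\<phi> \<in> {1..m} \<rightarrow>\<^sub>E B"
    then have "\<phi> ` {1..m} \<subseteq> B" by (intro image_subsetI) (rule PiE_mem)
    then have "(\<Prod>j\<in>{1..m}. y (\<phi> j)) = (\<Prod>i\<in>B. \<Prod>j\<in>{j\<in>{1..m}. \<phi> j = i}. y (\<phi> j))"
      by (intro prod.group[symmetric] B) auto
    also have "\<dots> = (\<Prod>i\<in>B. y i ^ card {j\<in>{1..m}. \<phi> j = i})" by (intro prod.cong refl) simp
    finally show "(\<Prod>j\<in>{1..m}. y (\<phi> j)) = (\<Prod>i\<in>B. y i ^ card {j\<in>{1..m}. \<phi> j = i})" .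
  qed
  finally show ?thesis .
qed

lemma set_partitionsD:
  assumes "\<sigma> \<in> set_partitions m r"
  shows "\<sigma> ` {1..m} = {1..r}" "\<sigma> \<in> extensional {1..m}"
    and "j \<in> {1..m} \<Longrightarrow> \<sigma> j = 1 \<or> (\<exists>k\<in>{1..m}. k < j \<and> \<sigma> j = \<sigma> k + 1)"
proof -
  have s: "\<sigma> \<in> {1..m} \<rightarrow>\<^sub>E {1..r}" and sur: "\<forall>q\<in>{1..r}. \<exists>j\<in>{1..m}. \<sigma> j = q"
    and gr: "\<forall>j\<in>{1..m}. \<sigma> j = 1 \<or> (\<exists>k\<in>{1..m}. k < j \<and> \<sigma> j = \<sigma> k + 1)"
    using assms unfolding set_partitions_def mem_Collect_eq by simp_all
  have "\<sigma> ` {1..m} \<subseteq> {1..r}" by (rule image_subsetI, rule PiE_mem[OF s])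
  moreover have "{1..r} \<subseteq> \<sigma> ` {1..m}"
  proof
    fix q assume "q \<in> {1..r}"
    with sur obtain j where "j \<in> {1..m}" "\<sigma> j = q" by (elim ballE bexE) auto
    then show "q \<in> \<sigma> ` {1..m}" by (intro image_eqI[of q \<sigma> j]) simp_all
  qed
  ultimately show "\<sigma> ` {1..m} = {1..r}" by (rule subset_antisym)
  show "\<sigma> \<in> extensional {1..m}" using s by (simp add: PiE_def)
  show "j \<in> {1..m} \<Longrightarrow> \<sigma> j = 1 \<or> (\<exists>k\<in>{1..m}. k < j \<and> \<sigma> j = \<sigma> k + 1)" by (rule bspec[OF gr])
qed

lemma finite_set_partitions: "finite (set_partitions m r)"
  by (rule finite_subset[of _ "{1..m} \<rightarrow>\<^sub>E {1..r}"]) (auto simp: set_partitions_def intro!: finite_PiE)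

text \<open>The maps are restricted growth functions: a value other than 1 exceeds some earlier
  value by exactly 1, so labels appear in increasing order without gaps.\<close>

lemma set_partitions_initial_image:
  assumes \<sigma>: "\<sigma> \<in> set_partitions m r" and "n \<le> m"
  shows "\<exists>s. \<sigma> ` {1..n} = {1..s}"
  using assms(2)
proof (induction n)
  case 0
  show ?case by (intro exI[of _ 0]) simp
next
  case (Suc n)
  then obtain s where s: "\<sigma> ` {1..n} = {1..s}" by auto
  have ins: "\<sigma> ` {1..Suc n} = insert (\<sigma> (Suc n)) {1..s}"
    unfolding s[symmetric] by (simp add: atLeastAtMostSuc_conv)
  have mem: "Suc n \<in> {1..m}" using Suc.prems by simp
  have pos: "\<sigma> (Suc n) \<ge> 1" using imageI[OF mem, of \<sigma>] unfolding set_partitionsD(1)[OF \<sigma>] by simp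
  have "\<sigma> (Suc n) \<le> Suc s"
    using set_partitionsD(3)[OF \<sigma> mem]
  proof
    assume "\<exists>k\<in>{1..m}. k < Suc n \<and> \<sigma> (Suc n) = \<sigma> k + 1"
    then obtain k where k: "k \<in> {1..m}" "k < Suc n" "\<sigma> (Suc n) = \<sigma> k + 1" by blast
    then have "k \<in> {1..n}" by simp
    from imageI[OF this, of \<sigma>] have "\<sigma> k \<in> {1..s}" unfolding s .
    with k(3) show ?thesis by simp
  qed simp
  then consider "\<sigma> (Suc n) \<le> s" | "\<sigma> (Suc n) = Suc s" by linarith
  then show ?case
  proof cases
    case 1
    then have "\<sigma> ` {1..Suc n} = {1..s}" using pos unfolding ins by auto
    then show ?thesis ..
  next
    case 2
    then have "\<sigma> ` {1..Suc n} = {1..Suc s}" unfolding ins by (simp add: atLeastAtMostSuc_conv)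
    then show ?thesis ..
  qed
qed

lemma set_partitions_new_block:
  assumes \<sigma>: "\<sigma> \<in> set_partitions m r" and j: "j \<in> {1..m}" and new: "\<sigma> j \<notin> \<sigma> ` {1..<j}"
  shows "\<sigma> j = Suc (card (\<sigma> ` {1..<j}))"
proof -
  have eq: "{1..<j} = {1..j - 1}" using j by auto
  have "j - 1 \<le> m" using j by auto
  from set_partitions_initial_image[OF \<sigma> this]
  obtain s where s: "\<sigma> ` {1..<j} = {1..s}" unfolding eq by blast
  have pos: "\<sigma> j \<ge> 1" using imageI[OF j, of \<sigma>] unfolding set_partitionsD(1)[OF \<sigma>] by simp
  have "\<sigma> j \<le> Suc s"
    using set_partitionsD(3)[OF \<sigma> j]
  proof
    assume "\<exists>k\<in>{1..m}. k < j \<and> \<sigma> j = \<sigma> k + 1"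
    then obtain k where k: "k \<in> {1..m}" "k < j" "\<sigma> j = \<sigma> k + 1" by blast
    then have "k \<in> {1..<j}" by simp
    from imageI[OF this, of \<sigma>] have "\<sigma> k \<in> {1..s}" unfolding s .
    with k(3) show ?thesis by simp
  qed simp
  moreover have "\<not> \<sigma> j \<le> s" using new pos unfolding s by simp
  ultimately show ?thesis unfolding s by simp
qed

text \<open>A restricted growth function is determined by which arguments share a value. By
  induction on j, either j joins the block of an earlier element, where both functions agree, or it
  opens a new block and receives the next free label in both.\<close>

lemma set_partitions_eqI:
  assumes \<sigma>: "\<sigma> \<in> set_partitions m r" and \<sigma>': "\<sigma>' \<in> set_partitions m r'"
    and eq: "\<And>j k. j \<in> {1..m} \<Longrightarrow> k \<in> {1..m} \<Longrightarrow> \<sigma> j = \<sigma> k \<longleftrightarrow> \<sigma>' j = \<sigma>' k"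
  shows "\<sigma> = \<sigma>'"
proof (rule extensionalityI[OF set_partitionsD(2)[OF \<sigma>] set_partitionsD(2)[OF \<sigma>']])
  fix j assume "j \<in> {1..m}"
  then show "\<sigma> j = \<sigma>' j"
  proof (induction j rule: less_induct)
    case (less j)
    have IH: "\<sigma> k = \<sigma>' k" if "k \<in> {1..<j}" for k using less.IH[of k] less.prems that by auto
    then have img: "\<sigma> ` {1..<j} = \<sigma>' ` {1..<j}" by (intro image_cong refl)
    show ?case
    proof (cases "\<sigma> j \<in> \<sigma> ` {1..<j}")
      case True
      then obtain k where k: "k \<in> {1..<j}" "\<sigma> j = \<sigma> k" by blast
      then have "\<sigma>' j = \<sigma>' k" using eq[of j k] less.prems by auto
      with k IH[of k] show ?thesis by simp
    next
      case False
      have "\<sigma>' j \<notin> \<sigma>' ` {1..<j}"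
      proof
        assume "\<sigma>' j \<in> \<sigma>' ` {1..<j}"
        then obtain k where k: "k \<in> {1..<j}" "\<sigma>' j = \<sigma>' k" by blast
        then have "\<sigma> j = \<sigma> k" using eq[of j k] less.prems by auto
        with k False show False by blast
      qed
      then show ?thesis
        using set_partitions_new_block[OF \<sigma> less.prems False] set_partitions_new_block[OF \<sigma>' less.prems] img by simp
    qed
  qed
qed

text \<open>Blocks are the fibres of \<phi>, labelled in the order of first appearance: a new
  argument either repeats a value and reuses its label, or opens the label r + 1.\<close>

lemma set_partition_factorization:
  fixes \<phi> :: "nat \<Rightarrow> 'a"
  shows "\<exists>r \<sigma> \<iota>. \<sigma> ` {1..m} = {1..r} \<and> r \<le> m \<and> inj_on \<iota> {1..r} \<and> (\<forall>j\<in>{1..m}. \<phi> j = \<iota> (\<sigma> j)) \<and>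
    (\<forall>j\<in>{1..m}. \<sigma> j = 1 \<or> (\<exists>k\<in>{1..m}. k < j \<and> \<sigma> j = \<sigma> k + 1))"
proof (induction m)
  case 0
  show ?case by (intro exI[of _ 0] exI[of _ "\<lambda>_. 0"] exI[of _ "\<lambda>_. undefined"]) auto
next
  case (Suc m)
  then obtain r \<sigma> \<iota> where IH: "\<sigma> ` {1..m} = {1..r}" "r \<le> m" "inj_on \<iota> {1..r}" "\<And>j. j \<in> {1..m} \<Longrightarrow> \<phi> j = \<iota> (\<sigma> j)"
    "\<And>j. j \<in> {1..m} \<Longrightarrow> \<sigma> j = 1 \<or> (\<exists>k\<in>{1..m}. k < j \<and> \<sigma> j = \<sigma> k + 1)" by blast
  \<comment> \<open>The common extension step: q is the label of the new argument, \<iota>' and r'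
    are the possibly enlarged injection and number of labels.\<close>
  have ext: ?case if q: "\<phi> (Suc m) = \<iota>' q" "q = 1 \<or> q - 1 \<in> {1..r}" "insert q {1..r} = {1..r'}" "r' \<le> Suc m"
    and \<iota>': "inj_on \<iota>' {1..r'}" "\<And>s. s \<in> {1..r} \<Longrightarrow> \<iota>' s = \<iota> s" for q r' \<iota>'
  proof (intro exI conjI)
    let ?\<sigma> = "\<sigma>(Suc m := q)"
    have ins: "{1..Suc m} = insert (Suc m) {1..m}" by (auto simp: atLeastAtMostSuc_conv)
    have "?\<sigma> ` {1..m} = \<sigma> ` {1..m}" by (rule image_cong) auto
    then show "?\<sigma> ` {1..Suc m} = {1..r'}" unfolding ins image_insert IH(1) using q(3) by simp
    show "r' \<le> Suc m" "inj_on \<iota>' {1..r'}" by fact+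
    show "\<forall>j\<in>{1..Suc m}. \<phi> j = \<iota>' (?\<sigma> j)"
    proof
      fix j assume "j \<in> {1..Suc m}"
      then consider "j = Suc m" | "j \<in> {1..m}" by force
      then show "\<phi> j = \<iota>' (?\<sigma> j)"
      proof cases
        case 2
        then have "\<sigma> j \<in> {1..r}" using IH(1) by blast
        then show ?thesis using 2 IH(4) \<iota>'(2) by simp
      qed (simp add: q)
    qed
    show "\<forall>j\<in>{1..Suc m}. ?\<sigma> j = 1 \<or> (\<exists>k\<in>{1..Suc m}. k < j \<and> ?\<sigma> j = ?\<sigma> k + 1)"
    proof
      fix j assume "j \<in> {1..Suc m}"
      then consider "j = Suc m" "q = 1" | "j = Suc m" "q - 1 \<in> {1..r}" | "j \<in> {1..m}" using q(2) by force
      then show "?\<sigma> j = 1 \<or> (\<exists>k\<in>{1..Suc m}. k < j \<and> ?\<sigma> j = ?\<sigma> k + 1)"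
      proof cases
        case 2
        then obtain k where k: "k \<in> {1..m}" "q - 1 = \<sigma> k" using IH(1) by blast
        then have "\<sigma> k \<ge> 1" using imageI[OF k(1), of \<sigma>] unfolding IH(1) by simp
        then show ?thesis using k 2 by (intro disjI2 bexI[of _ k]) auto
      next
        case 3
        from IH(5)[OF this] show ?thesis
        proof
          assume "\<exists>k\<in>{1..m}. k < j \<and> \<sigma> j = \<sigma> k + 1"
          then obtain k where "k \<in> {1..m}" "k < j" "\<sigma> j = \<sigma> k + 1" by blast
          then show ?thesis using 3 by (intro disjI2 bexI[of _ k]) auto
        qed (use 3 in auto)
      qed auto
    qed
  qed
  show ?case
  proof (cases "\<phi> (Suc m) \<in> \<iota> ` {1..r}")
    case True
    then obtain q where q: "q \<in> {1..r}" "\<phi> (Suc m) = \<iota> q" by blast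
    show ?thesis
    proof (rule ext[of \<iota> q r])
      show "q = 1 \<or> q - 1 \<in> {1..r}" "insert q {1..r} = {1..r}" using q(1) by auto
      show "r \<le> Suc m" using IH(2) by simp
    qed (use q(2) IH(3) in simp_all)
  next
    case False
    let ?\<iota> = "\<iota>(Suc r := \<phi> (Suc m))"
    have ins: "insert (Suc r) {1..r} = {1..Suc r}" by (auto simp: atLeastAtMostSuc_conv)
    have "inj_on ?\<iota> {1..r}" using IH(3) by (subst inj_on_cong[of _ _ \<iota>]) auto
    moreover have "?\<iota> ` {1..r} = \<iota> ` {1..r}" by (rule image_cong) auto
    ultimately have inj: "inj_on ?\<iota> {1..Suc r}"
      unfolding ins[symmetric] inj_on_insert using False by (auto simp: Diff_insert0)
    show ?thesis
    proof (rule ext[of ?\<iota> "Suc r" "Suc r"])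
      show "Suc r = 1 \<or> Suc r - 1 \<in> {1..r}" by (cases r) auto
      show "Suc r \<le> Suc m" using IH(2) by simp
    qed (use ins inj in simp_all)
  qed
qed

text \<open>The equality pattern of the composed map determines \<sigma>, its image then gives r,
  and surjectivity of \<sigma> gives \<iota>. As m is at least 1 there is at least one block, which
  matches the range of r.\<close>

lemma bij_betw_set_partition_injection:
  assumes m: "m \<ge> 1"
  shows "bij_betw (\<lambda>(r, \<sigma>, \<iota>). \<lambda>j\<in>{1..m}. \<iota> (\<sigma> j))
    (SIGMA r:{1..m}. set_partitions m r \<times> {\<iota> \<in> {1..r} \<rightarrow>\<^sub>E B. inj_on \<iota> {1..r}}) ({1..m} \<rightarrow>\<^sub>E B)"
proof (rule bij_betw_imageI)
  let ?S = "SIGMA r:{1..m}. set_partitions m r \<times> {\<iota> \<in> {1..r} \<rightarrow>\<^sub>E B. inj_on \<iota> {1..r}}"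
  let ?h = "\<lambda>(r, \<sigma>, \<iota>). \<lambda>j\<in>{1..m}. \<iota> (\<sigma> j)"
  show "inj_on ?h ?S"
  proof (rule inj_onI, clarify)
    fix r r' \<sigma> \<sigma>' \<iota> \<iota>'
    assume \<sigma>: "\<sigma> \<in> set_partitions m r" and \<sigma>': "\<sigma>' \<in> set_partitions m r'"
      and \<iota>: "\<iota> \<in> {1..r} \<rightarrow>\<^sub>E B" "inj_on \<iota> {1..r}" and \<iota>': "\<iota>' \<in> {1..r'} \<rightarrow>\<^sub>E B" "inj_on \<iota>' {1..r'}"
      and eq: "(\<lambda>j\<in>{1..m}. \<iota> (\<sigma> j)) = (\<lambda>j\<in>{1..m}. \<iota>' (\<sigma>' j))"
    have eqj: "\<iota> (\<sigma> j) = \<iota>' (\<sigma>' j)" if "j \<in> {1..m}" for j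
      using fun_cong[OF eq, of j] that by simp
    note im = set_partitionsD(1)[OF \<sigma>] and im' = set_partitionsD(1)[OF \<sigma>']
    have "\<sigma> j = \<sigma> k \<longleftrightarrow> \<sigma>' j = \<sigma>' k" if j: "j \<in> {1..m}" and k: "k \<in> {1..m}" for j k
    proof -
      have "\<sigma> j \<in> {1..r}" "\<sigma> k \<in> {1..r}" "\<sigma>' j \<in> {1..r'}" "\<sigma>' k \<in> {1..r'}" using im im' j k by blast+
      then have "\<sigma> j = \<sigma> k \<longleftrightarrow> \<iota> (\<sigma> j) = \<iota> (\<sigma> k)" "\<sigma>' j = \<sigma>' k \<longleftrightarrow> \<iota>' (\<sigma>' j) = \<iota>' (\<sigma>' k)"
        by (simp_all add: inj_on_eq_iff[OF \<iota>(2)] inj_on_eq_iff[OF \<iota>'(2)])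
      then show ?thesis using eqj j k by simp
    qed
    then have s: "\<sigma> = \<sigma>'" by (rule set_partitions_eqI[OF \<sigma> \<sigma>'])
    have "card (\<sigma> ` {1..m}) = r" "card (\<sigma>' ` {1..m}) = r'" unfolding im im' by simp_all
    then have r: "r = r'" using s by simp
    moreover have "\<iota> = \<iota>'"
    proof (rule PiE_ext[OF \<iota>(1)])
      show "\<iota>' \<in> {1..r} \<rightarrow>\<^sub>E B" using \<iota>'(1) r by simp
      fix q assume "q \<in> {1..r}"
      then obtain j where "j \<in> {1..m}" "q = \<sigma> j" using im by blast
      then show "\<iota> q = \<iota>' q" using eqj s by simp
    qed
    ultimately show "r = r' \<and> (\<sigma>, \<iota>) = (\<sigma>', \<iota>')" using s by simp
  qed
  show "?h ` ?S = ({1..m} \<rightarrow>\<^sub>E B)"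
  proof
    show "?h ` ?S \<subseteq> ({1..m} \<rightarrow>\<^sub>E B)"
    proof (rule image_subsetI, clarify)
      fix r \<sigma> \<iota> assume \<sigma>: "\<sigma> \<in> set_partitions m r" and \<iota>: "\<iota> \<in> {1..r} \<rightarrow>\<^sub>E B"
      show "(\<lambda>j\<in>{1..m}. \<iota> (\<sigma> j)) \<in> {1..m} \<rightarrow>\<^sub>E B"
        unfolding restrict_PiE_iff
      proof
        fix j assume "j \<in> {1..m}"
        then have "\<sigma> j \<in> {1..r}" using set_partitionsD(1)[OF \<sigma>] by blast
        then show "\<iota> (\<sigma> j) \<in> B" by (rule PiE_mem[OF \<iota>])
      qed
    qed
    show "({1..m} \<rightarrow>\<^sub>E B) \<subseteq> ?h ` ?S"
    proof (rule subsetI)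
      fix \<phi> assume \<phi>: "\<phi> \<in> {1..m} \<rightarrow>\<^sub>E B"
      obtain r \<sigma> \<iota> where *: "\<sigma> ` {1..m} = {1..r}" "r \<le> m" "inj_on \<iota> {1..r}" "\<And>j. j \<in> {1..m} \<Longrightarrow> \<phi> j = \<iota> (\<sigma> j)"
        "\<And>j. j \<in> {1..m} \<Longrightarrow> \<sigma> j = 1 \<or> (\<exists>k\<in>{1..m}. k < j \<and> \<sigma> j = \<sigma> k + 1)"
        using set_partition_factorization[of m \<phi>] by blast
      have mem: "\<sigma> j \<in> {1..r}" if "j \<in> {1..m}" for j using *(1) that by blast
      have "{1..r} \<noteq> {}" using *(1) m by force
      then have r: "r \<in> {1..m}" using *(2) by simp
      have \<sigma>: "restrict \<sigma> {1..m} \<in> set_partitions m r"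
        unfolding set_partitions_def mem_Collect_eq
      proof (intro conjI)
        show "restrict \<sigma> {1..m} \<in> {1..m} \<rightarrow>\<^sub>E {1..r}" unfolding restrict_PiE_iff using mem by blast
        show "\<forall>q\<in>{1..r}. \<exists>j\<in>{1..m}. restrict \<sigma> {1..m} j = q"
          unfolding *(1)[symmetric] by auto
        show "\<forall>j\<in>{1..m}. restrict \<sigma> {1..m} j = 1 \<or> (\<exists>k\<in>{1..m}. k < j \<and> restrict \<sigma> {1..m} j = restrict \<sigma> {1..m} k + 1)"
        proof
          fix j assume j: "j \<in> {1..m}"
          from *(5)[OF j] show "restrict \<sigma> {1..m} j = 1 \<or> (\<exists>k\<in>{1..m}. k < j \<and> restrict \<sigma> {1..m} j = restrict \<sigma> {1..m} k + 1)"
          proof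
            assume "\<exists>k\<in>{1..m}. k < j \<and> \<sigma> j = \<sigma> k + 1"
            then obtain k where "k \<in> {1..m}" "k < j" "\<sigma> j = \<sigma> k + 1" by blast
            then show ?thesis using j by (intro disjI2 bexI[of _ k]) auto
          qed (use j in simp)
        qed
      qed
      have \<iota>: "restrict \<iota> {1..r} \<in> {1..r} \<rightarrow>\<^sub>E B"
        unfolding restrict_PiE_iff
      proof
        fix q assume "q \<in> {1..r}"
        then obtain j where "j \<in> {1..m}" "q = \<sigma> j" using *(1) by blast
        then show "\<iota> q \<in> B" using PiE_mem[OF \<phi>, of j] *(4) by simp
      qed
      have inj: "inj_on (restrict \<iota> {1..r}) {1..r}" using *(3) by (simp only: inj_on_restrict_eq)
      have "?h (r, restrict \<sigma> {1..m}, restrict \<iota> {1..r}) = \<phi>"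
      proof (rule extensionalityI[of _ "{1..m}"])
        show "\<phi> \<in> extensional {1..m}" using \<phi> by (simp add: PiE_def)
        show "?h (r, restrict \<sigma> {1..m}, restrict \<iota> {1..r}) \<in> extensional {1..m}" by simp
        fix j assume j: "j \<in> {1..m}"
        show "?h (r, restrict \<sigma> {1..m}, restrict \<iota> {1..r}) j = \<phi> j"
          using *(4)[OF j] mem[OF j] j by simp
      qed
      moreover have "(r, restrict \<sigma> {1..m}, restrict \<iota> {1..r}) \<in> ?S"
        by (intro SigmaI CollectI conjI r \<sigma> \<iota> inj)
      ultimately show "\<phi> \<in> ?h ` ?S" by (rule image_eqI[OF sym])
    qed
  qed
qed

section \<open>Collapsing and enlarging signed permutation sums\<close>

lemma sum_permutes_relabel:
  fixes F :: "('b \<Rightarrow> 'b) \<Rightarrow> 'c::comm_ring_1"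
  assumes f: "bij_betw f A B" and A: "finite A"
  shows "(\<Sum>\<pi> | \<pi> permutes B. of_int (sign \<pi>) * F \<pi>) = (\<Sum>\<rho> | \<rho> permutes A. of_int (sign \<rho>) * F (map_permutation A f \<rho>))"
proof -
  have inj: "inj_on f A" and B: "f ` A = B" using f by (auto simp: bij_betw_def)
  have bij: "bij_betw (map_permutation A f) {\<rho>. \<rho> permutes A} {\<pi>. \<pi> permutes B}"
  proof (rule bij_betw_byWitness[of _ "map_permutation B (inv_into A f)"])
    have inv: "bij_betw (inv_into A f) B A" using f by (rule bij_betw_inv_into)
    show "\<forall>\<rho>\<in>{\<rho>. \<rho> permutes A}. map_permutation B (inv_into A f) (map_permutation A f \<rho>) = \<rho>"
      using map_permutation_compose_inv[OF f] inv_into_f_f[OF inj] by simp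
    show "\<forall>\<pi>\<in>{\<pi>. \<pi> permutes B}. map_permutation A f (map_permutation B (inv_into A f) \<pi>) = \<pi>"
      using map_permutation_compose_inv[OF inv] f_inv_into_f[of _ f A] B by simp
    show "map_permutation A f ` {\<rho>. \<rho> permutes A} \<subseteq> {\<pi>. \<pi> permutes B}"
      using map_permutation_permutes[OF f] by blast
    show "map_permutation B (inv_into A f) ` {\<pi>. \<pi> permutes B} \<subseteq> {\<rho>. \<rho> permutes A}"
      using map_permutation_permutes[OF inv] by blast
  qed
  have "(\<Sum>\<pi> | \<pi> permutes B. of_int (sign \<pi>) * F \<pi>) =
      (\<Sum>\<rho> | \<rho> permutes A. of_int (sign (map_permutation A f \<rho>)) * F (map_permutation A f \<rho>))"
    by (rule sum.reindex_bij_betw[OF bij, symmetric])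
  also have "\<dots> = (\<Sum>\<rho> | \<rho> permutes A. of_int (sign \<rho>) * F (map_permutation A f \<rho>))"
    using A inj by (intro sum.cong[OF refl]) (simp add: sign_map_permutation)
  finally show ?thesis .
qed

text \<open>Where l i = 0 the factor is a Kronecker delta of \<pi> i and i, so only permutations
  fixing every index outside the image of \<iota> contribute. They correspond to permutations of the
  block labels, with the same sign.\<close>

lemma permutation_sum_restrict:
  fixes c :: "nat \<Rightarrow> int \<Rightarrow> complex"
  assumes c0: "\<And>d. c 0 d = (if d = 0 then 1 else 0)"
    and \<iota>: "inj_on \<iota> Q" "\<iota> ` Q \<subseteq> {..<N}" and Q: "finite Q"
    and l: "\<And>q. q \<in> Q \<Longrightarrow> l (\<iota> q) = k q" "\<And>i. i \<notin> \<iota> ` Q \<Longrightarrow> l i = 0"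
  shows "(\<Sum>\<pi> | \<pi> permutes {..<N}. of_int (sign \<pi>) * (\<Prod>i<N. c (l i) (int (\<pi> i) - int i))) =
    (\<Sum>\<rho> | \<rho> permutes Q. of_int (sign \<rho>) * (\<Prod>q\<in>Q. c (k q) (int (\<iota> (\<rho> q)) - int (\<iota> q))))"
proof -
  define I where "I = \<iota> ` Q"
  have bij: "bij_betw \<iota> Q I" using \<iota>(1) by (simp add: bij_betw_def I_def)
  have IN: "I \<subseteq> {..<N}" using \<iota>(2) by (simp add: I_def)
  have "(\<Sum>\<pi> | \<pi> permutes {..<N}. of_int (sign \<pi>) * (\<Prod>i<N. c (l i) (int (\<pi> i) - int i))) =
      (\<Sum>\<pi> | \<pi> permutes I. of_int (sign \<pi>) * (\<Prod>i<N. c (l i) (int (\<pi> i) - int i)))"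
  proof (rule sum.mono_neutral_right)
    show "finite {\<pi>. \<pi> permutes {..<N}}" by (rule finite_permutations) simp
    show "{\<pi>. \<pi> permutes I} \<subseteq> {\<pi>. \<pi> permutes {..<N}}" using permutes_subset[OF _ IN] by blast
    show "\<forall>\<pi>\<in>{\<pi>. \<pi> permutes {..<N}} - {\<pi>. \<pi> permutes I}. of_int (sign \<pi>) * (\<Prod>i<N. c (l i) (int (\<pi> i) - int i)) = 0"
    proof
      fix \<pi> assume "\<pi> \<in> {\<pi>. \<pi> permutes {..<N}} - {\<pi>. \<pi> permutes I}"
      then have \<pi>: "\<pi> permutes {..<N}" "\<not> \<pi> permutes I" by simp_all
      obtain i where i: "i \<in> {..<N} - I" "\<pi> i \<noteq> i"
      proof (rule ccontr)
        assume "\<not> thesis"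
        then have "\<pi> permutes I" using that by (intro permutes_superset[OF \<pi>(1)]) blast
        with \<pi>(2) show False ..
      qed
      then have "c (l i) (int (\<pi> i) - int i) = 0" using l(2)[of i] c0 by (simp add: I_def)
      then have "(\<Prod>i<N. c (l i) (int (\<pi> i) - int i)) = 0" using i(1) by (intro prod_zero) auto
      then show "of_int (sign \<pi>) * (\<Prod>i<N. c (l i) (int (\<pi> i) - int i)) = 0" by simp
    qed
  qed
  also have "\<dots> = (\<Sum>\<pi> | \<pi> permutes I. of_int (sign \<pi>) * (\<Prod>i\<in>I. c (l i) (int (\<pi> i) - int i)))"
  proof (rule sum.cong[OF refl])
    fix \<pi> assume "\<pi> \<in> {\<pi>. \<pi> permutes I}"
    then have \<pi>: "\<pi> permutes I" by simp
    have "c (l i) (int (\<pi> i) - int i) = 1" if "i \<in> {..<N} - I" for i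
      using that permutes_not_in[OF \<pi>, of i] l(2)[of i] c0 by (simp add: I_def)
    then have "(\<Prod>i<N. c (l i) (int (\<pi> i) - int i)) = (\<Prod>i\<in>I. c (l i) (int (\<pi> i) - int i))"
      by (intro prod.mono_neutral_right ballI IN) auto
    then show "of_int (sign \<pi>) * (\<Prod>i<N. c (l i) (int (\<pi> i) - int i)) = of_int (sign \<pi>) * (\<Prod>i\<in>I. c (l i) (int (\<pi> i) - int i))" by simp
  qed
  also have "\<dots> = (\<Sum>\<rho> | \<rho> permutes Q. of_int (sign \<rho>) * (\<Prod>i\<in>I. c (l i) (int (map_permutation Q \<iota> \<rho> i) - int i)))"
    by (rule sum_permutes_relabel[OF bij Q])
  also have "\<dots> = (\<Sum>\<rho> | \<rho> permutes Q. of_int (sign \<rho>) * (\<Prod>q\<in>Q. c (k q) (int (\<iota> (\<rho> q)) - int (\<iota> q))))"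
  proof (rule sum.cong[OF refl])
    fix \<rho>
    have "(\<Prod>i\<in>I. c (l i) (int (map_permutation Q \<iota> \<rho> i) - int i)) =
        (\<Prod>q\<in>Q. c (l (\<iota> q)) (int (map_permutation Q \<iota> \<rho> (\<iota> q)) - int (\<iota> q)))"
      by (rule prod.reindex_bij_betw[OF bij, symmetric])
    also have "\<dots> = (\<Prod>q\<in>Q. c (k q) (int (\<iota> (\<rho> q)) - int (\<iota> q)))"
      by (intro prod.cong[OF refl]) (simp add: l(1) map_permutation_apply[OF \<iota>(1)])
    finally show "of_int (sign \<rho>) * (\<Prod>i\<in>I. c (l i) (int (map_permutation Q \<iota> \<rho> i) - int i)) =
        of_int (sign \<rho>) * (\<Prod>q\<in>Q. c (k q) (int (\<iota> (\<rho> q)) - int (\<iota> q)))" by simp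
  qed
  finally show ?thesis .
qed

text \<open>Exchanging two labels with the same value of \<iota> reverses the sign and nothing else.
  This allows injections to be replaced by arbitrary maps, after which the sum over \<iota>
  factorizes.\<close>

lemma permutation_sum_eq_0_of_not_inj:
  fixes H :: "'a \<Rightarrow> 'b \<Rightarrow> complex"
  assumes Q: "finite Q" and "\<not> inj_on \<iota> Q"
  shows "(\<Sum>\<rho> | \<rho> permutes Q. of_int (sign \<rho>) * (\<Prod>q\<in>Q. H q (\<iota> (\<rho> q)))) = 0"
proof -
  obtain a b where ab: "a \<in> Q" "b \<in> Q" "a \<noteq> b" "\<iota> a = \<iota> b" using assms(2) by (auto simp: inj_on_def)
  define \<tau> where "\<tau> = Transposition.transpose a b"
  have \<tau>: "\<tau> permutes Q" using ab by (simp add: \<tau>_def permutes_swap_id)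
  have \<iota>: "\<iota> (\<tau> q) = \<iota> q" for q using ab by (auto simp: \<tau>_def Transposition.transpose_def)
  define F where "F \<rho> = of_int (sign \<rho>) * (\<Prod>q\<in>Q. H q (\<iota> (\<rho> q)))" for \<rho>
  have neg: "F (\<tau> \<circ> \<rho>) = - F \<rho>" if "\<rho> permutes Q" for \<rho>
  proof -
    have "permutation \<rho>" "permutation \<tau>" using that \<tau> Q by (auto intro: permutation_permutes[THEN iffD2])
    then have "sign (\<tau> \<circ> \<rho>) = - sign \<rho>" using ab(3) by (simp add: sign_compose \<tau>_def sign_swap_id)
    then show ?thesis by (simp add: F_def \<iota>)
  qed
  have "(\<Sum>\<rho> | \<rho> permutes Q. F \<rho>) = (\<Sum>\<rho> | \<rho> permutes Q. F (\<tau> \<circ> \<rho>))"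
    by (rule setum_permutations_compose_left[OF \<tau>])
  also have "\<dots> = - (\<Sum>\<rho> | \<rho> permutes Q. F \<rho>)"
    unfolding sum_negf[symmetric] by (rule sum.cong[OF refl]) (simp add: neg)
  finally have "(\<Sum>\<rho> | \<rho> permutes Q. F \<rho>) = 0" by simp
  then show ?thesis by (simp add: F_def)
qed

text \<open>Each factor depends on one angle, so Fubini turns every term into a product of Fourier
  coefficients. Angles to which no factor g is attached have exponent 0 and drop out, which leaves a
  permutation sum over the r blocks.\<close>

lemma torus_moment_expansion:
  fixes g :: "real \<Rightarrow> real"
  assumes g [measurable]: "g \<in> borel_measurable borel" and B: "\<And>x. \<bar>g x\<bar> \<le> B" and m: "m \<ge> 1"
  defines "c \<equiv> \<lambda>k d. \<integral>\<theta>. of_real (g \<theta> ^ k) * cis (- of_int d * \<theta>) \<partial>circ"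
  shows "(\<integral>\<theta>. of_real ((\<Sum>i<N. g (\<theta> i)) ^ m) * weyl_kernel N \<theta> \<partial>torus N) =
    (\<Sum>r = 1..m. \<Sum>\<sigma>\<in>set_partitions m r. \<Sum>\<iota>\<in>{1..r} \<rightarrow>\<^sub>E {..<N}. \<Sum>\<rho> | \<rho> permutes {1..r}.
      of_int (sign \<rho>) * (\<Prod>q = 1..r. c (block_size m \<sigma> q) (int (\<iota> (\<rho> q)) - int (\<iota> q))))"
proof -
  have int: "integrable circ (\<lambda>\<theta>. of_real (g \<theta> ^ k) * cis (- of_int d * \<theta>))" for k d
  proof (rule circ.integrable_const_bound)
    show "AE \<theta> in circ. norm (complex_of_real (g \<theta> ^ k) * cis (- of_int d * \<theta>)) \<le> B ^ k"
      using B by (auto simp: norm_mult norm_power intro!: power_mono)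
  qed measurable
  define l where "l \<phi> i = card {j\<in>{1..m}. \<phi> j = i}" for \<phi> and i :: nat
  define T where "T l = (\<Sum>\<pi> | \<pi> permutes {..<N}. of_int (sign \<pi>) * (\<Prod>i<N. c (l i) (int (\<pi> i) - int i)))" for l
  have c0: "c 0 d = (if d = 0 then 1 else 0)" for d
    using integral_circ_cis[of "- d"] by (simp add: c_def)
  have expand: "of_real ((\<Sum>i<N. g (\<theta> i)) ^ m) * weyl_kernel N \<theta> =
      (\<Sum>\<phi>\<in>{1..m} \<rightarrow>\<^sub>E {..<N}. \<Sum>\<pi> | \<pi> permutes {..<N}. of_int (sign \<pi>) *
        (\<Prod>i<N. of_real (g (\<theta> i) ^ l \<phi> i) * cis (- of_int (int (\<pi> i) - int i) * \<theta> i)))" for \<theta>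
  proof -
    have pow: "of_real ((\<Sum>i<N. g (\<theta> i)) ^ m) = (\<Sum>\<phi>\<in>{1..m} \<rightarrow>\<^sub>E {..<N}. \<Prod>i<N. complex_of_real (g (\<theta> i) ^ l \<phi> i))"
      unfolding l_def by (subst sum_power_PiE) simp_all
    show ?thesis
      unfolding weyl_kernel_def pow sum_product prod.distrib
      by (rule sum.cong[OF refl], rule sum.cong[OF refl]) (simp only: mult_ac)
  qed
  have "(\<integral>\<theta>. of_real ((\<Sum>i<N. g (\<theta> i)) ^ m) * weyl_kernel N \<theta> \<partial>torus N) = (\<Sum>\<phi>\<in>{1..m} \<rightarrow>\<^sub>E {..<N}. T (l \<phi>))"
  proof -
    have ip: "integrable (torus N) (\<lambda>\<theta>. \<Prod>i<N. of_real (g (\<theta> i) ^ l \<phi> i) * cis (- of_int (int (\<pi> i) - int i) * \<theta> i))" for \<phi> \<pi>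
      by (rule integral_torus_prod(2)) (rule int)
    show ?thesis
      unfolding expand T_def c_def
      by (subst Bochner_Integration.integral_sum,
          intro Bochner_Integration.integrable_sum integrable_mult_right ip, rule sum.cong[OF refl],
          subst Bochner_Integration.integral_sum, intro integrable_mult_right ip, rule sum.cong[OF refl])
         (simp only: integral_mult_right_zero, subst integral_torus_prod(1), rule int, rule refl)
  qed
  also have "\<dots> = (\<Sum>(r, \<sigma>, \<iota>)\<in>(SIGMA r:{1..m}. set_partitions m r \<times> {\<iota> \<in> {1..r} \<rightarrow>\<^sub>E {..<N}. inj_on \<iota> {1..r}}).
      T (l (\<lambda>j\<in>{1..m}. \<iota> (\<sigma> j))))"
    by (subst sum.reindex_bij_betw[OF bij_betw_set_partition_injection[OF m], symmetric]) (simp add: case_prod_unfold)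
  also have "\<dots> = (\<Sum>r = 1..m. \<Sum>\<sigma>\<in>set_partitions m r. \<Sum>\<iota>\<in>{\<iota> \<in> {1..r} \<rightarrow>\<^sub>E {..<N}. inj_on \<iota> {1..r}}.
      T (l (\<lambda>j\<in>{1..m}. \<iota> (\<sigma> j))))"
    by (simp add: sum.Sigma[symmetric] sum.cartesian_product[symmetric] finite_set_partitions finite_PiE)
  also have "\<dots> = (\<Sum>r = 1..m. \<Sum>\<sigma>\<in>set_partitions m r. \<Sum>\<iota>\<in>{1..r} \<rightarrow>\<^sub>E {..<N}. \<Sum>\<rho> | \<rho> permutes {1..r}.
      of_int (sign \<rho>) * (\<Prod>q = 1..r. c (block_size m \<sigma> q) (int (\<iota> (\<rho> q)) - int (\<iota> q))))"
  proof (rule sum.cong[OF refl], rule sum.cong[OF refl], rule sum.mono_neutral_cong_left)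
    fix r \<sigma> assume \<sigma>: "\<sigma> \<in> set_partitions m r"
    show "finite ({1..r} \<rightarrow>\<^sub>E {..<N})" by (simp add: finite_PiE)
    show "{\<iota> \<in> {1..r} \<rightarrow>\<^sub>E {..<N}. inj_on \<iota> {1..r}} \<subseteq> {1..r} \<rightarrow>\<^sub>E {..<N}" by blast
    show "\<forall>\<iota>\<in>({1..r} \<rightarrow>\<^sub>E {..<N}) - {\<iota> \<in> {1..r} \<rightarrow>\<^sub>E {..<N}. inj_on \<iota> {1..r}}. (\<Sum>\<rho> | \<rho> permutes {1..r}.
      of_int (sign \<rho>) * (\<Prod>q = 1..r. c (block_size m \<sigma> q) (int (\<iota> (\<rho> q)) - int (\<iota> q)))) = 0"
    proof
      fix \<iota> assume "\<iota> \<in> ({1..r} \<rightarrow>\<^sub>E {..<N}) - {\<iota> \<in> {1..r} \<rightarrow>\<^sub>E {..<N}. inj_on \<iota> {1..r}}"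
      then have "\<not> inj_on \<iota> {1..r}" by blast
      then show "(\<Sum>\<rho> | \<rho> permutes {1..r}.
        of_int (sign \<rho>) * (\<Prod>q = 1..r. c (block_size m \<sigma> q) (int (\<iota> (\<rho> q)) - int (\<iota> q)))) = 0"
        by (rule permutation_sum_eq_0_of_not_inj[OF finite_atLeastAtMost,
            where H = "\<lambda>q i. c (block_size m \<sigma> q) (int i - int (\<iota> q))"])
    qed
    fix \<iota> assume "\<iota> \<in> {\<iota> \<in> {1..r} \<rightarrow>\<^sub>E {..<N}. inj_on \<iota> {1..r}}"
    then have \<iota>: "\<iota> \<in> {1..r} \<rightarrow>\<^sub>E {..<N}" and inj: "inj_on \<iota> {1..r}" by blast+
    have mem: "\<sigma> j \<in> {1..r}" if "j \<in> {1..m}" for j using set_partitionsD(1)[OF \<sigma>] that by blast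
    show "T (l (\<lambda>j\<in>{1..m}. \<iota> (\<sigma> j))) = (\<Sum>\<rho> | \<rho> permutes {1..r}.
        of_int (sign \<rho>) * (\<Prod>q = 1..r. c (block_size m \<sigma> q) (int (\<iota> (\<rho> q)) - int (\<iota> q))))"
      unfolding T_def
    proof (rule permutation_sum_restrict[where c = c and \<iota> = \<iota> and Q = "{1..r}" and k = "block_size m \<sigma>"
          and l = "l (\<lambda>j\<in>{1..m}. \<iota> (\<sigma> j))"])
      show "c 0 d = (if d = 0 then 1 else 0)" for d by (rule c0)
      show "inj_on \<iota> {1..r}" "finite {1..r}" by (fact inj, simp)
      show "\<iota> ` {1..r} \<subseteq> {..<N}" using \<iota> by (intro image_subsetI) (rule PiE_mem)
      show "l (\<lambda>j\<in>{1..m}. \<iota> (\<sigma> j)) (\<iota> q) = block_size m \<sigma> q" if "q \<in> {1..r}" for q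
      proof -
        have "{j\<in>{1..m}. (\<lambda>j\<in>{1..m}. \<iota> (\<sigma> j)) j = \<iota> q} = {j\<in>{1..m}. \<sigma> j = q}"
          using inj_on_eq_iff[OF inj mem that] by auto
        then show ?thesis by (simp only: l_def block_size_def)
      qed
      show "l (\<lambda>j\<in>{1..m}. \<iota> (\<sigma> j)) i = 0" if "i \<notin> \<iota> ` {1..r}" for i
      proof -
        have "{j\<in>{1..m}. (\<lambda>j\<in>{1..m}. \<iota> (\<sigma> j)) j = i} = {}" using mem that by auto
        then show ?thesis by (simp only: l_def card.empty)
      qed
    qed
  qed
  finally show ?thesis .
qed

section \<open>The scaling limit\<close>

lemma integral_circ_rescale:
  fixes h :: "real \<Rightarrow> complex"
  assumes [measurable]: "h \<in> borel_measurable borel" and supp: "\<And>\<theta>. \<theta> \<notin> {-pi..pi} \<Longrightarrow> h \<theta> = 0" and N: "N \<ge> 1"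
  shows "(\<integral>\<theta>. h \<theta> \<partial>circ) = (\<integral>x. h (2 * pi / real N * x) / of_nat N \<partial>lborel)"
proof -
  have c: "2 * pi / real N > 0" using N by simp
  have "(\<integral>\<theta>. h \<theta> \<partial>circ) = (1 / (2 * pi)) *\<^sub>R (\<integral>\<theta>. h \<theta> \<partial>lborel)"
    unfolding integral_circ[OF assms(1)] set_lebesgue_integral_def
    by (intro arg_cong[of _ _ "scaleR (1 / (2 * pi))"] Bochner_Integration.integral_cong refl) (use supp in \<open>auto simp: indicator_def\<close>)
  also have "(\<integral>\<theta>. h \<theta> \<partial>lborel) = (2 * pi / real N) *\<^sub>R (\<integral>x. h (2 * pi / real N * x) \<partial>lborel)"
    using lborel_integral_real_affine[of "2 * pi / real N" h 0] c N by simp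
  also have "(1 / (2 * pi)) *\<^sub>R (2 * pi / real N) *\<^sub>R (\<integral>x. h (2 * pi / real N * x) \<partial>lborel) = (\<integral>x. h (2 * pi / real N * x) / of_nat N \<partial>lborel)"
    by (simp add: scaleR_conv_of_real)
  finally show ?thesis .
qed

text \<open>The frequencies 0 to N - 1 are not centred; the limit therefore carries the phase
  \<open>cis (pi * t)\<close>.\<close>

definition dirichlet_kernel :: "nat \<Rightarrow> real \<Rightarrow> complex" where
  "dirichlet_kernel N t = (\<Sum>k<N. cis (real k * (2 * pi / real N) * t)) / of_nat N"

text \<open>For fixed \<rho>, the exponentials with frequency \<iota> q occur at x q and at the
  point indexed by the inverse image of q under \<rho>. Collecting them by q, the sum over \<iota>
  becomes a product of Dirichlet kernels. Replacing \<rho> by its inverse preserves the sign and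
  gives the stated form.\<close>

lemma sum_injections_conv_integral:
  fixes h :: "nat \<Rightarrow> real \<Rightarrow> complex"
  assumes h: "\<And>q. q \<in> {1..r} \<Longrightarrow> integrable lborel (h q)" and N: "N \<ge> 1"
  shows "(\<Sum>\<iota>\<in>{1..r} \<rightarrow>\<^sub>E {..<N}. \<Sum>\<rho> | \<rho> permutes {1..r}. of_int (sign \<rho>) *
      (\<Prod>q = 1..r. \<integral>x. h q x * cis (- of_int (int (\<iota> (\<rho> q)) - int (\<iota> q)) * (2 * pi / real N * x)) / of_nat N \<partial>lborel)) =
    (\<integral>x. (\<Prod>q = 1..r. h q (x q)) *
      (\<Sum>\<rho> | \<rho> permutes {1..r}. of_int (sign \<rho>) * (\<Prod>q = 1..r. dirichlet_kernel N (x q - x (\<rho> q)))) \<partial>(\<Pi>\<^sub>M i\<in>{1..r}. lborel))"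
proof -
  interpret product_sigma_finite "\<lambda>_. lborel :: real measure" by unfold_locales
  define a where "a = 2 * pi / real N"
  define X where "X d q x = h q x * cis (- of_int d * (a * x)) / of_nat N" for d :: int and q x
  have X: "integrable lborel (X d q)" if "q \<in> {1..r}" for d q
    unfolding X_def
  proof (rule integrable_divide, rule Bochner_Integration.integrable_bound[OF h[OF that]])
    have "h q \<in> borel_measurable lborel" using h[OF that] by (rule borel_measurable_integrable)
    moreover have "(\<lambda>x. cis (- of_int d * (a * x))) \<in> borel_measurable lborel" by measurable
    ultimately show "(\<lambda>x. h q x * cis (- of_int d * (a * x))) \<in> borel_measurable lborel" by (rule borel_measurable_times)
  qed (simp add: norm_mult)
  have pw: "(\<Sum>\<iota>\<in>{1..r} \<rightarrow>\<^sub>E {..<N}. \<Prod>q = 1..r. X (int (\<iota> (\<rho> q)) - int (\<iota> q)) q (x q)) =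
      (\<Prod>q = 1..r. h q (x q)) * (\<Prod>q = 1..r. dirichlet_kernel N (x q - x (Hilbert_Choice.inv \<rho> q)))"
    if \<rho>: "\<rho> permutes {1..r}" for \<rho> x
  proof -
    have "(\<Prod>q = 1..r. X (int (\<iota> (\<rho> q)) - int (\<iota> q)) q (x q)) =
        (\<Prod>q = 1..r. h q (x q)) * (\<Prod>q = 1..r. cis (real (\<iota> q) * a * (x q - x (Hilbert_Choice.inv \<rho> q))) / of_nat N)" for \<iota>
    proof -
      let ?c = "\<lambda>q. cis (- real (\<iota> (\<rho> q)) * a * x q)"
      have split: "X (int (\<iota> (\<rho> q)) - int (\<iota> q)) q (x q) = h q (x q) * (?c q * (cis (real (\<iota> q) * a * x q) / of_nat N))" for q
        by (simp add: X_def cis_mult algebra_simps)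
      have "(\<Prod>q = 1..r. ?c q) = (\<Prod>q = 1..r. ?c (Hilbert_Choice.inv \<rho> q))"
        by (rule prod.reindex_bij_betw[OF permutes_imp_bij[OF permutes_inv[OF \<rho>]], symmetric])
      also have "\<dots> = (\<Prod>q = 1..r. cis (- real (\<iota> q) * a * x (Hilbert_Choice.inv \<rho> q)))"
        using permutes_inverses(1)[OF \<rho>] by simp
      finally have c: "(\<Prod>q = 1..r. ?c q) = (\<Prod>q = 1..r. cis (- real (\<iota> q) * a * x (Hilbert_Choice.inv \<rho> q)))" .
      show ?thesis
        unfolding split prod.distrib c
        unfolding prod.distrib[symmetric]
        by (intro prod.cong[OF refl]) (simp add: cis_mult algebra_simps)
    qed
    then have "(\<Sum>\<iota>\<in>{1..r} \<rightarrow>\<^sub>E {..<N}. \<Prod>q = 1..r. X (int (\<iota> (\<rho> q)) - int (\<iota> q)) q (x q)) =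
        (\<Prod>q = 1..r. h q (x q)) * (\<Sum>\<iota>\<in>{1..r} \<rightarrow>\<^sub>E {..<N}. \<Prod>q = 1..r. cis (real (\<iota> q) * a * (x q - x (Hilbert_Choice.inv \<rho> q))) / of_nat N)"
      by (simp only: sum_distrib_left)
    also have "(\<Sum>\<iota>\<in>{1..r} \<rightarrow>\<^sub>E {..<N}. \<Prod>q = 1..r. cis (real (\<iota> q) * a * (x q - x (Hilbert_Choice.inv \<rho> q))) / of_nat N) =
        (\<Prod>q = 1..r. \<Sum>k<N. cis (real k * a * (x q - x (Hilbert_Choice.inv \<rho> q))) / of_nat N)"
      by (rule prod_sum_PiE[symmetric]) auto
    finally show ?thesis by (simp only: dirichlet_kernel_def a_def sum_divide_distrib)
  qed
  have ip: "integrable (\<Pi>\<^sub>M i\<in>{1..r}. lborel) (\<lambda>x. \<Prod>q = 1..r. X (d q) q (x q))" for d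
    by (rule product_integrable_prod) (use X in auto)
  have "(\<Sum>\<iota>\<in>{1..r} \<rightarrow>\<^sub>E {..<N}. \<Sum>\<rho> | \<rho> permutes {1..r}. of_int (sign \<rho>) *
      (\<Prod>q = 1..r. \<integral>x. X (int (\<iota> (\<rho> q)) - int (\<iota> q)) q x \<partial>lborel)) =
      (\<Sum>\<iota>\<in>{1..r} \<rightarrow>\<^sub>E {..<N}. \<Sum>\<rho> | \<rho> permutes {1..r}. of_int (sign \<rho>) *
      (\<integral>x. (\<Prod>q = 1..r. X (int (\<iota> (\<rho> q)) - int (\<iota> q)) q (x q)) \<partial>(\<Pi>\<^sub>M i\<in>{1..r}. lborel)))"
    by (rule sum.cong[OF refl], rule sum.cong[OF refl], subst product_integral_prod) (use X in auto)
  also have "\<dots> = (\<integral>x. (\<Sum>\<iota>\<in>{1..r} \<rightarrow>\<^sub>E {..<N}. \<Sum>\<rho> | \<rho> permutes {1..r}. of_int (sign \<rho>) *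
      (\<Prod>q = 1..r. X (int (\<iota> (\<rho> q)) - int (\<iota> q)) q (x q))) \<partial>(\<Pi>\<^sub>M i\<in>{1..r}. lborel))"
    unfolding integral_mult_right_zero[symmetric]
    by (subst Bochner_Integration.integral_sum, intro Bochner_Integration.integrable_sum integrable_mult_right ip,
        rule sum.cong[OF refl], rule Bochner_Integration.integral_sum[symmetric], intro integrable_mult_right ip)
  also have "\<dots> = (\<integral>x. (\<Prod>q = 1..r. h q (x q)) *
      (\<Sum>\<rho> | \<rho> permutes {1..r}. of_int (sign \<rho>) * (\<Prod>q = 1..r. dirichlet_kernel N (x q - x (\<rho> q)))) \<partial>(\<Pi>\<^sub>M i\<in>{1..r}. lborel))"
  proof (rule Bochner_Integration.integral_cong[OF refl])
    fix x :: "nat \<Rightarrow> real"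
    let ?D = "\<lambda>\<rho>. \<Prod>q = 1..r. dirichlet_kernel N (x q - x (\<rho> q))"
    have "(\<Sum>\<iota>\<in>{1..r} \<rightarrow>\<^sub>E {..<N}. \<Sum>\<rho> | \<rho> permutes {1..r}. of_int (sign \<rho>) * (\<Prod>q = 1..r. X (int (\<iota> (\<rho> q)) - int (\<iota> q)) q (x q))) =
        (\<Sum>\<rho> | \<rho> permutes {1..r}. of_int (sign \<rho>) * (\<Sum>\<iota>\<in>{1..r} \<rightarrow>\<^sub>E {..<N}. \<Prod>q = 1..r. X (int (\<iota> (\<rho> q)) - int (\<iota> q)) q (x q)))"
      unfolding sum_distrib_left by (rule sum.swap)
    also have "\<dots> = (\<Sum>\<rho> | \<rho> permutes {1..r}. of_int (sign \<rho>) * ((\<Prod>q = 1..r. h q (x q)) * ?D (Hilbert_Choice.inv \<rho>)))"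
      by (rule sum.cong[OF refl]) (simp only: mem_Collect_eq pw)
    also have "\<dots> = (\<Sum>\<rho> | \<rho> permutes {1..r}. of_int (sign (Hilbert_Choice.inv \<rho>)) * ((\<Prod>q = 1..r. h q (x q)) * ?D (Hilbert_Choice.inv \<rho>)))"
    proof (rule sum.cong[OF refl])
      fix \<rho> assume "\<rho> \<in> {\<rho>. \<rho> permutes {1..r}}"
      then have "permutation \<rho>" using permutation_permutes by blast
      then show "of_int (sign \<rho>) * ((\<Prod>q = 1..r. h q (x q)) * ?D (Hilbert_Choice.inv \<rho>)) =
          of_int (sign (Hilbert_Choice.inv \<rho>)) * ((\<Prod>q = 1..r. h q (x q)) * ?D (Hilbert_Choice.inv \<rho>))"
        by (simp only: sign_inverse)
    qed
    also have "\<dots> = (\<Sum>\<rho> | \<rho> permutes {1..r}. of_int (sign \<rho>) * ((\<Prod>q = 1..r. h q (x q)) * ?D \<rho>))"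
      by (rule sum_permutations_inverse[symmetric])
    also have "\<dots> = (\<Prod>q = 1..r. h q (x q)) * (\<Sum>\<rho> | \<rho> permutes {1..r}. of_int (sign \<rho>) * ?D \<rho>)"
      by (simp only: sum_distrib_left mult.left_commute)
    finally show "(\<Sum>\<iota>\<in>{1..r} \<rightarrow>\<^sub>E {..<N}. \<Sum>\<rho> | \<rho> permutes {1..r}. of_int (sign \<rho>) * (\<Prod>q = 1..r. X (int (\<iota> (\<rho> q)) - int (\<iota> q)) q (x q))) =
        (\<Prod>q = 1..r. h q (x q)) * (\<Sum>\<rho> | \<rho> permutes {1..r}. of_int (sign \<rho>) * ?D \<rho>)" .
  qed
  finally show ?thesis unfolding X_def a_def .
qed

lemma norm_dirichlet_kernel_le: "norm (dirichlet_kernel N t) \<le> 1"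
proof -
  have "norm (\<Sum>k<N. cis (real k * (2 * pi / real N) * t)) \<le> (\<Sum>k<N. 1)" by (rule sum_norm_le) simp
  then show ?thesis by (cases "N = 0") (simp_all add: dirichlet_kernel_def norm_divide)
qed

text \<open>For nonzero t the geometric sum is (cis (2 pi t) - 1) / (N (w - 1)) with w = cis (2 pi t
  / N). The denominator is a difference quotient of the exponential at 0, so it tends to 2 pi i t;
  being eventually nonzero, it also justifies the geometric sum.\<close>

lemma dirichlet_kernel_tendsto:
  "(\<lambda>N. dirichlet_kernel N t) \<longlonglongrightarrow> cis (pi * t) * of_real (sinc (pi * t))"
proof (cases "t = 0")
  case True
  have "eventually (\<lambda>N. dirichlet_kernel N t = 1) sequentially"
    using eventually_gt_at_top[of "0::nat"] by eventually_elim (simp add: dirichlet_kernel_def True)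
  then show ?thesis using True by (simp add: tendsto_eventually)
next
  case False
  define c where "c = 2 * of_real (pi * t) * \<i>"
  have c: "c \<noteq> 0" using False by (simp add: c_def)
  define w where "w N = cis (2 * pi / real N * t)" for N
  have "((\<lambda>z. exp (c * z)) has_field_derivative c * 1) (at 0)"
    by (auto intro!: derivative_eq_intros)
  then have "((\<lambda>h. (exp (c * h) - 1) / h) \<longlongrightarrow> c) (at 0)" by (simp add: DERIV_def)
  moreover have "filterlim (\<lambda>N. inverse (of_nat N) :: complex) (at 0) sequentially"
    unfolding filterlim_at
    using lim_inverse_n eventually_gt_at_top[of "0::nat"] by (auto elim!: eventually_mono)
  ultimately have "(\<lambda>N. (exp (c * inverse (of_nat N)) - 1) / inverse (of_nat N)) \<longlonglongrightarrow> c"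
    by (rule filterlim_compose)
  moreover have "(exp (c * inverse (of_nat N)) - 1) / inverse (of_nat N) = of_nat N * (w N - 1)" for N
  proof -
    have "exp (c * inverse (of_nat N)) = w N" by (simp add: w_def c_def cis_conv_exp field_simps)
    then show ?thesis by (simp add: divide_inverse)
  qed
  ultimately have lim: "(\<lambda>N. of_nat N * (w N - 1)) \<longlonglongrightarrow> c" by simp
  have "\<forall>\<^sub>F N in sequentially. of_nat N * (w N - 1) \<noteq> 0" by (rule tendsto_imp_eventually_ne[OF lim c])
  then have "\<forall>\<^sub>F N in sequentially. (cis (2 * pi * t) - 1) / (of_nat N * (w N - 1)) = dirichlet_kernel N t"
  proof eventually_elim
    case (elim N)
    then have N: "N \<noteq> 0" and w: "w N \<noteq> 1" by auto
    have "(\<Sum>k<N. cis (real k * (2 * pi / real N) * t)) = (\<Sum>k<N. w N ^ k)"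
      by (simp add: w_def Complex.DeMoivre mult.assoc)
    also have "\<dots> = (w N ^ N - 1) / (w N - 1)" using w by (rule geometric_sum)
    also have "w N ^ N = cis (2 * pi * t)" using N by (simp add: w_def Complex.DeMoivre)
    finally show ?case by (simp add: dirichlet_kernel_def)
  qed
  moreover have "(\<lambda>N. (cis (2 * pi * t) - 1) / (of_nat N * (w N - 1))) \<longlonglongrightarrow> (cis (2 * pi * t) - 1) / c"
    by (intro tendsto_divide tendsto_const lim c)
  ultimately have "(\<lambda>N. dirichlet_kernel N t) \<longlonglongrightarrow> (cis (2 * pi * t) - 1) / c"
    by (rule Lim_transform_eventually[rotated])
  moreover have "(cis (2 * pi * t) - 1) / c = cis (pi * t) * of_real (sinc (pi * t))"
  proof -
    have "cis (2 * pi * t) - 1 = cis (pi * t) * (cis (pi * t) - cis (- (pi * t)))"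
      by (simp add: right_diff_distrib cis_mult mult.assoc)
    also have "cis (pi * t) - cis (- (pi * t)) = 2 * \<i> * of_real (sin (pi * t))"
      by (simp add: complex_eq_iff)
    finally show ?thesis using False by (simp add: c_def field_simps)
  qed
  ultimately show ?thesis by simp
qed

section \<open>Periodization and its dominating weight\<close>

lemma integrable_powr_decay:
  assumes s: "s < - 1"
  shows "integrable lborel (\<lambda>x::real. (1 + \<bar>x\<bar>) powr s)"
proof -
  define h where "h x = indicator {0..} x * (1 + \<bar>x\<bar>) powr s" for x :: real
  have h_meas [measurable]: "h \<in> borel_measurable borel" unfolding h_def by measurable
  have "(\<integral>\<^sup>+x. ennreal ((1 + x) powr s) * indicator {0..} x \<partial>lborel) = 0 - (1 + 0) powr (s + 1) / (s + 1)"
  proof (rule nn_integral_FTC_atLeast)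
    show "((\<lambda>x. (1 + x) powr (s + 1) / (s + 1)) has_real_derivative (1 + x) powr s) (at x)" if "0 \<le> x" for x
      using that s by (auto intro!: derivative_eq_intros)
    have "((\<lambda>x. (1 + x) powr (s + 1)) \<longlongrightarrow> 0) at_top"
      by (rule tendsto_neg_powr) (use s in \<open>auto intro!: filterlim_tendsto_add_at_top[OF tendsto_const filterlim_ident]\<close>)
    from tendsto_divide[OF this tendsto_const[of "s + 1"]] s
    show "((\<lambda>x. (1 + x) powr (s + 1) / (s + 1)) \<longlongrightarrow> 0) at_top" by simp
  qed auto
  moreover have "ennreal (norm (h x)) = ennreal ((1 + x) powr s) * indicator {0..} x" for x
    by (auto simp: h_def indicator_def)
  ultimately have "(\<integral>\<^sup>+x. ennreal (norm (h x)) \<partial>lborel) < \<infinity>" by simp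
  then have h: "integrable lborel h" by (simp add: integrable_iff_bounded)
  have h': "integrable lborel (\<lambda>x. h (0 + (- 1) * x))" by (rule lborel_integrable_real_affine[OF h]) simp
  show ?thesis
  proof (rule Bochner_Integration.integrable_bound[OF Bochner_Integration.integrable_add[OF h h']])
    show "AE x in lborel. norm ((1 + \<bar>x\<bar>) powr s) \<le> norm (h x + h (0 + - 1 * x))"
      by (intro AE_I2) (auto simp: h_def indicator_def)
  qed measurable
qed

lemma summable_on_int_powr:
  assumes s: "s < - 1"
  shows "(\<lambda>j::int. \<bar>real_of_int j\<bar> powr s) summable_on UNIV"
proof -
  have nat: "(\<lambda>n::nat. real n powr s) summable_on UNIV"
    using s by (subst summable_on_UNIV_nonneg_real_iff) (auto simp: summable_real_powr_iff)
  have 1: "(\<lambda>j::int. \<bar>real_of_int j\<bar> powr s) summable_on (range int)"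
    by (subst summable_on_reindex) (use nat in \<open>auto simp: o_def\<close>)
  have 2: "(\<lambda>j::int. \<bar>real_of_int j\<bar> powr s) summable_on (range (\<lambda>n. - int n))"
    by (subst summable_on_reindex) (use nat in \<open>auto simp: o_def inj_on_def\<close>)
  have "UNIV = range int \<union> range (\<lambda>n. - int n)"
  proof (intro equalityI subsetI)
    fix j :: int
    show "j \<in> range int \<union> range (\<lambda>n. - int n)" by (cases j rule: int_cases2) auto
  qed simp
  then show ?thesis using summable_on_union[OF 1 2] by simp
qed

locale rapid_decay =
  fixes f :: "real \<Rightarrow> real" and \<epsilon> A :: real
  assumes f_meas [measurable]: "f \<in> borel_measurable borel"
    and \<epsilon>: "\<epsilon> > 0" and A: "A > 0"
    and decay: "\<bar>f x\<bar> < A * (1 + \<bar>x\<bar>) powr (- (1 + \<epsilon>))"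
begin

text \<open>The term j = 0 is 0 because \<open>0 powr s = 0\<close>, so this is twice the zeta value
  at 1 + \<epsilon>.\<close>

definition \<zeta> :: real where "\<zeta> = (\<Sum>\<^sub>\<infinity>j::int. \<bar>real_of_int j\<bar> powr (- (1 + \<epsilon>)))"

lemma \<zeta>_nonneg: "\<zeta> \<ge> 0"
  unfolding \<zeta>_def by (rule infsum_nonneg) simp

text \<open>For |x| at most N / 2 and j nonzero, |x + N j| is at least N |j| - N / 2, hence at least
  N |j| / 2.\<close>

lemma translate_bound:
  assumes N: "N \<ge> 1" and x: "\<bar>x\<bar> \<le> real N / 2" and j: "j \<noteq> 0"
  shows "\<bar>f (x + real N * of_int j)\<bar> \<le> A * (real N / 2) powr (- (1 + \<epsilon>)) * \<bar>real_of_int j\<bar> powr (- (1 + \<epsilon>))"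
proof -
  have j1: "\<bar>real_of_int j\<bar> \<ge> 1" using j by linarith
  have "real N * \<bar>real_of_int j\<bar> \<le> \<bar>x + real N * of_int j\<bar> + \<bar>x\<bar>"
    using abs_triangle_ineq4[of "x + real N * of_int j" x] by (simp add: abs_mult)
  moreover have "real N / 2 \<le> real N / 2 * \<bar>real_of_int j\<bar>" using j1 by (simp add: mult_le_cancel_left1)
  ultimately have le: "real N / 2 * \<bar>real_of_int j\<bar> \<le> 1 + \<bar>x + real N * of_int j\<bar>"
    using x by (simp add: field_simps)
  have "\<bar>f (x + real N * of_int j)\<bar> \<le> A * (1 + \<bar>x + real N * of_int j\<bar>) powr (- (1 + \<epsilon>))"
    by (rule less_imp_le[OF decay])
  also have "\<dots> \<le> A * (real N / 2 * \<bar>real_of_int j\<bar>) powr (- (1 + \<epsilon>))"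
    using A \<epsilon> N j1 by (intro mult_left_mono powr_mono2' le) auto
  also have "\<dots> = A * (real N / 2) powr (- (1 + \<epsilon>)) * \<bar>real_of_int j\<bar> powr (- (1 + \<epsilon>))"
    by (subst powr_mult) (simp_all only: mult.assoc)
  finally show ?thesis .
qed

lemma translates_summable:
  assumes N: "N \<ge> 1" and x: "\<bar>x\<bar> \<le> real N / 2"
  shows "(\<lambda>j::int. f (x + real N * of_int j)) summable_on UNIV"
    and "\<bar>(\<Sum>\<^sub>\<infinity>j::int. f (x + real N * of_int j)) - f x\<bar> \<le> A * (real N / 2) powr (- (1 + \<epsilon>)) * \<zeta>"
proof -
  let ?g = "\<lambda>j::int. f (x + real N * of_int j)"
  let ?C = "A * (real N / 2) powr (- (1 + \<epsilon>))"
  let ?b = "\<lambda>j::int. ?C * \<bar>real_of_int j\<bar> powr (- (1 + \<epsilon>))"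
  have b: "?b summable_on UNIV" using \<epsilon> by (intro summable_on_cmult_right summable_on_int_powr) simp
  then have b': "?b summable_on (UNIV - {0})" by (rule summable_on_subset_banach) simp
  have norm: "(\<lambda>j. norm (?g j)) summable_on (UNIV - {0})"
    by (rule summable_on_comparison_test[OF b']) (use translate_bound[OF N x] in auto)
  then have g: "?g summable_on (UNIV - {0})" by (rule abs_summable_summable)
  have g0: "?g summable_on {0}" by simp
  have U: "UNIV = {0::int} \<union> (UNIV - {0})" by auto
  show "?g summable_on UNIV" by (subst U, rule summable_on_Un_disjoint[OF g0 g]) auto
  have "infsum ?g UNIV = infsum ?g {0} + infsum ?g (UNIV - {0})"
    by (subst U, rule infsum_Un_disjoint[OF g0 g]) auto
  then have "\<bar>infsum ?g UNIV - f x\<bar> = norm (infsum ?g (UNIV - {0}))" by simp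
  also have "\<dots> \<le> infsum (\<lambda>j. norm (?g j)) (UNIV - {0})" by (rule norm_infsum_bound[OF norm])
  also have "\<dots> \<le> infsum ?b (UNIV - {0})"
    by (rule infsum_mono[OF norm b']) (use translate_bound[OF N x] in auto)
  also have "\<dots> \<le> infsum ?b UNIV"
    by (rule infsum_mono_neutral[OF b' b]) (use A in auto)
  also have "\<dots> = ?C * \<zeta>" unfolding \<zeta>_def by (rule infsum_cmult_right')
  finally show "\<bar>infsum ?g UNIV - f x\<bar> \<le> ?C * \<zeta>" .
qed

text \<open>The cutoff leaves the values at \<open>Arg z\<close> unchanged and makes the rescaled
  function on the line integrable, with one period as support.\<close>

definition circ_stat :: "nat \<Rightarrow> real \<Rightarrow> real" where
  "circ_stat N \<theta> = indicator {-pi..pi} \<theta> * F_per f N \<theta>"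

definition line_stat :: "nat \<Rightarrow> real \<Rightarrow> real" where
  "line_stat N x = circ_stat N (2 * pi / real N * x)"

lemma line_stat_eq:
  assumes "N \<ge> 1"
  shows "line_stat N x = indicator {- real N / 2..real N / 2} x * (\<Sum>\<^sub>\<infinity>j::int. f (x + real N * of_int j))"
proof -
  have "real N / (2 * pi) * (2 * pi / real N * x + 2 * pi * real_of_int j) = x + real N * of_int j" for j
    using assms by (simp add: field_simps)
  moreover have "2 * pi / real N * x \<in> {-pi..pi} \<longleftrightarrow> x \<in> {- real N / 2..real N / 2}"
  proof -
    have eq: "2 * pi / real N * x = pi * (2 * x / real N)" by simp
    have scale: "pi * a \<in> {-pi..pi} \<longleftrightarrow> a \<in> {-1..1}" for a
      using mult_le_cancel_left_pos[OF pi_gt_zero, of "- 1" a] mult_le_cancel_left_pos[OF pi_gt_zero, of a 1] by simp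
    show ?thesis unfolding eq scale using assms by (simp add: field_simps)
  qed
  ultimately show ?thesis by (simp add: line_stat_def circ_stat_def F_per_def indicator_def)
qed

text \<open>The translates are summable unconditionally, so the measurable sums over -n to n, which
  exhaust all finite index sets, converge pointwise to the infinite sum.\<close>

lemma measurable_line_stat:
  assumes N: "N \<ge> 1"
  shows "line_stat N \<in> borel_measurable borel"
proof (rule borel_measurable_LIMSEQ_real)
  let ?I = "indicator {- real N / 2..real N / 2} :: real \<Rightarrow> real"
  show "(\<lambda>x. ?I x * (\<Sum>j\<in>{- int n..int n}. f (x + real N * of_int j))) \<in> borel_measurable borel" for n
    by measurable
  fix x :: real
  show "(\<lambda>n. ?I x * (\<Sum>j\<in>{- int n..int n}. f (x + real N * of_int j))) \<longlonglongrightarrow> line_stat N x"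
  proof (cases "\<bar>x\<bar> \<le> real N / 2")
    case True
    have lim: "filterlim (\<lambda>n. {- int n..int n}) (finite_subsets_at_top UNIV) sequentially"
      unfolding filterlim_finite_subsets_at_top
    proof (intro allI impI)
      fix X :: "int set" assume X: "finite X \<and> X \<subseteq> UNIV"
      have bound: "\<bar>j\<bar> \<le> (\<Sum>j\<in>X. \<bar>j\<bar>)" if "j \<in> X" for j
        by (rule member_le_sum[OF that]) (use X in auto)
      show "\<forall>\<^sub>F n in sequentially. finite {- int n..int n} \<and> X \<subseteq> {- int n..int n} \<and> {- int n..int n} \<subseteq> UNIV"
        using eventually_ge_at_top[of "nat (\<Sum>j\<in>X. \<bar>j\<bar>)"]
      proof eventually_elim
        case (elim n)
        have "j \<in> {- int n..int n}" if "j \<in> X" for j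
          using bound[OF that] elim by (simp add: abs_le_iff nat_le_iff)
        then show ?case by auto
      qed
    qed
    have "((\<lambda>j. f (x + real N * of_int j)) has_sum (\<Sum>\<^sub>\<infinity>j::int. f (x + real N * of_int j))) UNIV"
      by (rule has_sum_infsum[OF translates_summable(1)[OF N True]])
    from filterlim_compose[OF this[unfolded has_sum_def] lim]
    have "(\<lambda>n. \<Sum>j\<in>{- int n..int n}. f (x + real N * of_int j)) \<longlonglongrightarrow> (\<Sum>\<^sub>\<infinity>j::int. f (x + real N * of_int j))" .
    then show ?thesis unfolding line_stat_eq[OF N] by (intro tendsto_mult tendsto_const)
  next
    case False
    then have "?I x = 0" by (auto simp: indicator_def abs_le_iff)
    then show ?thesis by (simp add: line_stat_eq[OF N])
  qed
qed

lemma measurable_circ_stat: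
  assumes N: "N \<ge> 1"
  shows "circ_stat N \<in> borel_measurable borel"
proof -
  have "circ_stat N = (\<lambda>\<theta>. line_stat N (real N / (2 * pi) * \<theta>))"
    using N by (simp add: line_stat_def fun_eq_iff)
  also have "\<dots> \<in> borel_measurable borel"
    by (rule measurable_compose[OF _ measurable_line_stat[OF N]]) measurable
  finally show ?thesis .
qed

text \<open>The 3 stems from 1 + |x| being at most 3 N / 2 when |x| is at most N / 2 and N at least
  1; it converts the error N / 2 to the power -(1 + \<epsilon>) into the weight at x. The maximum
  with 1 makes positivity immediate.\<close>

definition bound_const :: real where
  "bound_const = max 1 (A + A * 3 powr (1 + \<epsilon>) * \<zeta>)"

lemma line_stat_bound:
  assumes N: "N \<ge> 1"
  shows "\<bar>line_stat N x\<bar> \<le> bound_const * (1 + \<bar>x\<bar>) powr (- (1 + \<epsilon>))"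
proof (cases "\<bar>x\<bar> \<le> real N / 2")
  case True
  let ?S = "\<Sum>\<^sub>\<infinity>j::int. f (x + real N * of_int j)"
  have "x \<in> {- real N / 2..real N / 2}" using True by (simp add: abs_le_iff) linarith
  then have "line_stat N x = ?S" by (simp add: line_stat_eq[OF N])
  then have "\<bar>line_stat N x\<bar> \<le> \<bar>f x\<bar> + \<bar>?S - f x\<bar>" by linarith
  also have "\<dots> \<le> A * (1 + \<bar>x\<bar>) powr (- (1 + \<epsilon>)) + A * (real N / 2) powr (- (1 + \<epsilon>)) * \<zeta>"
    by (intro add_mono less_imp_le[OF decay] translates_summable(2)[OF N True])
  also have "\<dots> \<le> A * (1 + \<bar>x\<bar>) powr (- (1 + \<epsilon>)) + A * (3 powr (1 + \<epsilon>) * (1 + \<bar>x\<bar>) powr (- (1 + \<epsilon>))) * \<zeta>"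
  proof (intro add_mono order_refl mult_right_mono mult_left_mono)
    have "(real N / 2) powr (- (1 + \<epsilon>)) \<le> ((1 + \<bar>x\<bar>) / 3) powr (- (1 + \<epsilon>))"
      using True N \<epsilon> by (intro powr_mono2') auto
    also have "\<dots> = 3 powr (1 + \<epsilon>) * (1 + \<bar>x\<bar>) powr (- (1 + \<epsilon>))"
    proof -
      have "((1 + \<bar>x\<bar>) / 3) powr (- e) = 3 powr e * (1 + \<bar>x\<bar>) powr (- e)" for e :: real
        by (subst powr_divide) (auto simp: powr_minus field_simps)
      then show ?thesis .
    qed
    finally show "(real N / 2) powr (- (1 + \<epsilon>)) \<le> 3 powr (1 + \<epsilon>) * (1 + \<bar>x\<bar>) powr (- (1 + \<epsilon>))" .
  qed (use A \<zeta>_nonneg in auto)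
  also have "\<dots> = (A + A * 3 powr (1 + \<epsilon>) * \<zeta>) * (1 + \<bar>x\<bar>) powr (- (1 + \<epsilon>))" by (simp add: algebra_simps)
  also have "\<dots> \<le> bound_const * (1 + \<bar>x\<bar>) powr (- (1 + \<epsilon>))"
    by (rule mult_right_mono) (auto simp: bound_const_def)
  finally show ?thesis .
next
  case False
  then have "line_stat N x = 0" by (auto simp: line_stat_eq[OF N] indicator_def abs_le_iff)
  then show ?thesis by (simp add: bound_const_def)
qed

lemma bound_const_ge_1: "bound_const \<ge> 1" by (simp add: bound_const_def)

lemma weight_le_1: "(1 + \<bar>x\<bar>) powr (- (1 + \<epsilon>)) \<le> 1"
  using \<epsilon> powr_mono2'[of "- (1 + \<epsilon>)" 1 "1 + \<bar>x\<bar>"] by simp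

lemma circ_stat_bounded:
  assumes N: "N \<ge> 1"
  shows "\<bar>circ_stat N \<theta>\<bar> \<le> bound_const"
proof -
  have "circ_stat N \<theta> = line_stat N (real N / (2 * pi) * \<theta>)" using N by (simp add: line_stat_def)
  also have "\<bar>\<dots>\<bar> \<le> bound_const * 1"
    by (rule order_trans[OF line_stat_bound[OF N] mult_left_mono[OF weight_le_1]]) (simp add: bound_const_def)
  finally show ?thesis by simp
qed

text \<open>The weight is at most 1, so for positive k its k-th power is bounded by the weight
  itself; one integrable majorant serves all block sizes.\<close>

lemma line_stat_power_bound:
  assumes N: "N \<ge> 1" and k: "k \<ge> 1"
  shows "\<bar>line_stat N x ^ k\<bar> \<le> bound_const ^ k * (1 + \<bar>x\<bar>) powr (- (1 + \<epsilon>))"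
proof -
  let ?w = "(1 + \<bar>x\<bar>) powr (- (1 + \<epsilon>))"
  have "\<bar>line_stat N x ^ k\<bar> \<le> (bound_const * ?w) ^ k"
    unfolding power_abs by (intro power_mono line_stat_bound[OF N]) simp
  also have "\<dots> = bound_const ^ k * ?w ^ k" by (rule power_mult_distrib)
  also have "\<dots> \<le> bound_const ^ k * ?w"
    using power_decreasing[of 1 k ?w] k weight_le_1[of x] bound_const_ge_1 by (intro mult_left_mono) auto
  finally show ?thesis .
qed

lemma line_stat_tendsto: "(\<lambda>N. line_stat N x) \<longlonglongrightarrow> f x"
proof -
  obtain n where n: "2 * \<bar>x\<bar> \<le> real n" using real_arch_simple by blast
  have lim: "(\<lambda>N. A * (real N / 2) powr (- (1 + \<epsilon>)) * \<zeta>) \<longlonglongrightarrow> A * 0 * \<zeta>"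
  proof (intro tendsto_mult tendsto_const tendsto_neg_powr)
    show "- (1 + \<epsilon>) < 0" using \<epsilon> by simp
    show "LIM N sequentially. real N / 2 :> at_top"
      using filterlim_at_top_mult_tendsto_pos[OF tendsto_const[of "1/2"] _ filterlim_real_sequentially] by simp
  qed
  have "(\<lambda>N. line_stat N x - f x) \<longlonglongrightarrow> 0"
  proof (rule Lim_null_comparison)
    show "(\<lambda>N. A * (real N / 2) powr (- (1 + \<epsilon>)) * \<zeta>) \<longlonglongrightarrow> 0" using lim by simp
    show "\<forall>\<^sub>F N in sequentially. norm (line_stat N x - f x) \<le> A * (real N / 2) powr (- (1 + \<epsilon>)) * \<zeta>"
      using eventually_ge_at_top[of "max 1 n"]
    proof eventually_elim
      case (elim N)
      then have N: "N \<ge> 1" and "real n \<le> real N" by auto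
      with n have x: "\<bar>x\<bar> \<le> real N / 2" by simp
      then have "x \<in> {- real N / 2..real N / 2}" by (simp add: abs_le_iff) linarith
      then have "line_stat N x = (\<Sum>\<^sub>\<infinity>j::int. f (x + real N * of_int j))"
        by (simp add: line_stat_eq[OF N])
      then show ?case using translates_summable(2)[OF N x] by simp
    qed
  qed
  then show ?thesis by (simp add: LIM_zero_iff)
qed

end

section \<open>Determinants of translation kernels and passage to the limit\<close>

lemma det_translation_kernel:
  fixes S :: "real \<Rightarrow> real"
  shows "Determinant.det (Matrix.mat r r (\<lambda>(i, j). S (x (Suc j) - x (Suc i)))) =
    (\<Sum>\<rho> | \<rho> permutes {1..r}. of_int (sign \<rho>) * (\<Prod>q = 1..r. S (x (\<rho> q) - x q)))"
proof -
  have im: "Suc ` {0..<r} = {1..r}" by (simp add: image_Suc_atLeastLessThan atLeastLessThanSuc_atLeastAtMost)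
  then have bij: "bij_betw Suc {0..<r} {1..r}" by (simp add: bij_betw_def)
  have "Determinant.det (Matrix.mat r r (\<lambda>(i, j). S (x (Suc j) - x (Suc i)))) =
      (\<Sum>p | p permutes {0..<r}. of_int (sign p) * (\<Prod>i = 0..<r. S (x (Suc (p i)) - x (Suc i))))"
    by (subst det_def'[of _ r]) (auto intro!: sum.cong prod.cong dest: permutes_in_image)
  also have "\<dots> = (\<Sum>p | p permutes {0..<r}. of_int (sign p) * (\<Prod>q = 1..r. S (x (map_permutation {0..<r} Suc p q) - x q)))"
  proof (rule sum.cong[OF refl])
    fix p
    have "(\<Prod>i = 0..<r. S (x (Suc (p i)) - x (Suc i))) = (\<Prod>i = 0..<r. S (x (map_permutation {0..<r} Suc p (Suc i)) - x (Suc i)))"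
      by (intro prod.cong[OF refl]) (simp add: map_permutation_apply)
    also have "\<dots> = (\<Prod>q = 1..r. S (x (map_permutation {0..<r} Suc p q) - x q))"
      by (rule prod.reindex_bij_betw[OF bij])
    finally show "of_int (sign p) * (\<Prod>i = 0..<r. S (x (Suc (p i)) - x (Suc i))) =
        of_int (sign p) * (\<Prod>q = 1..r. S (x (map_permutation {0..<r} Suc p q) - x q))" by simp
  qed
  also have "\<dots> = (\<Sum>\<rho> | \<rho> permutes {1..r}. of_int (sign \<rho>) * (\<Prod>q = 1..r. S (x (\<rho> q) - x q)))"
    by (rule sum_permutes_relabel[OF bij, symmetric]) simp
  finally show ?thesis .
qed

definition sinc_pi :: "real \<Rightarrow> real" where "sinc_pi t = sinc (pi * t)"

lemma sinc_pi_minus: "sinc_pi (a - b) = sinc_pi (b - a)"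
  using sinc_neg[of "pi * (b - a)"] unfolding sinc_pi_def by (simp only: mult_minus_right[symmetric] minus_diff_eq)

lemma R_corr_conv_permutes:
  "R_corr r x = (\<Sum>\<rho> | \<rho> permutes {1..r}. of_int (sign \<rho>) * (\<Prod>q = 1..r. sinc_pi (x q - x (\<rho> q))))"
proof -
  have "R_corr r x = Determinant.det (Matrix.mat r r (\<lambda>(i, j). sinc_pi (x (Suc j) - x (Suc i))))"
    unfolding R_corr_def sinc_pi_def by (rule refl)
  also have "\<dots> = (\<Sum>\<rho> | \<rho> permutes {1..r}. of_int (sign \<rho>) * (\<Prod>q = 1..r. sinc_pi (x (\<rho> q) - x q)))"
    by (rule det_translation_kernel)
  also have "\<dots> = (\<Sum>\<rho> | \<rho> permutes {1..r}. of_int (sign \<rho>) * (\<Prod>q = 1..r. sinc_pi (x q - x (\<rho> q))))"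
    by (rule sum.cong[OF refl], rule arg_cong2[of _ _ _ _ "(*)", OF refl], rule prod.cong[OF refl], rule sinc_pi_minus)
  finally show ?thesis .
qed

lemma measurable_component_diff:
  assumes h: "h \<in> borel_measurable borel" and ab: "a \<in> I" "b \<in> I"
  shows "(\<lambda>x. h (x a - x b :: real)) \<in> borel_measurable (\<Pi>\<^sub>M i\<in>I. lborel)"
proof (rule measurable_compose[OF _ h])
  have "(\<lambda>x. x a) \<in> borel_measurable (\<Pi>\<^sub>M i\<in>I. lborel :: real measure)" if "a \<in> I" for a
    using measurable_component_singleton[OF that, of "\<lambda>_. lborel :: real measure"] by simp
  then show "(\<lambda>x. x a - x b :: real) \<in> borel_measurable (\<Pi>\<^sub>M i\<in>I. lborel)"
    using ab by (intro borel_measurable_diff)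
qed

lemma measurable_dirichlet_kernel: "dirichlet_kernel N \<in> borel_measurable borel"
  unfolding dirichlet_kernel_def by measurable

definition kernel_sum :: "nat \<Rightarrow> (real \<Rightarrow> complex) \<Rightarrow> (nat \<Rightarrow> real) \<Rightarrow> complex" where
  "kernel_sum r K x = (\<Sum>\<rho> | \<rho> permutes {1..r}. of_int (sign \<rho>) * (\<Prod>q = 1..r. K (x q - x (\<rho> q))))"

lemma measurable_kernel_sum:
  assumes "K \<in> borel_measurable borel"
  shows "kernel_sum r K \<in> borel_measurable (\<Pi>\<^sub>M i\<in>{1..r}. lborel)"
  unfolding kernel_sum_def
proof (intro borel_measurable_sum borel_measurable_times borel_measurable_const borel_measurable_prod)
  fix \<rho> q assume "\<rho> \<in> {\<rho>. \<rho> permutes {1..r}}" and q: "q \<in> {1..r}"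
  then have "\<rho> q \<in> {1..r}" by (simp only: mem_Collect_eq permutes_in_image)
  with q show "(\<lambda>x. K (x q - x (\<rho> q))) \<in> borel_measurable (\<Pi>\<^sub>M i\<in>{1..r}. lborel)"
    by (rule measurable_component_diff[OF assms])
qed

lemma norm_kernel_sum_le:
  assumes "\<And>t. norm (K t) \<le> 1"
  shows "norm (kernel_sum r K x) \<le> fact r"
proof -
  have "norm (kernel_sum r K x) \<le> (\<Sum>\<rho> | \<rho> permutes {1..r}. 1)"
    unfolding kernel_sum_def
  proof (rule sum_norm_le)
    fix \<rho> :: "nat \<Rightarrow> nat"
    have "norm (\<Prod>q = 1..r. K (x q - x (\<rho> q))) \<le> 1"
      unfolding prod_norm[symmetric] by (rule prod_le_1) (use assms in auto)
    then show "norm (of_int (sign \<rho>) * (\<Prod>q = 1..r. K (x q - x (\<rho> q)))) \<le> 1"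
      by (simp add: norm_mult sign_def)
  qed
  then show ?thesis by (simp add: card_permutations)
qed

text \<open>The phases \<open>cis (\<pi> t)\<close> of the limiting kernel cancel along each cycle of a permutation.\<close>

lemma kernel_sum_dirichlet_tendsto:
  "(\<lambda>N. kernel_sum r (dirichlet_kernel N) x) \<longlonglongrightarrow> of_real (R_corr r x)"
proof -
  have lim: "(\<lambda>N. dirichlet_kernel N t) \<longlonglongrightarrow> cis (pi * t) * of_real (sinc_pi t)" for t
    unfolding sinc_pi_def by (rule dirichlet_kernel_tendsto)
  have "(\<lambda>N. kernel_sum r (dirichlet_kernel N) x) \<longlonglongrightarrow>
      (\<Sum>\<rho> | \<rho> permutes {1..r}. of_int (sign \<rho>) * (\<Prod>q = 1..r. cis (pi * (x q - x (\<rho> q))) * of_real (sinc_pi (x q - x (\<rho> q)))))"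
    unfolding kernel_sum_def by (intro tendsto_sum tendsto_mult tendsto_const tendsto_prod lim)
  also have "(\<Sum>\<rho> | \<rho> permutes {1..r}. of_int (sign \<rho>) * (\<Prod>q = 1..r. cis (pi * (x q - x (\<rho> q))) * of_real (sinc_pi (x q - x (\<rho> q))))) =
      (\<Sum>\<rho> | \<rho> permutes {1..r}. of_int (sign \<rho>) * (\<Prod>q = 1..r. of_real (sinc_pi (x q - x (\<rho> q)))))"
  proof (rule sum.cong[OF refl])
    fix \<rho> assume "\<rho> \<in> {\<rho>. \<rho> permutes {1..r}}"
    then have \<rho>: "\<rho> permutes {1..r}" by simp
    have "(\<Prod>q = 1..r. cis (pi * (x q - x (\<rho> q)))) = (\<Prod>q = 1..r. cis (pi * x q)) * (\<Prod>q = 1..r. cis (- (pi * x (\<rho> q))))"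
      unfolding prod.distrib[symmetric] by (intro prod.cong[OF refl]) (simp add: cis_mult right_diff_distrib)
    also have "(\<Prod>q = 1..r. cis (- (pi * x (\<rho> q)))) = (\<Prod>q = 1..r. cis (- (pi * x q)))"
      by (rule prod.reindex_bij_betw[OF permutes_imp_bij[OF \<rho>]])
    also have "(\<Prod>q = 1..r. cis (pi * x q)) * (\<Prod>q = 1..r. cis (- (pi * x q))) = 1"
      unfolding prod.distrib[symmetric] by (simp add: cis_mult)
    finally show "of_int (sign \<rho>) * (\<Prod>q = 1..r. cis (pi * (x q - x (\<rho> q))) * of_real (sinc_pi (x q - x (\<rho> q)))) =
        of_int (sign \<rho>) * (\<Prod>q = 1..r. of_real (sinc_pi (x q - x (\<rho> q))))"
      by (simp only: prod.distrib mult_1_left)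
  qed
  also have "(\<Sum>\<rho> | \<rho> permutes {1..r}. of_int (sign \<rho>) * (\<Prod>q = 1..r. of_real (sinc_pi (x q - x (\<rho> q))))) = complex_of_real (R_corr r x)"
    by (simp only: R_corr_conv_permutes of_real_sum of_real_mult of_real_prod of_real_of_int_eq)
  finally show ?thesis .
qed

context rapid_decay
begin

lemma integrable_line_stat_power:
  assumes N: "N \<ge> 1" and k: "k \<ge> 1"
  shows "integrable lborel (\<lambda>x. complex_of_real (line_stat N x ^ k))"
proof (rule Bochner_Integration.integrable_bound)
  show "integrable lborel (\<lambda>x. bound_const ^ k * (1 + \<bar>x\<bar>) powr (- (1 + \<epsilon>)))"
    by (intro integrable_mult_right integrable_powr_decay) (use \<epsilon> in simp)
  have "line_stat N \<in> borel_measurable lborel" using measurable_line_stat[OF N] by simp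
  then show "(\<lambda>x. complex_of_real (line_stat N x ^ k)) \<in> borel_measurable lborel" by measurable
  show "AE x in lborel. norm (complex_of_real (line_stat N x ^ k)) \<le> norm (bound_const ^ k * (1 + \<bar>x\<bar>) powr (- (1 + \<epsilon>)))"
  proof (rule AE_I2)
    fix x
    have "norm (complex_of_real (line_stat N x ^ k)) \<le> bound_const ^ k * (1 + \<bar>x\<bar>) powr (- (1 + \<epsilon>))"
      unfolding norm_of_real by (rule line_stat_power_bound[OF N k])
    also have "\<dots> \<le> norm (bound_const ^ k * (1 + \<bar>x\<bar>) powr (- (1 + \<epsilon>)))" unfolding real_norm_def by (rule abs_ge_self)
    finally show "norm (complex_of_real (line_stat N x ^ k)) \<le> norm (bound_const ^ k * (1 + \<bar>x\<bar>) powr (- (1 + \<epsilon>)))" .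
  qed
qed

definition correlation_integral :: "nat \<Rightarrow> nat \<Rightarrow> (nat \<Rightarrow> nat) \<Rightarrow> complex" where
  "correlation_integral N r k = (\<integral>x. (\<Prod>q = 1..r. of_real (line_stat N (x q) ^ k q)) *
    kernel_sum r (dirichlet_kernel N) x \<partial>(\<Pi>\<^sub>M i\<in>{1..r}. lborel))"

text \<open>Dominated convergence: the kernel sums are bounded by r! and the other factors by a
  product of integrable weights. The sequence is shifted to \<open>Suc N\<close> because the bounds
  require N at least 1. Integrability of the limit is recorded so that the sum over partitions can
  be moved inside the integral.\<close>

lemma correlation_integral_tendsto:
  assumes k: "\<And>q. q \<in> {1..r} \<Longrightarrow> k q \<ge> 1"
  shows "integrable (\<Pi>\<^sub>M i\<in>{1..r}. lborel) (\<lambda>x. R_corr r x * (\<Prod>q = 1..r. f (x q) ^ k q))"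
    and "(\<lambda>N. correlation_integral N r k) \<longlonglongrightarrow>
      of_real (\<integral>x. R_corr r x * (\<Prod>q = 1..r. f (x q) ^ k q) \<partial>(\<Pi>\<^sub>M i\<in>{1..r}. lborel))"
proof -
  interpret product_sigma_finite "\<lambda>_. lborel :: real measure" by unfold_locales
  let ?P = "\<Pi>\<^sub>M i\<in>{1..r}. lborel :: real measure"
  let ?g = "\<lambda>x. complex_of_real (R_corr r x * (\<Prod>q = 1..r. f (x q) ^ k q))"
  let ?s = "\<lambda>N x. (\<Prod>q = 1..r. complex_of_real (line_stat (Suc N) (x q) ^ k q)) * kernel_sum r (dirichlet_kernel (Suc N)) x"
  let ?w = "\<lambda>x. fact r * (\<Prod>q = 1..r. bound_const ^ k q * (1 + \<bar>x q\<bar>) powr (- (1 + \<epsilon>)))"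
  have comp: "(\<lambda>x. h (x q)) \<in> borel_measurable ?P" if "h \<in> borel_measurable borel" "q \<in> {1..r}" for h :: "real \<Rightarrow> complex" and q
    using measurable_component_singleton[OF that(2), of "\<lambda>_. lborel :: real measure"]
    by (intro measurable_compose[OF _ that(1)]) simp
  have meas_s: "?s N \<in> borel_measurable ?P" for N
  proof (intro borel_measurable_times borel_measurable_prod measurable_kernel_sum measurable_dirichlet_kernel)
    fix q assume q: "q \<in> {1..r}"
    have "line_stat (Suc N) \<in> borel_measurable borel" by (rule measurable_line_stat) simp
    then have "(\<lambda>t. complex_of_real (line_stat (Suc N) t ^ k q)) \<in> borel_measurable borel" by measurable
    then show "(\<lambda>x. complex_of_real (line_stat (Suc N) (x q) ^ k q)) \<in> borel_measurable ?P" by (rule comp[OF _ q])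
  qed
  have lim: "(\<lambda>N. ?s N x) \<longlonglongrightarrow> ?g x" for x
  proof -
    have "(\<lambda>N. (\<Prod>q = 1..r. complex_of_real (line_stat N (x q) ^ k q)) * kernel_sum r (dirichlet_kernel N) x) \<longlonglongrightarrow>
        (\<Prod>q = 1..r. complex_of_real (f (x q) ^ k q)) * of_real (R_corr r x)"
      by (intro tendsto_mult tendsto_prod tendsto_of_real tendsto_power line_stat_tendsto kernel_sum_dirichlet_tendsto)
    from LIMSEQ_Suc[OF this] show ?thesis by (simp add: mult.commute)
  qed
  have meas_g: "?g \<in> borel_measurable ?P"
    by (rule borel_measurable_LIMSEQ_metric[OF meas_s]) (rule lim)
  have w: "integrable ?P ?w"
    by (intro integrable_mult_right product_integrable_prod integrable_powr_decay) (use \<epsilon> in auto)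
  have bound: "norm (?s N x) \<le> ?w x" for N x
  proof -
    have "norm (\<Prod>q = 1..r. complex_of_real (line_stat (Suc N) (x q) ^ k q)) \<le> (\<Prod>q = 1..r. bound_const ^ k q * (1 + \<bar>x q\<bar>) powr (- (1 + \<epsilon>)))"
      unfolding prod_norm[symmetric] norm_of_real
      by (intro prod_mono conjI abs_ge_zero line_stat_power_bound k) auto
    moreover have "norm (kernel_sum r (dirichlet_kernel (Suc N)) x) \<le> fact r"
      by (rule norm_kernel_sum_le[OF norm_dirichlet_kernel_le])
    ultimately have "norm (?s N x) \<le> (\<Prod>q = 1..r. bound_const ^ k q * (1 + \<bar>x q\<bar>) powr (- (1 + \<epsilon>))) * fact r"
      unfolding norm_mult by (intro mult_mono prod_nonneg) (auto simp: bound_const_def)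
    then show ?thesis by (simp only: mult.commute)
  qed
  have g: "integrable ?P ?g"
    by (rule integrable_dominated_convergence[OF meas_g meas_s w AE_I2 AE_I2]) (rule lim, rule bound)
  then show "integrable ?P (\<lambda>x. R_corr r x * (\<Prod>q = 1..r. f (x q) ^ k q))"
    by (simp only: complex_of_real_integrable_eq)
  have "(\<lambda>N. integral\<^sup>L ?P (?s N)) \<longlonglongrightarrow> integral\<^sup>L ?P ?g"
    by (rule integral_dominated_convergence[OF meas_g meas_s w AE_I2 AE_I2]) (rule lim, rule bound)
  then have "(\<lambda>N. correlation_integral (Suc N) r k) \<longlonglongrightarrow> integral\<^sup>L ?P ?g"
    by (simp only: correlation_integral_def)
  then have "(\<lambda>N. correlation_integral N r k) \<longlonglongrightarrow> integral\<^sup>L ?P ?g"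
    by (rule LIMSEQ_imp_Suc)
  then show "(\<lambda>N. correlation_integral N r k) \<longlonglongrightarrow> of_real (\<integral>x. R_corr r x * (\<Prod>q = 1..r. f (x q) ^ k q) \<partial>?P)"
    by (simp only: integral_complex_of_real)
qed

text \<open>A positive exponent makes the integrand vanish outside [-pi, pi]; a zeroth power would
  be 1 there and could not be extended to the line in this way.\<close>

lemma circ_coeff_rescale:
  assumes N: "N \<ge> 1" and k: "k \<ge> 1"
  shows "(\<integral>\<theta>. of_real (circ_stat N \<theta> ^ k) * cis (- of_int d * \<theta>) \<partial>circ) =
    (\<integral>x. of_real (line_stat N x ^ k) * cis (- of_int d * (2 * pi / real N * x)) / of_nat N \<partial>lborel)"
proof -
  have "(\<lambda>\<theta>. complex_of_real (circ_stat N \<theta> ^ k) * cis (- of_int d * \<theta>)) \<in> borel_measurable borel"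
    using measurable_circ_stat[OF N] by measurable
  then show ?thesis
    unfolding line_stat_def
    by (rule integral_circ_rescale[OF _ _ N]) (use k in \<open>simp add: circ_stat_def\<close>)
qed

lemma block_size_pos:
  assumes "\<sigma> \<in> set_partitions m r" "q \<in> {1..r}"
  shows "block_size m \<sigma> q \<ge> 1"
proof -
  have "q \<in> \<sigma> ` {1..m}" unfolding set_partitionsD(1)[OF assms(1)] by (rule assms(2))
  then have "{j \<in> {1..m}. \<sigma> j = q} \<noteq> {}" by blast
  then show ?thesis unfolding block_size_def Suc_le_eq One_nat_def card_gt_0_iff by simp
qed

text \<open>An exact identity for each N: substituting x = N \<theta> / (2 pi) turns the torus
  expansion into integrals whose measure does not depend on N, as dominated convergence
  requires.\<close>

lemma moment_eq_correlation_integrals: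
  assumes haar: "haar_prob N M" and N: "N \<ge> 1" and m: "m \<ge> 1"
  shows "(\<integral>U. Z_stat f N U ^ m \<partial>M) =
    Re (\<Sum>r = 1..m. \<Sum>\<sigma>\<in>set_partitions m r. correlation_integral N r (block_size m \<sigma>))"
proof -
  interpret H: haar_unitary N M by unfold_locales (rule haar)
  note g = measurable_circ_stat[OF N] and B = circ_stat_bounded[OF N]
  have "Arg z \<in> {-pi..pi}" for z using Arg_bounded[of z] by simp
  then have Z: "Z_stat f N U = eig_sum (\<lambda>z. circ_stat N (Arg z)) U" for U
    by (simp only: Z_stat_def eig_sum_def circ_stat_def indicator_simps mult_1_left)
  have int: "integrable (torus N) (\<lambda>\<theta>. complex_of_real ((\<Sum>i<N. circ_stat N (\<theta> i)) ^ m) * weyl_kernel N \<theta>)"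
  proof (rule torus.integrable_const_bound)
    show "AE \<theta> in torus N. norm (complex_of_real ((\<Sum>i<N. circ_stat N (\<theta> i)) ^ m) * weyl_kernel N \<theta>) \<le> (\<Sum>i<N. bound_const) ^ m * fact N"
    proof (rule AE_I2)
      fix \<theta>
      have "\<bar>\<Sum>i<N. circ_stat N (\<theta> i)\<bar> \<le> (\<Sum>i<N. bound_const)" by (rule order_trans[OF sum_abs sum_mono[OF B]])
      then have "\<bar>(\<Sum>i<N. circ_stat N (\<theta> i)) ^ m\<bar> \<le> (\<Sum>i<N. bound_const) ^ m"
        unfolding power_abs by (rule power_mono) simp
      then show "norm (complex_of_real ((\<Sum>i<N. circ_stat N (\<theta> i)) ^ m) * weyl_kernel N \<theta>) \<le> (\<Sum>i<N. bound_const) ^ m * fact N"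
        unfolding norm_mult norm_of_real using bound_const_ge_1
        by (intro mult_mono weyl_kernel_bound zero_le_power sum_nonneg) auto
    qed
    have "(\<lambda>\<theta>. \<Sum>i<N. circ_stat N (\<theta> i)) \<in> borel_measurable (torus N)" by (rule H.measurable_torus_sum[OF g])
    then have "(\<lambda>\<theta>. complex_of_real ((\<Sum>i<N. circ_stat N (\<theta> i)) ^ m)) \<in> borel_measurable (torus N)" by measurable
    then show "(\<lambda>\<theta>. complex_of_real ((\<Sum>i<N. circ_stat N (\<theta> i)) ^ m) * weyl_kernel N \<theta>) \<in> borel_measurable (torus N)"
      by (rule borel_measurable_times[OF _ measurable_weyl_kernel])
  qed
  have "(\<integral>U. Z_stat f N U ^ m \<partial>M) = (\<integral>\<theta>. (\<Sum>i<N. circ_stat N (\<theta> i)) ^ m * Re (weyl_kernel N \<theta>) \<partial>torus N)"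
    unfolding Z by (rule H.eig_sum_moment[OF g B])
  also have "\<dots> = (\<integral>\<theta>. Re (complex_of_real ((\<Sum>i<N. circ_stat N (\<theta> i)) ^ m) * weyl_kernel N \<theta>) \<partial>torus N)"
    by (simp del: of_real_power)
  also have "\<dots> = Re (\<integral>\<theta>. complex_of_real ((\<Sum>i<N. circ_stat N (\<theta> i)) ^ m) * weyl_kernel N \<theta> \<partial>torus N)"
    by (rule integral_Re[OF int])
  also have "(\<integral>\<theta>. complex_of_real ((\<Sum>i<N. circ_stat N (\<theta> i)) ^ m) * weyl_kernel N \<theta> \<partial>torus N) =
      (\<Sum>r = 1..m. \<Sum>\<sigma>\<in>set_partitions m r. correlation_integral N r (block_size m \<sigma>))"
    unfolding torus_moment_expansion[OF g B m]
  proof (rule sum.cong[OF refl], rule sum.cong[OF refl])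
    fix r \<sigma> assume \<sigma>: "\<sigma> \<in> set_partitions m r"
    let ?h = "\<lambda>q x. complex_of_real (line_stat N x ^ block_size m \<sigma> q)"
    have "(\<Sum>\<iota>\<in>{1..r} \<rightarrow>\<^sub>E {..<N}. \<Sum>\<rho> | \<rho> permutes {1..r}. of_int (sign \<rho>) *
        (\<Prod>q = 1..r. \<integral>\<theta>. of_real (circ_stat N \<theta> ^ block_size m \<sigma> q) * cis (- of_int (int (\<iota> (\<rho> q)) - int (\<iota> q)) * \<theta>) \<partial>circ)) =
      (\<Sum>\<iota>\<in>{1..r} \<rightarrow>\<^sub>E {..<N}. \<Sum>\<rho> | \<rho> permutes {1..r}. of_int (sign \<rho>) *
        (\<Prod>q = 1..r. \<integral>x. ?h q x * cis (- of_int (int (\<iota> (\<rho> q)) - int (\<iota> q)) * (2 * pi / real N * x)) / of_nat N \<partial>lborel))"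
      by (rule sum.cong[OF refl], rule sum.cong[OF refl], rule arg_cong2[of _ _ _ _ "(*)", OF refl], rule prod.cong[OF refl])
         (rule circ_coeff_rescale[OF N block_size_pos[OF \<sigma>]])
    also have "\<dots> = (\<integral>x. (\<Prod>q = 1..r. ?h q (x q)) *
        (\<Sum>\<rho> | \<rho> permutes {1..r}. of_int (sign \<rho>) * (\<Prod>q = 1..r. dirichlet_kernel N (x q - x (\<rho> q)))) \<partial>(\<Pi>\<^sub>M i\<in>{1..r}. lborel))"
      by (rule sum_injections_conv_integral[OF integrable_line_stat_power[OF N block_size_pos[OF \<sigma>]] N])
    finally show "(\<Sum>\<iota>\<in>{1..r} \<rightarrow>\<^sub>E {..<N}. \<Sum>\<rho> | \<rho> permutes {1..r}. of_int (sign \<rho>) *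
        (\<Prod>q = 1..r. \<integral>\<theta>. of_real (circ_stat N \<theta> ^ block_size m \<sigma> q) * cis (- of_int (int (\<iota> (\<rho> q)) - int (\<iota> q)) * \<theta>) \<partial>circ)) =
      correlation_integral N r (block_size m \<sigma>)"
      unfolding correlation_integral_def kernel_sum_def .
  qed
  finally show ?thesis .
qed

end

theorem theorem7p4:
  fixes f :: "real \<Rightarrow> real" and \<epsilon> A :: real and m :: nat
    and \<mu> :: "nat \<Rightarrow> complex mat measure"
  assumes f_even: "\<And>x. f (- x) = f x"
    and f_meas: "f \<in> borel_measurable borel"
    and \<epsilon>: "\<epsilon> > 0" and A: "A > 0"
    and f_decay: "\<And>x. \<bar>f x\<bar> < A * (1 + \<bar>x\<bar>) powr (- (1 + \<epsilon>))"
    and m: "m \<ge> 1"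
    and haar: "\<And>N. N \<ge> 1 \<Longrightarrow> haar_prob N (\<mu> N)"
  shows "(\<lambda>N. \<integral>U. Z_stat f N U ^ m \<partial>(\<mu> N)) \<longlonglongrightarrow>
    (\<Sum>r = 1..m. \<integral>x. R_corr r x *
        (\<Sum>\<sigma>\<in>set_partitions m r. \<Prod>q = 1..r. f (x q) ^ block_size m \<sigma> q)
      \<partial>(\<Pi>\<^sub>M i\<in>{1..r}. lborel))"
proof -
  interpret rapid_decay f \<epsilon> A by unfold_locales (fact f_meas \<epsilon> A f_decay)+
  let ?I = "\<lambda>r \<sigma>. \<integral>x. R_corr r x * (\<Prod>q = 1..r. f (x q) ^ block_size m \<sigma> q) \<partial>(\<Pi>\<^sub>M i\<in>{1..r}. lborel)"
  have "(\<lambda>N. Re (\<Sum>r = 1..m. \<Sum>\<sigma>\<in>set_partitions m r. correlation_integral N r (block_size m \<sigma>))) \<longlonglongrightarrow>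
      Re (\<Sum>r = 1..m. \<Sum>\<sigma>\<in>set_partitions m r. of_real (?I r \<sigma>))"
    by (intro tendsto_Re tendsto_sum correlation_integral_tendsto(2) block_size_pos)
  also have "Re (\<Sum>r = 1..m. \<Sum>\<sigma>\<in>set_partitions m r. of_real (?I r \<sigma>)) = (\<Sum>r = 1..m. \<Sum>\<sigma>\<in>set_partitions m r. ?I r \<sigma>)"
    by (simp only: of_real_sum[symmetric] Re_complex_of_real)
  also have "\<dots> = (\<Sum>r = 1..m. \<integral>x. R_corr r x *
        (\<Sum>\<sigma>\<in>set_partitions m r. \<Prod>q = 1..r. f (x q) ^ block_size m \<sigma> q) \<partial>(\<Pi>\<^sub>M i\<in>{1..r}. lborel))"
    \<comment> \<open>Each partition contributes an integrable function by itself, so the finite sum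
      may be interchanged with the integral.\<close>
    unfolding sum_distrib_left
    by (rule sum.cong[OF refl], rule Bochner_Integration.integral_sum[symmetric])
       (rule correlation_integral_tendsto(1)[OF block_size_pos])
  finally have lim: "(\<lambda>N. Re (\<Sum>r = 1..m. \<Sum>\<sigma>\<in>set_partitions m r. correlation_integral N r (block_size m \<sigma>))) \<longlonglongrightarrow>
      (\<Sum>r = 1..m. \<integral>x. R_corr r x *
        (\<Sum>\<sigma>\<in>set_partitions m r. \<Prod>q = 1..r. f (x q) ^ block_size m \<sigma> q) \<partial>(\<Pi>\<^sub>M i\<in>{1..r}. lborel))" .
  \<comment> \<open>The exact identity holds from N = 1 on, which is enough for the limit.\<close>
  have "\<forall>\<^sub>F N in sequentially. Re (\<Sum>r = 1..m. \<Sum>\<sigma>\<in>set_partitions m r. correlation_integral N r (block_size m \<sigma>)) =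
      (\<integral>U. Z_stat f N U ^ m \<partial>(\<mu> N))"
    using eventually_ge_at_top[of "1::nat"]
    by eventually_elim (rule moment_eq_correlation_integrals[OF haar _ m, symmetric])
  with lim show ?thesis by (rule Lim_transform_eventually)
qed

end
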